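(* There exist positive absolute (numerical) constants $\sigma^\star<1$ (sufficiently small), $c_0$, $\kappa_0$, $\rho^\star>1$, $\gamma_1$, $\gamma_2$ such that the following holds. Let the data $\mathbf{Y}=[\mathbf{y}_1,\dots,\mathbf{y}_N]\in\mathbb{R}^{n\times N}$ be generated by the semirandom noisy subspace model (defined in the context) with subspaces $S_1,\dots,S_L\subset\mathbb{R}^n$ of dimensions $d_1,\dots,d_L$, with $N_1,\dots,N_L$ points per subspace, sampling densities $\rho_\ell=N_\ell/d_\ell$ satisfying $\rho_\ell\le e^{d_\ell/2}$ for all $\ell$, and noise level $\sigma$, where $$0<\sigma<\sigma^\star \quad\text{and}\quad \max_{\ell} d_\ell< c_0\,\frac{n}{(\log N)^2}.$$ Fix $i\in\{1,\dots,N\}$, let $S_\ell$ be the subspace from which $\mathbf{y}_i$ originates, and write $d(i)=d_\ell$, $N(i)=N_\ell$. Assume that $S_\ell$ satisfies the affinity condition $$\max_{k:\,k\neq \ell}\operatorname{aff}(S_\ell,S_k)\le \frac{\kappa_0}{\log N}$$ and the sampling condition $\rho_\ell\ge\rho^\star$. Run the two-step procedure (defined in the context) on column $i$ with $\tau=2\sigma$ and a deterministic function $f:(0,\infty)\to(0,\infty)$ obeying $f(t)\ge 0.707\,\sigma\, t^{-1}$ for all $t>0$, and let $\mathbf{B}_i=\hat{\boldsymbol\beta}\in\mathbb{R}^N$ be its output. Then, with probability at least $$1-2e^{-\gamma_1 n}-6e^{-\gamma_2 d(i)}-e^{-\sqrt{N(i)d(i)}}-\frac{23}{N^2},$$ there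 is no false discovery in the $i$th column of $\mathbf{B}$; that is, $\hat\beta_j=0$ for every $j$ such that $\mathbf{y}_j$ does not originate from the same subspace as $\mathbf{y}_i$.
   Context: Semirandom noisy subspace model. $S_1,\dots,S_L$ are fixed linear subspaces of $\mathbb{R}^n$ with $\dim S_\ell=d_\ell\ge1$. The index set $\{1,\dots,N\}$ is partitioned (deterministically) into $L$ groups, the $\ell$th of size $N_\ell$, with $N=N_1+\dots+N_L\geq 2$. For each index $j$ in group $\ell$, the observed point is $\mathbf{y}_j=\mathbf{x}_j+\mathbf{z}_j$, where $\mathbf{x}_j$ is uniformly distributed on the unit sphere $\{\mathbf{x}\in S_\ell:\|\mathbf{x}\|_{\ell_2}=1\}$ of $S_\ell$, and $\mathbf{z}_j\in\mathbb{R}^n$ has i.i.d. $\mathcal{N}(0,\sigma^2/n)$ entries; all the $\mathbf{x}_j$'s and $\mathbf{z}_j$'s are mutually independent. One says that $\mathbf{y}_j$ originates from $S_\ell$. The sampling density of $S_\ell$ is $\rho_\ell=N_\ell/d_\ell$. Affinity. For subspaces $S,S'$ of dimensions $d,d'$ with matrices $\mathbf{U},\mathbf{V}$ whose columns are orthonormal bases of $S,S'$, the cosines of the principal angles $\theta^{(1)},\dots,\theta^{(d\wedge d')}$ are the singular values of $\mathbf{U}^T\mathbf{V}$, and $$\operatorname{aff}(S,S')=\sqrt{\frac{\cos^2\theta^{(1)}+\cdots+\cos^2\theta^{(d\wedge d')}}{d\wedge d'}}.$$ Two-step procedure for column $i$ (with parameters $\tau$ and $f$): 1. Let $\boldsymbol\beta^\star$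 be a solution of $\min_{\boldsymbol\beta\in\mathbb{R}^N}\|\boldsymbol\beta\|_{\ell_1}$ subject to $\|\mathbf{y}_i-\mathbf{Y}\boldsymbol\beta\|_{\ell_2}\le\tau$ and $\beta_i=0$. 2. Set $\lambda=f(\|\boldsymbol\beta^\star\|_{\ell_1})$. 3. Let $\hat{\boldsymbol\beta}$ be a solution of $\min_{\boldsymbol\beta\in\mathbb{R}^N}\frac12\|\mathbf{y}_i-\mathbf{Y}\boldsymbol\beta\|_{\ell_2}^2+\lambda\|\boldsymbol\beta\|_{\ell_1}$ subject to $\beta_i=0$. 4. Set the $i$th column of $\mathbf{B}$ to be $\mathbf{B}_i=\hat{\boldsymbol\beta}$. (If step 1 is infeasible or $\boldsymbol\beta^\star=\mathbf{0}$, the output is assigned by an arbitrary fixed convention.) A false discovery in column $i$ is an index $j$ with $\hat\beta_j\ne0$ such that $\mathbf{y}_i$ and $\mathbf{y}_j$ do not originate from the same subspace. "Numerical constants" are absolute: they do not depend on $n,N,L$, the subspaces, their dimensions, the $N_\ell$, $\sigma$, $f$ or $i$. *)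

theory Defs
  imports
    "HOL-Probability.Probability"
    "Jordan_Normal_Form.VS_Connect"
    "Jordan_Normal_Form.Char_Poly"
begin

text \<open>
  The constants of the theorem must not depend on the ambient dimension, so the dimension has to be
  quantified inside the formula. Vectors of Euclidean n-space are therefore elements of
  \<^term>\<open>carrier_vec n :: real Matrix.vec set\<close>. All indices (of points, groups and coordinates) start at 0.
\<close>

definition l2_norm :: "real Matrix.vec \<Rightarrow> real" where
  "l2_norm v = sqrt (scalar_prod v v)"

definition l1_norm :: "real Matrix.vec \<Rightarrow> real" where
  "l1_norm v = (\<Sum>k<dim_vec v. \<bar>vec_index v k\<bar>)"


section \<open>Subspaces and affinity\<close>

definition is_subspace :: "nat \<Rightarrow> real Matrix.vec set \<Rightarrow> bool" where
  "is_subspace n S \<longleftrightarrow> VectorSpace.subspace class_ring S (module_vec TYPE(real) n)"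

definition subspace_dim :: "nat \<Rightarrow> real Matrix.vec set \<Rightarrow> nat" where
  "subspace_dim n S = vectorspace.dim class_ring ((module_vec TYPE(real) n)\<lparr>carrier := S\<rparr>)"

definition is_orthonormal_basis :: "nat \<Rightarrow> real Matrix.vec set \<Rightarrow> real mat \<Rightarrow> bool" where
  "is_orthonormal_basis n S U \<longleftrightarrow>
     U \<in> carrier_mat n (subspace_dim n S) \<and>
     transpose_mat U * U = 1\<^sub>m (subspace_dim n S) \<and>
     vec_space.col_space n U = S"

text \<open>
  Some matrix whose columns are an orthonormal basis of the subspace. Neither the affinity nor the
  uniform law on the unit sphere below depends on which one is chosen.
\<close>

definition orthonormal_basis :: "nat \<Rightarrow> real Matrix.vec set \<Rightarrow> real mat" where
  "orthonormal_basis n S = (SOME U. is_orthonormal_basis n S U)"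

text \<open>
  The singular values of a p by q matrix A, in decreasing order: the square roots of the
  min(p,q) largest eigenvalues of the q by q Gram matrix of A, counted with algebraic multiplicity
  (the remaining eigenvalues of the Gram matrix vanish).
\<close>

definition singular_values :: "real mat \<Rightarrow> real list" where
  "singular_values A =
     take (min (dim_row A) (dim_col A))
       (rev (sorted_list_of_multiset (image_mset sqrt (proots (char_poly (transpose_mat A * A))))))"

definition principal_cosines :: "nat \<Rightarrow> real Matrix.vec set \<Rightarrow> real Matrix.vec set \<Rightarrow> real list" where
  "principal_cosines n S T =
     singular_values (transpose_mat (orthonormal_basis n S) * orthonormal_basis n T)"

definition aff :: "nat \<Rightarrow> real Matrix.vec set \<Rightarrow> real Matrix.vec set \<Rightarrow> real" where
  "aff n S T =
     sqrt ((\<Sum>c\<leftarrow>principal_cosines n S T. c\<^sup>2) / real (min (subspace_dim n S) (subspace_dim n T)))"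


section \<open>The semirandom noisy subspace model\<close>

definition vec_borel :: "nat \<Rightarrow> real Matrix.vec measure" where
  "vec_borel n =
     vimage_algebra (carrier_vec n) (\<lambda>v. \<lambda>k\<in>{..<n}. vec_index v k) (\<Pi>\<^sub>M k\<in>{..<n}. borel)"

text \<open>
  The uniform distribution on the unit sphere of S is the normalised cone measure: a point that is
  uniform on the unit ball of S (with respect to Lebesgue measure in orthonormal coordinates) is
  projected radially onto the sphere.
\<close>

definition unit_ball_law :: "nat \<Rightarrow> (nat \<Rightarrow> real) measure" where
  "unit_ball_law d =
     uniform_measure (\<Pi>\<^sub>M k\<in>{..<d}. lborel) {x \<in> {..<d} \<rightarrow>\<^sub>E UNIV. (\<Sum>k<d. (x k)\<^sup>2) \<le> 1}"

definition sphere_law :: "nat \<Rightarrow> real Matrix.vec set \<Rightarrow> real Matrix.vec measure" where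
  "sphere_law n S =
     distr (unit_ball_law (subspace_dim n S)) (vec_borel n)
       (\<lambda>x. let w = orthonormal_basis n S *\<^sub>v Matrix.vec (subspace_dim n S) x
            in (1 / l2_norm w) \<cdot>\<^sub>v w)"

text \<open>Independent entries of mean 0 and variance \<open>\<sigma>\<^sup>2 / n\<close>; \<^const>\<open>normal_density\<close> takes the standard
  deviation as its second argument.\<close>

definition noise_law :: "nat \<Rightarrow> real \<Rightarrow> real Matrix.vec measure" where
  "noise_law n \<sigma> =
     distr (\<Pi>\<^sub>M k\<in>{..<n}. density lborel (normal_density 0 (\<sigma> / sqrt (real n)))) (vec_borel n)
       (Matrix.vec n)"

text \<open>
  The joint law of the clean points x and the noise vectors z, where point j belongs to group
  \<open>g j\<close>. A sample is the pair (x, z).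
\<close>

definition semirandom_model ::
  "nat \<Rightarrow> nat \<Rightarrow> (nat \<Rightarrow> real Matrix.vec set) \<Rightarrow> (nat \<Rightarrow> nat) \<Rightarrow> real \<Rightarrow>
   ((nat \<Rightarrow> real Matrix.vec) \<times> (nat \<Rightarrow> real Matrix.vec)) measure" where
  "semirandom_model n N S g \<sigma> =
     (\<Pi>\<^sub>M j\<in>{..<N}. sphere_law n (S (g j))) \<Otimes>\<^sub>M (\<Pi>\<^sub>M j\<in>{..<N}. noise_law n \<sigma>)"

definition data_matrix ::
  "nat \<Rightarrow> nat \<Rightarrow> (nat \<Rightarrow> real Matrix.vec) \<times> (nat \<Rightarrow> real Matrix.vec) \<Rightarrow> real mat" where
  "data_matrix n N = (\<lambda>(x, z). mat_of_cols n (map (\<lambda>j. x j + z j) [0..<N]))"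

definition group_size :: "nat \<Rightarrow> (nat \<Rightarrow> nat) \<Rightarrow> nat \<Rightarrow> nat" where
  "group_size N g l = card {j. j < N \<and> g j = l}"

definition sampling_density ::
  "nat \<Rightarrow> nat \<Rightarrow> (nat \<Rightarrow> real Matrix.vec set) \<Rightarrow> (nat \<Rightarrow> nat) \<Rightarrow> nat \<Rightarrow> real" where
  "sampling_density n N S g l = real (group_size N g l) / real (subspace_dim n (S l))"


section \<open>The two-step procedure\<close>

definition step1_feasible :: "real \<Rightarrow> real mat \<Rightarrow> nat \<Rightarrow> real Matrix.vec \<Rightarrow> bool" where
  "step1_feasible \<tau> Y i \<beta> \<longleftrightarrow>
     \<beta> \<in> carrier_vec (dim_col Y) \<and> l2_norm (col Y i - Y *\<^sub>v \<beta>) \<le> \<tau> \<and> vec_index \<beta> i = 0"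

definition step1_solution :: "real \<Rightarrow> real mat \<Rightarrow> nat \<Rightarrow> real Matrix.vec \<Rightarrow> bool" where
  "step1_solution \<tau> Y i = is_arg_min l1_norm (step1_feasible \<tau> Y i)"

definition lasso_solution :: "real \<Rightarrow> real mat \<Rightarrow> nat \<Rightarrow> real Matrix.vec \<Rightarrow> bool" where
  "lasso_solution lam Y i =
     is_arg_min (\<lambda>\<beta>. 1/2 * (l2_norm (col Y i - Y *\<^sub>v \<beta>))\<^sup>2 + lam * l1_norm \<beta>)
       (\<lambda>\<beta>. \<beta> \<in> carrier_vec (dim_col Y) \<and> vec_index \<beta> i = 0)"

text \<open>
  Minimisers need not be unique, so the procedure is a relation: b is a possible output for column i
  of Y. The function conv is the convention that assigns the output when step 1 is infeasible or
  is solved by the zero vector.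
\<close>

definition two_step_output ::
  "real \<Rightarrow> (real \<Rightarrow> real) \<Rightarrow> (real mat \<Rightarrow> real Matrix.vec) \<Rightarrow> real mat \<Rightarrow> nat \<Rightarrow>
   real Matrix.vec \<Rightarrow> bool" where
  "two_step_output \<tau> f conv Y i b \<longleftrightarrow>
     (\<exists>\<beta>. step1_solution \<tau> Y i \<beta> \<and> \<beta> \<noteq> 0\<^sub>v (dim_col Y) \<and> lasso_solution (f (l1_norm \<beta>)) Y i b) \<or>
     (((\<nexists>\<beta>. step1_feasible \<tau> Y i \<beta>) \<or> step1_solution \<tau> Y i (0\<^sub>v (dim_col Y))) \<and> b = conv Y)"

definition false_discovery :: "(nat \<Rightarrow> nat) \<Rightarrow> nat \<Rightarrow> real Matrix.vec \<Rightarrow> nat \<Rightarrow> bool" where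
  "false_discovery g i b j \<longleftrightarrow> vec_index b j \<noteq> 0 \<and> g j \<noteq> g i"

text \<open>
  ``P holds with probability at least p'', as an inner probability: P may fail to be measurable,
  for instance because the function f of the procedure is not assumed to be.
\<close>

definition with_prob_at_least :: "'a measure \<Rightarrow> real \<Rightarrow> ('a \<Rightarrow> bool) \<Rightarrow> bool" where
  "with_prob_at_least M p P \<longleftrightarrow> (\<exists>E\<in>sets M. (\<forall>\<omega>\<in>E. P \<omega>) \<and> p \<le> measure M E)"

end

theory Submission
  imports Defs "HOL-Real_Asymp.Real_Asymp" "Jordan_Normal_Form.Schur_Decomposition"
begin

text \<open>
  Normalised Gaussian vectors are uniform on the sphere, so the data are a function of independent standard
  normals, written in an orthonormal basis of \<open>\<real>\<^sup>n\<close> whose first \<open>d\<close> vectors span the subspace of point \<open>i\<close>.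
  Restricted isometry bounds for Gaussian matrices show that least squares expresses point \<open>i\<close> by its own group with
  an \<open>\<ell>\<^sub>1\<close> norm of order \<open>\<surd>d\<close>, so \<open>\<lambda>\<close> is at least of order \<open>\<sigma> / \<surd>d\<close>.

  By the optimality conditions it suffices that the scaled residual \<open>u = v / \<lambda>\<close> of the lasso restricted to the group has
  \<open>\<bar>\<langle>y\<^sub>j, u\<rangle>\<bar> < 1\<close> for all points \<open>j\<close> outside of the group, for all admissible \<open>\<lambda>\<close> at once since \<open>\<lambda>\<close> is random.
  The law of the group data is invariant under reflections of the first \<open>d\<close> and of the last \<open>n - d\<close> coordinates, and
  reflections turn the direction of \<open>y\<^sub>j\<close> into a random sign vector; the inner products are therefore as small as
  for random signs. The path \<open>t \<mapsto> u(t)\<close>, \<open>t = 1 / \<lambda>\<close>, moves by a squared distance at most the increase of \<open>\<parallel>u\<parallel>\<^sup>2\<close>, so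
  a net of polynomial size handles all \<open>\<lambda>\<close> simultaneously. The affinity condition makes the part of \<open>y\<^sub>j\<close> in the
  subspace of order \<open>1 / \<surd>(log N)\<close>, which compensates the size \<open>\<surd>d\<close> of the corresponding part of \<open>u\<close>.
\<close>

subsection \<open>Euclidean norms of finite families\<close>

text \<open>No rotation group is involved: for each sign vector one measure-preserving reflection
  carries the direction of y_j to it, so a probability is an average over 2^m reflections, and for
  fixed data this average counts sign vectors. The split after d coordinates is forced, since the
  clean points of the group vanish beyond them and a reflection mixing both blocks would change
  their law. Constants: tails of single inner products have exponent 12 log N, which pays for the
  net, the d coordinates and the N points. The lattice has scale 192, and 36864 = 192^2 is an
  entropy per coordinate that the density 10^8 must beat. Outside the subspace u is bounded by 3 *
  10^12 sqrt(d log(e \<rho>)); this number is multiplied by \<sigma> in the bound inside the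
  subspace, whence 10^-14, and by sqrt(log N / n) in the final inner products, whence 10^-30. An
  affinity of 10^-5 / log N keeps the part of y_j in the subspace below 6 * 10^-5 / sqrt(log N),
  which meets a factor 1051 sqrt(log N).\<close>

lemma L2_set_power2: "(L2_set f A)\<^sup>2 = (\<Sum>i\<in>A. (f i)\<^sup>2)"
  by (simp add: L2_set_def sum_nonneg)

lemma L2_set_scale: "L2_set (\<lambda>i. c * f i) A = \<bar>c\<bar> * L2_set f A"
  by (simp add: L2_set_def power_mult_distrib real_sqrt_mult flip: sum_distrib_left)

lemma sum_mult_le_L2_set: "\<bar>\<Sum>i\<in>A. f i * g i\<bar> \<le> L2_set f A * L2_set g A" for f g :: "'a \<Rightarrow> real"
proof -
  have "\<bar>\<Sum>i\<in>A. f i * g i\<bar> \<le> (\<Sum>i\<in>A. \<bar>f i\<bar> * \<bar>g i\<bar>)"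
    using sum_abs[of "\<lambda>i. f i * g i" A] by (simp add: abs_mult)
  then show ?thesis using L2_set_mult_ineq[of f g A] by linarith
qed

lemma L2_set_triangle_diff: "L2_set (\<lambda>i. f i - g i) A \<le> L2_set f A + L2_set g A"
  using L2_set_triangle_ineq[of f "\<lambda>i. - g i" A] by (simp add: L2_set_def)

lemma L2_set_leI: "0 \<le> c \<Longrightarrow> (\<Sum>i\<in>A. (f i)\<^sup>2) \<le> c\<^sup>2 \<Longrightarrow> L2_set f A \<le> c"
  unfolding L2_set_def by (metis real_le_lsqrt)

lemma sum_power2_le_max_mult:
  fixes f :: "'a \<Rightarrow> real"
  assumes "\<And>i. i \<in> A \<Longrightarrow> \<bar>f i\<bar> \<le> M"
  shows "(\<Sum>i\<in>A. (f i)\<^sup>2) \<le> M * (\<Sum>i\<in>A. \<bar>f i\<bar>)"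
  unfolding sum_distrib_left
  by (intro sum_mono) (metis abs_ge_zero abs_mult assms mult_right_mono power2_abs power2_eq_square)

lemma L2_set_le_const:
  fixes f :: "'a \<Rightarrow> real"
  assumes "0 \<le> M" "\<And>i. i \<in> A \<Longrightarrow> \<bar>f i\<bar> \<le> M"
  shows "L2_set f A \<le> sqrt (real (card A)) * M"
proof -
  have "L2_set f A \<le> sqrt (\<Sum>i\<in>A. M\<^sup>2)"
    unfolding L2_set_def
    by (intro real_sqrt_le_mono sum_mono) (metis abs_ge_zero assms(2) power2_abs power_mono)
  then show ?thesis using assms(1) by (simp add: real_sqrt_mult)
qed

lemma sum_abs_le_sqrt_L2_set: "(\<Sum>i\<in>A. \<bar>f i\<bar>) \<le> sqrt (real (card A)) * L2_set f A" for f :: "'a \<Rightarrow> real"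
  using L2_set_mult_ineq[of "\<lambda>_. 1" f A] by (simp add: L2_set_def)

lemma L2_set_restrict_zero:
  assumes "finite A"
  shows "L2_set (\<lambda>i. if i \<in> T then f i else 0) A = L2_set f (A \<inter> T)"
  unfolding L2_set_def using assms by (simp add: if_distrib[of "\<lambda>x. x\<^sup>2"] sum.inter_restrict cong: if_cong)

subsection \<open>Restricted isometry from an integer net\<close>

text \<open>Rounding towards zero, not down: absolute values never grow, so the rounded vector stays
  in the unit ball, and zero entries stay zero, so the support is kept.\<close>

definition trunc_int :: "real \<Rightarrow> int" where
  "trunc_int x = (if x \<ge> 0 then \<lfloor>x\<rfloor> else - \<lfloor>- x\<rfloor>)"

lemma trunc_int_le: "\<bar>real_of_int (trunc_int x)\<bar> \<le> \<bar>x\<bar>"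
proof (cases "0 \<le> x")
  case True
  then show ?thesis unfolding trunc_int_def by simp
next
  case False
  then have "0 \<le> \<lfloor>- x\<rfloor>" "real_of_int \<lfloor>- x\<rfloor> \<le> - x" by simp_all
  then show ?thesis using False unfolding trunc_int_def by simp
qed

lemma trunc_int_diff: "\<bar>x - real_of_int (trunc_int x)\<bar> \<le> 1"
  unfolding trunc_int_def by (cases "0 \<le> x"; simp; linarith)

text \<open>The vector is rounded to the lattice of mesh \<open>1 / (192 \<surd>s)\<close> inside its own support.\<close>

lemma sparse_isometry_of_net:
  fixes W :: "'k \<Rightarrow> 'j \<Rightarrow> real" and s :: nat
  assumes fin: "finite K" "finite J" and mu: "0 \<le> \<mu>"
  defines "p \<equiv> \<lambda>\<beta>. L2_set (\<lambda>k. \<Sum>j\<in>J. \<beta> j * W k j) K"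
  assumes net: "\<And>z :: 'j \<Rightarrow> int. z \<in> J \<rightarrow>\<^sub>E UNIV \<Longrightarrow> (\<Sum>j\<in>J. (real_of_int (z j))\<^sup>2) \<le> 36864 * real s \<Longrightarrow>
      \<mu> / 6 * L2_set (\<lambda>j. real_of_int (z j)) J \<le> p (\<lambda>j. real_of_int (z j)) \<and>
      p (\<lambda>j. real_of_int (z j)) \<le> 4 * \<mu> * L2_set (\<lambda>j. real_of_int (z j)) J"
  assumes sparse: "card {j\<in>J. \<beta> j \<noteq> 0} \<le> s"
  shows "\<mu> / 24 * L2_set \<beta> J \<le> p \<beta>" "p \<beta> \<le> 8 * \<mu> * L2_set \<beta> J"
proof -
  have p_cong: "p a = p b" if "\<And>j. j \<in> J \<Longrightarrow> a j = b j" for a b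
    unfolding p_def using that by simp
  have p_tri: "p (\<lambda>j. a j + b j) \<le> p a + p b" for a b
    unfolding p_def by (simp add: distrib_right sum.distrib L2_set_triangle_ineq)
  have p_scale: "p (\<lambda>j. c * a j) = \<bar>c\<bar> * p a" for c a
    unfolding p_def by (simp add: mult.assoc L2_set_scale flip: sum_distrib_left)
  \<comment> \<open>Only the finiteness of this operator bound matters: it makes the supremum
    \<open>S\<close> below a real number.\<close>
  define B where "B = L2_set (\<lambda>k. L2_set (W k) J) K"
  have B0: "0 \<le> B" unfolding B_def by (rule L2_set_nonneg)
  have crude: "p a \<le> B * L2_set a J" for a
  proof -
    have "p a \<le> L2_set (\<lambda>k. L2_set a J * L2_set (W k) J) K"
      unfolding p_def L2_set_def[of _ K]
      by (intro real_sqrt_le_mono sum_mono abs_le_square_iff[THEN iffD1])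
        (use sum_mult_le_L2_set[of a "W _" J] in \<open>simp add: abs_mult\<close>)
    also have "\<dots> = B * L2_set a J" by (simp add: L2_set_scale B_def)
    finally show ?thesis .
  qed
  define T where "T = {j\<in>J. \<beta> j \<noteq> 0}"
  have T: "T \<subseteq> J" "finite T" "card T \<le> s" using fin sparse by (auto simp: T_def)
  have key: "\<exists>a b. (\<forall>j\<in>J. v j = a j + b j) \<and> (\<forall>j\<in>J-T. b j = 0) \<and> L2_set a J \<le> 1 \<and> L2_set b J \<le> 1/192 \<and>
      \<mu> / 6 * L2_set a J \<le> p a \<and> p a \<le> 4 * \<mu> * L2_set a J"
    if v: "\<forall>j\<in>J-T. v j = 0" "L2_set v J \<le> 1" for v
  proof (cases "s = 0")
    case True
    then have "T = {}" using T by simp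
    then have "\<forall>j\<in>J. v j = 0" using v by auto
    then show ?thesis
      by (intro exI[of _ "\<lambda>_. 0"]) (auto simp: L2_set_def p_def)
  next
    case False
    \<comment> \<open>With this mesh, errors on at most \<open>s\<close> entries have norm at most
      1/192, and the integer vector has squared norm at most 192^2 s = 36864 s, the radius in
      \<open>net\<close>.\<close>
    define d where "d = 1 / (192 * sqrt (real s))"
    have d: "d > 0" using False by (simp add: d_def)
    define z where "z = (\<lambda>j\<in>J. if j \<in> T then trunc_int (v j / d) else 0)"
    define a where "a = (\<lambda>j. d * real_of_int (z j))"
    have z: "z \<in> J \<rightarrow>\<^sub>E UNIV" by (simp add: z_def)
    have az: "\<bar>a j\<bar> \<le> \<bar>v j\<bar>" if "j \<in> J" for j
      using trunc_int_le[of "v j / d"] d that by (auto simp: a_def z_def abs_mult field_simps)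
    have diff: "\<bar>v j - a j\<bar> \<le> d" "j \<notin> T \<Longrightarrow> v j - a j = 0" if "j \<in> J" for j
    proof -
      have "\<bar>v j - a j\<bar> = d * \<bar>v j / d - real_of_int (trunc_int (v j / d))\<bar>" if "j \<in> T"
      proof -
        have "d * (v j / d - real_of_int (trunc_int (v j / d))) = v j - a j"
          using d \<open>j \<in> J\<close> that by (simp add: a_def z_def right_diff_distrib)
        then show ?thesis using d by (metis abs_mult abs_of_pos)
      qed
      then show "\<bar>v j - a j\<bar> \<le> d" "j \<notin> T \<Longrightarrow> v j - a j = 0"
        using trunc_int_diff[of "v j / d"] d v that
        by (cases "j \<in> T"; auto simp: a_def z_def)+
    qed
    have La: "L2_set a J \<le> L2_set v J"
      unfolding L2_set_def by (intro real_sqrt_le_mono sum_mono) (use az in \<open>auto simp: abs_le_square_iff[symmetric]\<close>)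
    have Lz: "L2_set a J = d * L2_set (\<lambda>j. real_of_int (z j)) J"
      unfolding a_def using d by (simp add: L2_set_scale)
    have "d\<^sup>2 * (\<Sum>j\<in>J. (real_of_int (z j))\<^sup>2) \<le> 1"
      using La v(2) Lz L2_set_power2[of "\<lambda>j. real_of_int (z j)" J]
      by (metis L2_set_nonneg order_trans power_mult_distrib power_one power_mono)
    then have "(\<Sum>j\<in>J. (real_of_int (z j))\<^sup>2) \<le> 36864 * real s"
      using False by (simp add: d_def power_divide power_mult_distrib field_simps)
    from net[OF z this] have nz: "\<mu> / 6 * L2_set (\<lambda>j. real_of_int (z j)) J \<le> p (\<lambda>j. real_of_int (z j))"
      "p (\<lambda>j. real_of_int (z j)) \<le> 4 * \<mu> * L2_set (\<lambda>j. real_of_int (z j)) J" by auto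
    have paz: "p a = d * p (\<lambda>j. real_of_int (z j))" unfolding a_def using d by (simp add: p_scale)
    have n: "\<mu> / 6 * L2_set a J \<le> p a" "p a \<le> 4 * \<mu> * L2_set a J"
      using mult_left_mono[OF nz(1), of d] mult_left_mono[OF nz(2), of d] d unfolding Lz paz
      by (simp_all add: mult_ac)
    have "L2_set (\<lambda>j. v j - a j) J = L2_set (\<lambda>j. v j - a j) T"
      unfolding L2_set_def using T diff fin
      by (intro arg_cong[where f=sqrt] sum.mono_neutral_right) auto
    also have "\<dots> \<le> sqrt (real (card T)) * d"
      by (rule L2_set_le_const) (use diff T d in auto)
    also have "\<dots> \<le> sqrt (real s) * d" using T d by simp
    also have "\<dots> = 1/192" using False by (simp add: d_def)
    finally show ?thesis
      using n La v diff T by (intro exI[of _ a] exI[of _ "\<lambda>j. v j - a j"]) auto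
  qed
  \<comment> \<open>Bootstrapping: the rounding error is again supported in \<open>T\<close>, hence
    is bounded by the supremum itself. This gives S \<le> 4 \<mu> + S / 192, which can be solved
    because \<open>SS\<close> is bounded.\<close>
  define SS where "SS = {p v | v. (\<forall>j\<in>J-T. v j = 0) \<and> L2_set v J \<le> 1}"
  have bdd: "bdd_above SS"
    by (rule bdd_aboveI[of _ B]) (use crude B0 in \<open>auto simp: SS_def intro: order_trans[OF crude mult_left_le]\<close>)
  have "p (\<lambda>_. 0) \<in> SS" unfolding SS_def
    by (intro CollectI exI[of _ "\<lambda>_. 0"]) (auto simp: L2_set_def)
  then have ne: "SS \<noteq> {}" by auto
  define S where "S = Sup SS"
  have S: "p v \<le> S" if "\<forall>j\<in>J-T. v j = 0" "L2_set v J \<le> 1" for v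
    unfolding S_def using that by (intro cSup_upper bdd) (auto simp: SS_def)
  have rest: "p b \<le> S / 192" if b: "\<forall>j\<in>J-T. b j = 0" "L2_set b J \<le> 1/192" for b
  proof -
    have "p (\<lambda>j. 192 * b j) \<le> S"
      by (intro S) (use b in \<open>auto simp: L2_set_scale\<close>)
    then show ?thesis by (simp add: p_scale)
  qed
  have "S \<le> 4 * \<mu> + S / 192"
    unfolding S_def
  proof (rule cSup_least[OF ne])
    fix x assume "x \<in> SS"
    then obtain v where v: "x = p v" "\<forall>j\<in>J-T. v j = 0" "L2_set v J \<le> 1" by (auto simp: SS_def)
    from key[OF v(2,3)] obtain a b where ab: "\<forall>j\<in>J. v j = a j + b j" "\<forall>j\<in>J-T. b j = 0" "L2_set a J \<le> 1"
      "L2_set b J \<le> 1/192" "p a \<le> 4 * \<mu> * L2_set a J" by blast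
    have "4 * \<mu> * L2_set a J \<le> 4 * \<mu>" using ab mu by (simp add: mult_left_le)
    moreover have "p v \<le> p a + p b" using p_tri[of a b] p_cong[of v "\<lambda>j. a j + b j"] ab by auto
    ultimately show "x \<le> 4 * \<mu> + Sup SS / 192" using rest[OF ab(2,4)] ab v unfolding S_def by linarith
  qed
  then have SU: "S \<le> 5 * \<mu>" using mu by linarith
  have unit: "\<mu> / 24 \<le> p v \<and> p v \<le> 8 * \<mu>" if v: "\<forall>j\<in>J-T. v j = 0" "L2_set v J = 1" for v
  proof -
    from key[of v] v obtain a b where ab: "\<forall>j\<in>J. v j = a j + b j" "\<forall>j\<in>J-T. b j = 0" "L2_set a J \<le> 1"
      "L2_set b J \<le> 1/192" "\<mu> / 6 * L2_set a J \<le> p a" by fastforce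
    have "L2_set v J = L2_set (\<lambda>j. a j + b j) J" using ab by (auto intro: L2_set_cong)
    then have "1 \<le> L2_set a J + L2_set b J" using v L2_set_triangle_ineq[of a b J] by simp
    then have "\<mu> / 6 * (191/192) \<le> \<mu> / 6 * L2_set a J" using mu ab by (intro mult_left_mono) auto
    moreover have "p a \<le> p v + p b"
      using p_tri[of v "\<lambda>j. -1 * b j"] p_cong[of a "\<lambda>j. v j + -1 * b j"] ab p_scale[of "-1" b] by simp
    \<comment> \<open>What is left is at least 191/192 of \<mu>/6 minus 5 \<mu>/192, well above
      \<mu>/24.\<close>
    ultimately have "\<mu> / 24 \<le> p v" using rest[OF ab(2,4)] SU ab mu by linarith
    then show ?thesis using S[of v] v SU mu by auto
  qed
  have "\<mu> / 24 * L2_set \<beta> J \<le> p \<beta> \<and> p \<beta> \<le> 8 * \<mu> * L2_set \<beta> J"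
  proof (cases "L2_set \<beta> J = 0")
    case True
    then have "\<forall>j\<in>J. \<beta> j = 0" using fin by (simp add: L2_set_eq_0_iff)
    then show ?thesis using True by (simp add: p_def L2_set_def)
  next
    case False
    define l where "l = L2_set \<beta> J"
    have l: "l > 0" using False L2_set_nonneg[of \<beta> J] unfolding l_def by linarith
    have "\<mu> / 24 \<le> p (\<lambda>j. (1/l) * \<beta> j) \<and> p (\<lambda>j. (1/l) * \<beta> j) \<le> 8 * \<mu>"
    proof (rule unit)
      show "L2_set (\<lambda>j. (1/l) * \<beta> j) J = 1" by (subst L2_set_scale) (use l in \<open>simp add: l_def[symmetric]\<close>)
    qed (auto simp: T_def)
    then show ?thesis using l unfolding p_scale l_def[symmetric] by (simp add: field_simps)
  qed
  then show "\<mu> / 24 * L2_set \<beta> J \<le> p \<beta>" "p \<beta> \<le> 8 * \<mu> * L2_set \<beta> J" by auto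
qed

section \<open>Counting lattice points in a ball\<close>

lemma sum_exp_neg_square_le:
  fixes \<theta> :: real
  assumes "1 \<le> \<theta>"
  shows "(\<Sum>k\<in>{- int B..int B}. exp (- \<theta> * (real_of_int k)\<^sup>2)) \<le> 1 + 4 * exp (- \<theta>)"
proof -
  \<comment> \<open>For k \<ge> 1 the exponent satisfies k^2 - 1 \<ge> k - 1, so the two tails of
    the theta series are geometric and contribute 2 * 2 * exp(-\<theta>).\<close>
  have le: "exp (- \<theta> * (real (Suc k))\<^sup>2) \<le> exp (- \<theta>) * (1/2) ^ k" for k
  proof -
    have "real k \<le> (real (Suc k))\<^sup>2 - 1" by (simp add: power2_eq_square algebra_simps)
    also have "\<dots> \<le> \<theta> * ((real (Suc k))\<^sup>2 - 1)"
      using assms mult_right_mono[of 1 \<theta> "(real (Suc k))\<^sup>2 - 1"] by (simp add: power2_eq_square algebra_simps)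
    finally have "exp (- \<theta> * (real (Suc k))\<^sup>2) \<le> exp (- \<theta> + real k * (- 1))" by (simp add: algebra_simps)
    also have "\<dots> = exp (- \<theta>) * exp (-1) ^ k" by (simp only: exp_add exp_of_nat_mult)
    also have "\<dots> \<le> exp (- \<theta>) * (1/2) ^ k"
      using exp_ge_add_one_self[of "1::real"]
      by (intro mult_left_mono power_mono) (auto simp: exp_minus field_simps)
    finally show ?thesis .
  qed
  have "(\<Sum>k\<in>{- int B..int B}. exp (- \<theta> * (real_of_int k)\<^sup>2)) \<le> 1 + 2 * (\<Sum>k<B. exp (- \<theta>) * (1/2) ^ k)" for B
  proof (induction B)
    case (Suc B)
    have "{- int (Suc B)..int (Suc B)} = insert (- int (Suc B)) (insert (int (Suc B)) {- int B..int B})" by auto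
    then have "(\<Sum>k\<in>{- int (Suc B)..int (Suc B)}. exp (- \<theta> * (real_of_int k)\<^sup>2)) =
      2 * exp (- \<theta> * (real (Suc B))\<^sup>2) + (\<Sum>k\<in>{- int B..int B}. exp (- \<theta> * (real_of_int k)\<^sup>2))"
      by (simp add: power2_eq_square algebra_simps)
    then show ?case using Suc le[of B] by simp
  qed auto
  also have "(\<Sum>k<B. exp (- \<theta>) * (1/2) ^ k) = exp (- \<theta>) * (2 - 2 * (1/2)^B)"
    by (simp add: sum_gp_strict flip: sum_distrib_left)
  also have "\<dots> \<le> exp (- \<theta>) * 2" by (intro mult_left_mono) auto
  finally show ?thesis by simp
qed

text \<open>Exponential weights: every counted vector has weight exp(\<theta> (R - |z|^2)) \<ge> 1,
  and the total weight factorises over the coordinates. With R proportional to s and \<theta> near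
  log(|J|/s) this reproduces the entropy s log(|J|/s) of sparse vectors without enumerating
  supports.\<close>

lemma card_int_vectors_le:
  fixes J :: "'j set" and R \<theta> :: real
  assumes J: "finite J" and th: "1 \<le> \<theta>"
  defines "Z \<equiv> {z \<in> J \<rightarrow>\<^sub>E (UNIV :: int set). (\<Sum>j\<in>J. (real_of_int (z j))\<^sup>2) \<le> R}"
  shows "finite Z" "real (card Z) \<le> exp (\<theta> * R + 4 * real (card J) * exp (- \<theta>))"
proof -
  define B where "B = nat \<lceil>R\<rceil>"
  have sub: "Z \<subseteq> J \<rightarrow>\<^sub>E {- int B..int B}"
  proof
    fix z assume z: "z \<in> Z"
    have "\<bar>z j\<bar> \<le> int B" if j: "j \<in> J" for j
    proof -
      have "\<bar>real_of_int (z j)\<bar> \<le> (real_of_int (z j))\<^sup>2"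
      proof (cases "z j = 0")
        case False
        then have "1 \<le> \<bar>real_of_int (z j)\<bar>" by linarith
        then have "\<bar>real_of_int (z j)\<bar> * 1 \<le> \<bar>real_of_int (z j)\<bar> * \<bar>real_of_int (z j)\<bar>"
          by (intro mult_left_mono) auto
        then show ?thesis by (simp add: power2_eq_square flip: abs_mult)
      qed simp
      also have "\<dots> \<le> R" using z j J member_le_sum[of j J "\<lambda>j. (real_of_int (z j))\<^sup>2"] by (auto simp: Z_def)
      finally have "\<bar>real_of_int (z j)\<bar> \<le> R" .
      then show ?thesis unfolding B_def by linarith
    qed
    then have "z j \<in> {- int B..int B}" if "j \<in> J" for j using that by (simp add: abs_le_iff) (metis minus_le_iff)
    moreover have "z \<in> extensional J" using z by (simp add: Z_def PiE_def)
    ultimately show "z \<in> J \<rightarrow>\<^sub>E {- int B..int B}" unfolding PiE_def by blast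
  qed
  have finP: "finite (J \<rightarrow>\<^sub>E {- int B..int B})" using J by (intro finite_PiE) auto
  show fin: "finite Z" by (rule finite_subset[OF sub finP])
  have "real (card Z) = (\<Sum>z\<in>Z. 1)" by simp
  also have "\<dots> \<le> (\<Sum>z\<in>Z. exp (\<theta> * R) * (\<Prod>j\<in>J. exp (- \<theta> * (real_of_int (z j))\<^sup>2)))"
  proof (rule sum_mono)
    fix z assume "z \<in> Z"
    then have "0 \<le> \<theta> * (R - (\<Sum>j\<in>J. (real_of_int (z j))\<^sup>2))" using th by (auto simp: Z_def)
    then have "1 \<le> exp (\<theta> * R + (\<Sum>j\<in>J. - \<theta> * (real_of_int (z j))\<^sup>2))"
      by (simp add: algebra_simps sum_negf sum_distrib_left)
    then show "1 \<le> exp (\<theta> * R) * (\<Prod>j\<in>J. exp (- \<theta> * (real_of_int (z j))\<^sup>2))"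
      by (simp only: exp_add exp_sum[OF J])
  qed
  also have "\<dots> \<le> (\<Sum>z\<in>J \<rightarrow>\<^sub>E {- int B..int B}. exp (\<theta> * R) * (\<Prod>j\<in>J. exp (- \<theta> * (real_of_int (z j))\<^sup>2)))"
    by (intro sum_mono2 finP sub) (simp add: prod_nonneg)
  also have "\<dots> = exp (\<theta> * R) * (\<Prod>j\<in>J. \<Sum>k\<in>{- int B..int B}. exp (- \<theta> * (real_of_int k)\<^sup>2))"
    by (subst prod_sum_PiE) (use J in \<open>auto simp: sum_distrib_left\<close>)
  also have "\<dots> \<le> exp (\<theta> * R) * (1 + 4 * exp (- \<theta>)) ^ card J"
    using sum_exp_neg_square_le[OF th, of B]
    by (simp add: power_mono sum_nonneg)
  also have "\<dots> \<le> exp (\<theta> * R) * exp (4 * exp (- \<theta>)) ^ card J"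
    by (intro mult_left_mono power_mono exp_ge_add_one_self) (auto intro: add_nonneg_nonneg)
  also have "\<dots> = exp (\<theta> * R + 4 * real (card J) * exp (- \<theta>))"
    by (simp add: exp_add mult_ac flip: exp_of_nat_mult)
  finally show "real (card Z) \<le> exp (\<theta> * R + 4 * real (card J) * exp (- \<theta>))" .
qed

section \<open>From sparse vectors to arbitrary ones\<close>

lemma exists_top_subset:
  fixes f :: "'a \<Rightarrow> real"
  assumes "finite A" "s \<le> card A"
  shows "\<exists>T\<subseteq>A. card T = s \<and> (\<forall>a\<in>T. \<forall>b\<in>A-T. f b \<le> f a)"
  using assms(2)
proof (induction s)
  case (Suc s)
  then obtain T where T: "T \<subseteq> A" "card T = s" "\<forall>a\<in>T. \<forall>b\<in>A-T. f b \<le> f a" by auto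
  have ne: "A - T \<noteq> {}" using Suc.prems T assms(1) by (metis card_mono finite_subset Diff_eq_empty_iff not_less_eq_eq)
  have fin: "finite (A - T)" using assms(1) by auto
  have "Max (f ` (A - T)) \<in> f ` (A - T)" using ne fin by (intro Max_in) auto
  then obtain m where "m \<in> A - T" "f m = Max (f ` (A - T))" by force
  then have m: "m \<in> A - T" "\<forall>b\<in>A-T. f b \<le> f m" using fin by auto
  have "finite T" using T assms(1) finite_subset by auto
  then show ?case using T m by (intro exI[of _ "insert m T"]) auto
qed auto

text \<open>The tail of a vector is cut into blocks of \<open>s\<close> entries of decreasing size; the norm of a block is
  controlled by the mean of the absolute values in the preceding one.\<close>

lemma seminorm_tail_le:
  fixes p :: "('j \<Rightarrow> real) \<Rightarrow> real"
  assumes J: "finite J" and s: "0 < s" and M: "0 \<le> M" and K: "0 \<le> K"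
  assumes tri: "\<And>a b. p (\<lambda>j. a j + b j) \<le> p a + p b"
  assumes up: "\<And>\<beta>. card {j\<in>J. \<beta> j \<noteq> 0} \<le> s \<Longrightarrow> p \<beta> \<le> K * L2_set \<beta> J"
  assumes "\<And>j. j \<in> J \<Longrightarrow> \<bar>\<tau> j\<bar> \<le> M"
  shows "p \<tau> \<le> K * (sqrt (real s) * M + (\<Sum>j\<in>J. \<bar>\<tau> j\<bar>) / sqrt (real s))"
  using assms(7) M
proof (induction "card {j\<in>J. \<tau> j \<noteq> 0}" arbitrary: \<tau> M rule: less_induct)
  case (less \<tau> M)
  define A where "A = {j\<in>J. \<tau> j \<noteq> 0}"
  have A: "finite A" "A \<subseteq> J" using J by (auto simp: A_def)
  have l1: "0 \<le> (\<Sum>j\<in>J. \<bar>\<tau> j\<bar>) / sqrt (real s)" by (simp add: sum_nonneg)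
  show ?case
  proof (cases "card A \<le> s")
    case True
    have "L2_set \<tau> J = L2_set \<tau> A"
      unfolding L2_set_def using A J by (intro arg_cong[where f=sqrt] sum.mono_neutral_right) (auto simp: A_def)
    also have "\<dots> \<le> sqrt (real (card A)) * M" using less.prems A by (intro L2_set_le_const) auto
    also have "\<dots> \<le> sqrt (real s) * M" using True less.prems by (intro mult_right_mono) auto
    finally have "K * L2_set \<tau> J \<le> K * (sqrt (real s) * M + (\<Sum>j\<in>J. \<bar>\<tau> j\<bar>) / sqrt (real s))"
      using l1 K by (intro mult_left_mono) linarith+
    then show ?thesis using up[of \<tau>] True unfolding A_def by linarith
  next
    case False
    then obtain T where T: "T \<subseteq> A" "card T = s" "\<forall>a\<in>T. \<forall>b\<in>A-T. \<bar>\<tau> b\<bar> \<le> \<bar>\<tau> a\<bar>"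
      using exists_top_subset[of A s "\<lambda>j. \<bar>\<tau> j\<bar>"] A by force
    have finT: "finite T" using T A finite_subset by auto
    have Tne: "T \<noteq> {}" using T s by auto
    \<comment> \<open>The mean of the removed block dominates all remaining entries, and sqrt s *
      \<open>M'\<close> is the l1 norm of that block divided by sqrt s. Hence the l1 terms telescope
      along the induction on the size of the support.\<close>
    define M' where "M' = (\<Sum>j\<in>T. \<bar>\<tau> j\<bar>) / real s"
    define a where "a = (\<lambda>j. if j \<in> T then \<tau> j else 0)"
    define b where "b = (\<lambda>j. if j \<in> T then 0 else \<tau> j)"
    have ab: "\<tau> = (\<lambda>j. a j + b j)" by (auto simp: a_def b_def)
    have suppa: "{j\<in>J. a j \<noteq> 0} = T" using T by (auto simp: a_def A_def)
    have "L2_set a J = L2_set \<tau> T"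
      unfolding a_def by (subst L2_set_restrict_zero) (use J T A in \<open>auto simp: Int_absorb1\<close>)
    also have "\<dots> \<le> sqrt (real s) * M" using less.prems A T L2_set_le_const[of M T \<tau>] by auto
    finally have pa: "p a \<le> K * (sqrt (real s) * M)"
      using up[of a] suppa T(2) K by (metis mult_left_mono order_refl order_trans)
    have bM: "\<bar>b j\<bar> \<le> M'" if j: "j \<in> J" for j
    proof (cases "j \<in> A - T")
      case True
      have "real s * \<bar>\<tau> j\<bar> = (\<Sum>k\<in>T. \<bar>\<tau> j\<bar>)" using T by simp
      also have "\<dots> \<le> (\<Sum>k\<in>T. \<bar>\<tau> k\<bar>)" using T True by (intro sum_mono) auto
      finally show ?thesis using s True by (simp add: M'_def b_def field_simps)
    qed (use j in \<open>auto simp: b_def A_def M'_def sum_nonneg\<close>)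
    have "{j\<in>J. b j \<noteq> 0} = A - T" by (auto simp: b_def A_def)
    then have lt: "card {j\<in>J. b j \<noteq> 0} < card {j\<in>J. \<tau> j \<noteq> 0}"
      using T Tne A unfolding A_def[symmetric] by (auto intro!: psubset_card_mono)
    have "0 \<le> M'" by (simp add: M'_def sum_nonneg)
    from less.hyps[OF lt bM this]
    have pb: "p b \<le> K * (sqrt (real s) * M' + (\<Sum>j\<in>J. \<bar>b j\<bar>) / sqrt (real s))" by auto
    have sb: "(\<Sum>j\<in>J. \<bar>b j\<bar>) = (\<Sum>j\<in>J. \<bar>\<tau> j\<bar>) - (\<Sum>j\<in>T. \<bar>\<tau> j\<bar>)"
    proof -
      have "(\<Sum>j\<in>J. \<bar>b j\<bar>) = (\<Sum>j\<in>J-T. \<bar>\<tau> j\<bar>)"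
        using J T A by (intro sum.mono_neutral_cong_right) (auto simp: b_def)
      then show ?thesis using J T A sum_diff[of J T "\<lambda>j. \<bar>\<tau> j\<bar>"] by auto
    qed
    have "sqrt (real s) * M' = (\<Sum>j\<in>T. \<bar>\<tau> j\<bar>) / sqrt (real s)"
      using s by (simp add: M'_def field_simps)
    then have pb': "p b \<le> K * ((\<Sum>j\<in>J. \<bar>\<tau> j\<bar>) / sqrt (real s))" using pb sb by (simp add: diff_divide_distrib)
    have "p \<tau> \<le> p a + p b" using tri[of a b] ab by simp
    then show ?thesis using pa pb' by (simp add: distrib_left)
  qed
qed

text \<open>At most s entries exceed the threshold l1/s; they form a sparse vector. The other
  entries are small, so their contribution is of order l1/sqrt s by the block argument. The lower
  bound is informative on the cone where l1 is small against sqrt s times l2.\<close>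

lemma seminorm_of_sparse:
  fixes p :: "('j \<Rightarrow> real) \<Rightarrow> real"
  assumes J: "finite J" and s: "0 < s" and K: "0 \<le> K" and kap: "0 \<le> \<kappa>"
  assumes tri: "\<And>a b. p (\<lambda>j. a j + b j) \<le> p a + p b" and neg: "\<And>a. p (\<lambda>j. - a j) = p a"
  assumes up: "\<And>\<beta>. card {j\<in>J. \<beta> j \<noteq> 0} \<le> s \<Longrightarrow> p \<beta> \<le> K * L2_set \<beta> J"
  assumes low: "\<And>\<beta>. card {j\<in>J. \<beta> j \<noteq> 0} \<le> s \<Longrightarrow> \<kappa> * L2_set \<beta> J \<le> p \<beta>"
  shows "p \<beta> \<le> K * (L2_set \<beta> J + 2 * (\<Sum>j\<in>J. \<bar>\<beta> j\<bar>) / sqrt (real s))"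
    and "\<kappa> * L2_set \<beta> J - (\<kappa> + 2 * K) * (\<Sum>j\<in>J. \<bar>\<beta> j\<bar>) / sqrt (real s) \<le> p \<beta>"
proof -
  define l where "l = (\<Sum>j\<in>J. \<bar>\<beta> j\<bar>)"
  have l: "0 \<le> l" by (simp add: l_def sum_nonneg)
  define M where "M = l / real s"
  have M: "0 \<le> M" using l by (simp add: M_def)
  define T where "T = {j\<in>J. \<bar>\<beta> j\<bar> > M}"
  define a where "a = (\<lambda>j. if j \<in> T then \<beta> j else 0)"
  define b where "b = (\<lambda>j. if j \<in> T then 0 else \<beta> j)"
  have ab: "\<beta> = (\<lambda>j. a j + b j)" by (auto simp: a_def b_def)
  have "card T \<le> s"
  proof (rule ccontr)
    assume "\<not> card T \<le> s"
    then have c: "s < card T" by simp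
    have "l \<le> real (card T) * M" using c s l by (simp add: M_def field_simps mult_left_mono)
    also have "\<dots> = (\<Sum>j\<in>T. M)" by simp
    also have "\<dots> < (\<Sum>j\<in>T. \<bar>\<beta> j\<bar>)"
    proof (rule sum_strict_mono)
      show "finite T" using J by (simp add: T_def)
      show "T \<noteq> {}" using c by auto
    qed (simp add: T_def)
    also have "\<dots> \<le> l" unfolding l_def using J by (intro sum_mono2) (auto simp: T_def)
    finally show False by simp
  qed
  moreover have "{j\<in>J. a j \<noteq> 0} \<subseteq> T" by (auto simp: a_def)
  moreover have "finite T" using J by (auto simp: T_def)
  ultimately have ca: "card {j\<in>J. a j \<noteq> 0} \<le> s" by (meson card_mono le_trans)
  have bM: "\<bar>b j\<bar> \<le> M" if "j \<in> J" for j using that M by (auto simp: b_def T_def)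
  have bl: "(\<Sum>j\<in>J. \<bar>b j\<bar>) \<le> l" unfolding l_def by (intro sum_mono) (auto simp: b_def)
  have sM: "sqrt (real s) * M = l / sqrt (real s)" using s by (simp add: M_def field_simps)
  have "p b \<le> K * (sqrt (real s) * M + (\<Sum>j\<in>J. \<bar>b j\<bar>) / sqrt (real s))"
    by (rule seminorm_tail_le[OF J s M K tri up bM])
  also have "\<dots> \<le> K * (2 * l / sqrt (real s))"
    using sM bl K s by (intro mult_left_mono) (auto simp: field_simps)
  finally have pb: "p b \<le> K * (2 * l / sqrt (real s))" .
  have La: "L2_set a J \<le> L2_set \<beta> J" unfolding L2_set_def by (intro real_sqrt_le_mono sum_mono) (auto simp: a_def)
  have "(\<Sum>j\<in>J. (b j)\<^sup>2) \<le> M * (\<Sum>j\<in>J. \<bar>b j\<bar>)" by (rule sum_power2_le_max_mult) (rule bM)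
  also have "\<dots> \<le> M * l" using bl M by (rule mult_left_mono)
  also have "\<dots> = (l / sqrt (real s))\<^sup>2" by (simp add: M_def power_divide power2_eq_square)
  finally have Lb: "L2_set b J \<le> l / sqrt (real s)" using l by (intro L2_set_leI) auto
  have "L2_set \<beta> J \<le> L2_set a J + L2_set b J" by (subst ab) (rule L2_set_triangle_ineq)
  then have "\<kappa> * L2_set \<beta> J \<le> \<kappa> * (L2_set a J + l / sqrt (real s))" using Lb kap by (intro mult_left_mono) auto
  also have "\<dots> \<le> p a + \<kappa> * l / sqrt (real s)" using low[OF ca] by (simp add: distrib_left)
  also have "a = (\<lambda>j. \<beta> j + - b j)" by (auto simp: a_def b_def)
  then have "p a \<le> p \<beta> + p b" using tri[of \<beta> "\<lambda>j. - b j"] neg[of b] by metis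
  finally show "\<kappa> * L2_set \<beta> J - (\<kappa> + 2 * K) * (\<Sum>j\<in>J. \<bar>\<beta> j\<bar>) / sqrt (real s) \<le> p \<beta>"
    using pb unfolding l_def[symmetric] by (simp add: algebra_simps add_divide_distrib)
  have "p \<beta> \<le> p a + p b" using tri[of a b] ab by simp
  also have "p a \<le> K * L2_set \<beta> J" using up[OF ca] La K by (meson mult_left_mono order_trans)
  finally show "p \<beta> \<le> K * (L2_set \<beta> J + 2 * (\<Sum>j\<in>J. \<bar>\<beta> j\<bar>) / sqrt (real s))"
    using pb by (simp add: distrib_left l_def)
qed

subsection \<open>Invariance properties of product Lebesgue and Gaussian measures\<close>

interpretation lborel_product: product_sigma_finite "\<lambda>_ :: 'i. lborel :: real measure"
  by standard

text \<open>Fubini, one coordinate at a time. Translations (\<open>c = 1\<close>) are used for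
  reflections, dilations (\<open>t = 0\<close>) for the cone argument behind the uniform law on the
  sphere.\<close>

lemma nn_integral_PiM_lborel_affine:
  fixes c :: real and t :: "'i \<Rightarrow> real"
  assumes I: "finite I" and c: "c \<noteq> 0"
  assumes "f \<in> borel_measurable (\<Pi>\<^sub>M i\<in>I. lborel)"
  shows "(\<integral>\<^sup>+x. f x \<partial>(\<Pi>\<^sub>M i\<in>I. lborel)) =
    ennreal (\<bar>c\<bar> ^ card I) * (\<integral>\<^sup>+x. f (\<lambda>i\<in>I. t i + c * x i) \<partial>(\<Pi>\<^sub>M i\<in>I. lborel))"
  using I assms(3)
proof (induction I arbitrary: f)
  case empty
  then show ?case by (simp add: PiM_empty nn_integral_count_space_finite)
next
  case (insert i I)
  note [measurable] = insert.prems
  have m[measurable]: "(\<lambda>x. \<integral>\<^sup>+y. f (x(i := y)) \<partial>lborel) \<in> borel_measurable (\<Pi>\<^sub>M i\<in>I. lborel)"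
    "(\<lambda>x. \<integral>\<^sup>+y. f (x(i := t i + c * y)) \<partial>lborel) \<in> borel_measurable (\<Pi>\<^sub>M i\<in>I. lborel)"
    by measurable
  have "(\<integral>\<^sup>+x. f x \<partial>(\<Pi>\<^sub>M i\<in>insert i I. lborel)) =
      (\<integral>\<^sup>+x. (\<integral>\<^sup>+y. f (x(i := y)) \<partial>lborel) \<partial>(\<Pi>\<^sub>M i\<in>I. lborel))"
    by (rule lborel_product.product_nn_integral_insert) (use insert in auto)
  also have "\<dots> = (\<integral>\<^sup>+x. \<bar>c\<bar> * (\<integral>\<^sup>+y. f (x(i := t i + c * y)) \<partial>lborel) \<partial>(\<Pi>\<^sub>M i\<in>I. lborel))"
  proof (rule nn_integral_cong)
    fix x :: "'i \<Rightarrow> real" assume x: "x \<in> space (\<Pi>\<^sub>M i\<in>I. lborel)"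
    have "(\<lambda>y. f (x(i := y))) \<in> borel_measurable borel"
      using measurable_comp[OF measurable_component_update[OF x insert(2)] insert.prems] by (simp add: comp_def)
    then show "(\<integral>\<^sup>+y. f (x(i := y)) \<partial>lborel) = \<bar>c\<bar> * (\<integral>\<^sup>+y. f (x(i := t i + c * y)) \<partial>lborel)"
      by (rule nn_integral_real_affine) (rule c)
  qed
  also have "\<dots> = \<bar>c\<bar> * (\<integral>\<^sup>+x. (\<integral>\<^sup>+y. f (x(i := t i + c * y)) \<partial>lborel) \<partial>(\<Pi>\<^sub>M i\<in>I. lborel))"
    by (rule nn_integral_cmult) (rule m)
  also have "\<dots> = \<bar>c\<bar> * (ennreal (\<bar>c\<bar> ^ card I) *
      (\<integral>\<^sup>+x. (\<integral>\<^sup>+y. f ((\<lambda>j\<in>I. t j + c * x j)(i := t i + c * y)) \<partial>lborel) \<partial>(\<Pi>\<^sub>M i\<in>I. lborel)))"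
    by (subst insert.IH[OF m(2)]) rule
  also have "\<dots> = ennreal (\<bar>c\<bar> ^ card (insert i I)) *
      (\<integral>\<^sup>+x. (\<integral>\<^sup>+y. f ((\<lambda>j\<in>I. t j + c * x j)(i := t i + c * y)) \<partial>lborel) \<partial>(\<Pi>\<^sub>M i\<in>I. lborel))"
    using insert(1,2) by (simp add: ennreal_mult mult.assoc)
  also have "(\<integral>\<^sup>+x. (\<integral>\<^sup>+y. f ((\<lambda>j\<in>I. t j + c * x j)(i := t i + c * y)) \<partial>lborel) \<partial>(\<Pi>\<^sub>M i\<in>I. lborel)) =
      (\<integral>\<^sup>+x. (\<integral>\<^sup>+y. f (\<lambda>j\<in>insert i I. t j + c * (x(i := y)) j) \<partial>lborel) \<partial>(\<Pi>\<^sub>M i\<in>I. lborel))"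
    using insert(2) by (intro nn_integral_cong arg_cong[where f=f]) auto
  also have "\<dots> = (\<integral>\<^sup>+x. f (\<lambda>j\<in>insert i I. t j + c * x j) \<partial>(\<Pi>\<^sub>M i\<in>insert i I. lborel))"
    by (rule lborel_product.product_nn_integral_insert[symmetric]) (use insert in auto)
  finally show ?case .
qed

text \<open>The Householder reflection along \<open>h\<close>. For h = 0 the quotient is 0 by
  convention and the map is the identity on I, so reflections along a difference of two unit vectors
  make sense also when these coincide.\<close>

definition reflect :: "'i set \<Rightarrow> ('i \<Rightarrow> real) \<Rightarrow> ('i \<Rightarrow> real) \<Rightarrow> 'i \<Rightarrow> real" where
  "reflect I h x = (\<lambda>i\<in>I. x i - 2 * (\<Sum>k\<in>I. h k * x k) / (\<Sum>k\<in>I. (h k)\<^sup>2) * h i)"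

lemma measurable_reflect[measurable]:
  assumes "sets M = sets borel" "finite I"
  shows "reflect I h \<in> measurable (\<Pi>\<^sub>M i\<in>I. M) (\<Pi>\<^sub>M i\<in>I. M)"
proof -
  have s: "sets (\<Pi>\<^sub>M i\<in>I. M) = sets (\<Pi>\<^sub>M i\<in>I. borel)" by (intro sets_PiM_cong) (auto simp: assms)
  have "reflect I h \<in> measurable (\<Pi>\<^sub>M i\<in>I. borel) (\<Pi>\<^sub>M i\<in>I. borel)"
    unfolding reflect_def by measurable
  then show ?thesis by (simp add: measurable_cong_sets[OF s s])
qed

lemma sum_power2_reflect: "(\<Sum>i\<in>I. (reflect I h x i)\<^sup>2) = (\<Sum>i\<in>I. (x i)\<^sup>2)"
proof (cases "(\<Sum>k\<in>I. (h k)\<^sup>2) = 0")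
  case False
  define q where "q = (\<Sum>k\<in>I. (h k)\<^sup>2)"
  define s where "s = (\<Sum>k\<in>I. h k * x k)"
  have "(\<Sum>i\<in>I. (reflect I h x i)\<^sup>2) = (\<Sum>i\<in>I. (x i)\<^sup>2 - 4 * s / q * (h i * x i) + 4 * s\<^sup>2 / q\<^sup>2 * (h i)\<^sup>2)"
  proof (intro sum.cong refl)
    fix i assume "i \<in> I"
    then have "reflect I h x i = x i - 2 * s / q * h i" by (simp add: reflect_def q_def s_def)
    then show "(reflect I h x i)\<^sup>2 = (x i)\<^sup>2 - 4 * s / q * (h i * x i) + 4 * s\<^sup>2 / q\<^sup>2 * (h i)\<^sup>2"
      by (simp add: power2_diff power_mult_distrib power_divide)
  qed
  also have "\<dots> = (\<Sum>i\<in>I. (x i)\<^sup>2) - 4 * s / q * s + 4 * s\<^sup>2 / q\<^sup>2 * q"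
    by (simp only: sum.distrib sum_subtractf sum_distrib_left[symmetric] s_def[symmetric] q_def[symmetric])
  also have "\<dots> = (\<Sum>i\<in>I. (x i)\<^sup>2)" using False by (simp add: q_def[symmetric] power2_eq_square)
  finally show ?thesis .
qed (simp add: reflect_def)

text \<open>In the coordinates \<open>r = \<langle>h, x\<rangle>\<close> and \<open>x k\<close> for \<open>k \<noteq> m\<close>, where \<open>h m \<noteq> 0\<close>, a reflection is a
  translation of the \<open>x k\<close> by a multiple of \<open>r\<close> followed by \<open>r \<mapsto> - r\<close>.\<close>

lemma nn_integral_PiM_lborel_reflect:
  assumes I: "finite I" and f: "f \<in> borel_measurable (\<Pi>\<^sub>M i\<in>I. lborel)"
  shows "(\<integral>\<^sup>+x. f (reflect I h x) \<partial>(\<Pi>\<^sub>M i\<in>I. lborel)) = (\<integral>\<^sup>+x. f x \<partial>(\<Pi>\<^sub>M i\<in>I. lborel))"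
proof (cases "\<exists>m\<in>I. h m \<noteq> 0")
  case False
  then have "reflect I h x = restrict x I" for x by (auto simp: reflect_def)
  then show ?thesis
    by (intro nn_integral_cong) (auto simp: space_PiM PiE_restrict)
next
  case True
  then obtain m where m: "m \<in> I" "h m \<noteq> 0" by auto
  define J where "J = I - {m}"
  have J: "finite J" "m \<notin> J" and IJ: "I = insert m J" using I m by (auto simp: J_def)
  note [measurable] = f[unfolded IJ]
  define q where "q = (\<Sum>k\<in>I. (h k)\<^sup>2)"
  have q: "q > 0" unfolding q_def using I m by (intro sum_pos2[of _ m]) auto
  define L where "L x = (\<Sum>k\<in>J. h k * x k)" for x :: "'a \<Rightarrow> real"
  define \<phi> where "\<phi> x r = f (x(m := (r - L x) / h m))" for x r
  have Lm[measurable]: "L \<in> borel_measurable (\<Pi>\<^sub>M i\<in>J. lborel)"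
    unfolding L_def by measurable
  have phi[measurable]: "(\<lambda>(x, r). \<phi> x r) \<in> borel_measurable ((\<Pi>\<^sub>M i\<in>J. lborel) \<Otimes>\<^sub>M lborel)"
    unfolding \<phi>_def split_beta by measurable
  \<comment> \<open>Substitution of r = \<langle>h, x\<rangle> for the coordinate \<open>m\<close>,
    with Jacobian 1/|h m|.\<close>
  have base: "(\<integral>\<^sup>+x. g x \<partial>(\<Pi>\<^sub>M i\<in>I. lborel)) =
      ennreal (1 / \<bar>h m\<bar>) * (\<integral>\<^sup>+x. (\<integral>\<^sup>+r. g (x(m := (r - L x) / h m)) \<partial>lborel) \<partial>(\<Pi>\<^sub>M i\<in>J. lborel))"
    if g: "g \<in> borel_measurable (\<Pi>\<^sub>M i\<in>I. lborel)" for g :: "('a \<Rightarrow> real) \<Rightarrow> ennreal"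
  proof -
    note [measurable] = g[unfolded IJ]
    have mm: "(\<lambda>x. \<integral>\<^sup>+r. g (x(m := (r - L x) / h m)) \<partial>lborel) \<in> borel_measurable (\<Pi>\<^sub>M i\<in>J. lborel)"
      by measurable
    have "(\<integral>\<^sup>+x. g x \<partial>(\<Pi>\<^sub>M i\<in>I. lborel)) = (\<integral>\<^sup>+x. (\<integral>\<^sup>+y. g (x(m := y)) \<partial>lborel) \<partial>(\<Pi>\<^sub>M i\<in>J. lborel))"
      unfolding IJ by (rule lborel_product.product_nn_integral_insert) (use J g in \<open>auto simp: IJ\<close>)
    also have "\<dots> = (\<integral>\<^sup>+x. ennreal (1 / \<bar>h m\<bar>) * (\<integral>\<^sup>+r. g (x(m := (r - L x) / h m)) \<partial>lborel) \<partial>(\<Pi>\<^sub>M i\<in>J. lborel))"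
    proof (rule nn_integral_cong)
      fix x :: "'a \<Rightarrow> real" assume x: "x \<in> space (\<Pi>\<^sub>M i\<in>J. lborel)"
      have "(\<lambda>y. g (x(m := y))) \<in> borel_measurable borel"
        using measurable_comp[OF measurable_component_update[OF x J(2)] g[unfolded IJ]] by (simp add: comp_def)
      from nn_integral_real_affine[OF this, of "1 / h m" "- L x / h m"] m(2)
      show "(\<integral>\<^sup>+y. g (x(m := y)) \<partial>lborel) = ennreal (1 / \<bar>h m\<bar>) * (\<integral>\<^sup>+r. g (x(m := (r - L x) / h m)) \<partial>lborel)"
        by (simp add: diff_divide_distrib)
    qed
    also have "\<dots> = ennreal (1 / \<bar>h m\<bar>) * (\<integral>\<^sup>+x. (\<integral>\<^sup>+r. g (x(m := (r - L x) / h m)) \<partial>lborel) \<partial>(\<Pi>\<^sub>M i\<in>J. lborel))"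
      by (rule nn_integral_cmult) (rule mm)
    finally show ?thesis .
  qed
  \<comment> \<open>In the new coordinates the reflection is (x, r) \<mapsto> (x - (2 r / q) h, -
    r); the coordinate \<open>m\<close> is recovered from - r and the shifted x.\<close>
  have refl: "f (reflect I h (x(m := (r - L x) / h m))) = \<phi> (\<lambda>i\<in>J. (- 2 * r / q * h i) + 1 * x i) (- r)"
    if x: "x \<in> space (\<Pi>\<^sub>M i\<in>J. lborel)" for x r
  proof -
    define w where "w = x(m := (r - L x) / h m)"
    have wr: "(\<Sum>k\<in>I. h k * w k) = r"
    proof -
      have "(\<Sum>k\<in>I. h k * w k) = h m * w m + (\<Sum>k\<in>J. h k * w k)" unfolding IJ using J by simp
      also have "(\<Sum>k\<in>J. h k * w k) = L x" unfolding L_def w_def using J by (intro sum.cong) auto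
      finally show ?thesis using m by (simp add: w_def)
    qed
    have qJ: "q = (h m)\<^sup>2 + (\<Sum>k\<in>J. (h k)\<^sup>2)" unfolding q_def IJ using J by simp
    have "L (\<lambda>i\<in>J. (- 2 * r / q * h i) + 1 * x i) = (\<Sum>k\<in>J. h k * x k - 2 * r / q * (h k)\<^sup>2)"
      unfolding L_def by (intro sum.cong) (auto simp: power2_eq_square algebra_simps)
    also have "\<dots> = L x - 2 * r / q * (q - (h m)\<^sup>2)"
      unfolding sum_subtractf sum_distrib_left[symmetric] by (simp add: L_def qJ)
    finally have L': "L (\<lambda>i\<in>J. (- 2 * r / q * h i) + 1 * x i) = L x - 2 * r + 2 * r * (h m)\<^sup>2 / q"
      using q by (simp add: field_simps)
    have "reflect I h w = (\<lambda>i\<in>J. (- 2 * r / q * h i) + 1 * x i)(m := (- r - L (\<lambda>i\<in>J. (- 2 * r / q * h i) + 1 * x i)) / h m)"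
    proof
      fix i
      show "reflect I h w i = ((\<lambda>i\<in>J. (- 2 * r / q * h i) + 1 * x i)(m := (- r - L (\<lambda>i\<in>J. (- 2 * r / q * h i) + 1 * x i)) / h m)) i"
        unfolding reflect_def wr q_def[symmetric] L'
        using m J q by (auto simp: w_def IJ field_simps power2_eq_square)
    qed
    then show ?thesis unfolding \<phi>_def w_def by simp
  qed
  have shift: "(\<integral>\<^sup>+x. \<phi> (\<lambda>i\<in>J. (- 2 * r / q * h i) + 1 * x i) (- r) \<partial>(\<Pi>\<^sub>M i\<in>J. lborel)) = (\<integral>\<^sup>+x. \<phi> x (- r) \<partial>(\<Pi>\<^sub>M i\<in>J. lborel))" for r
  proof -
    have "(\<lambda>x. \<phi> x (- r)) \<in> borel_measurable (\<Pi>\<^sub>M i\<in>J. lborel)" by measurable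
    from nn_integral_PiM_lborel_affine[OF J(1) _ this, of 1 "\<lambda>i. - 2 * r / q * h i"] show ?thesis by simp
  qed
  interpret P: pair_sigma_finite "\<Pi>\<^sub>M i\<in>J. lborel :: real measure" "lborel :: real measure"
    by (intro pair_sigma_finite.intro product_sigma_finite.sigma_finite[OF lborel_product.product_sigma_finite_axioms J(1)]
      lborel.sigma_finite_measure_axioms)
  have fr: "(\<lambda>x. f (reflect I h x)) \<in> borel_measurable (\<Pi>\<^sub>M i\<in>I. lborel)"
    using measurable_comp[OF measurable_reflect[of lborel I h] f] I by (simp add: comp_def)
  have "(\<integral>\<^sup>+x. f (reflect I h x) \<partial>(\<Pi>\<^sub>M i\<in>I. lborel)) =
     ennreal (1 / \<bar>h m\<bar>) * (\<integral>\<^sup>+x. (\<integral>\<^sup>+r. \<phi> (\<lambda>i\<in>J. (- 2 * r / q * h i) + 1 * x i) (- r) \<partial>lborel) \<partial>(\<Pi>\<^sub>M i\<in>J. lborel))"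
    unfolding base[OF fr] by (intro arg_cong2[where f="(*)"] refl nn_integral_cong) auto
  also have "(\<integral>\<^sup>+x. (\<integral>\<^sup>+r. \<phi> (\<lambda>i\<in>J. (- 2 * r / q * h i) + 1 * x i) (- r) \<partial>lborel) \<partial>(\<Pi>\<^sub>M i\<in>J. lborel)) =
      (\<integral>\<^sup>+r. (\<integral>\<^sup>+x. \<phi> (\<lambda>i\<in>J. (- 2 * r / q * h i) + 1 * x i) (- r) \<partial>(\<Pi>\<^sub>M i\<in>J. lborel)) \<partial>lborel)"
    by (rule P.Fubini'[symmetric]) measurable
  also have "\<dots> = (\<integral>\<^sup>+r. (\<integral>\<^sup>+x. \<phi> x (- r) \<partial>(\<Pi>\<^sub>M i\<in>J. lborel)) \<partial>lborel)"
    by (simp only: shift)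
  also have "\<dots> = (\<integral>\<^sup>+r. (\<integral>\<^sup>+x. \<phi> x r \<partial>(\<Pi>\<^sub>M i\<in>J. lborel)) \<partial>lborel)"
    using nn_integral_real_affine[of "\<lambda>r. \<integral>\<^sup>+x. \<phi> x r \<partial>(\<Pi>\<^sub>M i\<in>J. lborel)" "-1" 0] by simp
  also have "\<dots> = (\<integral>\<^sup>+x. (\<integral>\<^sup>+r. \<phi> x r \<partial>lborel) \<partial>(\<Pi>\<^sub>M i\<in>J. lborel))"
    by (rule P.Fubini') measurable
  finally show ?thesis unfolding base[OF f] \<phi>_def .
qed

abbreviation std_normal :: "real measure" where
  "std_normal \<equiv> density lborel (\<lambda>x. ennreal (std_normal_density x))"

abbreviation gauss :: "'i set \<Rightarrow> ('i \<Rightarrow> real) measure" where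
  "gauss I \<equiv> \<Pi>\<^sub>M i\<in>I. std_normal"

lemma prob_space_std_normal: "prob_space std_normal"
  by (rule prob_space_normal_density) simp

interpretation std_normal: prob_space std_normal
  by (rule prob_space_std_normal)

interpretation gauss_product: product_sigma_finite "\<lambda>_ :: 'i. std_normal"
  by standard

lemma prob_space_gauss: "prob_space (gauss I)"
  by (intro prob_space_PiM prob_space_std_normal)

lemma sets_gauss: "sets (gauss I) = sets (\<Pi>\<^sub>M i\<in>I. lborel)"
  by (intro sets_PiM_cong) auto

lemma space_gauss: "space (gauss I) = I \<rightarrow>\<^sub>E UNIV"
  by (simp add: space_PiM)

lemma gauss_eq_density:
  assumes I: "finite I"
  shows "gauss I = density (\<Pi>\<^sub>M i\<in>I. lborel) (\<lambda>x. ennreal (\<Prod>i\<in>I. std_normal_density (x i)))"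
proof (rule gauss_product.PiM_eqI[symmetric, OF I])
  fix A :: "'a \<Rightarrow> real set" assume A: "\<And>i. i \<in> I \<Longrightarrow> A i \<in> sets std_normal"
  then have A': "\<And>i. i \<in> I \<Longrightarrow> A i \<in> sets borel" by simp
  have P: "Pi\<^sub>E I A \<in> sets (\<Pi>\<^sub>M i\<in>I. lborel)" using A' I by (intro sets_PiM_I_finite) auto
  have "emeasure (density (\<Pi>\<^sub>M i\<in>I. lborel) (\<lambda>x. ennreal (\<Prod>i\<in>I. std_normal_density (x i)))) (Pi\<^sub>E I A) =
    (\<integral>\<^sup>+x. ennreal (\<Prod>i\<in>I. std_normal_density (x i)) * indicator (Pi\<^sub>E I A) x \<partial>(\<Pi>\<^sub>M i\<in>I. lborel))"
    using P by (intro emeasure_density) auto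
  also have "\<dots> = (\<integral>\<^sup>+x. (\<Prod>i\<in>I. ennreal (std_normal_density (x i)) * indicator (A i) (x i)) \<partial>(\<Pi>\<^sub>M i\<in>I. lborel))"
  proof (intro nn_integral_cong)
    fix x :: "'a \<Rightarrow> real" assume x: "x \<in> space (\<Pi>\<^sub>M i\<in>I. lborel)"
    have "indicator (Pi\<^sub>E I A) x = (\<Prod>i\<in>I. indicator (A i) (x i) :: ennreal)"
      using x I by (auto simp: indicator_def space_PiM PiE_iff prod_zero_iff intro!: prod.neutral[symmetric] prod_zero[symmetric])
    then show "ennreal (\<Prod>i\<in>I. std_normal_density (x i)) * indicator (Pi\<^sub>E I A) x =
       (\<Prod>i\<in>I. ennreal (std_normal_density (x i)) * indicator (A i) (x i))"
      by (simp add: prod.distrib prod_ennreal)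
  qed
  also have "\<dots> = (\<Prod>i\<in>I. \<integral>\<^sup>+x. ennreal (std_normal_density x) * indicator (A i) x \<partial>lborel)"
    by (rule lborel_product.product_nn_integral_prod) (use I A' in auto)
  also have "\<dots> = (\<Prod>i\<in>I. emeasure std_normal (A i))"
    using A' by (intro prod.cong) (auto simp: emeasure_density)
  finally show "emeasure (density (\<Pi>\<^sub>M i\<in>I. lborel) (\<lambda>x. ennreal (\<Prod>i\<in>I. std_normal_density (x i)))) (Pi\<^sub>E I A) =
    (\<Prod>i\<in>I. emeasure std_normal (A i))" .
qed (simp add: sets_gauss)

lemma prod_std_normal_density:
  "finite I \<Longrightarrow> (\<Prod>i\<in>I. std_normal_density (x i)) = (1 / sqrt (2 * pi)) ^ card I * exp (- (\<Sum>i\<in>I. (x i)\<^sup>2) / 2)"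
  by (simp add: std_normal_density_def prod_dividef exp_sum[symmetric] sum_divide_distrib power_divide flip: sum_negf)

text \<open>The joint density is a function of the sum of squares, which a reflection preserves, and
  Lebesgue measure is invariant.\<close>

lemma distr_gauss_reflect:
  assumes I: "finite I"
  shows "distr (gauss I) (gauss I) (reflect I h) = gauss I"
proof (rule measure_eqI)
  fix A assume "A \<in> sets (distr (gauss I) (gauss I) (reflect I h))"
  then have A: "A \<in> sets (gauss I)" "A \<in> sets (\<Pi>\<^sub>M i\<in>I. lborel)" by (simp_all add: sets_gauss)
  define d where "d x = ennreal (\<Prod>i\<in>I. std_normal_density (x i))" for x :: "'a \<Rightarrow> real"
  have dr: "d (reflect I h x) = d x" for x
    unfolding d_def prod_std_normal_density[OF I] sum_power2_reflect ..
  have dm[measurable]: "d \<in> borel_measurable (\<Pi>\<^sub>M i\<in>I. lborel)" unfolding d_def by measurable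
  have g: "gauss I = density (\<Pi>\<^sub>M i\<in>I. lborel) d" unfolding d_def by (rule gauss_eq_density[OF I])
  have rm: "reflect I h \<in> measurable (\<Pi>\<^sub>M i\<in>I. lborel) (\<Pi>\<^sub>M i\<in>I. lborel)"
    using I by (intro measurable_reflect) auto
  have rm': "reflect I h \<in> measurable (gauss I) (gauss I)"
    using I by (intro measurable_reflect) auto
  have rA: "reflect I h -` A \<inter> space (gauss I) \<in> sets (\<Pi>\<^sub>M i\<in>I. lborel)"
    using measurable_sets[OF rm' A(1)] by (simp add: sets_gauss)
  have "emeasure (distr (gauss I) (gauss I) (reflect I h)) A = emeasure (gauss I) (reflect I h -` A \<inter> space (gauss I))"
    by (rule emeasure_distr[OF rm' A(1)])
  also have "\<dots> = (\<integral>\<^sup>+x. d x * indicator (reflect I h -` A \<inter> space (gauss I)) x \<partial>(\<Pi>\<^sub>M i\<in>I. lborel))"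
    unfolding g by (subst emeasure_density) (use rA in \<open>auto simp: g[symmetric]\<close>)
  also have "\<dots> = (\<integral>\<^sup>+x. d (reflect I h x) * indicator A (reflect I h x) \<partial>(\<Pi>\<^sub>M i\<in>I. lborel))"
    by (intro nn_integral_cong) (auto simp: dr indicator_def space_PiM)
  also have "\<dots> = (\<integral>\<^sup>+x. d x * indicator A x \<partial>(\<Pi>\<^sub>M i\<in>I. lborel))"
    by (rule nn_integral_PiM_lborel_reflect[OF I, where f="\<lambda>x. d x * indicator A x"]) (use A in measurable)
  also have "\<dots> = emeasure (gauss I) A" unfolding g using A by (subst emeasure_density) auto
  finally show "emeasure (distr (gauss I) (gauss I) (reflect I h)) A = emeasure (gauss I) A" .
qed simp

subsection \<open>Concentration of Gaussian linear forms\<close>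

lemma indep_vars_gauss:
  assumes I: "finite I"
  shows "prob_space.indep_vars (gauss I) (\<lambda>_. borel) (\<lambda>i \<omega>. \<omega> i) I"
proof (cases "I = {}")
  case True
  then show ?thesis
    by (simp add: prob_space.indep_vars_def[OF prob_space_gauss] prob_space.indep_sets_def[OF prob_space_gauss])
next
  case False
  have ps: "prob_space (gauss I)" by (rule prob_space_gauss)
  have m: "(\<lambda>\<omega>. \<omega> i) \<in> measurable (gauss I) borel" if "i \<in> I" for i
    using measurable_component_singleton[OF that, of "\<lambda>_. std_normal"] by simp
  have d: "distr (gauss I) borel (\<lambda>\<omega>. \<omega> i) = std_normal" if "i \<in> I" for i
  proof -
    have "distr (gauss I) borel (\<lambda>\<omega>. \<omega> i) = distr (gauss I) std_normal (\<lambda>\<omega>. \<omega> i)"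
      by (intro distr_cong) auto
    also have "\<dots> = std_normal" by (rule distr_PiM_component) (auto simp: that prob_space_std_normal)
    finally show ?thesis .
  qed
  have "distr (gauss I) (\<Pi>\<^sub>M i\<in>I. borel) (\<lambda>x. \<lambda>i\<in>I. x i) = distr (gauss I) (gauss I) (\<lambda>x. x)"
    by (intro distr_cong sets_PiM_cong) (auto simp: space_PiM)
  also have "\<dots> = gauss I" by (rule distr_id)
  also have "\<dots> = (\<Pi>\<^sub>M i\<in>I. distr (gauss I) borel (\<lambda>\<omega>. \<omega> i))"
    by (intro PiM_cong refl d[symmetric])
  finally show ?thesis
    by (subst prob_space.indep_vars_iff_distr_eq_PiM'[OF ps False]) (use m in auto)
qed

lemma distributed_gauss_linear_form:
  assumes I: "finite I" and c: "(\<Sum>i\<in>I. (c i)\<^sup>2) = 1"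
  shows "distributed (gauss I) lborel (\<lambda>\<omega>. \<Sum>i\<in>I. c i * \<omega> i) std_normal_density"
proof -
  interpret G: prob_space "gauss I" by (rule prob_space_gauss)
  \<comment> \<open>Zero coefficients are discarded because scaling and summing of normal variables
    are available for positive deviations only.\<close>
  define J where "J = {i\<in>I. c i \<noteq> 0}"
  have J: "finite J" "J \<subseteq> I" using I by (auto simp: J_def)
  have sJ: "(\<Sum>i\<in>J. (c i)\<^sup>2) = 1"
    unfolding c[symmetric] using I J by (intro sum.mono_neutral_left) (auto simp: J_def)
  then have Jne: "J \<noteq> {}" by auto
  have ind: "G.indep_vars (\<lambda>_. borel) (\<lambda>i \<omega>. c i * \<omega> i) J"
    by (rule G.indep_vars_compose2[OF G.indep_vars_subset[OF indep_vars_gauss[OF I] J(2)]]) simp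
  have nd: "distributed (gauss I) lborel (\<lambda>\<omega>. c i * \<omega> i) (normal_density 0 \<bar>c i\<bar>)" if "i \<in> J" for i
  proof -
    have i: "i \<in> I" "c i \<noteq> 0" using that by (auto simp: J_def)
    have "distributed (gauss I) lborel (\<lambda>\<omega>. \<omega> i) std_normal_density"
      unfolding distributed_def
    proof (intro conjI)
      show "(\<lambda>\<omega>. \<omega> i) \<in> measurable (gauss I) lborel"
        using measurable_component_singleton[OF i(1), of "\<lambda>_. std_normal"] by simp
      have "distr (gauss I) lborel (\<lambda>\<omega>. \<omega> i) = distr (gauss I) std_normal (\<lambda>\<omega>. \<omega> i)"
        by (intro distr_cong) auto
      also have "\<dots> = std_normal" by (rule distr_PiM_component) (auto simp: i prob_space_std_normal)
      finally show "distr (gauss I) lborel (\<lambda>\<omega>. \<omega> i) = std_normal" .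
    qed auto
    from G.normal_density_affine[OF this _ i(2), of 0] show ?thesis by simp
  qed
  have "distributed (gauss I) lborel (\<lambda>\<omega>. \<Sum>i\<in>J. c i * \<omega> i) (normal_density (\<Sum>i\<in>J. 0) (sqrt (\<Sum>i\<in>J. \<bar>c i\<bar>\<^sup>2)))"
    by (rule G.sum_indep_normal[OF J(1) Jne ind _ nd]) (auto simp: J_def)
  moreover have "(\<Sum>i\<in>I. c i * \<omega> i) = (\<Sum>i\<in>J. c i * \<omega> i)" for \<omega>
    using I J by (intro sum.mono_neutral_right) (auto simp: J_def)
  ultimately show ?thesis using sJ by simp
qed

text \<open>The integrand is s times the normal density of deviation s = 1 / sqrt(1 - 2 \<theta>).
  Negative \<theta> is included on purpose: it yields lower tails.\<close>

lemma nn_integral_exp_square_std_normal: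
  fixes \<theta> :: real
  assumes "\<theta> < 1/2"
  shows "(\<integral>\<^sup>+x. ennreal (std_normal_density x) * ennreal (exp (\<theta> * x\<^sup>2)) \<partial>lborel) = ennreal (1 / sqrt (1 - 2 * \<theta>))"
proof -
  define s where "s = 1 / sqrt (1 - 2 * \<theta>)"
  have s: "s > 0" "s\<^sup>2 = 1 / (1 - 2 * \<theta>)" using assms by (auto simp: s_def power_divide)
  have eq: "std_normal_density x * exp (\<theta> * x\<^sup>2) = s * normal_density 0 s x" for x
  proof -
    have "1 / s\<^sup>2 = 1 - 2 * \<theta>" using assms s by simp
    then have "- (x - 0)\<^sup>2 / (2 * s\<^sup>2) = - x\<^sup>2 / 2 * (1 - 2 * \<theta>)"
      by (metis (no_types, opaque_lifting) diff_zero divide_divide_eq_left divide_inverse inverse_eq_divide)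
    then have "- x\<^sup>2 / 2 + \<theta> * x\<^sup>2 = - (x - 0)\<^sup>2 / (2 * s\<^sup>2)" by (simp add: algebra_simps)
    moreover have "sqrt (2 * pi * s\<^sup>2) = sqrt (2 * pi) * s"
      using s(1) by (simp only: real_sqrt_mult[of "2 * pi"] real_sqrt_abs abs_of_pos)
    then have "1 / sqrt (2 * pi) = s * (1 / sqrt (2 * pi * s\<^sup>2))" using s(1) by simp
    ultimately show ?thesis
      unfolding std_normal_density_def normal_density_def mult.assoc exp_add[symmetric] by simp
  qed
  have "(\<integral>\<^sup>+x. ennreal (std_normal_density x) * ennreal (exp (\<theta> * x\<^sup>2)) \<partial>lborel) =
      (\<integral>\<^sup>+x. ennreal s * ennreal (normal_density 0 s x) \<partial>lborel)"
    by (intro nn_integral_cong) (simp add: ennreal_mult[symmetric] eq s less_imp_le)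
  also have "\<dots> = ennreal s * (\<integral>\<^sup>+x. ennreal (normal_density 0 s x) \<partial>lborel)"
    by (rule nn_integral_cmult) simp
  also have "(\<integral>\<^sup>+x. ennreal (normal_density 0 s x) \<partial>lborel) = 1"
    using s by (subst nn_integral_eq_integral) auto
  finally show ?thesis by (simp add: s_def)
qed

text \<open>The rows \<open>e k\<close> of coordinates are disjoint, so the linear forms are independent standard normals.\<close>

lemma nn_integral_exp_chi_square:
  fixes e :: "'k \<Rightarrow> 'j \<Rightarrow> 'i" and \<theta> :: real
  assumes I: "finite I" and K: "finite K" and J: "finite J"
  assumes e: "\<And>k j. k \<in> K \<Longrightarrow> j \<in> J \<Longrightarrow> e k j \<in> I"
  assumes inj: "\<And>k j k' j'. k \<in> K \<Longrightarrow> j \<in> J \<Longrightarrow> k' \<in> K \<Longrightarrow> j' \<in> J \<Longrightarrow> e k j = e k' j' \<Longrightarrow> k = k' \<and> j = j'"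
  assumes c: "(\<Sum>j\<in>J. (c j)\<^sup>2) = 1" and th: "\<theta> < 1/2"
  shows "(\<integral>\<^sup>+\<omega>. ennreal (exp (\<theta> * (\<Sum>k\<in>K. (\<Sum>j\<in>J. c j * \<omega> (e k j))\<^sup>2))) \<partial>gauss I) = ennreal ((1 / sqrt (1 - 2 * \<theta>)) ^ card K)"
proof -
  interpret G: prob_space "gauss I" by (rule prob_space_gauss)
  define B where "B k = e k ` J" for k
  define ci where "ci k i = c (the_inv_into J (e k) i)" for k i
  have injk: "inj_on (e k) J" if "k \<in> K" for k using inj that by (meson inj_onI)
  have BI: "B k \<subseteq> I" if "k \<in> K" for k using e that by (auto simp: B_def)
  have disj: "disjoint_family_on B K" using inj by (fastforce simp: disjoint_family_on_def B_def)
  have sumB: "(\<Sum>i\<in>B k. ci k i * \<omega> i) = (\<Sum>j\<in>J. c j * \<omega> (e k j))" if "k \<in> K" for k \<omega>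
    unfolding B_def using injk[OF that]
    by (subst sum.reindex) (auto simp: ci_def the_inv_into_f_f intro!: sum.cong)
  have m: "(\<lambda>\<omega>. \<omega> i) \<in> borel_measurable (gauss I)" if "i \<in> I" for i
    using measurable_component_singleton[OF that, of "\<lambda>_. std_normal"] by simp
  have ind1: "G.indep_vars (\<lambda>k. \<Pi>\<^sub>M i\<in>B k. borel) (\<lambda>k \<omega>. restrict (\<lambda>i. \<omega> i) (B k)) K"
    by (rule G.indep_vars_restrict[OF indep_vars_gauss[OF I] BI disj])
  have ind: "G.indep_vars (\<lambda>_. borel) (\<lambda>k \<omega>. ennreal (exp (\<theta> * (\<Sum>i\<in>B k. ci k i * restrict (\<lambda>i. \<omega> i) (B k) i)\<^sup>2))) K"
  proof (rule G.indep_vars_compose2[OF ind1])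
    fix k assume "k \<in> K"
    show "(\<lambda>x. ennreal (exp (\<theta> * (\<Sum>i\<in>B k. ci k i * x i)\<^sup>2))) \<in> borel_measurable (\<Pi>\<^sub>M i\<in>B k. borel)"
      by measurable
  qed
  have eq: "(\<Sum>i\<in>B k. ci k i * restrict (\<lambda>i. \<omega> i) (B k) i) = (\<Sum>j\<in>J. c j * \<omega> (e k j))" if "k \<in> K" for k \<omega>
    using sumB[OF that] by (simp cong: sum.cong)
  have "(\<integral>\<^sup>+\<omega>. ennreal (exp (\<theta> * (\<Sum>k\<in>K. (\<Sum>j\<in>J. c j * \<omega> (e k j))\<^sup>2))) \<partial>gauss I) =
    (\<integral>\<^sup>+\<omega>. (\<Prod>k\<in>K. ennreal (exp (\<theta> * (\<Sum>i\<in>B k. ci k i * restrict (\<lambda>i. \<omega> i) (B k) i)\<^sup>2))) \<partial>gauss I)"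
  proof (intro nn_integral_cong)
    fix \<omega>
    have "ennreal (exp (\<theta> * (\<Sum>k\<in>K. (\<Sum>j\<in>J. c j * \<omega> (e k j))\<^sup>2))) = (\<Prod>k\<in>K. ennreal (exp (\<theta> * (\<Sum>j\<in>J. c j * \<omega> (e k j))\<^sup>2)))"
      by (simp add: prod_ennreal exp_sum[OF K, symmetric] sum_distrib_left)
    also have "\<dots> = (\<Prod>k\<in>K. ennreal (exp (\<theta> * (\<Sum>i\<in>B k. ci k i * restrict (\<lambda>i. \<omega> i) (B k) i)\<^sup>2)))"
      by (intro prod.cong refl) (simp only: eq)
    finally show "ennreal (exp (\<theta> * (\<Sum>k\<in>K. (\<Sum>j\<in>J. c j * \<omega> (e k j))\<^sup>2))) =
      (\<Prod>k\<in>K. ennreal (exp (\<theta> * (\<Sum>i\<in>B k. ci k i * restrict (\<lambda>i. \<omega> i) (B k) i)\<^sup>2)))" .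
  qed
  also have "\<dots> = (\<Prod>k\<in>K. \<integral>\<^sup>+\<omega>. ennreal (exp (\<theta> * (\<Sum>i\<in>B k. ci k i * restrict (\<lambda>i. \<omega> i) (B k) i)\<^sup>2)) \<partial>gauss I)"
    by (rule G.indep_vars_nn_integral[OF K ind]) simp
  also have "\<dots> = (\<Prod>k\<in>K. ennreal (1 / sqrt (1 - 2 * \<theta>)))"
  proof (rule prod.cong[OF refl])
    fix k assume k: "k \<in> K"
    define ck where "ck i = (if i \<in> B k then ci k i else 0)" for i
    have sI: "(\<Sum>i\<in>I. f (ck i) i) = (\<Sum>i\<in>B k. f (ci k i) i)" if "\<And>i. f 0 i = 0" for f :: "real \<Rightarrow> 'i \<Rightarrow> real"
      using I BI[OF k] by (intro sum.mono_neutral_cong_right) (auto simp: ck_def that)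
    have "(\<Sum>i\<in>B k. (ci k i)\<^sup>2) = (\<Sum>j\<in>J. (c j)\<^sup>2)"
      unfolding B_def using injk[OF k] by (subst sum.reindex) (auto simp: ci_def the_inv_into_f_f intro!: sum.cong)
    then have "(\<Sum>i\<in>I. (ck i)\<^sup>2) = 1" using c sI[of "\<lambda>x _. x\<^sup>2"] by simp
    from distributed_gauss_linear_form[OF I this]
    have D: "distributed (gauss I) lborel (\<lambda>\<omega>. \<Sum>i\<in>I. ck i * \<omega> i) std_normal_density" .
    have "(\<integral>\<^sup>+\<omega>. ennreal (exp (\<theta> * (\<Sum>i\<in>B k. ci k i * restrict (\<lambda>i. \<omega> i) (B k) i)\<^sup>2)) \<partial>gauss I) =
      (\<integral>\<^sup>+\<omega>. ennreal (exp (\<theta> * (\<Sum>i\<in>I. ck i * \<omega> i)\<^sup>2)) \<partial>gauss I)"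
      using sI[of "\<lambda>x i. x * _ i"] by simp
    also have "\<dots> = (\<integral>\<^sup>+x. ennreal (std_normal_density x) * ennreal (exp (\<theta> * x\<^sup>2)) \<partial>lborel)"
      by (rule distributed_nn_integral[OF D, symmetric]) measurable
    also have "\<dots> = ennreal (1 / sqrt (1 - 2 * \<theta>))" by (rule nn_integral_exp_square_std_normal[OF th])
    finally show "(\<integral>\<^sup>+\<omega>. ennreal (exp (\<theta> * (\<Sum>i\<in>B k. ci k i * restrict (\<lambda>i. \<omega> i) (B k) i)\<^sup>2)) \<partial>gauss I) = ennreal (1 / sqrt (1 - 2 * \<theta>))" .
  qed
  also have "\<dots> = ennreal ((1 / sqrt (1 - 2 * \<theta>)) ^ card K)" using th by (simp add: prod_ennreal ennreal_power)
  finally show ?thesis .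
qed

lemma (in prob_space) prob_le_of_nn_integral_exp:
  fixes X :: "'a \<Rightarrow> real"
  assumes [measurable]: "X \<in> borel_measurable M"
  assumes "(\<integral>\<^sup>+\<omega>. ennreal (exp (X \<omega>)) \<partial>M) \<le> ennreal b" "0 \<le> b"
  shows "prob {\<omega>\<in>space M. a \<le> X \<omega>} \<le> b * exp (- a)"
proof -
  have "emeasure M {\<omega>\<in>space M. 1 \<le> ennreal (exp (- a)) * ennreal (exp (X \<omega>))} \<le>
      ennreal (exp (- a)) * (\<integral>\<^sup>+\<omega>. ennreal (exp (X \<omega>)) * indicator (space M) \<omega> \<partial>M)"
    by (rule nn_integral_Markov_inequality) auto
  also have "(\<integral>\<^sup>+\<omega>. ennreal (exp (X \<omega>)) * indicator (space M) \<omega> \<partial>M) = (\<integral>\<^sup>+\<omega>. ennreal (exp (X \<omega>)) \<partial>M)"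
    by (intro nn_integral_cong) auto
  also have "ennreal (exp (- a)) * \<dots> \<le> ennreal (exp (- a)) * ennreal b"
    by (intro mult_left_mono assms) simp
  also have "\<dots> = ennreal (b * exp (- a))" using assms by (simp add: ennreal_mult mult.commute)
  finally have "emeasure M {\<omega>\<in>space M. 1 \<le> ennreal (exp (- a)) * ennreal (exp (X \<omega>))} \<le> ennreal (b * exp (- a))" .
  moreover have "{\<omega>\<in>space M. 1 \<le> ennreal (exp (- a)) * ennreal (exp (X \<omega>))} = {\<omega>\<in>space M. a \<le> X \<omega>}"
    by (auto simp: ennreal_mult[symmetric] exp_minus field_simps simp flip: exp_diff ennreal_1)
  ultimately show ?thesis
    using assms by (simp add: emeasure_eq_measure)
qed

text \<open>Chernoff's bound. Keeping the factor \<theta> on both sides of the event treats both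
  tails at once: the sum is at least r for \<theta> > 0 and at most r for \<theta> < 0.\<close>

lemma prob_chi_square_ge:
  fixes e :: "'k \<Rightarrow> 'j \<Rightarrow> 'i" and \<theta> r :: real
  assumes I: "finite I" and K: "finite K" and J: "finite J"
  assumes e: "\<And>k j. k \<in> K \<Longrightarrow> j \<in> J \<Longrightarrow> e k j \<in> I"
  assumes inj: "\<And>k j k' j'. k \<in> K \<Longrightarrow> j \<in> J \<Longrightarrow> k' \<in> K \<Longrightarrow> j' \<in> J \<Longrightarrow> e k j = e k' j' \<Longrightarrow> k = k' \<and> j = j'"
  assumes c: "(\<Sum>j\<in>J. (c j)\<^sup>2) = 1" and th: "\<theta> < 1/2"
  shows "{\<omega>\<in>space (gauss I). \<theta> * r \<le> \<theta> * (\<Sum>k\<in>K. (\<Sum>j\<in>J. c j * \<omega> (e k j))\<^sup>2)} \<in> sets (gauss I)"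
    and "measure (gauss I) {\<omega>\<in>space (gauss I). \<theta> * r \<le> \<theta> * (\<Sum>k\<in>K. (\<Sum>j\<in>J. c j * \<omega> (e k j))\<^sup>2)}
      \<le> (1 / sqrt (1 - 2 * \<theta>)) ^ card K * exp (- \<theta> * r)"
proof -
  interpret G: prob_space "gauss I" by (rule prob_space_gauss)
  have m: "(\<lambda>\<omega>. \<omega> (e k j)) \<in> borel_measurable (gauss I)" if "k \<in> K" "j \<in> J" for k j
    using measurable_component_singleton[OF e[OF that], of "\<lambda>_. std_normal"] by simp
  have X: "(\<lambda>\<omega>. \<theta> * (\<Sum>k\<in>K. (\<Sum>j\<in>J. c j * \<omega> (e k j))\<^sup>2)) \<in> borel_measurable (gauss I)"
    by (intro borel_measurable_times borel_measurable_sum borel_measurable_power m) auto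
  then show "{\<omega>\<in>space (gauss I). \<theta> * r \<le> \<theta> * (\<Sum>k\<in>K. (\<Sum>j\<in>J. c j * \<omega> (e k j))\<^sup>2)} \<in> sets (gauss I)"
    by (rule borel_measurable_le[OF borel_measurable_const])
  have "measure (gauss I) {\<omega>\<in>space (gauss I). \<theta> * r \<le> \<theta> * (\<Sum>k\<in>K. (\<Sum>j\<in>J. c j * \<omega> (e k j))\<^sup>2)}
      \<le> (1 / sqrt (1 - 2 * \<theta>)) ^ card K * exp (- (\<theta> * r))"
  proof (rule G.prob_le_of_nn_integral_exp[OF X])
    show "(\<integral>\<^sup>+\<omega>. ennreal (exp (\<theta> * (\<Sum>k\<in>K. (\<Sum>j\<in>J. c j * \<omega> (e k j))\<^sup>2))) \<partial>gauss I) \<le> ennreal ((1 / sqrt (1 - 2 * \<theta>)) ^ card K)"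
      by (rule eq_refl, rule nn_integral_exp_chi_square[OF I K J e inj c th])
    show "0 \<le> (1 / sqrt (1 - 2 * \<theta>)) ^ card K" using th by simp
  qed
  then show "measure (gauss I) {\<omega>\<in>space (gauss I). \<theta> * r \<le> \<theta> * (\<Sum>k\<in>K. (\<Sum>j\<in>J. c j * \<omega> (e k j))\<^sup>2)}
      \<le> (1 / sqrt (1 - 2 * \<theta>)) ^ card K * exp (- \<theta> * r)" by simp
qed

text \<open>The number 73 = 1 - 2 * (-36) comes from the lower tail in
  \<open>gauss_norm_bounds\<close>, where exp 2 \<le> sqrt 73 is needed.\<close>

lemma exp_4_le: "exp (4::real) \<le> 73"
proof -
  have "exp (1::real) \<le> 2.72" using e_less_272 by simp
  then have "exp (1::real) ^ 4 \<le> 2.72 ^ 4" by (intro power_mono) auto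
  moreover have "exp (4::real) = exp 1 ^ 4" using exp_of_nat_mult[of 4 "1::real"] by simp
  moreover have "(2.72::real) ^ 4 \<le> 73" by (simp add: power_divide)
  ultimately show ?thesis by linarith
qed

lemma gauss_norm_bounds:
  fixes e :: "'k \<Rightarrow> 'j \<Rightarrow> 'i"
  assumes I: "finite I" and K: "finite K" and J: "finite J"
  assumes e: "\<And>k j. k \<in> K \<Longrightarrow> j \<in> J \<Longrightarrow> e k j \<in> I"
  assumes inj: "\<And>k j k' j'. k \<in> K \<Longrightarrow> j \<in> J \<Longrightarrow> k' \<in> K \<Longrightarrow> j' \<in> J \<Longrightarrow> e k j = e k' j' \<Longrightarrow> k = k' \<and> j = j'"
  shows "\<exists>A\<in>sets (gauss I). measure (gauss I) A \<le> 2 * exp (- real (card K)) \<and>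
    (\<forall>\<omega>\<in>space (gauss I) - A. sqrt (real (card K)) / 6 * L2_set c J \<le> L2_set (\<lambda>k. \<Sum>j\<in>J. c j * \<omega> (e k j)) K \<and>
      L2_set (\<lambda>k. \<Sum>j\<in>J. c j * \<omega> (e k j)) K \<le> 4 * sqrt (real (card K)) * L2_set c J)"
proof (cases "L2_set c J = 0")
  case True
  then have "\<forall>j\<in>J. c j = 0" using J by (simp add: L2_set_eq_0_iff)
  then show ?thesis using True by (intro bexI[of _ "{}"]) (auto simp: L2_set_def)
next
  case False
  interpret G: prob_space "gauss I" by (rule prob_space_gauss)
  define l where "l = L2_set c J"
  have l: "l > 0" using False L2_set_nonneg[of c J] unfolding l_def by linarith
  define m where "m = card K"
  define d where "d j = c j / l" for j
  have d1: "(\<Sum>j\<in>J. (d j)\<^sup>2) = 1"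
  proof -
    have "(\<Sum>j\<in>J. (d j)\<^sup>2) = (\<Sum>j\<in>J. (c j)\<^sup>2) / l\<^sup>2" by (simp add: d_def power_divide sum_divide_distrib)
    also have "(\<Sum>j\<in>J. (c j)\<^sup>2) = l\<^sup>2" unfolding l_def by (rule L2_set_power2[symmetric])
    finally show ?thesis using l by simp
  qed
  define Q where "Q \<omega> = (\<Sum>k\<in>K. (\<Sum>j\<in>J. d j * \<omega> (e k j))\<^sup>2)" for \<omega>
  have cQ: "L2_set (\<lambda>k. \<Sum>j\<in>J. c j * \<omega> (e k j)) K = l * sqrt (Q \<omega>)" for \<omega>
  proof -
    have "(\<lambda>k. \<Sum>j\<in>J. c j * \<omega> (e k j)) = (\<lambda>k. l * (\<Sum>j\<in>J. d j * \<omega> (e k j)))"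
      using l by (simp add: d_def sum_distrib_left)
    then show ?thesis using l by (simp add: L2_set_scale) (simp add: L2_set_def Q_def)
  qed
  \<comment> \<open>Upper tail: \<theta> = 3/8 costs a factor 2 per row, while the threshold 16 m
    gives exp(-6 m). Lower tail: \<theta> = -36 gives 1/sqrt 73 per row against exp m from the
    threshold m/36. Both products are at most exp(-m).\<close>
  have th: "(3/8::real) < 1/2" "(- 36::real) < 1/2" by auto
  define A1 where "A1 = {\<omega>\<in>space (gauss I). 3/8 * (16 * real m) \<le> 3/8 * Q \<omega>}"
  define A2 where "A2 = {\<omega>\<in>space (gauss I). - 36 * (real m / 36) \<le> - 36 * Q \<omega>}"
  have s1: "A1 \<in> sets (gauss I)" and p1: "measure (gauss I) A1 \<le> (1 / sqrt (1 - 2 * (3/8))) ^ m * exp (- (3/8) * (16 * real m))"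
    unfolding A1_def Q_def m_def
    by (rule prob_chi_square_ge[OF I K J e inj d1 th(1)]; assumption)+
  have s2: "A2 \<in> sets (gauss I)" and p2: "measure (gauss I) A2 \<le> (1 / sqrt (1 - 2 * (- 36))) ^ m * exp (- (- 36) * (real m / 36))"
    unfolding A2_def Q_def m_def
    by (rule prob_chi_square_ge[OF I K J e inj d1 th(2)]; assumption)+
  have "1 / sqrt (1 - 2 * (3/8)) = (2::real)"
    by (simp add: real_sqrt_divide)
  then have "(1 / sqrt (1 - 2 * (3/8))) ^ m * exp (- (3/8) * (16 * real m)) = (2::real) ^ m * exp (real m * (-5) + real m * (-1))"
    by simp
  also have "\<dots> = (2 * exp (-5)) ^ m * exp (- real m)"
    by (simp only: exp_add exp_of_nat_mult power_mult_distrib) (simp add: exp_of_nat_mult[symmetric])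
  also have "\<dots> \<le> 1 ^ m * exp (- real m)"
  proof (intro mult_right_mono power_mono)
    have "2 \<le> exp (5::real)" using exp_ge_add_one_self[of "5::real"] by linarith
    then show "2 * exp (- 5) \<le> (1::real)" by (simp add: exp_minus field_simps)
  qed auto
  finally have P1: "measure (gauss I) A1 \<le> exp (- real m)" using p1 by simp
  have "exp (2::real) \<le> sqrt 73"
  proof (rule real_le_rsqrt)
    show "(exp (2::real))\<^sup>2 \<le> 73" using exp_4_le by (simp add: exp_of_nat_mult[symmetric] flip: exp_double)
  qed
  then have e2: "1 / sqrt 73 * exp 2 \<le> (1::real)" by (simp add: field_simps)
  have "(1 / sqrt (1 - 2 * (- 36))) ^ m * exp (- (- 36) * (real m / 36)) = (1 / sqrt 73) ^ m * exp (real m * 2 + real m * (-1))"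
    by simp
  also have "\<dots> = (1 / sqrt 73 * exp 2) ^ m * exp (- real m)"
    by (simp only: exp_add exp_of_nat_mult power_mult_distrib) (simp add: exp_of_nat_mult[symmetric])
  also have "\<dots> \<le> 1 ^ m * exp (- real m)" using e2 by (intro mult_right_mono power_mono) auto
  finally have P2: "measure (gauss I) A2 \<le> exp (- real m)" using p2 by simp
  have "measure (gauss I) (A1 \<union> A2) \<le> 2 * exp (- real m)"
    using measure_Un_le[OF s1 s2] P1 P2 by simp
  moreover have "sqrt (real m) / 6 * l \<le> l * sqrt (Q \<omega>) \<and> l * sqrt (Q \<omega>) \<le> 4 * sqrt (real m) * l"
    if "\<omega> \<in> space (gauss I) - (A1 \<union> A2)" for \<omega>
  proof -
    have "real m / 36 \<le> Q \<omega>" "Q \<omega> \<le> 16 * real m" using that by (auto simp: A1_def A2_def)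
    then have "sqrt (real m / 36) \<le> sqrt (Q \<omega>)" "sqrt (Q \<omega>) \<le> sqrt (16 * real m)" by simp_all
    then have "sqrt (real m) / 6 \<le> sqrt (Q \<omega>)" "sqrt (Q \<omega>) \<le> 4 * sqrt (real m)"
      by (simp_all add: real_sqrt_divide real_sqrt_mult)
    then show ?thesis using l by (simp add: mult.commute)
  qed
  ultimately show ?thesis using s1 s2
    by (intro bexI[of _ "A1 \<union> A2"]) (auto simp: cQ m_def l_def)
qed

subsection \<open>Restricted isometry for Gaussian matrices\<close>

text \<open>Union bound over the integer net: the exponent is the entropy of the net minus the
  number of rows. The injection \<open>e\<close> names the Gaussian coordinates of the matrix, so
  that one lemma covers clean points, noise and the transposed matrix.\<close>

lemma gauss_sparse_isometry:
  fixes e :: "'k \<Rightarrow> 'j \<Rightarrow> 'i" and s :: nat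
  assumes I: "finite I" and K: "finite K" and J: "finite J"
  assumes e: "\<And>k j. k \<in> K \<Longrightarrow> j \<in> J \<Longrightarrow> e k j \<in> I"
  assumes inj: "\<And>k j k' j'. k \<in> K \<Longrightarrow> j \<in> J \<Longrightarrow> k' \<in> K \<Longrightarrow> j' \<in> J \<Longrightarrow> e k j = e k' j' \<Longrightarrow> k = k' \<and> j = j'"
  assumes th: "1 \<le> \<theta>"
  shows "\<exists>A\<in>sets (gauss I).
    measure (gauss I) A \<le> 2 * exp (\<theta> * (36864 * real s) + 4 * real (card J) * exp (- \<theta>) - real (card K)) \<and>
    (\<forall>\<omega>\<in>space (gauss I) - A. \<forall>\<beta>. card {j\<in>J. \<beta> j \<noteq> 0} \<le> s \<longrightarrow>
      sqrt (real (card K)) / 24 * L2_set \<beta> J \<le> L2_set (\<lambda>k. \<Sum>j\<in>J. \<beta> j * \<omega> (e k j)) K \<and>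
      L2_set (\<lambda>k. \<Sum>j\<in>J. \<beta> j * \<omega> (e k j)) K \<le> 8 * sqrt (real (card K)) * L2_set \<beta> J)"
proof -
  interpret G: prob_space "gauss I" by (rule prob_space_gauss)
  define Z where "Z = {z \<in> J \<rightarrow>\<^sub>E (UNIV :: int set). (\<Sum>j\<in>J. (real_of_int (z j))\<^sup>2) \<le> 36864 * real s}"
  have Z: "finite Z" "real (card Z) \<le> exp (\<theta> * (36864 * real s) + 4 * real (card J) * exp (- \<theta>))"
    unfolding Z_def using card_int_vectors_le[OF J th, of "36864 * real s"] by auto
  have "\<forall>z\<in>Z. \<exists>A\<in>sets (gauss I). measure (gauss I) A \<le> 2 * exp (- real (card K)) \<and>
    (\<forall>\<omega>\<in>space (gauss I) - A. sqrt (real (card K)) / 6 * L2_set (\<lambda>j. real_of_int (z j)) J \<le> L2_set (\<lambda>k. \<Sum>j\<in>J. real_of_int (z j) * \<omega> (e k j)) K \<and>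
      L2_set (\<lambda>k. \<Sum>j\<in>J. real_of_int (z j) * \<omega> (e k j)) K \<le> 4 * sqrt (real (card K)) * L2_set (\<lambda>j. real_of_int (z j)) J)"
  proof
    fix z assume "z \<in> Z"
    show "\<exists>A\<in>sets (gauss I). measure (gauss I) A \<le> 2 * exp (- real (card K)) \<and>
    (\<forall>\<omega>\<in>space (gauss I) - A. sqrt (real (card K)) / 6 * L2_set (\<lambda>j. real_of_int (z j)) J \<le> L2_set (\<lambda>k. \<Sum>j\<in>J. real_of_int (z j) * \<omega> (e k j)) K \<and>
      L2_set (\<lambda>k. \<Sum>j\<in>J. real_of_int (z j) * \<omega> (e k j)) K \<le> 4 * sqrt (real (card K)) * L2_set (\<lambda>j. real_of_int (z j)) J)"
      by (rule gauss_norm_bounds[OF I K J e inj])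
  qed
  then have "\<forall>z\<in>Z. \<exists>A. A \<in> sets (gauss I) \<and> measure (gauss I) A \<le> 2 * exp (- real (card K)) \<and>
    (\<forall>\<omega>\<in>space (gauss I) - A. sqrt (real (card K)) / 6 * L2_set (\<lambda>j. real_of_int (z j)) J \<le> L2_set (\<lambda>k. \<Sum>j\<in>J. real_of_int (z j) * \<omega> (e k j)) K \<and>
      L2_set (\<lambda>k. \<Sum>j\<in>J. real_of_int (z j) * \<omega> (e k j)) K \<le> 4 * sqrt (real (card K)) * L2_set (\<lambda>j. real_of_int (z j)) J)"
    unfolding Bex_def .
  from bchoice[OF this] obtain A where A: "\<And>z. z \<in> Z \<Longrightarrow> A z \<in> sets (gauss I)"
    "\<And>z. z \<in> Z \<Longrightarrow> measure (gauss I) (A z) \<le> 2 * exp (- real (card K))"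
    "\<And>z \<omega>. z \<in> Z \<Longrightarrow> \<omega>\<in>space (gauss I) - A z \<Longrightarrow> sqrt (real (card K)) / 6 * L2_set (\<lambda>j. real_of_int (z j)) J \<le> L2_set (\<lambda>k. \<Sum>j\<in>J. real_of_int (z j) * \<omega> (e k j)) K \<and>
      L2_set (\<lambda>k. \<Sum>j\<in>J. real_of_int (z j) * \<omega> (e k j)) K \<le> 4 * sqrt (real (card K)) * L2_set (\<lambda>j. real_of_int (z j)) J"
    by blast
  have "measure (gauss I) (\<Union>z\<in>Z. A z) \<le> (\<Sum>z\<in>Z. measure (gauss I) (A z))"
    using Z A by (intro measure_UNION_le) auto
  also have "\<dots> \<le> (\<Sum>z\<in>Z. 2 * exp (- real (card K)))" by (intro sum_mono A)
  also have "\<dots> = real (card Z) * (2 * exp (- real (card K)))" by simp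
  also have "\<dots> \<le> exp (\<theta> * (36864 * real s) + 4 * real (card J) * exp (- \<theta>)) * (2 * exp (- real (card K)))"
    using Z by (intro mult_right_mono) auto
  finally have "measure (gauss I) (\<Union>z\<in>Z. A z) \<le>
      2 * exp (\<theta> * (36864 * real s) + 4 * real (card J) * exp (- \<theta>) - real (card K))"
    by (simp only: exp_diff exp_minus divide_inverse mult_ac)
  moreover have "sqrt (real (card K)) / 24 * L2_set \<beta> J \<le> L2_set (\<lambda>k. \<Sum>j\<in>J. \<beta> j * \<omega> (e k j)) K \<and>
      L2_set (\<lambda>k. \<Sum>j\<in>J. \<beta> j * \<omega> (e k j)) K \<le> 8 * sqrt (real (card K)) * L2_set \<beta> J"
    if w: "\<omega> \<in> space (gauss I) - (\<Union>z\<in>Z. A z)" and b: "card {j\<in>J. \<beta> j \<noteq> 0} \<le> s" for \<omega> \<beta>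
  proof -
    have net: "sqrt (real (card K)) / 6 * L2_set (\<lambda>j. real_of_int (z j)) J \<le> L2_set (\<lambda>k. \<Sum>j\<in>J. real_of_int (z j) * \<omega> (e k j)) K \<and>
      L2_set (\<lambda>k. \<Sum>j\<in>J. real_of_int (z j) * \<omega> (e k j)) K \<le> 4 * sqrt (real (card K)) * L2_set (\<lambda>j. real_of_int (z j)) J"
      if "z \<in> J \<rightarrow>\<^sub>E UNIV" "(\<Sum>j\<in>J. (real_of_int (z j))\<^sup>2) \<le> 36864 * real s" for z
      using A(3)[of z \<omega>] w that by (auto simp: Z_def)
    show ?thesis
      using sparse_isometry_of_net[where W="\<lambda>k j. \<omega> (e k j)", OF K J _ net b] by simp
  qed
  ultimately show ?thesis using Z A by (intro bexI[of _ "\<Union>z\<in>Z. A z"]) auto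
qed

text \<open>The sparse bounds \<mu>/24 and 8 \<mu> enter \<open>seminorm_of_sparse\<close>; the
  factor 17 bounds 1/24 + 2 * 8.\<close>

lemma gauss_cone_isometry:
  fixes e :: "'k \<Rightarrow> 'j \<Rightarrow> 'i" and s :: nat
  assumes I: "finite I" and K: "finite K" and J: "finite J"
  assumes e: "\<And>k j. k \<in> K \<Longrightarrow> j \<in> J \<Longrightarrow> e k j \<in> I"
  assumes inj: "\<And>k j k' j'. k \<in> K \<Longrightarrow> j \<in> J \<Longrightarrow> k' \<in> K \<Longrightarrow> j' \<in> J \<Longrightarrow> e k j = e k' j' \<Longrightarrow> k = k' \<and> j = j'"
  assumes th: "1 \<le> \<theta>" and s: "0 < s"
  shows "\<exists>A\<in>sets (gauss I).
    measure (gauss I) A \<le> 2 * exp (\<theta> * (36864 * real s) + 4 * real (card J) * exp (- \<theta>) - real (card K)) \<and>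
    (\<forall>\<omega>\<in>space (gauss I) - A. \<forall>\<beta>.
      sqrt (real (card K)) * (L2_set \<beta> J / 24 - 17 * (\<Sum>j\<in>J. \<bar>\<beta> j\<bar>) / sqrt (real s)) \<le> L2_set (\<lambda>k. \<Sum>j\<in>J. \<beta> j * \<omega> (e k j)) K \<and>
      L2_set (\<lambda>k. \<Sum>j\<in>J. \<beta> j * \<omega> (e k j)) K \<le> 8 * sqrt (real (card K)) * (L2_set \<beta> J + 2 * (\<Sum>j\<in>J. \<bar>\<beta> j\<bar>) / sqrt (real s)))"
proof -
  define \<mu> where "\<mu> = sqrt (real (card K))"
  have mu: "0 \<le> \<mu>" by (simp add: \<mu>_def)
  have "\<exists>A\<in>sets (gauss I).
    measure (gauss I) A \<le> 2 * exp (\<theta> * (36864 * real s) + 4 * real (card J) * exp (- \<theta>) - real (card K)) \<and>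
    (\<forall>\<omega>\<in>space (gauss I) - A. \<forall>\<beta>. card {j\<in>J. \<beta> j \<noteq> 0} \<le> s \<longrightarrow>
      \<mu> / 24 * L2_set \<beta> J \<le> L2_set (\<lambda>k. \<Sum>j\<in>J. \<beta> j * \<omega> (e k j)) K \<and>
      L2_set (\<lambda>k. \<Sum>j\<in>J. \<beta> j * \<omega> (e k j)) K \<le> 8 * \<mu> * L2_set \<beta> J)"
    unfolding \<mu>_def by (rule gauss_sparse_isometry[OF I K J e inj th])
  then obtain A where A: "A \<in> sets (gauss I)"
    "measure (gauss I) A \<le> 2 * exp (\<theta> * (36864 * real s) + 4 * real (card J) * exp (- \<theta>) - real (card K))"
    "\<And>\<omega> \<beta>. \<omega>\<in>space (gauss I) - A \<Longrightarrow> card {j\<in>J. \<beta> j \<noteq> 0} \<le> s \<Longrightarrow>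
      \<mu> / 24 * L2_set \<beta> J \<le> L2_set (\<lambda>k. \<Sum>j\<in>J. \<beta> j * \<omega> (e k j)) K \<and>
      L2_set (\<lambda>k. \<Sum>j\<in>J. \<beta> j * \<omega> (e k j)) K \<le> 8 * \<mu> * L2_set \<beta> J"
    by blast
  have "\<mu> * (L2_set \<beta> J / 24 - 17 * (\<Sum>j\<in>J. \<bar>\<beta> j\<bar>) / sqrt (real s)) \<le> L2_set (\<lambda>k. \<Sum>j\<in>J. \<beta> j * \<omega> (e k j)) K \<and>
      L2_set (\<lambda>k. \<Sum>j\<in>J. \<beta> j * \<omega> (e k j)) K \<le> 8 * \<mu> * (L2_set \<beta> J + 2 * (\<Sum>j\<in>J. \<bar>\<beta> j\<bar>) / sqrt (real s))"
    if w: "\<omega> \<in> space (gauss I) - A" for \<omega> \<beta>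
  proof -
    define p where "p \<beta> = L2_set (\<lambda>k. \<Sum>j\<in>J. \<beta> j * \<omega> (e k j)) K" for \<beta>
    have tri: "p (\<lambda>j. a j + b j) \<le> p a + p b" for a b
      unfolding p_def by (simp add: distrib_right sum.distrib L2_set_triangle_ineq)
    have neg: "p (\<lambda>j. - a j) = p a" for a
      unfolding p_def by (simp add: sum_negf L2_set_def)
    have up: "p \<beta> \<le> 8 * \<mu> * L2_set \<beta> J" and low: "\<mu> / 24 * L2_set \<beta> J \<le> p \<beta>" if "card {j\<in>J. \<beta> j \<noteq> 0} \<le> s" for \<beta>
      using A(3)[OF w that] by (auto simp: p_def)
    have K0: "0 \<le> 8 * \<mu>" "0 \<le> \<mu> / 24" using mu by auto
    note r = seminorm_of_sparse[of J s "8 * \<mu>" "\<mu> / 24" p, OF J s K0 tri neg up low]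
    have "\<mu> * (L2_set \<beta> J / 24 - 17 * (\<Sum>j\<in>J. \<bar>\<beta> j\<bar>) / sqrt (real s)) \<le>
       \<mu> / 24 * L2_set \<beta> J - (\<mu> / 24 + 2 * (8 * \<mu>)) * (\<Sum>j\<in>J. \<bar>\<beta> j\<bar>) / sqrt (real s)"
    proof -
      define t where "t = (\<Sum>j\<in>J. \<bar>\<beta> j\<bar>) / sqrt (real s)"
      have "0 \<le> \<mu> * t" using mu by (simp add: t_def sum_nonneg)
      then have "\<mu> * (L2_set \<beta> J / 24 - 17 * t) \<le> \<mu> / 24 * L2_set \<beta> J - (\<mu> / 24 + 2 * (8 * \<mu>)) * t"
        by (simp add: algebra_simps)
      then show ?thesis by (simp add: t_def)
    qed
    then show ?thesis using r(1)[of \<beta>] r(2)[of \<beta>] unfolding p_def by auto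
  qed
  then show ?thesis using A(1,2) unfolding \<mu>_def by blast
qed

subsection \<open>Inner products of finite sequences\<close>

definition ip :: "nat \<Rightarrow> (nat \<Rightarrow> real) \<Rightarrow> (nat \<Rightarrow> real) \<Rightarrow> real" where
  "ip n u v = (\<Sum>k<n. u k * v k)"

lemma ip_commute: "ip n u v = ip n v u"
  by (simp add: ip_def mult.commute)

lemma ip_add_left: "ip n (\<lambda>k. u k + v k) w = ip n u w + ip n v w"
  by (simp add: ip_def distrib_right sum.distrib)

lemma ip_diff_left: "ip n (\<lambda>k. u k - v k) w = ip n u w - ip n v w"
  by (simp add: ip_def left_diff_distrib sum_subtractf)

lemma ip_add_right: "ip n w (\<lambda>k. u k + v k) = ip n w u + ip n w v"
  by (simp add: ip_def distrib_left sum.distrib)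

lemma ip_diff_right: "ip n w (\<lambda>k. u k - v k) = ip n w u - ip n w v"
  by (simp add: ip_def right_diff_distrib sum_subtractf)

lemma ip_scale_left: "ip n (\<lambda>k. c * u k) w = c * ip n u w"
  by (simp add: ip_def sum_distrib_left mult.assoc)

lemma ip_scale_right: "ip n w (\<lambda>k. c * u k) = c * ip n w u"
  by (simp add: ip_def sum_distrib_left mult.left_commute)

lemma ip_sum_left: "ip n (\<lambda>k. \<Sum>j\<in>A. f j k) w = (\<Sum>j\<in>A. ip n (f j) w)"
  unfolding ip_def sum_distrib_right by (rule sum.swap)

lemma ip_sum_right: "ip n w (\<lambda>k. \<Sum>j\<in>A. f j k) = (\<Sum>j\<in>A. ip n w (f j))"
  unfolding ip_def sum_distrib_left by (rule sum.swap)

lemma ip_self: "ip n u u = (L2_set u {..<n})\<^sup>2"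
  unfolding L2_set_power2 by (simp add: ip_def power2_eq_square)

lemma abs_ip_le: "\<bar>ip n u v\<bar> \<le> L2_set u {..<n} * L2_set v {..<n}"
  unfolding ip_def by (rule sum_mult_le_L2_set)

lemma ip_cong: "(\<And>k. k < n \<Longrightarrow> u k = u' k) \<Longrightarrow> (\<And>k. k < n \<Longrightarrow> v k = v' k) \<Longrightarrow> ip n u v = ip n u' v'"
  by (simp add: ip_def)

lemmas ip_simps = ip_add_left ip_diff_left ip_add_right ip_diff_right ip_scale_left ip_scale_right
  ip_sum_left ip_sum_right

text \<open>A first-order condition without derivatives: at e = - a / (|a| + |b| + 1) the linear
  term outweighs the quadratic one.\<close>

lemma linear_coeff_zero:
  fixes a b :: real
  assumes "\<And>e. \<bar>e\<bar> \<le> 1 \<Longrightarrow> 0 \<le> a * e + b * e\<^sup>2"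
  shows "a = 0"
proof (rule ccontr)
  assume a: "a \<noteq> 0"
  define c where "c = \<bar>a\<bar> + \<bar>b\<bar> + 1"
  have c: "c > 0" by (simp add: c_def)
  define e where "e = - a / c"
  have "\<bar>e\<bar> \<le> 1" using c by (simp add: e_def c_def)
  from assms[OF this] have "0 \<le> - (a\<^sup>2 / c) + b * (a\<^sup>2 / c\<^sup>2)"
    by (simp add: e_def power2_eq_square)
  moreover have "b * (a\<^sup>2 / c\<^sup>2) < a\<^sup>2 / c"
  proof -
    have "b * (a\<^sup>2 / c\<^sup>2) = (b / c) * (a\<^sup>2 / c)" by (simp add: power2_eq_square)
    also have "\<dots> < 1 * (a\<^sup>2 / c)" using c a by (intro mult_strict_right_mono) (auto simp: c_def)
    finally show ?thesis by simp
  qed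
  ultimately show False by simp
qed

text \<open>Vectors are functions on a whole type, so entries outside \<open>A\<close> are pinned to
  0; the box is then a product of compact sets and Tychonoff's theorem applies.\<close>

lemma exists_min_on_box:
  fixes F :: "('i \<Rightarrow> real) \<Rightarrow> real"
  assumes F: "continuous_on UNIV F" and B: "0 \<le> B"
  shows "\<exists>x. (\<forall>j\<in>A. \<bar>x j\<bar> \<le> B) \<and> (\<forall>j. j \<notin> A \<longrightarrow> x j = 0) \<and>
    (\<forall>y. (\<forall>j\<in>A. \<bar>y j\<bar> \<le> B) \<longrightarrow> (\<forall>j. j \<notin> A \<longrightarrow> y j = 0) \<longrightarrow> F x \<le> F y)"
proof -
  define C where "C = PiE UNIV (\<lambda>j. if j \<in> A then {-B..B} else {0::real})"
  have C: "x \<in> C \<longleftrightarrow> (\<forall>j. (j \<in> A \<longrightarrow> \<bar>x j\<bar> \<le> B) \<and> (j \<notin> A \<longrightarrow> x j = 0))" for x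
    by (auto simp: C_def PiE_iff abs_le_iff minus_le_iff split: if_splits)
  have "compactin (product_topology (\<lambda>_. euclidean) UNIV) C"
    unfolding C_def by (subst compactin_PiE) auto
  then have "compact C" by (simp add: euclidean_product_topology)
  moreover have "(\<lambda>_. 0) \<in> C" using B by (simp add: C)
  ultimately obtain x where x: "x \<in> C" "\<forall>y\<in>C. F x \<le> F y"
    using continuous_attains_inf[of C F] continuous_on_subset[OF F] by blast
  then show ?thesis
    by (intro exI[of _ x]) (auto simp: C)
qed

subsection \<open>Least squares\<close>

text \<open>The normal equations, solved by minimising \<open>F\<close>: stationarity at w says that
  \<beta>_j = \<langle>x_j, w\<rangle> satisfies \<Sum> \<beta>_j x_j = b. Then |\<beta>|^2 =
  \<langle>b, w\<rangle>, and the frame bound |\<beta>| \<ge> \<kappa> |w| gives the norm of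
  \<beta>.\<close>

lemma exists_small_preimage:
  fixes x :: "nat \<Rightarrow> nat \<Rightarrow> real"
  assumes G: "finite G" and kap: "0 < \<kappa>"
  assumes low: "\<And>w. (\<kappa> * L2_set w {..<d})\<^sup>2 \<le> (\<Sum>j\<in>G. (ip d (x j) w)\<^sup>2)"
  shows "\<exists>\<beta>. (\<forall>k<d. (\<Sum>j\<in>G. \<beta> j * x j k) = b k) \<and> L2_set \<beta> G \<le> L2_set b {..<d} / \<kappa>"
proof -
  define F where "F w = 1/2 * (\<Sum>j\<in>G. (ip d (x j) w)\<^sup>2) - ip d b w" for w
  have contF: "continuous_on UNIV F"
    unfolding F_def ip_def by (intro continuous_intros continuous_on_product_coordinates)
  define nb where "nb = L2_set b {..<d}"
  \<comment> \<open>F w \<le> F 0 forces |w| \<le> R. Minimising over the larger box of radius R + 1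
    therefore leaves room for perturbations of size at most 1 in each coordinate.\<close>
  define R where "R = 2 * nb / \<kappa>\<^sup>2"
  have R: "0 \<le> R" by (simp add: R_def nb_def)
  have "0 \<le> R + 1" using R by simp
  from exists_min_on_box[OF contF this, of "{..<d}"] obtain w where
    w: "\<forall>k\<in>{..<d}. \<bar>w k\<bar> \<le> R + 1" "\<forall>k. k \<notin> {..<d} \<longrightarrow> w k = 0" and
    min: "\<forall>y. (\<forall>k\<in>{..<d}. \<bar>y k\<bar> \<le> R + 1) \<longrightarrow> (\<forall>k. k \<notin> {..<d} \<longrightarrow> y k = 0) \<longrightarrow> F w \<le> F y"
    by (elim exE conjE)
  define nw where "nw = L2_set w {..<d}"
  have nw0: "0 \<le> nw" by (simp add: nw_def)
  have "F w \<le> F (\<lambda>_. 0)" by (rule min[rule_format]) (use R in auto)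
  then have "1/2 * (\<Sum>j\<in>G. (ip d (x j) w)\<^sup>2) \<le> ip d b w" by (simp add: F_def ip_def)
  moreover have "ip d b w \<le> nb * nw" using abs_ip_le[of d b w] by (simp add: nb_def nw_def)
  ultimately have "1/2 * (\<kappa> * nw)\<^sup>2 \<le> nb * nw" using low[of w] by (simp add: nw_def)
  then have "nw * (\<kappa>\<^sup>2 * nw) \<le> nw * (2 * nb)" by (simp add: power_mult_distrib power2_eq_square mult_ac)
  then have nwR: "nw \<le> R"
    using nw0 kap by (cases "nw = 0") (auto simp: R_def field_simps nb_def mult_le_cancel_left)
  have wk: "\<bar>w k\<bar> \<le> R" if "k < d" for k
    using member_le_L2_set[of "{..<d}" k "\<lambda>k. \<bar>w k\<bar>"] that nwR by (simp add: nw_def L2_set_def)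
  define \<beta> where "\<beta> j = ip d (x j) w" for j
  have eq: "(\<Sum>j\<in>G. \<beta> j * x j k) = b k" if k: "k < d" for k
  proof -
    have "(\<Sum>j\<in>G. \<beta> j * x j k) - b k = 0"
    proof (rule linear_coeff_zero[of _ "1/2 * (\<Sum>j\<in>G. (x j k)\<^sup>2)"])
      fix e :: real assume e: "\<bar>e\<bar> \<le> 1"
      define w' where "w' = (\<lambda>l. w l + (if l = k then e else 0))"
      have "F w \<le> F w'"
      proof (rule min[rule_format])
        fix l
        show "\<bar>w' l\<bar> \<le> R + 1" if "l \<in> {..<d}"
          using wk[of l] that e R abs_triangle_ineq[of "w l" e] by (cases "l = k") (auto simp: w'_def)
        show "w' l = 0" if "l \<notin> {..<d}"
          using w(2) k that by (auto simp: w'_def)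
      qed
      moreover have "ip d c w' = ip d c w + e * c k" for c
        using k by (simp add: w'_def ip_def distrib_left sum.distrib if_distrib[of "\<lambda>x. c _ * x"] mult.commute cong: if_cong)
      then have "F w' = F w + (((\<Sum>j\<in>G. \<beta> j * x j k) - b k) * e + 1/2 * (\<Sum>j\<in>G. (x j k)\<^sup>2) * e\<^sup>2)"
        unfolding F_def \<beta>_def by (simp add: power2_sum sum.distrib power_mult_distrib algebra_simps sum_distrib_left sum_distrib_right)
      ultimately show "0 \<le> ((\<Sum>j\<in>G. \<beta> j * x j k) - b k) * e + 1/2 * (\<Sum>j\<in>G. (x j k)\<^sup>2) * e\<^sup>2" by simp
    qed
    then show ?thesis by simp
  qed
  have "(L2_set \<beta> G)\<^sup>2 = ip d (\<lambda>k. \<Sum>j\<in>G. \<beta> j * x j k) w"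
    unfolding L2_set_power2 ip_sum_left ip_scale_left by (simp add: power2_eq_square \<beta>_def)
  also have "\<dots> = ip d b w" by (rule ip_cong) (auto simp: eq)
  also have "\<dots> \<le> nb * nw" using abs_ip_le[of d b w] by (simp add: nb_def nw_def)
  finally have sq: "(L2_set \<beta> G)\<^sup>2 \<le> nb * nw" .
  have "\<kappa> * nw \<le> L2_set \<beta> G"
    using low[of w] kap nw0 unfolding nw_def[symmetric] \<beta>_def L2_set_power2[symmetric]
    by (meson L2_set_nonneg power2_le_imp_le)
  then have "nb * (\<kappa> * nw) \<le> nb * L2_set \<beta> G" by (intro mult_left_mono) (auto simp: nb_def)
  moreover have "\<kappa> * (L2_set \<beta> G)\<^sup>2 \<le> \<kappa> * (nb * nw)" using sq kap by (intro mult_left_mono) auto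
  ultimately have "\<kappa> * (L2_set \<beta> G)\<^sup>2 \<le> nb * L2_set \<beta> G" by (metis mult.left_commute order_trans)
  then have "L2_set \<beta> G * (\<kappa> * L2_set \<beta> G) \<le> L2_set \<beta> G * nb" by (simp add: power2_eq_square mult_ac)
  then have "L2_set \<beta> G \<le> nb / \<kappa>"
    using kap L2_set_nonneg[of \<beta> G]
    by (cases "L2_set \<beta> G = 0") (auto simp: field_simps nb_def mult_le_cancel_left)
  then show ?thesis using eq by (auto simp: nb_def)
qed

subsection \<open>The lasso\<close>

definition resid :: "(nat \<Rightarrow> nat \<Rightarrow> real) \<Rightarrow> nat \<Rightarrow> nat set \<Rightarrow> (nat \<Rightarrow> real) \<Rightarrow> nat \<Rightarrow> real" where
  "resid y i G \<beta> = (\<lambda>k. y i k - (\<Sum>j\<in>G. \<beta> j * y j k))"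

definition lasso_obj :: "nat \<Rightarrow> (nat \<Rightarrow> nat \<Rightarrow> real) \<Rightarrow> nat \<Rightarrow> nat set \<Rightarrow> real \<Rightarrow> (nat \<Rightarrow> real) \<Rightarrow> real" where
  "lasso_obj n y i G lam \<beta> =
    1/2 * ip n (resid y i G \<beta>) (resid y i G \<beta>) + lam * (\<Sum>j\<in>G. \<bar>\<beta> j\<bar>)"

text \<open>The choice depends on the data only through the objective as a function of the
  coefficients. Data with the same objective have literally the same chosen minimiser, on which
  \<open>lasso_path_reflect_on\<close> relies.\<close>

definition lasso_min :: "nat \<Rightarrow> (nat \<Rightarrow> nat \<Rightarrow> real) \<Rightarrow> nat \<Rightarrow> nat set \<Rightarrow> real \<Rightarrow> nat \<Rightarrow> real" where
  "lasso_min n y i G lam = (SOME \<beta>. \<forall>\<beta>'. lasso_obj n y i G lam \<beta> \<le> lasso_obj n y i G lam \<beta>')"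

lemma ip_nonneg: "0 \<le> ip n u u"
  by (simp add: ip_self)

text \<open>Outside the box of radius F(0)/\<lambda> the penalty alone exceeds F(0), so the minimum
  over the box is global.\<close>

lemma lasso_min_exists:
  assumes G: "finite G" and lam: "0 < lam"
  shows "\<exists>\<beta>. \<forall>\<beta>'. lasso_obj n y i G lam \<beta> \<le> lasso_obj n y i G lam \<beta>'"
proof -
  define F where "F = lasso_obj n y i G lam"
  have cont: "continuous_on UNIV F"
    unfolding F_def lasso_obj_def ip_def resid_def
    by (intro continuous_intros continuous_on_product_coordinates)
  define B where "B = F (\<lambda>_. 0) / lam"
  have F0: "0 \<le> F (\<lambda>_. 0)" unfolding F_def lasso_obj_def by (simp add: ip_nonneg)
  then have B: "0 \<le> B" using lam by (simp add: B_def)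
  obtain \<beta> where
    min: "\<forall>\<beta>'. (\<forall>j\<in>G. \<bar>\<beta>' j\<bar> \<le> B) \<longrightarrow> (\<forall>j. j \<notin> G \<longrightarrow> \<beta>' j = 0) \<longrightarrow> F \<beta> \<le> F \<beta>'"
    using exists_min_on_box[OF cont B, of G] by (elim exE conjE)
  have "F \<beta> \<le> F \<beta>'" for \<beta>'
  proof (cases "\<forall>j\<in>G. \<bar>\<beta>' j\<bar> \<le> B")
    case True
    have "F \<beta> \<le> F (\<lambda>j. if j \<in> G then \<beta>' j else 0)" by (rule min[rule_format]) (use True in auto)
    also have "\<dots> = F \<beta>'" unfolding F_def lasso_obj_def resid_def by (simp cong: sum.cong)
    finally show ?thesis .
  next
    case False
    then obtain j where j: "j \<in> G" "B < \<bar>\<beta>' j\<bar>" by auto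
    have "F \<beta> \<le> F (\<lambda>_. 0)" by (rule min[rule_format]) (use B in auto)
    also have "\<dots> = lam * B" using lam by (simp add: B_def)
    also have "\<dots> \<le> lam * (\<Sum>j\<in>G. \<bar>\<beta>' j\<bar>)"
      using j lam G member_le_sum[of j G "\<lambda>j. \<bar>\<beta>' j\<bar>"] by (intro mult_left_mono) auto
    also have "\<dots> \<le> F \<beta>'" unfolding F_def lasso_obj_def by (simp add: ip_nonneg)
    finally show ?thesis .
  qed
  then show ?thesis unfolding F_def by blast
qed

lemma lasso_min_le:
  assumes "finite G" "0 < lam"
  shows "lasso_obj n y i G lam (lasso_min n y i G lam) \<le> lasso_obj n y i G lam \<beta>"
  unfolding lasso_min_def using someI_ex[OF lasso_min_exists[OF assms]] by blast

context
  fixes n :: nat and y :: "nat \<Rightarrow> nat \<Rightarrow> real" and i :: nat and G :: "nat set" and lam :: real and b v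
  assumes G: "finite G" and lam: "0 < lam"
    and min: "\<And>\<beta>. lasso_obj n y i G lam b \<le> lasso_obj n y i G lam \<beta>"
    and v: "v = resid y i G b"
begin

lemma lasso_obj_shift:
  "lasso_obj n y i G lam (\<lambda>j. b j + c j) = 1/2 * ip n v v - ip n v (\<lambda>k. \<Sum>j\<in>G. c j * y j k) +
    1/2 * ip n (\<lambda>k. \<Sum>j\<in>G. c j * y j k) (\<lambda>k. \<Sum>j\<in>G. c j * y j k) + lam * (\<Sum>j\<in>G. \<bar>b j + c j\<bar>)"
proof -
  have "resid y i G (\<lambda>j. b j + c j) = (\<lambda>k. v k - (\<Sum>j\<in>G. c j * y j k))"
    by (simp add: v resid_def distrib_right sum.distrib fun_eq_iff)
  then show ?thesis unfolding lasso_obj_def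
    by (simp add: ip_diff_left ip_diff_right ip_commute[of n "\<lambda>k. \<Sum>j\<in>G. c j * y j k" v])
qed

text \<open>Moving coefficient j by e along the sign of \<langle>y_j, v\<rangle> costs at most
  \<lambda> e in the penalty and gains e |\<langle>y_j, v\<rangle>| to first order.\<close>

lemma lasso_kkt_le:
  assumes j: "j \<in> G"
  shows "\<bar>ip n (y j) v\<bar> \<le> lam"
proof (rule ccontr)
  assume "\<not> ?thesis"
  then have gt: "lam < \<bar>ip n (y j) v\<bar>" by simp
  define s where "s = sgn (ip n (y j) v)"
  have s: "\<bar>s\<bar> = 1" "s * ip n (y j) v = \<bar>ip n (y j) v\<bar>"
    using gt lam by (auto simp: s_def sgn_if abs_if)
  have "0 \<le> (lam - \<bar>ip n (y j) v\<bar>) * e + 1/2 * ip n (y j) (y j) * e\<^sup>2" if e: "0 \<le> e" for e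
  proof -
    define c where "c = (\<lambda>l. if l = j then e * s else 0)"
    have cy: "(\<lambda>k. \<Sum>l\<in>G. c l * y l k) = (\<lambda>k. (e * s) * y j k)"
      using G j by (simp add: c_def if_distrib[of "\<lambda>x. x * _"] cong: if_cong)
    have "lasso_obj n y i G lam b = 1/2 * ip n v v + lam * (\<Sum>j\<in>G. \<bar>b j\<bar>)"
      by (simp add: lasso_obj_def v)
    moreover have "lasso_obj n y i G lam (\<lambda>j. b j + c j) \<le> 1/2 * ip n v v - e * \<bar>ip n (y j) v\<bar> +
      1/2 * ip n (y j) (y j) * e\<^sup>2 + lam * ((\<Sum>j\<in>G. \<bar>b j\<bar>) + e)"
    proof -
      have "(\<Sum>j\<in>G. \<bar>b j + c j\<bar>) \<le> (\<Sum>j\<in>G. \<bar>b j\<bar> + \<bar>c j\<bar>)" by (intro sum_mono abs_triangle_ineq)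
      also have "\<dots> = (\<Sum>j\<in>G. \<bar>b j\<bar>) + e"
        using G j s e by (simp add: c_def sum.distrib if_distrib[of abs] abs_mult cong: if_cong)
      finally have "lam * (\<Sum>j\<in>G. \<bar>b j + c j\<bar>) \<le> lam * ((\<Sum>j\<in>G. \<bar>b j\<bar>) + e)" using lam by simp
      moreover have "ip n v (\<lambda>k. (e * s) * y j k) = e * \<bar>ip n (y j) v\<bar>"
        by (simp add: ip_scale_right s(2)[symmetric] ip_commute[of n v] mult.assoc)
      moreover have "s * s = 1" using s(1) by (metis abs_mult_self_eq mult_1)
      then have "ip n (\<lambda>k. (e * s) * y j k) (\<lambda>k. (e * s) * y j k) = ip n (y j) (y j) * e\<^sup>2"
        by (simp add: ip_scale_left ip_scale_right power2_eq_square algebra_simps)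
      ultimately show ?thesis unfolding lasso_obj_shift cy by simp
    qed
    ultimately show ?thesis using min[of "\<lambda>j. b j + c j"] by (simp add: algebra_simps)
  qed
  note q = this
  define a where "a = \<bar>ip n (y j) v\<bar> - lam"
  define B where "B = ip n (y j) (y j)"
  have a: "a > 0" using gt by (simp add: a_def)
  have B: "B \<ge> 0" by (simp add: B_def ip_nonneg)
  have gen: "(- a) * (a / c) + 1/2 * B * (a / c)\<^sup>2 = (a\<^sup>2 / c) * (1/2 * (B / c) - 1)" for c
    by (simp add: power2_eq_square right_diff_distrib mult_ac)
  \<comment> \<open>The step a / (B + 1) is defined also for a zero column (B = 0), and its
    quadratic cost is less than half of the linear gain.\<close>
  have "0 \<le> (- a) * (a / (B + 1)) + 1/2 * B * (a / (B + 1))\<^sup>2"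
    using q[of "a / (B + 1)"] a B by (simp add: a_def B_def)
  also have "\<dots> = (a\<^sup>2 / (B + 1)) * (1/2 * (B / (B + 1)) - 1)" by (rule gen)
  also have "\<dots> < 0" using a B by (intro mult_pos_neg) (auto simp: field_simps)
  finally show False by simp
qed

text \<open>Along the ray (1 + e) b with |e| \<le> 1 no sign changes, so the objective is a
  quadratic polynomial in e. Both signs of e are allowed, hence an equality.\<close>

lemma lasso_kkt_eq: "ip n v (\<lambda>k. \<Sum>j\<in>G. b j * y j k) = lam * (\<Sum>j\<in>G. \<bar>b j\<bar>)"
proof -
  define p where "p = (\<lambda>k. \<Sum>j\<in>G. b j * y j k)"
  define l where "l = (\<Sum>j\<in>G. \<bar>b j\<bar>)"
  have "lam * l - ip n v p = 0"
  proof (rule linear_coeff_zero[of _ "1/2 * ip n p p"])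
    fix e :: real assume e: "\<bar>e\<bar> \<le> 1"
    have cy: "(\<lambda>k. \<Sum>l\<in>G. (e * b l) * y l k) = (\<lambda>k. e * p k)"
      by (simp add: p_def sum_distrib_left mult.assoc)
    have "(\<Sum>j\<in>G. \<bar>b j + e * b j\<bar>) = (\<Sum>j\<in>G. (1 + e) * \<bar>b j\<bar>)"
    proof (rule sum.cong[OF refl])
      fix j
      have "b j + e * b j = (1 + e) * b j" by (simp add: algebra_simps)
      then show "\<bar>b j + e * b j\<bar> = (1 + e) * \<bar>b j\<bar>" using e by (simp add: abs_mult)
    qed
    also have "\<dots> = (1 + e) * l" by (simp add: l_def sum_distrib_left)
    finally have l1: "(\<Sum>j\<in>G. \<bar>b j + e * b j\<bar>) = (1 + e) * l" .
    have "lasso_obj n y i G lam b = 1/2 * ip n v v + lam * l" by (simp add: lasso_obj_def v l_def)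
    moreover have "lasso_obj n y i G lam (\<lambda>j. b j + e * b j) =
       1/2 * ip n v v - e * ip n v p + 1/2 * (e\<^sup>2 * ip n p p) + lam * ((1 + e) * l)"
      unfolding lasso_obj_shift cy l1 by (simp add: ip_scale_left ip_scale_right power2_eq_square)
    ultimately show "0 \<le> (lam * l - ip n v p) * e + 1/2 * ip n p p * e\<^sup>2"
      using min[of "\<lambda>j. b j + e * b j"] by (simp add: algebra_simps)
  qed
  then show ?thesis by (simp add: p_def l_def)
qed

text \<open>Quadratic growth in the residual: minimisers may differ, but their residuals agree, and
  an almost minimising vector has almost the same residual. This is the key to measurability of the
  path.\<close>

lemma lasso_obj_gap:
  "lasso_obj n y i G lam b + 1/2 * (L2_set (\<lambda>k. resid y i G \<beta> k - v k) {..<n})\<^sup>2 \<le> lasso_obj n y i G lam \<beta>"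
proof -
  define c where "c j = \<beta> j - b j" for j
  define w where "w = (\<lambda>k. \<Sum>j\<in>G. c j * y j k)"
  have "resid y i G \<beta> k - v k = - w k" for k
    by (simp add: v resid_def w_def c_def left_diff_distrib sum_subtractf)
  then have L: "(L2_set (\<lambda>k. resid y i G \<beta> k - v k) {..<n})\<^sup>2 = ip n w w"
    by (simp add: ip_self L2_set_def)
  have "lasso_obj n y i G lam \<beta> = lasso_obj n y i G lam (\<lambda>j. b j + c j)" by (simp add: c_def)
  also have "\<dots> = 1/2 * ip n v v - ip n v w + 1/2 * ip n w w + lam * (\<Sum>j\<in>G. \<bar>\<beta> j\<bar>)"
    unfolding lasso_obj_shift w_def by (simp add: c_def)
  finally have F: "lasso_obj n y i G lam \<beta> = 1/2 * ip n v v - ip n v w + 1/2 * ip n w w + lam * (\<Sum>j\<in>G. \<bar>\<beta> j\<bar>)" .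
  have "ip n v w = ip n v (\<lambda>k. \<Sum>j\<in>G. \<beta> j * y j k) - ip n v (\<lambda>k. \<Sum>j\<in>G. b j * y j k)"
    unfolding w_def c_def ip_diff_right[symmetric] by (simp add: left_diff_distrib sum_subtractf)
  also have "ip n v (\<lambda>k. \<Sum>j\<in>G. \<beta> j * y j k) \<le> lam * (\<Sum>j\<in>G. \<bar>\<beta> j\<bar>)"
    unfolding ip_sum_right ip_scale_right sum_distrib_left
  proof (rule sum_mono)
    fix j assume "j \<in> G"
    from lasso_kkt_le[OF this] have "\<bar>\<beta> j\<bar> * \<bar>ip n v (y j)\<bar> \<le> \<bar>\<beta> j\<bar> * lam"
      by (intro mult_left_mono) (auto simp: ip_commute[of n v])
    then show "\<beta> j * ip n v (y j) \<le> lam * \<bar>\<beta> j\<bar>" by (simp add: abs_mult[symmetric] mult.commute)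
  qed
  finally have "ip n v w \<le> lam * (\<Sum>j\<in>G. \<bar>\<beta> j\<bar>) - lam * (\<Sum>j\<in>G. \<bar>b j\<bar>)" unfolding lasso_kkt_eq by simp
  then show ?thesis unfolding L F by (simp add: lasso_obj_def v)
qed

end

text \<open>The rescaled residual \<open>u = v / \<lambda>\<close>, as a function of \<open>t = 1 / \<lambda>\<close>, is the projection of \<open>t y\<^sub>i\<close> onto
  the polytope \<open>{w. \<bar>\<langle>y\<^sub>j, w\<rangle>\<bar> \<le> 1 for all j}\<close>.\<close>

definition lasso_path :: "nat \<Rightarrow> (nat \<Rightarrow> nat \<Rightarrow> real) \<Rightarrow> nat \<Rightarrow> nat set \<Rightarrow> real \<Rightarrow> nat \<Rightarrow> real" where
  "lasso_path n y i G t = (\<lambda>k. t * resid y i G (lasso_min n y i G (1 / t)) k)"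

lemma lasso_path_feasible:
  assumes G: "finite G" and t: "0 < t" and j: "j \<in> G"
  shows "\<bar>ip n (y j) (lasso_path n y i G t)\<bar> \<le> 1"
proof -
  have "\<bar>ip n (y j) (resid y i G (lasso_min n y i G (1 / t)))\<bar> \<le> 1 / t"
    by (rule lasso_kkt_le[OF G _ _ refl j]) (use lasso_min_le[OF G] t in auto)
  then show ?thesis using t unfolding lasso_path_def ip_scale_right by (simp add: abs_mult field_simps)
qed

text \<open>The obtuse-angle criterion for a projection. The difference t y_i - u is t p, where p is
  the fitted vector; \<langle>p, u\<rangle> equals the l1 norm of the coefficients, while
  \<langle>p, w\<rangle> is at most that norm for every feasible w.\<close>

lemma lasso_path_variational:
  assumes G: "finite G" and t: "0 < t" and w: "\<And>j. j \<in> G \<Longrightarrow> \<bar>ip n (y j) w\<bar> \<le> 1"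
  shows "ip n (\<lambda>k. t * y i k - lasso_path n y i G t k) (\<lambda>k. w k - lasso_path n y i G t k) \<le> 0"
proof -
  define b where "b = lasso_min n y i G (1 / t)"
  define v where "v = resid y i G b"
  define p where "p = (\<lambda>k. \<Sum>j\<in>G. b j * y j k)"
  have kkt: "ip n v p = 1 / t * (\<Sum>j\<in>G. \<bar>b j\<bar>)"
    unfolding p_def by (rule lasso_kkt_eq[OF G, of "1 / t" n y i])
      (use lasso_min_le[OF G] t in \<open>auto simp: v_def b_def\<close>)
  have u: "lasso_path n y i G t = (\<lambda>k. t * v k)" by (simp add: lasso_path_def v_def b_def)
  have "(\<lambda>k. t * y i k - lasso_path n y i G t k) = (\<lambda>k. t * p k)"
    by (simp add: u v_def resid_def p_def right_diff_distrib)
  then have "ip n (\<lambda>k. t * y i k - lasso_path n y i G t k) (\<lambda>k. w k - lasso_path n y i G t k) = t * (ip n p w - t * ip n v p)"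
    by (simp add: u ip_scale_left ip_scale_right ip_diff_right ip_commute[of n p v])
  also have "t * ip n v p = (\<Sum>j\<in>G. \<bar>b j\<bar>)" using kkt t by simp
  also have "t * (ip n p w - (\<Sum>j\<in>G. \<bar>b j\<bar>)) \<le> 0"
  proof -
    have "ip n p w \<le> (\<Sum>j\<in>G. \<bar>b j\<bar>)"
      unfolding p_def ip_sum_left ip_scale_left
    proof (rule sum_mono)
      fix j assume "j \<in> G"
      have "b j * ip n (y j) w \<le> \<bar>b j\<bar> * \<bar>ip n (y j) w\<bar>" by (simp add: abs_mult[symmetric])
      also have "\<dots> \<le> \<bar>b j\<bar> * 1" by (intro mult_left_mono w \<open>j \<in> G\<close>) auto
      finally show "b j * ip n (y j) w \<le> \<bar>b j\<bar>" by simp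
    qed
    then show ?thesis using t by (simp add: mult_le_0_iff)
  qed
  finally show ?thesis .
qed

text \<open>Each of the two points is feasible in the variational inequality of the other. The first
  bound does not mention t - s, so nets can be indexed by norms alone; the second one passes from
  rational to real parameters.\<close>

lemma lasso_path_dist:
  fixes n :: nat and y :: "nat \<Rightarrow> nat \<Rightarrow> real" and i :: nat
  assumes G: "finite G" and s: "0 < s" and st: "s \<le> t"
  defines "D \<equiv> L2_set (\<lambda>k. lasso_path n y i G t k - lasso_path n y i G s k) {..<n}"
  shows "D\<^sup>2 \<le> (L2_set (lasso_path n y i G t) {..<n})\<^sup>2 - (L2_set (lasso_path n y i G s) {..<n})\<^sup>2"
    and "D \<le> (t - s) * L2_set (y i) {..<n}"
proof -
  have t: "0 < t" using s st by simp
  define ut where "ut = lasso_path n y i G t"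
  define us where "us = lasso_path n y i G s"
  have VT: "ip n (\<lambda>k. t * y i k - ut k) (\<lambda>k. us k - ut k) \<le> 0"
    unfolding ut_def by (rule lasso_path_variational[OF G t]) (auto simp: us_def intro: lasso_path_feasible[OF G s])
  have VS: "ip n (\<lambda>k. s * y i k - us k) (\<lambda>k. ut k - us k) \<le> 0"
    unfolding us_def by (rule lasso_path_variational[OF G s]) (auto simp: ut_def intro: lasso_path_feasible[OF G t])
  define A where "A = ip n (y i) ut - ip n (y i) us"
  define TT where "TT = ip n ut ut"
  define SS where "SS = ip n us us"
  define TS where "TS = ip n ut us"
  have VT': "- t * A + TT - TS \<le> 0" using VT
    by (simp add: ip_simps A_def TT_def TS_def algebra_simps)
  have VS': "s * A - TS + SS \<le> 0" using VS
    by (simp add: ip_simps A_def SS_def TS_def ip_commute[of n us ut] algebra_simps)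
  have D2: "D\<^sup>2 = TT - 2 * TS + SS"
    by (simp add: D_def ip_self[symmetric] ip_simps TT_def SS_def TS_def us_def ut_def
      ip_commute[of n "lasso_path n y i G s" "lasso_path n y i G t"])
  have key: "D\<^sup>2 \<le> (t - s) * A" using VT' VS' by (simp add: D2 algebra_simps)
  \<comment> \<open>A negative \<open>A\<close> together with s < t would make the squared distance
    in \<open>key\<close> negative.\<close>
  have "0 \<le> A \<or> s = t"
    using key st by (metis diff_gt_0_iff_gt linorder_not_le mult_pos_neg not_less_iff_gr_or_eq order_less_le_trans zero_le_power2)
  then have "TS \<ge> SS"
  proof
    assume "0 \<le> A"
    then have "0 \<le> s * A" using s by simp
    then show ?thesis using VS' by linarith
  next
    assume "s = t"
    then show ?thesis by (simp add: TS_def SS_def ut_def us_def)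
  qed
  then show "D\<^sup>2 \<le> (L2_set (lasso_path n y i G t) {..<n})\<^sup>2 - (L2_set (lasso_path n y i G s) {..<n})\<^sup>2"
    by (simp add: D2 ip_self[symmetric] TT_def SS_def us_def ut_def)
  have "A = ip n (y i) (\<lambda>k. ut k - us k)" by (simp add: A_def ip_diff_right)
  then have "A \<le> L2_set (y i) {..<n} * D" using abs_ip_le[of n "y i" "\<lambda>k. ut k - us k"] by (simp add: D_def ut_def us_def)
  then have "D\<^sup>2 \<le> (t - s) * (L2_set (y i) {..<n} * D)" using key st by (meson diff_ge_0_iff_ge mult_left_mono order_trans)
  then have "D * D \<le> D * ((t - s) * L2_set (y i) {..<n})" by (simp add: power2_eq_square mult_ac)
  moreover have "0 \<le> (t - s) * L2_set (y i) {..<n}" using st by simp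
  moreover have "0 \<le> D" by (simp add: D_def)
  ultimately show "D \<le> (t - s) * L2_set (y i) {..<n}"
    by (cases "D = 0") (auto simp: mult_le_cancel_left)
qed

text \<open>A primal-dual witness: extending the minimiser over \<open>G\<close> by zeros gives dual
  slack at every point outside \<open>G\<close>. Any minimiser over \<open>H\<close> with a nonzero
  coefficient there would have a strictly larger objective, so the conclusion holds for all
  minimisers, unique or not.\<close>

lemma lasso_zero_of_strict:
  assumes H: "finite H" and GH: "G \<subseteq> H" and lam: "0 < lam"
  assumes min: "\<And>\<beta>. lasso_obj n y i H lam b \<le> lasso_obj n y i H lam \<beta>"
  assumes strict: "\<And>j. j \<in> H - G \<Longrightarrow> \<bar>ip n (y j) (lasso_path n y i G (1 / lam))\<bar> < 1"
  assumes j: "j \<in> H - G"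
  shows "b j = 0"
proof (rule ccontr)
  assume bj: "b j \<noteq> 0"
  have G: "finite G" using H GH finite_subset by auto
  define g where "g = lasso_min n y i G lam"
  define v where "v = resid y i G g"
  have gmin: "lasso_obj n y i G lam g \<le> lasso_obj n y i G lam \<beta>" for \<beta>
    unfolding g_def by (rule lasso_min_le[OF G lam])
  have vp: "lasso_path n y i G (1 / lam) = (\<lambda>k. 1 / lam * v k)"
    using lam by (simp add: lasso_path_def v_def g_def)
  have le: "\<bar>ip n (y j) v\<bar> \<le> lam" if "j \<in> G" for j by (rule lasso_kkt_le[OF G lam gmin v_def that])
  have lt: "\<bar>ip n (y j) v\<bar> < lam" if "j \<in> H - G" for j
    using strict[OF that] lam unfolding vp ip_scale_right by (simp add: abs_mult field_simps)
  define g' where "g' = (\<lambda>j. if j \<in> G then g j else 0)"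
  have extend: "(\<Sum>j\<in>H. f (g' j) j) = (\<Sum>j\<in>G. f (g j) j)" if "\<And>j. f 0 j = 0" for f :: "real \<Rightarrow> nat \<Rightarrow> real"
    using H GH by (intro sum.mono_neutral_cong_right) (auto simp: g'_def that)
  have rg: "resid y i H g' = v" unfolding v_def resid_def using extend[of "\<lambda>x j. x * y j _"] by (simp add: fun_eq_iff)
  have "lasso_obj n y i H lam g' = lasso_obj n y i G lam g"
    unfolding lasso_obj_def rg using extend[of "\<lambda>x j. \<bar>x\<bar>"] by (simp add: v_def)
  then have up: "lasso_obj n y i H lam b \<le> 1/2 * ip n v v + lam * (\<Sum>j\<in>G. \<bar>g j\<bar>)"
    using min[of g'] by (simp add: lasso_obj_def v_def)
  define w where "w = (\<lambda>k. v k - resid y i H b k)"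
  have wb: "w = (\<lambda>k. (\<Sum>j\<in>H. b j * y j k) - (\<Sum>j\<in>G. g j * y j k))"
    by (simp add: w_def v_def resid_def fun_eq_iff)
  have "ip n (resid y i H b) (resid y i H b) = ip n (\<lambda>k. v k - w k) (\<lambda>k. v k - w k)"
    by (simp add: w_def)
  also have "\<dots> = ip n v v - 2 * ip n v w + ip n w w" by (simp add: ip_diff_left ip_diff_right ip_commute[of n w v])
  finally have "lasso_obj n y i H lam b \<ge> 1/2 * ip n v v - ip n v w + lam * (\<Sum>j\<in>H. \<bar>b j\<bar>)"
    unfolding lasso_obj_def using ip_nonneg[of n w] by simp
  moreover have "ip n v w = (\<Sum>j\<in>H. b j * ip n (y j) v) - lam * (\<Sum>j\<in>G. \<bar>g j\<bar>)"
    unfolding wb ip_diff_right lasso_kkt_eq[OF G lam gmin v_def]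
    by (simp add: ip_sum_right ip_scale_right ip_commute[of n v])
  moreover have "(\<Sum>j\<in>H. b j * ip n (y j) v) < (\<Sum>j\<in>H. lam * \<bar>b j\<bar>)"
  proof (rule sum_strict_mono_ex1[OF H])
    show "\<forall>j\<in>H. b j * ip n (y j) v \<le> lam * \<bar>b j\<bar>"
    proof
      fix j assume "j \<in> H"
      then have "\<bar>ip n (y j) v\<bar> \<le> lam" using le lt by (cases "j \<in> G") (auto intro: less_imp_le)
      then have "\<bar>b j\<bar> * \<bar>ip n (y j) v\<bar> \<le> \<bar>b j\<bar> * lam" by (intro mult_left_mono) auto
      then show "b j * ip n (y j) v \<le> lam * \<bar>b j\<bar>" by (simp add: abs_mult[symmetric] mult.commute)
    qed
    have "\<bar>b j\<bar> * \<bar>ip n (y j) v\<bar> < \<bar>b j\<bar> * lam" using lt[OF j] bj by (intro mult_strict_left_mono) auto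
    then have "b j * ip n (y j) v < lam * \<bar>b j\<bar>" by (simp add: abs_mult[symmetric] mult.commute)
    then show "\<exists>a\<in>H. b a * ip n (y a) v < lam * \<bar>b a\<bar>" using j by auto
  qed
  ultimately show False using up by (simp add: sum_distrib_left)
qed

subsection \<open>Size of the lasso path of well-conditioned data\<close>

text \<open>Here \<open>a\<close> stands for \<open>log N\<close> and \<open>r\<close> for \<open>log (e \<rho>)\<close>.\<close>

locale conditioned_group =
  fixes n d :: nat and G :: "nat set" and i :: nat and x z :: "nat \<Rightarrow> nat \<Rightarrow> real" and \<sigma> a r :: real
  assumes finG: "finite G" and d: "1 \<le> d" "d \<le> n" and a: "1 \<le> a" and r: "1 \<le> r" "r \<le> a"
    and sig: "0 < \<sigma>" "\<sigma> \<le> 1 / 10^14"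
    and card_large: "10^7 * real d \<le> real (card G)" "real d * r \<le> real (card G)"
    and dim_small: "real d * a\<^sup>2 \<le> real n / 10^30"
    and x_low: "\<And>j k. j \<in> insert i G \<Longrightarrow> d \<le> k \<Longrightarrow> x j k = 0"
    and x_unit: "L2_set (x i) {..<n} = 1"
    and x_frame: "\<And>w. 1/96 * (sqrt (real (card G)) / sqrt (real d)) * L2_set w {..<d} \<le> L2_set (\<lambda>j. ip d (x j) w) G"
    and x_cone: "\<And>\<beta>. L2_set \<beta> G / 96 - 100000 * (sqrt r / sqrt (real d)) * (\<Sum>j\<in>G. \<bar>\<beta> j\<bar>) \<le>
        L2_set (\<lambda>k. \<Sum>j\<in>G. \<beta> j * x j k) {..<n}"
    and z_cone: "\<And>\<beta>. L2_set (\<lambda>k. \<Sum>j\<in>G. \<beta> j * z j k) {..<n} \<le>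
        \<sigma> * (8 * L2_set \<beta> G + 16000 * (sqrt a / sqrt (real n)) * (\<Sum>j\<in>G. \<bar>\<beta> j\<bar>))"
    and z_self: "L2_set (z i) {..<n} \<le> 1.5 * \<sigma>"
begin

definition y :: "nat \<Rightarrow> nat \<Rightarrow> real" where "y j k = x j k + z j k"

abbreviation "q \<equiv> real (card G)"
abbreviation "h \<equiv> sqrt a / sqrt (real n)"

lemma n_pos: "0 < n" and q_pos: "0 < q"
  using d card_large by auto

text \<open>10^-15 is the square root of the 10^-30 in \<open>dim_small\<close>. One factor
  \<open>a\<close> of a^2 belongs to \<open>h\<close>, the other one absorbs r \<le> a.\<close>

lemma h_sqrt: "h * sqrt (real d) \<le> 1 / 10^15" "h * sqrt (real d * r) \<le> 1 / 10^15"
proof -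
  have h: "h = sqrt (a / real n)" by (simp add: real_sqrt_divide)
  have da: "real d * a \<le> real d * a\<^sup>2" "real d * (r * a) \<le> real d * a\<^sup>2"
    using a r d by (auto simp: power2_eq_square intro!: mult_left_mono mult_right_mono)
  have "h * sqrt (real d) = sqrt (real d * a / real n)" unfolding h real_sqrt_mult[symmetric] by (simp add: mult.commute)
  also have "\<dots> \<le> sqrt ((1 / 10^15)\<^sup>2)"
    using da dim_small n_pos by (intro real_sqrt_le_mono) (simp add: field_simps)
  finally show "h * sqrt (real d) \<le> 1 / 10^15" by simp
  have "h * sqrt (real d * r) = sqrt (real d * (r * a) / real n)" unfolding h real_sqrt_mult[symmetric] by (simp add: mult_ac)
  also have "\<dots> \<le> sqrt ((1 / 10^15)\<^sup>2)"
    using da dim_small n_pos by (intro real_sqrt_le_mono) (simp add: field_simps)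
  finally show "h * sqrt (real d * r) \<le> 1 / 10^15" by simp
qed

lemma sqrt_ratio: "sqrt (real d) / sqrt q \<le> 32 / 10^5" "sqrt (real d) / sqrt q * sqrt (real d * r) \<le> sqrt (real d)"
proof -
  have "sqrt (real d) / sqrt q = sqrt (real d / q)" by (simp add: real_sqrt_divide)
  also have "\<dots> \<le> sqrt ((32 / 10^5)\<^sup>2)"
    using card_large q_pos by (intro real_sqrt_le_mono) (simp add: field_simps)
  finally show "sqrt (real d) / sqrt q \<le> 32 / 10^5" by simp
  have "sqrt (real d * r) \<le> sqrt q" using card_large by simp
  then have "sqrt (real d) * sqrt (real d * r) \<le> sqrt (real d) * sqrt q" by (intro mult_left_mono) auto
  then show "sqrt (real d) / sqrt q * sqrt (real d * r) \<le> sqrt (real d)"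
    using q_pos by (simp add: field_simps)
qed

lemma sd: "1 \<le> sqrt (real d)" and sr: "1 \<le> sqrt r"
  using d r by auto

text \<open>Least squares reproduces the clean point exactly, so the residual consists of noise
  only: 1.5 \<sigma> from point i and 0.3 \<sigma> from the combination. The total stays strictly
  below \<tau> = 2 \<sigma>.\<close>

lemma exists_sparse_representation:
  "\<exists>\<beta>. (\<Sum>j\<in>G. \<bar>\<beta> j\<bar>) \<le> 96 * sqrt (real d) \<and> L2_set (resid y i G \<beta>) {..<n} \<le> 1.8 * \<sigma>"
proof -
  define \<kappa> where "\<kappa> = 1/96 * (sqrt q / sqrt (real d))"
  have kap: "0 < \<kappa>" using q_pos d by (simp add: \<kappa>_def)
  have low: "(\<kappa> * L2_set w {..<d})\<^sup>2 \<le> (\<Sum>j\<in>G. (ip d (x j) w)\<^sup>2)" for w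
    unfolding L2_set_power2[symmetric] using kap x_frame[of w] by (intro power_mono) (auto simp: \<kappa>_def)
  from exists_small_preimage[OF finG kap low, of "x i"] obtain \<beta> where
    b: "\<forall>k<d. (\<Sum>j\<in>G. \<beta> j * x j k) = x i k" "L2_set \<beta> G \<le> L2_set (x i) {..<d} / \<kappa>" by blast
  have "L2_set (x i) {..<d} = 1"
    unfolding x_unit[symmetric] L2_set_def using d x_low
    by (intro arg_cong[where f=sqrt] sum.mono_neutral_left) auto
  then have b2: "L2_set \<beta> G \<le> 96 * (sqrt (real d) / sqrt q)" using b(2) by (simp add: \<kappa>_def)
  have "(\<Sum>j\<in>G. \<bar>\<beta> j\<bar>) \<le> sqrt q * L2_set \<beta> G" by (rule sum_abs_le_sqrt_L2_set)
  also have "\<dots> \<le> sqrt q * (96 * (sqrt (real d) / sqrt q))" using b2 by (intro mult_left_mono) auto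
  finally have b1: "(\<Sum>j\<in>G. \<bar>\<beta> j\<bar>) \<le> 96 * sqrt (real d)" using q_pos by simp
  have "resid y i G \<beta> k = z i k - (\<Sum>j\<in>G. \<beta> j * z j k)" for k
  proof -
    have "(\<Sum>j\<in>G. \<beta> j * x j k) = x i k"
      using b(1) x_low by (cases "k < d") auto
    then show ?thesis by (simp add: resid_def y_def distrib_left sum.distrib)
  qed
  then have "resid y i G \<beta> = (\<lambda>k. z i k - (\<Sum>j\<in>G. \<beta> j * z j k))" by (rule ext)
  then have "L2_set (resid y i G \<beta>) {..<n} \<le> L2_set (z i) {..<n} + L2_set (\<lambda>k. \<Sum>j\<in>G. \<beta> j * z j k) {..<n}"
    by (simp add: L2_set_triangle_diff)
  also have "\<dots> \<le> 1.5 * \<sigma> + \<sigma> * (8 * L2_set \<beta> G + 16000 * h * (\<Sum>j\<in>G. \<bar>\<beta> j\<bar>))"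
    using z_self z_cone[of \<beta>] by linarith
  also have "\<dots> \<le> 1.5 * \<sigma> + \<sigma> * 0.3"
  proof (intro add_left_mono mult_left_mono)
    have "h * (\<Sum>j\<in>G. \<bar>\<beta> j\<bar>) \<le> h * (96 * sqrt (real d))" using b1 a by (intro mult_left_mono) auto
    then have "16000 * h * (\<Sum>j\<in>G. \<bar>\<beta> j\<bar>) \<le> 16000 * 96 / 10^15" using h_sqrt(1) by simp
    moreover have "8 * L2_set \<beta> G \<le> 8 * 96 * (32 / 10^5)" using b2 sqrt_ratio(1) by simp
    ultimately show "8 * L2_set \<beta> G + 16000 * h * (\<Sum>j\<in>G. \<bar>\<beta> j\<bar>) \<le> 0.3" by simp
  qed (use sig in auto)
  finally show ?thesis using b1 by auto
qed

lemma y_self: "L2_set (y i) {..<n} \<le> 2" "1/2 \<le> L2_set (y i) {..<n}"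
proof -
  have yd: "y i = (\<lambda>k. x i k + z i k)" by (simp add: y_def fun_eq_iff)
  show "L2_set (y i) {..<n} \<le> 2"
    unfolding yd using L2_set_triangle_ineq[of "x i" "z i" "{..<n}"] x_unit z_self sig by simp
  show "1/2 \<le> L2_set (y i) {..<n}"
    using L2_set_triangle_diff[of "y i" "z i" "{..<n}"] x_unit z_self sig by (simp add: y_def)
qed

text \<open>Duality: the upper bound on combinations of the noise vectors is tested with the
  coefficients \<langle>z_j, u\<rangle> themselves.\<close>

lemma z_transpose: "L2_set (\<lambda>j. ip n (z j) u) G \<le> \<sigma> * (8 + 16000 * h * sqrt q) * L2_set u {..<n}"
proof -
  define \<gamma> where "\<gamma> j = ip n (z j) u" for j
  have h0: "0 \<le> h" using a by simp
  have "(L2_set \<gamma> G)\<^sup>2 = ip n (\<lambda>k. \<Sum>j\<in>G. \<gamma> j * z j k) u"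
    unfolding L2_set_power2 ip_sum_left ip_scale_left by (simp add: power2_eq_square \<gamma>_def)
  also have "\<dots> \<le> L2_set (\<lambda>k. \<Sum>j\<in>G. \<gamma> j * z j k) {..<n} * L2_set u {..<n}"
    using abs_ip_le[of n "\<lambda>k. \<Sum>j\<in>G. \<gamma> j * z j k" u] by simp
  also have "\<dots> \<le> (\<sigma> * (8 * L2_set \<gamma> G + 16000 * h * (sqrt q * L2_set \<gamma> G))) * L2_set u {..<n}"
  proof (intro mult_right_mono)
    have "16000 * h * (\<Sum>j\<in>G. \<bar>\<gamma> j\<bar>) \<le> 16000 * h * (sqrt q * L2_set \<gamma> G)"
      using h0 sum_abs_le_sqrt_L2_set[of \<gamma> G] by (intro mult_left_mono) auto
    then have "\<sigma> * (8 * L2_set \<gamma> G + 16000 * h * (\<Sum>j\<in>G. \<bar>\<gamma> j\<bar>)) \<le>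
      \<sigma> * (8 * L2_set \<gamma> G + 16000 * h * (sqrt q * L2_set \<gamma> G))"
      using sig by simp
    then show "L2_set (\<lambda>k. \<Sum>j\<in>G. \<gamma> j * z j k) {..<n} \<le> \<sigma> * (8 * L2_set \<gamma> G + 16000 * h * (sqrt q * L2_set \<gamma> G))"
      using z_cone[of \<gamma>] by (rule order_trans[rotated])
  qed simp
  also have "\<dots> = L2_set \<gamma> G * (\<sigma> * (8 + 16000 * h * sqrt q) * L2_set u {..<n})"
    by (simp add: algebra_simps)
  finally have *: "L2_set \<gamma> G * L2_set \<gamma> G \<le> L2_set \<gamma> G * (\<sigma> * (8 + 16000 * h * sqrt q) * L2_set u {..<n})"
    by (simp add: power2_eq_square)
  have "0 \<le> \<sigma> * (8 + 16000 * h * sqrt q) * L2_set u {..<n}"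
    using sig a by (intro mult_nonneg_nonneg add_nonneg_nonneg) auto
  then have "L2_set \<gamma> G \<le> \<sigma> * (8 + 16000 * h * sqrt q) * L2_set u {..<n}"
    using * by (cases "L2_set \<gamma> G = 0") (auto simp: mult_le_cancel_left less_le)
  then show ?thesis unfolding \<gamma>_def .
qed

text \<open>Beyond the first d coordinates the residual is z_i minus the combination of the z_j.
  Comparison with the sparse representation bounds the l1 norm of the coefficients by 100 sqrt d,
  the lower cone bound turns this into an l2 norm of order sqrt r, and the factor t \<le> 140 sqrt d
  / \<sigma> cancels the size \<sigma> of the noise.\<close>

lemma lasso_path_perp_le:
  assumes t: "0 < t" "t \<le> 140 * sqrt (real d) / \<sigma>"
  shows "L2_set (lasso_path n y i G t) {d..<n} \<le> 3 * 10^12 * sqrt (real d * r)"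
proof -
  define b where "b = lasso_min n y i G (1 / t)"
  define v where "v = resid y i G b"
  define l1 where "l1 = (\<Sum>j\<in>G. \<bar>b j\<bar>)"
  define l2 where "l2 = L2_set b G"
  have min: "lasso_obj n y i G (1 / t) b \<le> lasso_obj n y i G (1 / t) \<beta>" for \<beta>
    unfolding b_def by (rule lasso_min_le[OF finG]) (use t in simp)
  have h0: "0 \<le> h" using a by simp
  obtain \<beta> where \<beta>: "(\<Sum>j\<in>G. \<bar>\<beta> j\<bar>) \<le> 96 * sqrt (real d)" "L2_set (resid y i G \<beta>) {..<n} \<le> 1.8 * \<sigma>"
    using exists_sparse_representation by blast
  have "1 / t * l1 \<le> lasso_obj n y i G (1 / t) b"
    by (simp add: lasso_obj_def l1_def ip_nonneg)
  also have "\<dots> \<le> lasso_obj n y i G (1 / t) \<beta>" by (rule min)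
  also have "\<dots> \<le> 1/2 * (2 * \<sigma>)\<^sup>2 + 1 / t * (96 * sqrt (real d))"
    unfolding lasso_obj_def ip_self using \<beta> t sig
    by (intro add_mono mult_left_mono power_mono) auto
  finally have "l1 \<le> 2 * \<sigma>\<^sup>2 * t + 96 * sqrt (real d)" using t by (simp add: field_simps)
  also have "2 * \<sigma>\<^sup>2 * t \<le> 2 * \<sigma>\<^sup>2 * (140 * sqrt (real d) / \<sigma>)" using t by (intro mult_left_mono) auto
  also have "\<dots> = 280 * \<sigma> * sqrt (real d)" using sig by (simp add: power2_eq_square)
  also have "\<dots> \<le> 1 * sqrt (real d)" using sig by (intro mult_right_mono) auto
  finally have l1: "l1 \<le> 100 * sqrt (real d)" using sd by linarith
  have "1/2 * (L2_set v {..<n})\<^sup>2 \<le> lasso_obj n y i G (1 / t) b"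
    unfolding lasso_obj_def ip_self v_def using t by (simp add: sum_nonneg)
  also have "\<dots> \<le> lasso_obj n y i G (1 / t) (\<lambda>_. 0)" by (rule min)
  also have "\<dots> = 1/2 * (L2_set (y i) {..<n})\<^sup>2" by (simp add: lasso_obj_def ip_self resid_def)
  also have "\<dots> \<le> 1/2 * 2\<^sup>2" using y_self by (intro mult_left_mono power_mono) auto
  finally have "(L2_set v {..<n})\<^sup>2 \<le> 2\<^sup>2" by simp
  then have vn: "L2_set v {..<n} \<le> 2" by (rule power2_le_imp_le) simp
  define Xb where "Xb = (\<lambda>k. \<Sum>j\<in>G. b j * x j k)"
  define Zb where "Zb = (\<lambda>k. \<Sum>j\<in>G. b j * z j k)"
  have vk: "v k = y i k - (Xb k + Zb k)" for k
    by (simp add: v_def resid_def y_def Xb_def Zb_def distrib_left sum.distrib)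
  have "16000 * h * l1 \<le> 16000 * h * (100 * sqrt (real d))" using l1 h0 by (intro mult_left_mono) auto
  also have "\<dots> = 1600000 * (h * sqrt (real d))" by simp
  also have "\<dots> \<le> 1600000 * (1 / 10^15)" by (intro mult_left_mono h_sqrt) auto
  also have "\<dots> \<le> 1" by simp
  finally have "L2_set Zb {..<n} \<le> \<sigma> * (8 * l2 + 1)"
    using z_cone[of b] sig unfolding Zb_def l1_def l2_def
    by (meson add_left_mono mult_left_mono less_imp_le order_trans)
  then have Zb: "L2_set Zb {..<n} \<le> 8 * \<sigma> * l2 + \<sigma>" by (simp add: algebra_simps)
  have "Xb = (\<lambda>k. (y i k - v k) - Zb k)" by (simp add: vk fun_eq_iff)
  then have "L2_set Xb {..<n} \<le> L2_set (\<lambda>k. y i k - v k) {..<n} + L2_set Zb {..<n}"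
    using L2_set_triangle_diff[of "\<lambda>k. y i k - v k" Zb "{..<n}"] by simp
  also have "\<dots> \<le> 4 + (8 * \<sigma> * l2 + \<sigma>)"
    using L2_set_triangle_diff[of "y i" v "{..<n}"] y_self vn Zb by linarith
  finally have Xb: "L2_set Xb {..<n} \<le> 4 + (8 * \<sigma> * l2 + \<sigma>)" .
  have "100000 * (sqrt r / sqrt (real d)) * l1 \<le> 100000 * (sqrt r / sqrt (real d)) * (100 * sqrt (real d))"
    using l1 r by (intro mult_left_mono) auto
  also have "\<dots> = 10^7 * sqrt r" using d by simp
  finally have "l2 / 96 \<le> 10^7 * sqrt r + 4 + 8 * \<sigma> * l2 + \<sigma>"
    using x_cone[of b] Xb unfolding Xb_def l1_def l2_def by linarith
  \<comment> \<open>The noise bound involves \<open>l2\<close> itself; with \<sigma> \<le> 10^-14 it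
    is absorbed by l2/96 on the left.\<close>
  moreover have "8 * \<sigma> * l2 \<le> 8 / 10^14 * l2" using sig by (intro mult_right_mono) (auto simp: l2_def)
  moreover have "0 \<le> l2" by (simp add: l2_def)
  ultimately have "l2 / 96 \<le> 10000000 * sqrt r + 5 + 1 / 1000000 * l2" using sig by simp
  then have "l2 \<le> 2000000000 * sqrt r" using sr by linarith
  then have l2: "l2 \<le> 2 * 10^9 * sqrt r" by simp
  have "L2_set v {d..<n} = L2_set (\<lambda>k. z i k - Zb k) {d..<n}"
    using x_low by (intro L2_set_cong) (auto simp: vk y_def Xb_def)
  also have "\<dots> \<le> L2_set (\<lambda>k. z i k - Zb k) {..<n}"
    unfolding L2_set_def by (intro real_sqrt_le_mono sum_mono2) auto
  also have "\<dots> \<le> 1.5 * \<sigma> + (8 * \<sigma> * l2 + \<sigma>)"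
    using L2_set_triangle_diff[of "z i" Zb "{..<n}"] z_self Zb by linarith
  also have "\<dots> = \<sigma> * (2.5 + 8 * l2)" by (simp add: algebra_simps)
  also have "\<dots> \<le> \<sigma> * (2 * 10^10 * sqrt r)"
  proof (intro mult_left_mono)
    have "2.5 + 8 * l2 \<le> 20000000000 * sqrt r" using \<open>l2 \<le> 2000000000 * sqrt r\<close> sr by linarith
    then show "2.5 + 8 * l2 \<le> 2 * 10^10 * sqrt r" by simp
  qed (use sig in simp)
  finally have vperp: "L2_set v {d..<n} \<le> \<sigma> * (2 * 10^10 * sqrt r)" .
  have "L2_set (lasso_path n y i G t) {d..<n} = t * L2_set v {d..<n}"
    using t by (simp add: lasso_path_def L2_set_scale v_def b_def)
  also have "\<dots> \<le> (140 * sqrt (real d) / \<sigma>) * (\<sigma> * (2 * 10^10 * sqrt r))"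
    using t vperp sig by (intro mult_mono) auto
  also have "\<dots> = 28 * 10^11 * sqrt (real d * r)" using sig by (simp add: real_sqrt_mult)
  also have "\<dots> \<le> 3 * 10^12 * sqrt (real d * r)" using r by (intro mult_right_mono) auto
  finally show ?thesis .
qed

text \<open>All points of the group satisfy |\<langle>y_j, u\<rangle>| \<le> 1, so these inner
  products have l2 norm at most sqrt q; the frame bound makes them at least of order sqrt(q/d) times
  the part of u in the subspace. The perpendicular part \<open>W\<close> enters only through the
  noise and is damped by \<sigma>.\<close>

lemma lasso_path_par_le:
  assumes t: "0 < t" "t \<le> 140 * sqrt (real d) / \<sigma>"
  shows "L2_set (lasso_path n y i G t) {..<d} \<le> 210 * sqrt (real d)"
proof -
  define u where "u = lasso_path n y i G t"
  define U where "U = L2_set u {..<d}"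
  define W where "W = L2_set u {d..<n}"
  have W: "W \<le> 3 * 10^12 * sqrt (real d * r)" unfolding W_def u_def by (rule lasso_path_perp_le[OF t])
  have pos: "0 \<le> U" "0 \<le> W" by (simp_all add: U_def W_def)
  have h0: "0 \<le> h" using a by simp
  have un: "L2_set u {..<n} \<le> U + W"
  proof -
    have "{..<n} = {..<d} \<union> {d..<n}" "{..<d} \<inter> {d..<n} = {}" using d by auto
    then have "(L2_set u {..<n})\<^sup>2 = U\<^sup>2 + W\<^sup>2"
      unfolding U_def W_def L2_set_power2 by (simp add: sum.union_disjoint)
    also have "\<dots> \<le> (U + W)\<^sup>2" using pos by (simp add: power2_sum)
    finally show ?thesis by (rule power2_le_imp_le) (use pos in simp)
  qed
  have ipx: "ip d (x j) u = ip n (x j) u" if "j \<in> G" for j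
    unfolding ip_def using d x_low that by (intro sum.mono_neutral_left) auto
  have "1/96 * (sqrt q / sqrt (real d)) * U \<le> L2_set (\<lambda>j. ip d (x j) u) G"
    unfolding U_def by (rule x_frame)
  also have "\<dots> = L2_set (\<lambda>j. ip n (y j) u - ip n (z j) u) G"
    using ipx by (intro L2_set_cong) (auto simp: y_def[abs_def] ip_add_left)
  also have "\<dots> \<le> L2_set (\<lambda>j. ip n (y j) u) G + L2_set (\<lambda>j. ip n (z j) u) G" by (rule L2_set_triangle_diff)
  also have "\<dots> \<le> sqrt q * 1 + \<sigma> * (8 + 16000 * h * sqrt q) * L2_set u {..<n}"
    using L2_set_le_const[of 1 G "\<lambda>j. ip n (y j) u"] lasso_path_feasible[OF finG t(1)] z_transpose[of u]
    by (intro add_mono) (auto simp: u_def)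
  also have "\<dots> \<le> sqrt q * 1 + \<sigma> * (8 + 16000 * h * sqrt q) * (U + W)"
    using un sig a by (intro add_left_mono mult_left_mono mult_nonneg_nonneg add_nonneg_nonneg) auto
  finally have "1/96 * (sqrt q / sqrt (real d)) * U * (sqrt (real d) / sqrt q) \<le>
     (sqrt q + \<sigma> * (8 + 16000 * h * sqrt q) * (U + W)) * (sqrt (real d) / sqrt q)"
    by (intro mult_right_mono) auto
  moreover have "1/96 * (sqrt q / sqrt (real d)) * U * (sqrt (real d) / sqrt q) = U / 96" using q_pos d by simp
  moreover define R where "R = sqrt (real d) / sqrt q"
  moreover have "(sqrt q + \<sigma> * (8 + 16000 * h * sqrt q) * (U + W)) * R =
     sqrt (real d) + \<sigma> * (8 * R + 16000 * (h * sqrt (real d))) * U + \<sigma> * (8 * (R * W) + 16000 * (h * sqrt (real d) * W))"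
  proof -
    have Rq: "sqrt (real d) = sqrt q * R" using q_pos by (simp add: R_def)
    show ?thesis unfolding Rq by (simp add: algebra_simps add_divide_distrib)
  qed
  ultimately have main: "U / 96 \<le> sqrt (real d) + \<sigma> * (8 * R + 16000 * (h * sqrt (real d))) * U +
     \<sigma> * (8 * (R * W) + 16000 * (h * sqrt (real d) * W))" by (simp only: R_def)
  have R: "0 \<le> R" "R \<le> 1" "R * sqrt (real d * r) \<le> sqrt (real d)"
  proof -
    have "R \<le> 32 / 10^5" unfolding R_def by (rule sqrt_ratio)
    then show "R \<le> 1" by (rule order_trans) simp
    show "R * sqrt (real d * r) \<le> sqrt (real d)" unfolding R_def by (rule sqrt_ratio)
  qed (simp add: R_def)
  define H where "H = h * sqrt (real d)"
  have H: "0 \<le> H" "H \<le> 1 / 10^15"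
    unfolding H_def by (rule mult_nonneg_nonneg[OF h0], simp) (rule h_sqrt(1))
  have HW: "H * W \<le> 3 * 10^12 * sqrt (real d) * (1 / 10^15)"
  proof -
    have "H * W \<le> H * (3 * 10^12 * sqrt (real d * r))" using W H by (intro mult_left_mono)
    also have "\<dots> = 3 * 10^12 * sqrt (real d) * (h * sqrt (real d * r))" by (simp add: H_def)
    also have "\<dots> \<le> 3 * 10^12 * sqrt (real d) * (1 / 10^15)"
      by (intro mult_left_mono h_sqrt(2)) simp
    finally show ?thesis .
  qed
  have RW: "R * W \<le> 3 * 10^12 * sqrt (real d)"
  proof -
    have "R * W \<le> R * (3 * 10^12 * sqrt (real d * r))" using W R by (intro mult_left_mono)
    also have "\<dots> = 3 * 10^12 * (R * sqrt (real d * r))" by simp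
    also have "\<dots> \<le> 3 * 10^12 * sqrt (real d)" by (intro mult_left_mono R) simp
    finally show ?thesis .
  qed
  have "\<sigma> * (8 * R + 16000 * H) * U \<le> (1 / 10^14 * 9) * U"
  proof (intro mult_right_mono mult_mono)
    show "8 * R + 16000 * H \<le> 9" using R H by simp
  qed (use sig R H pos in auto)
  \<comment> \<open>Here 10^-14 meets the factor 10^12 of the perpendicular bound: 27 * 10^12 /
    10^14 = 0.27.\<close>
  moreover have "\<sigma> * (8 * (R * W) + 16000 * (H * W)) \<le> 1 / 10^14 * (27 * 10^12 * sqrt (real d))"
  proof (intro mult_mono)
    have "R * W \<le> 3000000000000 * sqrt (real d)" "H * W * 1000 \<le> 3 * sqrt (real d)" using RW HW by auto
    then have "8 * (R * W) + 16000 * (H * W) \<le> 27000000000000 * sqrt (real d)" using sd by linarith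
    then show "8 * (R * W) + 16000 * (H * W) \<le> 27 * 10^12 * sqrt (real d)" by simp
  qed (use sig R pos H in auto)
  moreover note main[folded H_def]
  ultimately have "U / 96 \<le> sqrt (real d) + (1 / 10^14 * 9) * U + 1 / 10^14 * (27 * 10^12 * sqrt (real d))"
    by linarith
  then have "U / 96 \<le> sqrt (real d) + 1 / 1000000 * U + (27 / 100) * sqrt (real d)"
    using pos by simp
  then have "U \<le> 210 * sqrt (real d)" using sd pos by linarith
  then show ?thesis by (simp add: U_def u_def)
qed

end

subsection \<open>Measurability of the lasso path\<close>

lemma floor_scaled_tendsto:
  "(\<lambda>m. of_int \<lfloor>of_nat (Suc m) * x\<rfloor> / of_nat (Suc m)) \<longlonglongrightarrow> (x :: real)"
proof (rule real_tendsto_sandwich)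
  have "(\<lambda>m. x - 1 / of_nat (Suc m)) \<longlonglongrightarrow> x - 0"
    by (intro tendsto_intros LIMSEQ_Suc[OF lim_1_over_n])
  then show "(\<lambda>m. x - 1 / of_nat (Suc m)) \<longlonglongrightarrow> x" by simp
  show "(\<lambda>_. x) \<longlonglongrightarrow> x" by simp
  show "\<forall>\<^sub>F m in sequentially. x - 1 / of_nat (Suc m) \<le> of_int \<lfloor>of_nat (Suc m) * x\<rfloor> / of_nat (Suc m)"
  proof (intro always_eventually allI)
    fix m :: nat
    have "real (Suc m) * x - 1 \<le> of_int \<lfloor>real (Suc m) * x\<rfloor>" by linarith
    then have "(real (Suc m) * x - 1) / real (Suc m) \<le> of_int \<lfloor>real (Suc m) * x\<rfloor> / real (Suc m)"
      by (intro divide_right_mono) auto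
    then show "x - 1 / of_nat (Suc m) \<le> of_int \<lfloor>of_nat (Suc m) * x\<rfloor> / of_nat (Suc m)"
      by (simp only: diff_divide_distrib) simp
  qed
  show "\<forall>\<^sub>F m in sequentially. of_int \<lfloor>of_nat (Suc m) * x\<rfloor> / of_nat (Suc m) \<le> x"
  proof (intro always_eventually allI)
    fix m :: nat
    have "of_int \<lfloor>real (Suc m) * x\<rfloor> \<le> real (Suc m) * x" by linarith
    then show "of_int \<lfloor>of_nat (Suc m) * x\<rfloor> / of_nat (Suc m) \<le> x"
      by (simp add: field_simps)
  qed
qed

lemma rational_lasso_approx:
  fixes y :: "nat \<Rightarrow> nat \<Rightarrow> real"
  assumes "0 < e"
  obtains \<beta>' where "\<beta>' \<in> G \<rightarrow>\<^sub>E (\<rat> :: real set)"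
    "\<bar>lasso_obj n y i G lam \<beta>' - lasso_obj n y i G lam \<beta>\<bar> < e" "\<bar>resid y i G \<beta>' k - resid y i G \<beta> k\<bar> < e"
proof -
  define \<beta>s where "\<beta>s m = (\<lambda>j\<in>G. of_int \<lfloor>of_nat (Suc m) * \<beta> j\<rfloor> / of_nat (Suc m) :: real)" for m
  have lim: "(\<lambda>m. \<beta>s m j) \<longlonglongrightarrow> \<beta> j" if "j \<in> G" for j
    using floor_scaled_tendsto[of "\<beta> j"] that by (simp add: \<beta>s_def)
  have r: "(\<lambda>m. resid y i G (\<beta>s m) k) \<longlonglongrightarrow> resid y i G \<beta> k" for k
    unfolding resid_def by (intro tendsto_intros lim)
  have "(\<lambda>m. lasso_obj n y i G lam (\<beta>s m)) \<longlonglongrightarrow> lasso_obj n y i G lam \<beta>"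
    unfolding lasso_obj_def ip_def by (intro tendsto_intros r lim)
  then have "\<forall>\<^sub>F m in sequentially. \<bar>lasso_obj n y i G lam (\<beta>s m) - lasso_obj n y i G lam \<beta>\<bar> < e"
    using assms by (auto dest!: tendstoD simp: dist_real_def)
  moreover have "\<forall>\<^sub>F m in sequentially. \<bar>resid y i G (\<beta>s m) k - resid y i G \<beta> k\<bar> < e"
    using r[of k] assms by (auto dest!: tendstoD simp: dist_real_def)
  ultimately have "\<forall>\<^sub>F m in sequentially. \<bar>lasso_obj n y i G lam (\<beta>s m) - lasso_obj n y i G lam \<beta>\<bar> < e \<and>
     \<bar>resid y i G (\<beta>s m) k - resid y i G \<beta> k\<bar> < e" by eventually_elim auto
  then obtain m where "\<bar>lasso_obj n y i G lam (\<beta>s m) - lasso_obj n y i G lam \<beta>\<bar> < e"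
     "\<bar>resid y i G (\<beta>s m) k - resid y i G \<beta> k\<bar> < e"
    by (auto simp: eventually_sequentially)
  moreover have "\<beta>s m \<in> G \<rightarrow>\<^sub>E (\<rat> :: real set)" by (auto simp: \<beta>s_def)
  ultimately show ?thesis using that by blast
qed

text \<open>Almost minimising rational coefficient vectors have almost the right residual.\<close>

lemma borel_measurable_lasso_path:
  assumes G: "finite G" and t: "0 < t" and k: "k < n"
  assumes Y: "\<And>j k. j \<in> insert i G \<Longrightarrow> k < n \<Longrightarrow> (\<lambda>\<omega>. Y \<omega> j k) \<in> borel_measurable M"
  shows "(\<lambda>\<omega>. lasso_path n (Y \<omega>) i G t k) \<in> borel_measurable M"
proof -
  define lam where "lam = 1 / t"
  have lam: "0 < lam" using t by (simp add: lam_def)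
  define C where "C = (G \<rightarrow>\<^sub>E (\<rat> :: real set))"
  have C: "countable C" unfolding C_def using G by (intro countable_PiE countable_rat)
  define F where "F \<omega> \<beta> = lasso_obj n (Y \<omega>) i G lam \<beta>" for \<omega> \<beta>
  define v where "v \<omega> = resid (Y \<omega>) i G (lasso_min n (Y \<omega>) i G lam)" for \<omega>
  have R[measurable]: "(\<lambda>\<omega>. resid (Y \<omega>) i G \<beta> k) \<in> borel_measurable M" if "k < n" for \<beta> k
    unfolding resid_def using Y that by (intro borel_measurable_diff borel_measurable_sum borel_measurable_times) auto
  have Fm: "(\<lambda>\<omega>. F \<omega> \<beta>) \<in> borel_measurable M" for \<beta>
    unfolding F_def lasso_obj_def ip_def using R
    by (intro borel_measurable_add borel_measurable_sum borel_measurable_times) auto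
  have Fmin: "F \<omega> (lasso_min n (Y \<omega>) i G lam) \<le> F \<omega> \<beta>" for \<omega> \<beta>
    unfolding F_def by (rule lasso_min_le[OF G lam])
  \<comment> \<open>\<open>lasso_min\<close> is an arbitrary choice, but its residual is determined
    by the data. A threshold event for it is therefore expressed by countable quantifiers over
    rational vectors that almost minimise among rational vectors.\<close>
  have iff: "v \<omega> k \<le> a \<longleftrightarrow> (\<forall>m::nat. \<exists>\<beta>\<in>C. (\<forall>\<beta>'\<in>C. F \<omega> \<beta> \<le> F \<omega> \<beta>' + 1 / real (Suc m)) \<and> resid (Y \<omega>) i G \<beta> k \<le> a + 1 / real (Suc m))"
    (is "?L \<longleftrightarrow> ?R") for \<omega> a
  proof
    assume ?L
    show ?R
    proof
      fix m :: nat
      have e: "0 < 1 / real (Suc m)" by simp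
      obtain \<beta> where b: "\<beta> \<in> C" "\<bar>F \<omega> \<beta> - F \<omega> (lasso_min n (Y \<omega>) i G lam)\<bar> < 1 / real (Suc m)"
        "\<bar>resid (Y \<omega>) i G \<beta> k - v \<omega> k\<bar> < 1 / real (Suc m)"
        unfolding C_def F_def v_def
        by (rule rational_lasso_approx[OF e, where G=G and n=n and y="Y \<omega>" and i=i and lam=lam
          and \<beta>="lasso_min n (Y \<omega>) i G lam" and k=k])
      show "\<exists>\<beta>\<in>C. (\<forall>\<beta>'\<in>C. F \<omega> \<beta> \<le> F \<omega> \<beta>' + 1 / real (Suc m)) \<and> resid (Y \<omega>) i G \<beta> k \<le> a + 1 / real (Suc m)"
      proof (intro bexI[OF _ b(1)] conjI ballI)
        fix \<beta>' show "F \<omega> \<beta> \<le> F \<omega> \<beta>' + 1 / real (Suc m)" using Fmin[of \<omega> \<beta>'] b(2) by linarith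
        show "resid (Y \<omega>) i G \<beta> k \<le> a + 1 / real (Suc m)" using b(3) \<open>?L\<close> by linarith
      qed
    qed
  next
    assume R: ?R
    have "v \<omega> k \<le> a + 1 / real (Suc m) + sqrt (2 * (1 / real (Suc m)))" for m
    proof -
      obtain \<beta> where b: "\<And>\<beta>'. \<beta>' \<in> C \<Longrightarrow> F \<omega> \<beta> \<le> F \<omega> \<beta>' + 1 / real (Suc m)" "resid (Y \<omega>) i G \<beta> k \<le> a + 1 / real (Suc m)"
        using R by blast
      \<comment> \<open>Rational vectors come arbitrarily close to the minimum, so near optimality
        among them is near optimality among all vectors.\<close>
      have "F \<omega> \<beta> \<le> F \<omega> (lasso_min n (Y \<omega>) i G lam) + 1 / real (Suc m)"
      proof (rule field_le_epsilon)
        fix e :: real assume e: "0 < e"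
        obtain \<beta>' where b': "\<beta>' \<in> C" "\<bar>F \<omega> \<beta>' - F \<omega> (lasso_min n (Y \<omega>) i G lam)\<bar> < e"
          unfolding C_def F_def
          by (rule rational_lasso_approx[OF e, where G=G and n=n and y="Y \<omega>" and i=i and lam=lam
            and \<beta>="lasso_min n (Y \<omega>) i G lam" and k=k])
        show "F \<omega> \<beta> \<le> F \<omega> (lasso_min n (Y \<omega>) i G lam) + 1 / real (Suc m) + e"
          using b(1)[OF b'(1)] b'(2) by linarith
      qed
      moreover have "F \<omega> (lasso_min n (Y \<omega>) i G lam) + 1/2 * (L2_set (\<lambda>k. resid (Y \<omega>) i G \<beta> k - v \<omega> k) {..<n})\<^sup>2 \<le> F \<omega> \<beta>"
        unfolding F_def by (rule lasso_obj_gap[OF G lam]) (auto simp: v_def lasso_min_le[OF G lam])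
      ultimately have "(L2_set (\<lambda>k. resid (Y \<omega>) i G \<beta> k - v \<omega> k) {..<n})\<^sup>2 \<le> 2 * (1 / real (Suc m))" by linarith
      then have "L2_set (\<lambda>k. resid (Y \<omega>) i G \<beta> k - v \<omega> k) {..<n} \<le> sqrt (2 * (1 / real (Suc m)))"
        by (rule real_le_rsqrt)
      moreover have "\<bar>resid (Y \<omega>) i G \<beta> k - v \<omega> k\<bar> \<le> L2_set (\<lambda>k. resid (Y \<omega>) i G \<beta> k - v \<omega> k) {..<n}"
        using member_le_L2_set[of "{..<n}" k "\<lambda>k. \<bar>resid (Y \<omega>) i G \<beta> k - v \<omega> k\<bar>"] k by (simp add: L2_set_def)
      ultimately show ?thesis using b(2) by linarith
    qed
    moreover have "(\<lambda>m. a + 1 / real (Suc m) + sqrt (2 * (1 / real (Suc m)))) \<longlonglongrightarrow> a + 0 + sqrt (2 * 0)"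
      by (intro tendsto_intros LIMSEQ_Suc[OF lim_1_over_n])
    ultimately show ?L by (intro LIMSEQ_le_const[where X="\<lambda>m. a + 1 / real (Suc m) + sqrt (2 * (1 / real (Suc m)))"]) auto
  qed
  have vm: "(\<lambda>\<omega>. v \<omega> k) \<in> borel_measurable M"
    unfolding borel_measurable_iff_le iff
    by (intro allI sets.sets_Collect_countable_All sets.sets_Collect_countable_Ex'[OF _ C] sets.sets_Collect_conj
      sets.sets_Collect_countable_All'[OF _ C] borel_measurable_le borel_measurable_add Fm R k borel_measurable_const)
  show ?thesis
    using borel_measurable_times[OF borel_measurable_const[of t] vm] unfolding lasso_path_def v_def lam_def .
qed

subsection \<open>Reflections of the data\<close>

text \<open>Reflects the coordinates in \<open>Q\<close> and leaves all others unchanged, in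
  contrast to \<open>reflect\<close>, which restricts the result to its index set.\<close>

definition reflect_on :: "nat set \<Rightarrow> (nat \<Rightarrow> real) \<Rightarrow> (nat \<Rightarrow> real) \<Rightarrow> nat \<Rightarrow> real" where
  "reflect_on Q h u k = u k - 2 * (\<Sum>m\<in>Q. h m * u m) / (\<Sum>m\<in>Q. (h m)\<^sup>2) * (if k \<in> Q then h k else 0)"

lemma reflect_on_lincomb:
  "reflect_on Q h (\<lambda>k. u k - (\<Sum>j\<in>A. c j * f j k)) k = reflect_on Q h u k - (\<Sum>j\<in>A. c j * reflect_on Q h (f j) k)"
proof -
  have "(\<Sum>m\<in>Q. h m * (u m - (\<Sum>j\<in>A. c j * f j m))) = (\<Sum>m\<in>Q. h m * u m) - (\<Sum>j\<in>A. c j * (\<Sum>m\<in>Q. h m * f j m))"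
    by (simp add: right_diff_distrib sum_subtractf sum_distrib_left mult.left_commute) (rule sum.swap)
  then show ?thesis
    by (simp add: reflect_on_def right_diff_distrib diff_divide_distrib left_diff_distrib sum_subtractf
      sum_distrib_left sum_distrib_right sum_divide_distrib mult_ac)
qed

lemma reflect_on_scale: "reflect_on Q h (\<lambda>k. c * u k) k = c * reflect_on Q h u k"
  by (simp add: reflect_on_def right_diff_distrib mult.left_commute[of _ c] flip: sum_distrib_left)

lemma ip_reflect_on:
  assumes Q: "Q \<subseteq> {..<n}"
  shows "ip n (reflect_on Q h u) (reflect_on Q h w) = ip n u w"
proof (cases "(\<Sum>m\<in>Q. (h m)\<^sup>2) = 0")
  case True
  then show ?thesis by (simp add: reflect_on_def ip_def)
next
  case False
  define s where "s = (\<Sum>m\<in>Q. (h m)\<^sup>2)"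
  define h' where "h' k = (if k \<in> Q then h k else 0)" for k
  have ext: "(\<Sum>m\<in>Q. h m * f m) = ip n h' f" for f
    unfolding ip_def h'_def using Q by (intro sum.mono_neutral_cong_left) auto
  have s: "s = ip n h' h'" unfolding s_def power2_eq_square ip_def h'_def using Q
    by (intro sum.mono_neutral_cong_left) auto
  have r: "reflect_on Q h f = (\<lambda>k. f k - (2 * ip n h' f / s) * h' k)" for f
    by (simp add: reflect_on_def ext h'_def s_def fun_eq_iff)
  have "ip n (reflect_on Q h u) (reflect_on Q h w) =
     ip n u w - 4 * ip n h' u * ip n h' w / s + (2 * ip n h' u / s) * (2 * ip n h' w / s) * s"
    unfolding r by (simp only: ip_simps s[symmetric]) (simp add: ip_commute[of n u h'] algebra_simps)
  also have "\<dots> = ip n u w" using False unfolding s_def[symmetric] by simp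
  finally show ?thesis .
qed

text \<open>An isometry does not change the objective as a function of the coefficients, so the
  chosen coefficients are the same and only the residual is reflected.\<close>

lemma lasso_path_reflect_on:
  assumes Q: "Q \<subseteq> {..<n}"
    and y': "\<And>j k. j \<in> insert i G \<Longrightarrow> k < n \<Longrightarrow> y' j k = reflect_on Q h (y j) k" and k: "k < n"
  shows "lasso_path n y' i G t k = reflect_on Q h (lasso_path n y i G t) k"
proof -
  have r: "resid y' i G \<beta> k = reflect_on Q h (resid y i G \<beta>) k" if "k < n" for \<beta> k
    unfolding resid_def reflect_on_lincomb using y' that by (intro arg_cong2[where f="(-)"] sum.cong) auto
  have "lasso_obj n y' i G lam = lasso_obj n y i G lam" for lam
  proof
    fix \<beta>
    have "ip n (resid y' i G \<beta>) (resid y' i G \<beta>) = ip n (reflect_on Q h (resid y i G \<beta>)) (reflect_on Q h (resid y i G \<beta>))"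
      by (rule ip_cong) (auto simp: r)
    then show "lasso_obj n y' i G lam \<beta> = lasso_obj n y i G lam \<beta>"
      unfolding lasso_obj_def ip_reflect_on[OF Q] by simp
  qed
  then have "lasso_min n y' i G lam = lasso_min n y i G lam" for lam unfolding lasso_min_def by simp
  then show ?thesis unfolding lasso_path_def reflect_on_scale using r[OF k] by simp
qed

lemma lasso_path_cong:
  assumes "\<And>j k. j \<in> insert i G \<Longrightarrow> k < n \<Longrightarrow> y' j k = y j k" "k < n"
  shows "lasso_path n y' i G t k = lasso_path n y i G t k"
proof -
  \<comment> \<open>Agreement of the data on the first n coordinates is the special case of the
    trivial reflection.\<close>
  have "reflect_on {} (\<lambda>_. 0) u = u" for u by (simp add: reflect_on_def fun_eq_iff)
  then show ?thesis using lasso_path_reflect_on[of "{}" n i G y' "\<lambda>_. 0" y k t] assms by simp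
qed

text \<open>The reflection along v - g is self-adjoint and exchanges the unit vectors v and g. If v
  = g it is the identity, by the convention for division by zero.\<close>

lemma sum_reflect_on_swap:
  fixes v g :: "nat \<Rightarrow> real"
  assumes Q: "finite Q" and v: "(\<Sum>m\<in>Q. (v m)\<^sup>2) = 1" and g: "(\<Sum>m\<in>Q. (g m)\<^sup>2) = 1"
  shows "(\<Sum>m\<in>Q. v m * reflect_on Q (\<lambda>m. v m - g m) u m) = (\<Sum>m\<in>Q. g m * u m)"
proof -
  define s where "s = (\<Sum>m\<in>Q. (v m - g m)\<^sup>2)"
  define vg where "vg = (\<Sum>m\<in>Q. v m * g m)"
  define hu where "hu = (\<Sum>m\<in>Q. (v m - g m) * u m)"
  have s: "s = 2 - 2 * vg"
    using v g by (simp add: s_def vg_def power2_diff sum.distrib sum_subtractf mult.assoc flip: sum_distrib_left)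
  have "(\<Sum>m\<in>Q. v m * reflect_on Q (\<lambda>m. v m - g m) u m) = (\<Sum>m\<in>Q. v m * u m - (2 * hu / s) * ((v m)\<^sup>2 - v m * g m))"
    by (intro sum.cong) (auto simp: reflect_on_def s_def hu_def algebra_simps power2_eq_square)
  also have "\<dots> = (\<Sum>m\<in>Q. v m * u m) - (2 * hu / s) * (1 - vg)"
    unfolding sum_subtractf sum_distrib_left[symmetric] v vg_def ..
  also have "\<dots> = (\<Sum>m\<in>Q. g m * u m)"
  proof (cases "s = 0")
    case True
    then have "\<forall>m\<in>Q. v m = g m" using Q by (simp add: s_def sum_nonneg_eq_0_iff)
    then show ?thesis using True by (simp cong: sum.cong)
  next
    case False
    then have "(2 * hu / s) * (1 - vg) = hu" by (simp add: s field_simps)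
    then show ?thesis by (simp add: hu_def left_diff_distrib sum_subtractf)
  qed
  finally show ?thesis .
qed

subsection \<open>Random signs\<close>

text \<open>Termwise comparison of the series of cosh x and exp(x^2/2), by 2^k k! \<le>
  (2k)!.\<close>

lemma exp_plus_exp_minus_le: "exp x + exp (- x) \<le> 2 * exp (x\<^sup>2 / 2)" for x :: real
proof -
  have fact: "2 ^ k * fact k \<le> (fact (2 * k) :: real)" for k
  proof (induction k)
    case (Suc k)
    have "2 ^ Suc k * fact (Suc k) = (2 * real (Suc k)) * (2 ^ k * fact k)" by simp
    also have "\<dots> \<le> (2 * real (Suc k)) * fact (2 * k)" by (intro mult_left_mono Suc) auto
    also have "\<dots> \<le> (2 * real (Suc k)) * (real (2 * k + 1) * fact (2 * k))"
    proof (intro mult_left_mono)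
      have "1 * fact (2 * k) \<le> real (2 * k + 1) * (fact (2 * k) :: real)" by (intro mult_right_mono) auto
      then show "fact (2 * k) \<le> real (2 * k + 1) * (fact (2 * k) :: real)" by simp
    qed auto
    also have "\<dots> = fact (2 * Suc k)" by (simp add: algebra_simps)
    finally show ?case .
  qed simp
  have c: "(\<lambda>n. if even n then x ^ n /\<^sub>R fact n else 0) sums cosh x" by (rule cosh_converges)
  have "(\<lambda>k. (if even (2 * k) then x ^ (2 * k) /\<^sub>R fact (2 * k) else 0)) sums cosh x"
    by (subst sums_mono_reindex[of "\<lambda>k. 2 * k" "\<lambda>n. if even n then x ^ n /\<^sub>R fact n else 0"])
      (use c in \<open>auto simp: strict_mono_def elim: evenE\<close>)
  then have s1: "(\<lambda>k. x ^ (2 * k) /\<^sub>R fact (2 * k)) sums cosh x" by simp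
  have s2: "(\<lambda>k. (x\<^sup>2 / 2) ^ k /\<^sub>R fact k) sums exp (x\<^sup>2 / 2)" by (rule exp_converges)
  have le: "x ^ (2 * k) /\<^sub>R fact (2 * k) \<le> (x\<^sup>2 / 2) ^ k /\<^sub>R fact k" for k
  proof -
    have "x ^ (2 * k) /\<^sub>R fact (2 * k) = x ^ (2 * k) / fact (2 * k)" by (simp add: field_simps)
    also have "\<dots> \<le> x ^ (2 * k) / (2 ^ k * fact k)" by (intro divide_left_mono fact) auto
    also have "\<dots> = (x\<^sup>2 / 2) ^ k /\<^sub>R fact k" by (simp only: power_mult power_divide) (simp add: divide_inverse)
    finally show ?thesis .
  qed
  have "cosh x \<le> exp (x\<^sup>2 / 2)" by (rule sums_le[OF le s1 s2])
  then show ?thesis by (simp add: cosh_field_def)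
qed

abbreviation signs :: "nat set \<Rightarrow> (nat \<Rightarrow> real) set" where
  "signs Q \<equiv> Q \<rightarrow>\<^sub>E {-1, 1}"

lemma finite_signs: "finite Q \<Longrightarrow> finite (signs Q)"
  by (intro finite_PiE) auto

lemma card_signs: "finite Q \<Longrightarrow> card (signs Q) = 2 ^ card Q"
  by (simp add: card_PiE numeral_2_eq_2)

text \<open>Hoeffding's inequality in counting form; \<theta> = \<tau>/\<Lambda>^2 minimises the
  exponent.\<close>

lemma card_signs_gt_le:
  fixes w :: "nat \<Rightarrow> real"
  assumes Q: "finite Q" and L: "0 < \<Lambda>" "L2_set w Q \<le> \<Lambda>" and tau: "0 \<le> \<tau>"
  shows "real (card {s \<in> signs Q. \<tau> < (\<Sum>m\<in>Q. s m * w m)}) \<le> 2 ^ card Q * exp (- (\<tau>\<^sup>2 / (2 * \<Lambda>\<^sup>2)))"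
proof -
  define \<theta> where "\<theta> = \<tau> / \<Lambda>\<^sup>2"
  have th: "0 \<le> \<theta>" using tau by (simp add: \<theta>_def)
  define A where "A = {s \<in> signs Q. \<tau> < (\<Sum>m\<in>Q. s m * w m)}"
  have fin: "finite (signs Q)" "finite A" using finite_signs[OF Q] by (auto simp: A_def)
  have "real (card A) = (\<Sum>s\<in>A. 1)" by simp
  also have "\<dots> \<le> (\<Sum>s\<in>A. exp (- \<theta> * \<tau>) * exp (\<theta> * (\<Sum>m\<in>Q. s m * w m)))"
  proof (rule sum_mono)
    fix s assume "s \<in> A"
    then have "\<theta> * \<tau> \<le> \<theta> * (\<Sum>m\<in>Q. s m * w m)" using th by (intro mult_left_mono) (auto simp: A_def)
    then show "1 \<le> exp (- \<theta> * \<tau>) * exp (\<theta> * (\<Sum>m\<in>Q. s m * w m))" by (simp flip: exp_add)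
  qed
  also have "\<dots> \<le> (\<Sum>s\<in>signs Q. exp (- \<theta> * \<tau>) * exp (\<theta> * (\<Sum>m\<in>Q. s m * w m)))"
    using fin by (intro sum_mono2) (auto simp: A_def)
  also have "\<dots> = exp (- \<theta> * \<tau>) * (\<Sum>s\<in>signs Q. \<Prod>m\<in>Q. exp (\<theta> * (s m * w m)))"
    by (simp add: sum_distrib_left exp_sum[OF Q])
  also have "(\<Sum>s\<in>signs Q. \<Prod>m\<in>Q. exp (\<theta> * (s m * w m))) = (\<Prod>m\<in>Q. \<Sum>e\<in>{-1, 1}. exp (\<theta> * (e * w m)))"
    by (subst prod_sum_PiE) (use Q in auto)
  also have "\<dots> = (\<Prod>m\<in>Q. exp (\<theta> * w m) + exp (- (\<theta> * w m)))"
    by (intro prod.cong) auto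
  also have "\<dots> \<le> (\<Prod>m\<in>Q. 2 * exp ((\<theta> * w m)\<^sup>2 / 2))"
    by (intro prod_mono conjI exp_plus_exp_minus_le) (simp add: add_nonneg_nonneg)
  also have "\<dots> = 2 ^ card Q * exp (\<theta>\<^sup>2 / 2 * (L2_set w Q)\<^sup>2)"
    by (simp add: prod.distrib exp_sum[OF Q, symmetric] L2_set_power2 sum_distrib_left power_mult_distrib)
  also have "\<dots> \<le> 2 ^ card Q * exp (\<theta>\<^sup>2 / 2 * \<Lambda>\<^sup>2)"
    using L by (intro mult_left_mono) (auto intro!: mult_left_mono power_mono)
  finally have "real (card A) \<le> exp (- \<theta> * \<tau>) * (2 ^ card Q * exp (\<theta>\<^sup>2 / 2 * \<Lambda>\<^sup>2))" by simp
  also have "\<dots> = 2 ^ card Q * exp (- \<theta> * \<tau> + \<theta>\<^sup>2 / 2 * \<Lambda>\<^sup>2)" by (simp only: exp_add mult_ac)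
  also have "- \<theta> * \<tau> + \<theta>\<^sup>2 / 2 * \<Lambda>\<^sup>2 = - (\<tau>\<^sup>2 / (2 * \<Lambda>\<^sup>2))"
    using L by (simp add: \<theta>_def power2_eq_square field_simps)
  finally show ?thesis unfolding A_def .
qed

lemma card_signs_abs_gt_le:
  fixes w :: "nat \<Rightarrow> real"
  assumes Q: "finite Q" and L: "0 < \<Lambda>" "L2_set w Q \<le> \<Lambda>" and tau: "0 \<le> \<tau>"
  shows "real (card {s \<in> signs Q. \<tau> < \<bar>\<Sum>m\<in>Q. s m * w m\<bar>}) \<le> 2 ^ card Q * (2 * exp (- (\<tau>\<^sup>2 / (2 * \<Lambda>\<^sup>2))))"
proof -
  define A1 where "A1 = {s \<in> signs Q. \<tau> < (\<Sum>m\<in>Q. s m * w m)}"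
  define A2 where "A2 = {s \<in> signs Q. \<tau> < (\<Sum>m\<in>Q. s m * (- w m))}"
  have "{s \<in> signs Q. \<tau> < \<bar>\<Sum>m\<in>Q. s m * w m\<bar>} \<subseteq> A1 \<union> A2"
    by (auto simp: A1_def A2_def abs_if sum_negf split: if_splits)
  moreover have fin: "finite A1" "finite A2" using finite_signs[OF Q] by (auto simp: A1_def A2_def)
  ultimately have "card {s \<in> signs Q. \<tau> < \<bar>\<Sum>m\<in>Q. s m * w m\<bar>} \<le> card (A1 \<union> A2)" by (intro card_mono) auto
  also have "\<dots> \<le> card A1 + card A2" by (rule card_Un_le)
  finally have "real (card {s \<in> signs Q. \<tau> < \<bar>\<Sum>m\<in>Q. s m * w m\<bar>}) \<le> real (card A1) + real (card A2)" by linarith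
  also have "real (card A1) \<le> 2 ^ card Q * exp (- (\<tau>\<^sup>2 / (2 * \<Lambda>\<^sup>2)))"
    unfolding A1_def by (rule card_signs_gt_le[OF Q L tau])
  also have "real (card A2) \<le> 2 ^ card Q * exp (- (\<tau>\<^sup>2 / (2 * \<Lambda>\<^sup>2)))"
    unfolding A2_def by (rule card_signs_gt_le[OF Q L(1) _ tau]) (use L in \<open>simp add: L2_set_def\<close>)
  finally show ?thesis by simp
qed

text \<open>A set on which squared distances are bounded by differences of squared norms is covered by few small
  balls: one for each value of the norm squared, rounded to a multiple of \<open>1 / 256\<close>.\<close>

lemma card_signs_path_le:
  fixes U :: "(nat \<Rightarrow> real) set"
  assumes Q: "Q \<subseteq> {..<n}" "Q \<noteq> {}" and L: "0 < \<Lambda>" and eta: "0 \<le> \<eta>"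
  assumes dist: "\<And>u u'. u \<in> U \<Longrightarrow> u' \<in> U \<Longrightarrow>
      (L2_set (\<lambda>k. u k - u' k) {..<n})\<^sup>2 \<le> \<bar>(L2_set u {..<n})\<^sup>2 - (L2_set u' {..<n})\<^sup>2\<bar>"
  assumes norms: "\<And>u. u \<in> U \<Longrightarrow> L2_set u {..<n} \<le> \<Lambda>'" "\<And>u. u \<in> U \<Longrightarrow> L2_set u Q \<le> \<Lambda>"
  shows "real (card {s \<in> signs Q. \<exists>u\<in>U. \<eta> + 1/16 < \<bar>\<Sum>m\<in>Q. s m / sqrt (real (card Q)) * u m\<bar>}) \<le>
    (256 * \<Lambda>'\<^sup>2 + 1) * (2 ^ card Q * (2 * exp (- (real (card Q) * \<eta>\<^sup>2 / (2 * \<Lambda>\<^sup>2)))))"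
proof -
  have fQ: "finite Q" using Q finite_subset by auto
  define c where "c = sqrt (real (card Q))"
  have c: "0 < c" using Q fQ by (simp add: c_def card_gt_0_iff)
  \<comment> \<open>The bucket of u. Since 256 = 16^2, two vectors in one bucket are at distance at
    most 1/16, which is the slack next to \<eta> in the statement.\<close>
  define b where "b u = nat \<lfloor>256 * (L2_set u {..<n})\<^sup>2\<rfloor>" for u
  define N where "N = nat \<lfloor>256 * \<Lambda>'\<^sup>2\<rfloor>"
  have bN: "b u \<le> N" if "u \<in> U" for u
    unfolding b_def N_def using norms(1)[OF that]
    by (intro nat_mono floor_mono mult_left_mono power_mono) auto
  \<comment> \<open>One representative per bucket. For an empty bucket the choice is arbitrary, so
    \<open>I\<close> keeps the indices whose representative lies in \<open>U\<close>, which is all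
    that the norm bound asks for.\<close>
  define rep where "rep l = (SOME u. u \<in> U \<and> b u = l)" for l
  have rep: "rep (b u) \<in> U" "b (rep (b u)) = b u" if "u \<in> U" for u
    using someI[of "\<lambda>v. v \<in> U \<and> b v = b u" u] that by (auto simp: rep_def)
  define S where "S = {s \<in> signs Q. \<exists>u\<in>U. \<eta> + 1/16 < \<bar>\<Sum>m\<in>Q. s m / c * u m\<bar>}"
  define T where "T l = {s \<in> signs Q. \<eta> * c < \<bar>\<Sum>m\<in>Q. s m * rep l m\<bar>}" for l
  define I where "I = {l \<in> {..N}. rep l \<in> U}"
  have "S \<subseteq> (\<Union>l\<in>I. T l)"
  proof
    fix s assume "s \<in> S"
    then obtain u where s: "s \<in> signs Q" and u: "u \<in> U" "\<eta> + 1/16 < \<bar>\<Sum>m\<in>Q. s m / c * u m\<bar>" by (auto simp: S_def)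
    define u' where "u' = rep (b u)"
    have u': "u' \<in> U" "b u' = b u" using rep[OF u(1)] by (auto simp: u'_def)
    have "\<bar>256 * (L2_set u {..<n})\<^sup>2 - 256 * (L2_set u' {..<n})\<^sup>2\<bar> \<le> 1"
    proof -
      have "\<lfloor>256 * (L2_set u {..<n})\<^sup>2\<rfloor> = \<lfloor>256 * (L2_set u' {..<n})\<^sup>2\<rfloor>"
        using u'(2) unfolding b_def by (subst (asm) eq_nat_nat_iff) auto
      then show ?thesis by linarith
    qed
    then have "(L2_set (\<lambda>k. u k - u' k) {..<n})\<^sup>2 \<le> (1/16)\<^sup>2"
      using dist[OF u(1) u'(1)] by (simp add: power2_eq_square abs_if split: if_splits)
    then have "L2_set (\<lambda>k. u k - u' k) {..<n} \<le> 1/16" by (rule power2_le_imp_le) simp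
    moreover have "L2_set (\<lambda>k. u k - u' k) Q \<le> L2_set (\<lambda>k. u k - u' k) {..<n}"
      unfolding L2_set_def using Q by (intro real_sqrt_le_mono sum_mono2) auto
    moreover have "L2_set (\<lambda>m. s m / c) Q = 1"
    proof -
      have "(\<Sum>m\<in>Q. (s m / c)\<^sup>2) = (\<Sum>m\<in>Q. 1 / c\<^sup>2)"
        using s by (intro sum.cong) (auto simp: power_divide PiE_iff)
      also have "\<dots> = 1" using c Q fQ by (simp add: c_def)
      finally show ?thesis by (simp add: L2_set_def)
    qed
    then have "\<bar>\<Sum>m\<in>Q. s m / c * (u m - u' m)\<bar> \<le> L2_set (\<lambda>k. u k - u' k) Q"
      using sum_mult_le_L2_set[of "\<lambda>m. s m / c" "\<lambda>m. u m - u' m" Q] by simp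
    ultimately have "\<bar>(\<Sum>m\<in>Q. s m / c * u m) - (\<Sum>m\<in>Q. s m / c * u' m)\<bar> \<le> 1/16"
      unfolding sum_subtractf[symmetric] right_diff_distrib[symmetric] by linarith
    then have "\<eta> < \<bar>\<Sum>m\<in>Q. s m / c * u' m\<bar>" using u(2) by linarith
    also have "(\<Sum>m\<in>Q. s m / c * u' m) = (\<Sum>m\<in>Q. s m * u' m) / c" by (simp add: sum_divide_distrib)
    finally have "\<eta> * c < \<bar>\<Sum>m\<in>Q. s m * u' m\<bar>" using c by (simp add: field_simps)
    then show "s \<in> (\<Union>l\<in>I. T l)" using s bN[OF u(1)] u'(1) by (auto simp: T_def I_def u'_def)
  qed
  moreover have finT: "finite (T l)" for l using finite_signs[OF fQ] by (auto simp: T_def)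
  moreover have finI: "finite I" by (auto simp: I_def)
  ultimately have "card S \<le> card (\<Union>l\<in>I. T l)" by (intro card_mono) auto
  also have "\<dots> \<le> (\<Sum>l\<in>I. card (T l))" by (rule card_UN_le[OF finI])
  finally have "real (card S) \<le> (\<Sum>l\<in>I. real (card (T l)))" by (metis of_nat_le_iff of_nat_sum)
  also have "\<dots> \<le> (\<Sum>l\<in>I. 2 ^ card Q * (2 * exp (- ((\<eta> * c)\<^sup>2 / (2 * \<Lambda>\<^sup>2)))))"
    unfolding T_def using norms(2) c eta
    by (intro sum_mono card_signs_abs_gt_le[OF fQ L]) (auto simp: I_def)
  also have "\<dots> = real (card I) * (2 ^ card Q * (2 * exp (- ((\<eta> * c)\<^sup>2 / (2 * \<Lambda>\<^sup>2)))))" by simp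
  also have "\<dots> \<le> (256 * \<Lambda>'\<^sup>2 + 1) * (2 ^ card Q * (2 * exp (- ((\<eta> * c)\<^sup>2 / (2 * \<Lambda>\<^sup>2)))))"
  proof (intro mult_right_mono)
    have "card I \<le> card {..N}" by (intro card_mono) (auto simp: I_def)
    then have "real (card I) \<le> real N + 1" by simp
    also have "real N \<le> 256 * \<Lambda>'\<^sup>2" unfolding N_def by simp
    finally show "real (card I) \<le> 256 * \<Lambda>'\<^sup>2 + 1" by simp
  qed auto
  also have "(\<eta> * c)\<^sup>2 = real (card Q) * \<eta>\<^sup>2" by (simp add: c_def power_mult_distrib mult.commute)
  finally show ?thesis unfolding S_def c_def .
qed

subsection \<open>Averaging over random reflections\<close>

text \<open>Simultaneous reflections along pairwise orthogonal vectors, as one sum. A single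
  reflection of \<real>^n acts on every data vector, that is, on many disjoint blocks of the
  Gaussian coordinates at once.\<close>

definition reflect_family :: "'i set \<Rightarrow> 'b set \<Rightarrow> ('b \<Rightarrow> 'i \<Rightarrow> real) \<Rightarrow> ('i \<Rightarrow> real) \<Rightarrow> 'i \<Rightarrow> real" where
  "reflect_family I F h x = (\<lambda>i\<in>I. x i - (\<Sum>b\<in>F. 2 * (\<Sum>k\<in>I. h b k * x k) / (\<Sum>k\<in>I. (h b k)\<^sup>2) * h b i))"

lemma measurable_reflect_family:
  assumes I: "finite I"
  shows "reflect_family I F h \<in> measurable (gauss I) (gauss I)"
proof -
  have s: "sets (gauss I) = sets (\<Pi>\<^sub>M i\<in>I. borel)" by (intro sets_PiM_cong) auto
  have "reflect_family I F h \<in> measurable (\<Pi>\<^sub>M i\<in>I. borel) (\<Pi>\<^sub>M i\<in>I. borel)"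
    unfolding reflect_family_def by measurable
  then show ?thesis by (simp add: measurable_cong_sets[OF s s])
qed

lemma distr_gauss_reflect_family:
  assumes I: "finite I" and F: "finite F"
    and orth: "\<And>b b'. b \<in> F \<Longrightarrow> b' \<in> F \<Longrightarrow> b \<noteq> b' \<Longrightarrow> (\<Sum>i\<in>I. h b i * h b' i) = 0"
  shows "distr (gauss I) (gauss I) (reflect_family I F h) = gauss I"
  using F orth
proof (induction F rule: finite_induct)
  case empty
  have "distr (gauss I) (gauss I) (reflect_family I {} h) = distr (gauss I) (gauss I) (\<lambda>x. x)"
    by (intro distr_cong) (auto simp: reflect_family_def space_gauss)
  then show ?case by (simp add: distr_id)
next
  case (insert b F)
  have IH: "distr (gauss I) (gauss I) (reflect_family I F h) = gauss I" using insert by auto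
  have comp: "reflect_family I (insert b F) h x = reflect I (h b) (reflect_family I F h x)" for x
  proof
    fix i
    have "(\<Sum>k\<in>I. h b k * reflect_family I F h x k) =
      (\<Sum>k\<in>I. h b k * x k) - (\<Sum>k\<in>I. \<Sum>c\<in>F. (2 * (\<Sum>k\<in>I. h c k * x k) / (\<Sum>k\<in>I. (h c k)\<^sup>2)) * (h b k * h c k))"
      by (simp add: reflect_family_def right_diff_distrib sum_subtractf sum_distrib_left mult_ac cong: sum.cong)
    also have "(\<Sum>k\<in>I. \<Sum>c\<in>F. (2 * (\<Sum>k\<in>I. h c k * x k) / (\<Sum>k\<in>I. (h c k)\<^sup>2)) * (h b k * h c k)) =
      (\<Sum>c\<in>F. (2 * (\<Sum>k\<in>I. h c k * x k) / (\<Sum>k\<in>I. (h c k)\<^sup>2)) * (\<Sum>k\<in>I. h b k * h c k))"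
      by (subst sum.swap) (simp only: sum_distrib_left)
    also have "\<dots> = 0" using insert by (intro sum.neutral) auto
    finally have "(\<Sum>k\<in>I. h b k * reflect_family I F h x k) = (\<Sum>k\<in>I. h b k * x k)" by simp
    then show "reflect_family I (insert b F) h x i = reflect I (h b) (reflect_family I F h x) i"
      using insert(1,2) by (simp add: reflect_def reflect_family_def)
  qed
  have "distr (gauss I) (gauss I) (reflect_family I (insert b F) h) =
      distr (gauss I) (gauss I) (reflect I (h b) \<circ> reflect_family I F h)"
    by (intro arg_cong[where f="distr (gauss I) (gauss I)"]) (simp add: comp fun_eq_iff)
  also have "\<dots> = distr (distr (gauss I) (gauss I) (reflect_family I F h)) (gauss I) (reflect I (h b))"
    using I by (intro distr_distr[symmetric] measurable_reflect measurable_reflect_family) auto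
  also have "\<dots> = gauss I" unfolding IH by (rule distr_gauss_reflect[OF I])
  finally show ?case .
qed

text \<open>Since every \<open>T s\<close> preserves the law, the probability of \<open>A\<close> is
  the expected fraction of those s for which \<open>T s\<close> leads into \<open>A\<close>. A bound
  on this fraction for each fixed outcome, a purely combinatorial statement, is then enough.\<close>

lemma (in prob_space) prob_le_average:
  assumes S: "finite S" "S \<noteq> {}" and A: "A \<in> sets M" and del: "0 \<le> \<delta>"
    and T: "\<And>s. s \<in> S \<Longrightarrow> T s \<in> measurable M M" "\<And>s. s \<in> S \<Longrightarrow> distr M M (T s) = M"
    and count: "\<And>\<omega>. \<omega> \<in> space M \<Longrightarrow> real (card {s\<in>S. T s \<omega> \<in> A}) \<le> real (card S) * \<delta>"
  shows "prob A \<le> \<delta>"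
proof -
  have "ennreal (real (card S)) * emeasure M A = (\<Sum>s\<in>S. emeasure M A)"
    by (simp add: ennreal_of_nat_eq_real_of_nat)
  also have "\<dots> = (\<Sum>s\<in>S. emeasure M (T s -` A \<inter> space M))"
  proof (rule sum.cong[OF refl])
    fix s assume s: "s \<in> S"
    have "emeasure M A = emeasure (distr M M (T s)) A" using T(2)[OF s] by simp
    also have "\<dots> = emeasure M (T s -` A \<inter> space M)" by (rule emeasure_distr[OF T(1)[OF s] A])
    finally show "emeasure M A = emeasure M (T s -` A \<inter> space M)" .
  qed
  also have "\<dots> = (\<Sum>s\<in>S. \<integral>\<^sup>+\<omega>. indicator (T s -` A \<inter> space M) \<omega> \<partial>M)"
    using T(1) A by (intro sum.cong refl nn_integral_indicator[symmetric] measurable_sets)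
  also have "\<dots> = (\<integral>\<^sup>+\<omega>. (\<Sum>s\<in>S. indicator (T s -` A \<inter> space M) \<omega>) \<partial>M)"
    using T(1) A by (intro nn_integral_sum[symmetric] borel_measurable_indicator measurable_sets)
  also have "\<dots> \<le> (\<integral>\<^sup>+\<omega>. ennreal (real (card S) * \<delta>) \<partial>M)"
  proof (rule nn_integral_mono)
    fix \<omega> assume w: "\<omega> \<in> space M"
    have "(\<Sum>s\<in>S. indicator (T s -` A \<inter> space M) \<omega> :: ennreal) = (\<Sum>s\<in>{s\<in>S. T s \<omega> \<in> A}. 1)"
      using S w by (intro sum.mono_neutral_cong_right) (auto simp: indicator_def)
    also have "\<dots> = ennreal (real (card {s\<in>S. T s \<omega> \<in> A}))" by (simp add: ennreal_of_nat_eq_real_of_nat)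
    also have "\<dots> \<le> ennreal (real (card S) * \<delta>)" using count[OF w] by (intro ennreal_leI)
    finally show "(\<Sum>s\<in>S. indicator (T s -` A \<inter> space M) \<omega>) \<le> ennreal (real (card S) * \<delta>)" .
  qed
  also have "\<dots> = ennreal (real (card S) * \<delta>)" by (simp add: emeasure_space_1)
  finally have "ennreal (real (card S) * prob A) \<le> ennreal (real (card S) * \<delta>)"
    by (simp add: emeasure_eq_measure ennreal_mult)
  then have "real (card S) * prob A \<le> real (card S) * \<delta>" using del by simp
  moreover have "0 < card S" using S by (simp add: card_gt_0_iff)
  ultimately show ?thesis by (simp add: mult_le_cancel_left)
qed

lemma borel_measurable_L2_set:
  assumes "\<And>i. i \<in> A \<Longrightarrow> (\<lambda>\<omega>. f \<omega> i) \<in> borel_measurable M"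
  shows "(\<lambda>\<omega>. L2_set (\<lambda>i. f \<omega> i) A) \<in> borel_measurable M"
proof -
  have "(\<lambda>\<omega>. \<Sum>i\<in>A. (f \<omega> i)\<^sup>2) \<in> borel_measurable M"
    by (intro borel_measurable_sum borel_measurable_power assms)
  then show ?thesis unfolding L2_set_def by measurable
qed

text \<open>Reflections send the direction of \<open>c\<close> to normalised sign vectors, and preserve the law of the Gaussian vector.\<close>

lemma prob_gauss_direction:
  fixes e :: "nat \<Rightarrow> 'i" and c :: "nat \<Rightarrow> real"
  assumes I: "finite I" and Q: "finite Q" "Q \<noteq> {}" and e: "inj_on e Q" "e ` Q \<subseteq> I" and tau: "0 \<le> \<tau>"
  shows "{\<omega>\<in>space (gauss I). \<tau> * L2_set c Q * L2_set (\<lambda>r. \<omega> (e r)) Q < \<bar>\<Sum>r\<in>Q. c r * \<omega> (e r)\<bar>} \<in> sets (gauss I)"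
    (is "?A \<in> _")
    and "measure (gauss I) {\<omega>\<in>space (gauss I). \<tau> * L2_set c Q * L2_set (\<lambda>r. \<omega> (e r)) Q < \<bar>\<Sum>r\<in>Q. c r * \<omega> (e r)\<bar>}
      \<le> 2 * exp (- (real (card Q) * \<tau>\<^sup>2 / 2))"
proof -
  interpret G: prob_space "gauss I" by (rule prob_space_gauss)
  have m: "(\<lambda>\<omega>. \<omega> (e r)) \<in> borel_measurable (gauss I)" if "r \<in> Q" for r
    using measurable_component_singleton[of "e r" I "\<lambda>_. std_normal"] e that by auto
  have "(\<lambda>\<omega>. L2_set (\<lambda>r. \<omega> (e r)) Q) \<in> borel_measurable (gauss I)"
    by (rule borel_measurable_L2_set) (rule m)
  moreover have "(\<lambda>\<omega>. \<bar>\<Sum>r\<in>Q. c r * \<omega> (e r)\<bar>) \<in> borel_measurable (gauss I)"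
    using m by (intro borel_measurable_abs borel_measurable_sum borel_measurable_times) auto
  ultimately show A: "?A \<in> sets (gauss I)"
    by (intro borel_measurable_less borel_measurable_times borel_measurable_const)
  show "measure (gauss I) ?A \<le> 2 * exp (- (real (card Q) * \<tau>\<^sup>2 / 2))"
  proof (cases "L2_set c Q = 0")
    case True
    then have "\<forall>r\<in>Q. c r = 0" using Q by (simp add: L2_set_eq_0_iff)
    then have "?A = {}" using True by auto
    then show ?thesis by (simp del: Collect_empty_eq)
  next
    case False
    define l where "l = L2_set c Q"
    have l: "0 < l" using False L2_set_nonneg[of c Q] unfolding l_def by linarith
    define q where "q = sqrt (real (card Q))"
    have q: "0 < q" "q\<^sup>2 = real (card Q)" using Q by (auto simp: q_def card_gt_0_iff)
    define v where "v r = c r / l" for r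
    have v1: "(\<Sum>r\<in>Q. (v r)\<^sup>2) = 1"
    proof -
      have "(\<Sum>r\<in>Q. (v r)\<^sup>2) = (\<Sum>r\<in>Q. (c r)\<^sup>2) / l\<^sup>2" by (simp add: v_def power_divide sum_divide_distrib)
      also have "(\<Sum>r\<in>Q. (c r)\<^sup>2) = l\<^sup>2" unfolding l_def by (rule L2_set_power2[symmetric])
      finally show ?thesis using l by simp
    qed
    \<comment> \<open>The reflection along this vector exchanges the unit vector v with the
      normalised sign vector s/q; \<open>hh\<close> transports it to the index set of the Gaussian
      vector.\<close>
    define h where "h s r = v r - s r / q" for s r
    define hh where "hh s i = (if i \<in> e ` Q then h s (the_inv_into Q e i) else 0)" for s i
    have he: "hh s (e r) = h s r" if "r \<in> Q" for s r
      using that e by (simp add: hh_def the_inv_into_f_f)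
    have sumI: "(\<Sum>i\<in>I. f (hh s i) i) = (\<Sum>r\<in>Q. f (h s r) (e r))" if "\<And>i. f 0 i = 0" for f :: "real \<Rightarrow> 'i \<Rightarrow> real" and s
    proof -
      have "(\<Sum>i\<in>I. f (hh s i) i) = (\<Sum>i\<in>e ` Q. f (hh s i) i)"
        using I e that by (intro sum.mono_neutral_right) (auto simp: hh_def)
      also have "\<dots> = (\<Sum>r\<in>Q. f (h s r) (e r))" using e by (subst sum.reindex) (auto simp: he)
      finally show ?thesis .
    qed
    have Te: "reflect I (hh s) \<omega> (e r) = reflect_on Q (h s) (\<lambda>r. \<omega> (e r)) r" if "r \<in> Q" for s \<omega> r
      using that e sumI[of "\<lambda>x i. x * \<omega> i" s] sumI[of "\<lambda>x i. x\<^sup>2" s] by (auto simp: reflect_def reflect_on_def he)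
    show ?thesis
    proof (rule G.prob_le_average[where S="signs Q" and T="\<lambda>s. reflect I (hh s)"])
      fix \<omega> assume w: "\<omega> \<in> space (gauss I)"
      define a where "a r = \<omega> (e r)" for r
      define L where "L = L2_set a Q"
      have norm: "L2_set (\<lambda>r. reflect I (hh s) \<omega> (e r)) Q = L" for s
      proof -
        have "(\<Sum>r\<in>Q. (reflect I (hh s) \<omega> (e r))\<^sup>2) = (\<Sum>r\<in>Q. (reflect Q (h s) a r)\<^sup>2)"
        proof (rule sum.cong[OF refl])
          fix r assume r: "r \<in> Q"
          have "reflect I (hh s) \<omega> (e r) = reflect_on Q (h s) a r" using Te[OF r] by (simp add: a_def[abs_def])
          also have "\<dots> = reflect Q (h s) a r" using r by (simp add: reflect_on_def reflect_def)
          finally show "(reflect I (hh s) \<omega> (e r))\<^sup>2 = (reflect Q (h s) a r)\<^sup>2" by simp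
        qed
        then show ?thesis unfolding L_def L2_set_def sum_power2_reflect by simp
      qed
      have sub: "{s \<in> signs Q. reflect I (hh s) \<omega> \<in> ?A} \<subseteq> {s \<in> signs Q. \<tau> * q * L < \<bar>\<Sum>r\<in>Q. s r * a r\<bar>}"
      proof safe
        fix s assume s: "s \<in> signs Q" and "\<tau> * L2_set c Q * L2_set (\<lambda>r. reflect I (hh s) \<omega> (e r)) Q < \<bar>\<Sum>r\<in>Q. c r * reflect I (hh s) \<omega> (e r)\<bar>"
        then have lt: "\<tau> * l * L < \<bar>\<Sum>r\<in>Q. c r * reflect I (hh s) \<omega> (e r)\<bar>" by (simp add: norm l_def)
        have "(\<Sum>r\<in>Q. c r * reflect I (hh s) \<omega> (e r)) = l * (\<Sum>r\<in>Q. v r * reflect_on Q (\<lambda>r. v r - s r / q) a r)"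
          using l by (simp add: Te v_def h_def[abs_def] a_def[abs_def] sum_distrib_left cong: sum.cong)
        also have "(\<Sum>r\<in>Q. v r * reflect_on Q (\<lambda>r. v r - s r / q) a r) = (\<Sum>r\<in>Q. s r / q * a r)"
        proof (rule sum_reflect_on_swap[OF Q(1) v1])
          have "(\<Sum>m\<in>Q. (s m / q)\<^sup>2) = (\<Sum>m\<in>Q. 1 / q\<^sup>2)"
            using s by (intro sum.cong) (auto simp: power_divide PiE_iff)
          then show "(\<Sum>m\<in>Q. (s m / q)\<^sup>2) = 1" using q Q by (auto simp: card_gt_0_iff)
        qed
        also have "\<dots> = (\<Sum>r\<in>Q. s r * a r) / q" by (simp add: sum_divide_distrib)
        finally have "\<tau> * l * L < l * (\<bar>\<Sum>r\<in>Q. s r * a r\<bar> / q)" using lt l q by (simp add: abs_mult)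
        then have "l * (\<tau> * L) < l * (\<bar>\<Sum>r\<in>Q. s r * a r\<bar> / q)" by (simp add: mult_ac)
        then have "\<tau> * L < \<bar>\<Sum>r\<in>Q. s r * a r\<bar> / q" using l by (rule mult_left_less_imp_less[OF _ less_imp_le])
        then show "\<tau> * q * L < \<bar>\<Sum>r\<in>Q. s r * a r\<bar>" using q by (simp add: field_simps)
      qed
      have "real (card {s \<in> signs Q. reflect I (hh s) \<omega> \<in> ?A}) \<le> real (card {s \<in> signs Q. \<tau> * q * L < \<bar>\<Sum>r\<in>Q. s r * a r\<bar>})"
        using sub finite_signs[OF Q(1)] by (auto intro!: card_mono)
      also have "\<dots> \<le> 2 ^ card Q * (2 * exp (- (real (card Q) * \<tau>\<^sup>2 / 2)))"
      proof (cases "L = 0")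
        case True
        then have "\<forall>r\<in>Q. a r = 0" using Q by (simp add: L_def L2_set_eq_0_iff)
        then have "{s \<in> signs Q. \<tau> * q * L < \<bar>\<Sum>r\<in>Q. s r * a r\<bar>} = {}" using True by auto
        then show ?thesis by (simp del: Collect_empty_eq)
      next
        case False
        then have L: "0 < L" using L2_set_nonneg[of a Q] unfolding L_def by linarith
        have eq: "(\<tau> * q * L)\<^sup>2 / (2 * L\<^sup>2) = real (card Q) * \<tau>\<^sup>2 / 2"
          using L q by (simp add: power_mult_distrib)
        have c: "L2_set a Q \<le> L" "0 \<le> \<tau> * q * L" using tau q L by (simp_all add: L_def)
        show ?thesis
          using card_signs_abs_gt_le[OF Q(1) L c] unfolding eq .
      qed
      finally show "real (card {s \<in> signs Q. reflect I (hh s) \<omega> \<in> ?A}) \<le> real (card (signs Q)) * (2 * exp (- (real (card Q) * \<tau>\<^sup>2 / 2)))"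
        by (simp add: card_signs[OF Q(1)])
    qed (use A I finite_signs[OF Q(1)] in \<open>auto simp: distr_gauss_reflect PiE_eq_empty_iff intro!: measurable_reflect\<close>)
  qed
qed

subsection \<open>The uniform law on the sphere as a normalised Gaussian\<close>

lemma nn_integral_gauss_tail:
  assumes r: "0 \<le> r"
  shows "(\<integral>\<^sup>+t. ennreal (t * exp (- t\<^sup>2 / 2)) * indicator {r..} t \<partial>lborel) = ennreal (exp (- r\<^sup>2 / 2))"
proof -
  have "(\<integral>\<^sup>+t. ennreal (t * exp (- t\<^sup>2 / 2)) * indicator {r..} t \<partial>lborel) = ennreal (0 - (- exp (- r\<^sup>2 / 2)))"
  proof (rule nn_integral_FTC_atLeast)
    show "(\<lambda>t::real. t * exp (- t\<^sup>2 / 2)) \<in> borel_measurable borel" by measurable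
    show "((\<lambda>t. - exp (- t\<^sup>2 / 2)) has_real_derivative t * exp (- t\<^sup>2 / 2)) (at t)" for t :: real
      by (auto intro!: derivative_eq_intros simp: algebra_simps)
    show "0 \<le> t * exp (- t\<^sup>2 / 2)" if "r \<le> t" for t using r that by simp
    show "((\<lambda>t::real. - exp (- t\<^sup>2 / 2)) \<longlongrightarrow> 0) at_top" by real_asymp
  qed
  then show ?thesis by simp
qed

text \<open>The Gaussian density is a mixture of indicators of centred balls, and the ball of radius \<open>t\<close> gives a cone
  \<open>t ^ card I\<close> times the mass that the unit ball gives it.\<close>

lemma emeasure_gauss_cone:
  fixes A :: "('i \<Rightarrow> real) set"
  assumes I: "finite I" and A: "A \<in> sets (\<Pi>\<^sub>M i\<in>I. lborel)"
    and cone: "\<And>c x. 0 < c \<Longrightarrow> x \<in> I \<rightarrow>\<^sub>E UNIV \<Longrightarrow> (\<lambda>i\<in>I. c * x i) \<in> A \<longleftrightarrow> x \<in> A"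
  shows "emeasure (gauss I) A = emeasure (uniform_measure (\<Pi>\<^sub>M i\<in>I. lborel) {x \<in> I \<rightarrow>\<^sub>E UNIV. (\<Sum>i\<in>I. (x i)\<^sup>2) \<le> 1}) A"
proof -
  let ?L = "\<Pi>\<^sub>M i\<in>I. lborel :: real measure"
  interpret P: pair_sigma_finite "?L" "lborel :: real measure"
    by (intro pair_sigma_finite.intro product_sigma_finite.sigma_finite[OF lborel_product.product_sigma_finite_axioms I]
      lborel.sigma_finite_measure_axioms)
  define R where "R x = sqrt (\<Sum>i\<in>I. (x i)\<^sup>2)" for x :: "'i \<Rightarrow> real"
  have Rm[measurable]: "R \<in> borel_measurable ?L" unfolding R_def by measurable
  have R0: "0 \<le> R x" for x by (simp add: R_def sum_nonneg)
  define k where "k = (1 / sqrt (2 * pi)) ^ card I"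
  have k: "0 \<le> k" by (simp add: k_def)
  define B where "B = {x \<in> I \<rightarrow>\<^sub>E (UNIV :: real set). (\<Sum>i\<in>I. (x i)\<^sup>2) \<le> 1}"
  have Bx: "x \<in> B \<longleftrightarrow> R x \<le> 1" if "x \<in> space ?L" for x
    using that by (auto simp: B_def R_def space_PiM)
  have Bs: "B \<in> sets ?L"
  proof -
    have "B = {x \<in> space ?L. R x \<le> 1}" using Bx by (auto simp: B_def space_PiM)
    then show ?thesis by simp
  qed
  define w where "w t = ennreal (t * exp (- t\<^sup>2 / 2)) * indicator {0<..} t" for t :: real
  have wm[measurable]: "w \<in> borel_measurable borel" unfolding w_def by measurable
  define K where "K = ennreal k * (\<integral>\<^sup>+t. w t * ennreal (t ^ card I) \<partial>lborel)"
  have main: "emeasure (gauss I) C = K * emeasure ?L (C \<inter> B)"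
    if C: "C \<in> sets ?L" and cone: "\<And>c x. 0 < c \<Longrightarrow> x \<in> I \<rightarrow>\<^sub>E UNIV \<Longrightarrow> (\<lambda>i\<in>I. c * x i) \<in> C \<longleftrightarrow> x \<in> C" for C
  proof -
    note [measurable] = C
    have scale: "(\<integral>\<^sup>+x. indicator C x * (if R x \<le> t then 1 else 0) \<partial>?L) = ennreal (t ^ card I) * emeasure ?L (C \<inter> B)"
      if t: "0 < t" for t :: real
    proof -
      have "(\<integral>\<^sup>+x. indicator C x * (if R x \<le> t then 1 else 0) \<partial>?L) =
        ennreal (\<bar>t\<bar> ^ card I) * (\<integral>\<^sup>+x. indicator C (\<lambda>i\<in>I. 0 + t * x i) * (if R (\<lambda>i\<in>I. 0 + t * x i) \<le> t then 1 else 0) \<partial>?L)"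
        by (rule nn_integral_PiM_lborel_affine[OF I, where t="\<lambda>_. 0" and f="\<lambda>x. indicator C x * (if R x \<le> t then 1 else 0)"]) (use t in auto)
      also have "(\<integral>\<^sup>+x. indicator C (\<lambda>i\<in>I. 0 + t * x i) * (if R (\<lambda>i\<in>I. 0 + t * x i) \<le> t then 1 else 0) \<partial>?L) = (\<integral>\<^sup>+x. indicator (C \<inter> B) x \<partial>?L)"
      proof (rule nn_integral_cong)
        fix x assume x: "x \<in> space ?L"
        have "R (\<lambda>i\<in>I. 0 + t * x i) = t * R x"
        proof -
          have "(\<Sum>i\<in>I. ((\<lambda>i\<in>I. 0 + t * x i) i)\<^sup>2) = t\<^sup>2 * (\<Sum>i\<in>I. (x i)\<^sup>2)"
            by (simp add: power_mult_distrib sum_distrib_left)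
          then show ?thesis using t by (simp add: R_def real_sqrt_mult)
        qed
        moreover have "(\<lambda>i\<in>I. 0 + t * x i) \<in> C \<longleftrightarrow> x \<in> C" using cone[OF t] x by (simp add: space_PiM)
        ultimately show "indicator C (\<lambda>i\<in>I. 0 + t * x i) * (if R (\<lambda>i\<in>I. 0 + t * x i) \<le> t then 1 else 0) = (indicator (C \<inter> B) x :: ennreal)"
          using t Bx[OF x] by (auto simp: indicator_def)
      qed
      also have "\<dots> = emeasure ?L (C \<inter> B)" using C Bs by simp
      finally show ?thesis using t by simp
    qed
    have "emeasure (gauss I) C = (\<integral>\<^sup>+x. ennreal (\<Prod>i\<in>I. std_normal_density (x i)) * indicator C x \<partial>?L)"
      unfolding gauss_eq_density[OF I] by (rule emeasure_density) (use C in auto)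
    also have "\<dots> = (\<integral>\<^sup>+x. ennreal k * (\<integral>\<^sup>+t. w t * (indicator C x * (if R x \<le> t then 1 else 0)) \<partial>lborel) \<partial>?L)"
    proof (rule nn_integral_cong)
      fix x assume x: "x \<in> space ?L"
      have "(\<integral>\<^sup>+t. w t * (indicator C x * (if R x \<le> t then 1 else 0)) \<partial>lborel) =
         (\<integral>\<^sup>+t. ennreal (t * exp (- t\<^sup>2 / 2)) * indicator {R x..} t * indicator C x \<partial>lborel)"
      proof (rule nn_integral_cong)
        fix t :: real
        show "w t * (indicator C x * (if R x \<le> t then 1 else 0)) = ennreal (t * exp (- t\<^sup>2 / 2)) * indicator {R x..} t * indicator C x"
          using R0[of x] by (cases "t = 0") (auto simp: w_def indicator_def)
      qed
      also have "\<dots> = ennreal (exp (- (R x)\<^sup>2 / 2)) * indicator C x"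
        unfolding nn_integral_gauss_tail[OF R0, symmetric] by (rule nn_integral_multc) measurable
      also have "(R x)\<^sup>2 = (\<Sum>i\<in>I. (x i)\<^sup>2)" by (simp add: R_def sum_nonneg)
      finally show "ennreal (\<Prod>i\<in>I. std_normal_density (x i)) * indicator C x =
          ennreal k * (\<integral>\<^sup>+t. w t * (indicator C x * (if R x \<le> t then 1 else 0)) \<partial>lborel)"
        unfolding prod_std_normal_density[OF I] k_def[symmetric] using k by (simp add: ennreal_mult mult.assoc)
    qed
    also have "\<dots> = ennreal k * (\<integral>\<^sup>+x. (\<integral>\<^sup>+t. w t * (indicator C x * (if R x \<le> t then 1 else 0)) \<partial>lborel) \<partial>?L)"
      by (rule nn_integral_cmult) measurable
    also have "(\<integral>\<^sup>+x. (\<integral>\<^sup>+t. w t * (indicator C x * (if R x \<le> t then 1 else 0)) \<partial>lborel) \<partial>?L) =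
       (\<integral>\<^sup>+t. (\<integral>\<^sup>+x. w t * (indicator C x * (if R x \<le> t then 1 else 0)) \<partial>?L) \<partial>lborel)"
      by (rule P.Fubini'[symmetric]) measurable
    also have "\<dots> = (\<integral>\<^sup>+t. w t * ennreal (t ^ card I) * emeasure ?L (C \<inter> B) \<partial>lborel)"
    proof (rule nn_integral_cong)
      fix t :: real
      have "(\<integral>\<^sup>+x. w t * (indicator C x * (if R x \<le> t then 1 else 0)) \<partial>?L) = w t * (\<integral>\<^sup>+x. indicator C x * (if R x \<le> t then 1 else 0) \<partial>?L)"
        by (rule nn_integral_cmult) measurable
      then show "(\<integral>\<^sup>+x. w t * (indicator C x * (if R x \<le> t then 1 else 0)) \<partial>?L) = w t * ennreal (t ^ card I) * emeasure ?L (C \<inter> B)"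
        using scale[of t] by (cases "0 < t") (auto simp: w_def mult.assoc)
    qed
    also have "\<dots> = (\<integral>\<^sup>+t. w t * ennreal (t ^ card I) \<partial>lborel) * emeasure ?L (C \<inter> B)"
      by (rule nn_integral_multc) measurable
    finally show ?thesis by (simp add: K_def mult.assoc)
  qed
  have sp: "space ?L = I \<rightarrow>\<^sub>E UNIV" by (simp add: space_PiM)
  \<comment> \<open>The whole space is a cone too. This identifies \<open>K\<close> as the inverse
    volume of the ball without computing either.\<close>
  have "emeasure (gauss I) (space ?L) = K * emeasure ?L (space ?L \<inter> B)"
    by (rule main[OF sets.top]) (auto simp: sp)
  moreover have "emeasure (gauss I) (space ?L) = 1"
    using prob_space.emeasure_space_1[OF prob_space_gauss[of I]] by (simp add: space_PiM)
  moreover have "space ?L \<inter> B = B" using sets.sets_into_space[OF Bs] by auto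
  ultimately have K1: "K * emeasure ?L B = 1" by simp
  have B0: "emeasure ?L B \<noteq> 0" using K1 by (intro notI) simp
  have "emeasure ?L B \<noteq> \<infinity>"
  proof
    assume "emeasure ?L B = \<infinity>"
    then show False using K1 by (cases "K = 0") (simp_all add: ennreal_mult_top)
  qed
  then have "K = 1 / emeasure ?L B"
    using ennreal_mult_divide_eq[of "emeasure ?L B" K] B0 K1 by simp
  then have "emeasure (gauss I) A = emeasure ?L (B \<inter> A) / emeasure ?L B"
    using main[OF A cone] by (simp only: ennreal_divide_times mult_1 Int_commute[of A])
  also have "\<dots> = emeasure (uniform_measure ?L B) A"
    by (rule emeasure_uniform_measure[symmetric]) (use Bs A in auto)
  finally show ?thesis unfolding B_def .
qed

lemma measurable_vec_borelI:
  assumes "\<And>\<omega>. \<omega> \<in> space M \<Longrightarrow> f \<omega> \<in> carrier_vec n"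
    and "\<And>k. k < n \<Longrightarrow> (\<lambda>\<omega>. vec_index (f \<omega>) k) \<in> borel_measurable M"
  shows "f \<in> measurable M (vec_borel n)"
  unfolding vec_borel_def
proof (rule measurable_vimage_algebra2)
  show "f \<in> space M \<rightarrow> carrier_vec n" using assms(1) by auto
  show "(\<lambda>\<omega>. \<lambda>k\<in>{..<n}. vec_index (f \<omega>) k) \<in> measurable M (\<Pi>\<^sub>M k\<in>{..<n}. borel)"
    using assms(2) by (intro measurable_restrict) auto
qed

lemma measurable_vec_index:
  assumes k: "k < n"
  shows "(\<lambda>v. vec_index v k) \<in> borel_measurable (vec_borel n)"
proof -
  have "(\<lambda>v. \<lambda>k\<in>{..<n}. vec_index v k) \<in> measurable (vec_borel n) (\<Pi>\<^sub>M k\<in>{..<n}. borel)"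
    unfolding vec_borel_def by (rule measurable_vimage_algebra1) (auto simp: space_PiM)
  from measurable_compose[OF this measurable_component_singleton[of k "{..<n}"]] k
  show ?thesis by simp
qed

definition sphere_point :: "nat \<Rightarrow> real mat \<Rightarrow> nat \<Rightarrow> (nat \<Rightarrow> real) \<Rightarrow> real Matrix.vec" where
  "sphere_point n U d x = (let w = U *\<^sub>v Matrix.vec d x in (1 / l2_norm w) \<cdot>\<^sub>v w)"

lemma l2_norm_eq: "l2_norm v = L2_set (vec_index v) {..<dim_vec v}"
  by (simp add: l2_norm_def L2_set_def scalar_prod_def lessThan_atLeast0 power2_eq_square)

lemma vec_index_mult_mat_vec:
  assumes "U \<in> carrier_mat n d" "k < n"
  shows "vec_index (U *\<^sub>v Matrix.vec d x) k = (\<Sum>r<d. U $$ (k, r) * x r)"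
  using assms by (simp add: scalar_prod_def lessThan_atLeast0)

lemma sphere_point_index:
  assumes U: "U \<in> carrier_mat n d" and k: "k < n"
  shows "vec_index (sphere_point n U d x) k =
    (\<Sum>r<d. U $$ (k, r) * x r) / L2_set (\<lambda>k. \<Sum>r<d. U $$ (k, r) * x r) {..<n}"
proof -
  have "l2_norm (U *\<^sub>v Matrix.vec d x) = L2_set (\<lambda>k. \<Sum>r<d. U $$ (k, r) * x r) {..<n}"
    unfolding l2_norm_eq using U by (intro L2_set_cong) (auto simp: vec_index_mult_mat_vec[OF U] simp del: index_mult_mat_vec)
  then show ?thesis
    using U k vec_index_mult_mat_vec[OF U k] by (simp add: sphere_point_def Let_def del: index_mult_mat_vec)
qed

lemma measurable_sphere_point:
  assumes U: "U \<in> carrier_mat n d"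
    and X: "\<And>r. r < d \<Longrightarrow> (\<lambda>\<omega>. X \<omega> r) \<in> borel_measurable M"
  shows "(\<lambda>\<omega>. sphere_point n U d (X \<omega>)) \<in> measurable M (vec_borel n)"
proof (rule measurable_vec_borelI)
  show "sphere_point n U d (X \<omega>) \<in> carrier_vec n" for \<omega>
    using U by (simp add: sphere_point_def Let_def)
  fix k assume k: "k < n"
  have s: "(\<lambda>\<omega>. \<Sum>r<d. U $$ (k, r) * X \<omega> r) \<in> borel_measurable M" for k
    by (intro borel_measurable_sum borel_measurable_times borel_measurable_const X) simp
  have "(\<lambda>\<omega>. \<Sum>k<n. (\<Sum>r<d. U $$ (k, r) * X \<omega> r)\<^sup>2) \<in> borel_measurable M"
    by (rule borel_measurable_sum, rule borel_measurable_power, rule s)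
  then have "(\<lambda>\<omega>. sqrt (\<Sum>k<n. (\<Sum>r<d. U $$ (k, r) * X \<omega> r)\<^sup>2)) \<in> borel_measurable M"
    by measurable
  then show "(\<lambda>\<omega>. vec_index (sphere_point n U d (X \<omega>)) k) \<in> borel_measurable M"
    unfolding sphere_point_index[OF U k] L2_set_def by (rule borel_measurable_divide[OF s])
qed

text \<open>Radial projection is constant on rays, so preimages of measurable sets are cones, and on
  cones the Gaussian measure and the uniform measure of the ball agree.\<close>

lemma sphere_law_eq_gauss:
  assumes U: "orthonormal_basis n S \<in> carrier_mat n (subspace_dim n S)"
  shows "sphere_law n S = distr (gauss {..<subspace_dim n S}) (vec_borel n)
    (sphere_point n (orthonormal_basis n S) (subspace_dim n S))"
proof -
  define d where "d = subspace_dim n S"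
  define V where "V = orthonormal_basis n S"
  have V: "V \<in> carrier_mat n d" using U by (simp add: V_def d_def)
  define \<Phi> where "\<Phi> = sphere_point n V d"
  let ?L = "\<Pi>\<^sub>M k\<in>{..<d}. lborel :: real measure"
  have comp: "(\<lambda>x. x r) \<in> borel_measurable ?L" if "r < d" for r
    using measurable_component_singleton[of r "{..<d}" "\<lambda>_. lborel :: real measure"] that by simp
  have mL: "\<Phi> \<in> measurable ?L (vec_borel n)"
    unfolding \<Phi>_def using measurable_sphere_point[OF V comp] by simp
  have mG: "\<Phi> \<in> measurable (gauss {..<d}) (vec_borel n)"
    using mL by (simp add: measurable_cong_sets[OF sets_gauss refl])
  have mU: "\<Phi> \<in> measurable (unit_ball_law d) (vec_borel n)"
    using mL by (simp add: unit_ball_law_def measurable_def sets_uniform_measure space_uniform_measure)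
  have hom: "\<Phi> (\<lambda>i\<in>{..<d}. c * x i) = \<Phi> x" if c: "0 < c" for c x
  proof (rule eq_vecI)
    show "dim_vec (\<Phi> (\<lambda>i\<in>{..<d}. c * x i)) = dim_vec (\<Phi> x)" by (simp add: \<Phi>_def sphere_point_def Let_def)
    fix k assume "k < dim_vec (\<Phi> x)"
    then have k: "k < n" using V by (simp add: \<Phi>_def sphere_point_def Let_def)
    have "(\<Sum>r<d. V $$ (k, r) * (\<lambda>i\<in>{..<d}. c * x i) r) = c * (\<Sum>r<d. V $$ (k, r) * x r)" for k
      by (simp add: sum_distrib_left mult.left_commute)
    then show "vec_index (\<Phi> (\<lambda>i\<in>{..<d}. c * x i)) k = vec_index (\<Phi> x) k"
      unfolding \<Phi>_def sphere_point_index[OF V k] using c by (simp add: L2_set_scale)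
  qed
  have "sphere_law n S = distr (unit_ball_law d) (vec_borel n) \<Phi>"
    unfolding sphere_law_def \<Phi>_def sphere_point_def[abs_def] V_def d_def ..
  also have "\<dots> = distr (gauss {..<d}) (vec_borel n) \<Phi>"
  proof (rule measure_eqI)
    fix A assume "A \<in> sets (distr (unit_ball_law d) (vec_borel n) \<Phi>)"
    then have A: "A \<in> sets (vec_borel n)" by simp
    define C where "C = \<Phi> -` A \<inter> space ?L"
    have C: "C \<in> sets ?L" unfolding C_def by (rule measurable_sets[OF mL A])
    have cone: "(\<lambda>i\<in>{..<d}. c * x i) \<in> C \<longleftrightarrow> x \<in> C" if "0 < c" "x \<in> {..<d} \<rightarrow>\<^sub>E UNIV" for c x
      using that hom[OF that(1), of x] by (simp add: C_def space_PiM)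
    have "emeasure (distr (unit_ball_law d) (vec_borel n) \<Phi>) A = emeasure (unit_ball_law d) C"
      unfolding emeasure_distr[OF mU A] C_def by (simp add: unit_ball_law_def space_uniform_measure)
    also have "\<dots> = emeasure (gauss {..<d}) C"
      unfolding unit_ball_law_def by (rule emeasure_gauss_cone[symmetric, OF _ C cone]) auto
    also have "\<dots> = emeasure (distr (gauss {..<d}) (vec_borel n) \<Phi>) A"
      unfolding emeasure_distr[OF mG A] C_def by (simp add: space_PiM)
    finally show "emeasure (distr (unit_ball_law d) (vec_borel n) \<Phi>) A = emeasure (distr (gauss {..<d}) (vec_borel n) \<Phi>) A" .
  qed simp
  finally show ?thesis unfolding \<Phi>_def V_def d_def .
qed

lemma noise_law_eq_gauss:
  assumes s: "0 < \<sigma>" and n: "0 < n"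
  shows "noise_law n \<sigma> = distr (gauss {..<n}) (vec_borel n) (\<lambda>b. Matrix.vec n (\<lambda>k. \<sigma> / sqrt (real n) * b k))"
proof -
  define c where "c = \<sigma> / sqrt (real n)"
  have c: "0 < c" using s n by (simp add: c_def)
  define Nc where "Nc = density lborel (\<lambda>x. ennreal (normal_density 0 c x))"
  have ps: "prob_space Nc" unfolding Nc_def using c by (rule prob_space_normal_density)
  have Nc: "Nc = distr std_normal lborel (\<lambda>x. c * x)"
  proof -
    have "distributed std_normal lborel (\<lambda>x. x) std_normal_density"
      unfolding distributed_def by (auto intro: distr_id2)
    from std_normal.normal_density_affine[OF this, of c 0] c
    have "distributed std_normal lborel (\<lambda>x. 0 + c * x) (normal_density (0 + c * 0) (\<bar>c\<bar> * 1))" by auto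
    then show ?thesis using c unfolding distributed_def Nc_def by simp
  qed
  have sN: "sets (\<Pi>\<^sub>M k\<in>{..<n}. Nc) = sets (\<Pi>\<^sub>M k\<in>{..<n}. lborel :: real measure)"
    by (intro sets_PiM_cong) (auto simp: Nc_def)
  have vm: "Matrix.vec n \<in> measurable (\<Pi>\<^sub>M k\<in>{..<n}. lborel :: real measure) (vec_borel n)"
  proof (rule measurable_vec_borelI)
    fix k assume "k < n"
    then show "(\<lambda>\<omega>. vec_index (Matrix.vec n \<omega>) k) \<in> borel_measurable (\<Pi>\<^sub>M k\<in>{..<n}. lborel :: real measure)"
      using measurable_component_singleton[of k "{..<n}" "\<lambda>_. lborel :: real measure"] by simp
  qed simp
  have cm: "compose {..<n} (\<lambda>x. c * x) \<in> measurable (gauss {..<n}) (\<Pi>\<^sub>M k\<in>{..<n}. lborel :: real measure)"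
    unfolding compose_def
  proof (rule measurable_restrict)
    fix k assume "k \<in> {..<n}"
    from measurable_component_singleton[OF this, of "\<lambda>_. std_normal"]
    show "(\<lambda>\<omega>. c * \<omega> k) \<in> measurable (gauss {..<n}) lborel" by simp
  qed
  have "(\<Pi>\<^sub>M k\<in>{..<n}. Nc) = distr (gauss {..<n}) (\<Pi>\<^sub>M k\<in>{..<n}. Nc) (compose {..<n} (\<lambda>x. c * x))"
  proof -
    have "distr (gauss {..<n}) (\<Pi>\<^sub>M k\<in>{..<n}. Nc) (compose {..<n} (\<lambda>x. c * x)) = (\<Pi>\<^sub>M k\<in>{..<n}. distr std_normal Nc (\<lambda>x. c * x))"
      by (rule distr_PiM_finite_prob_space') (auto simp: prob_space_std_normal ps, simp add: Nc_def)
    also have "\<dots> = (\<Pi>\<^sub>M k\<in>{..<n}. Nc)"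
    proof (rule PiM_cong[OF refl])
      have "distr std_normal Nc (\<lambda>x. c * x) = distr std_normal lborel (\<lambda>x. c * x)"
        by (intro distr_cong) (auto simp: Nc_def)
      then show "distr std_normal Nc (\<lambda>x. c * x) = Nc" by (simp add: Nc)
    qed
    finally show ?thesis ..
  qed
  then have "noise_law n \<sigma> = distr (distr (gauss {..<n}) (\<Pi>\<^sub>M k\<in>{..<n}. Nc) (compose {..<n} (\<lambda>x. c * x))) (vec_borel n) (Matrix.vec n)"
    unfolding noise_law_def c_def[symmetric] Nc_def[symmetric] by simp
  also have "\<dots> = distr (gauss {..<n}) (vec_borel n) (Matrix.vec n \<circ> compose {..<n} (\<lambda>x. c * x))"
    using vm cm by (intro distr_distr) (simp_all add: measurable_cong_sets[OF sN refl] measurable_cong_sets[OF refl sN])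
  also have "Matrix.vec n \<circ> compose {..<n} (\<lambda>x. c * x) = (\<lambda>b. Matrix.vec n (\<lambda>k. c * b k))"
    by (auto simp: fun_eq_iff compose_def intro!: eq_vecI)
  finally show ?thesis by (simp add: c_def)
qed

subsection \<open>Orthonormal families in coordinates\<close>

definition orthonormal :: "nat \<Rightarrow> nat \<Rightarrow> (nat \<Rightarrow> nat \<Rightarrow> real) \<Rightarrow> bool" where
  "orthonormal n d p \<longleftrightarrow> (\<forall>a<d. \<forall>b<d. ip n (p a) (p b) = (if a = b then 1 else 0))"

text \<open>The vector \<open>r\<close> is the part of the l-th unit vector orthogonal to the
  family. The formula for its norm replaces all dimension arguments in what follows.\<close>

lemma orthonormal_residual:
  assumes p: "orthonormal n d p" and l: "l < n"
  defines "r \<equiv> \<lambda>k. (if k = l then 1 else 0) - (\<Sum>a<d. p a l * p a k)"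
  shows "ip n r r = 1 - (\<Sum>a<d. (p a l)\<^sup>2)" and "\<And>a. a < d \<Longrightarrow> ip n (p a) r = 0"
proof -
  have e: "ip n u (\<lambda>k. if k = l then 1 else 0) = u l" for u
    using l by (simp add: ip_def if_distrib cong: if_cong)
  have pe: "ip n (p a) (\<lambda>k. \<Sum>b<d. p b l * p b k) = p a l" if "a < d" for a
  proof -
    have "ip n (p a) (\<lambda>k. \<Sum>b<d. p b l * p b k) = (\<Sum>b<d. p b l * (if a = b then 1 else 0))"
      unfolding ip_sum_right ip_scale_right using p that by (intro sum.cong) (auto simp: orthonormal_def)
    then show ?thesis using that by (simp add: if_distrib cong: if_cong)
  qed
  show orth: "ip n (p a) r = 0" if "a < d" for a
    unfolding r_def ip_diff_right e pe[OF that] by simp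
  have "ip n r r = ip n r (\<lambda>k. if k = l then 1 else 0) - ip n r (\<lambda>k. \<Sum>a<d. p a l * p a k)"
    by (subst (2) r_def) (rule ip_diff_right)
  also have "ip n r (\<lambda>k. \<Sum>a<d. p a l * p a k) = 0"
    unfolding ip_sum_right ip_scale_right using orth by (simp add: ip_commute[of n r])
  finally show "ip n r r = 1 - (\<Sum>a<d. (p a l)\<^sup>2)"
    unfolding e by (simp add: r_def power2_eq_square)
qed

lemma orthonormal_sum_squares:
  assumes "orthonormal n d p"
  shows "(\<Sum>l<n. \<Sum>a<d. (p a l)\<^sup>2) = real d"
proof -
  have "(\<Sum>l<n. \<Sum>a<d. (p a l)\<^sup>2) = (\<Sum>a<d. ip n (p a) (p a))"
    by (subst sum.swap) (simp add: ip_def power2_eq_square)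
  also have "\<dots> = real d" using assms by (simp add: orthonormal_def)
  finally show ?thesis .
qed

lemma orthonormal_le:
  assumes "orthonormal n d p"
  shows "d \<le> n"
proof -
  have "(\<Sum>l<n. \<Sum>a<d. (p a l)\<^sup>2) \<le> (\<Sum>l<n. 1)"
  proof (rule sum_mono)
    fix l assume "l \<in> {..<n}"
    then show "(\<Sum>a<d. (p a l)\<^sup>2) \<le> 1"
      using orthonormal_residual(1)[OF assms, of l]
        ip_nonneg[of n "\<lambda>k. (if k = l then 1 else 0) - (\<Sum>a<d. p a l * p a k)"] by simp
  qed
  then show ?thesis unfolding orthonormal_sum_squares[OF assms] by simp
qed

text \<open>The squared coordinates of the family add up to d < n, so some unit vector has a nonzero
  residual; normalising it gives the new vector.\<close>

lemma orthonormal_extend: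
  assumes p: "orthonormal n d p" and d: "d < n"
  shows "\<exists>w. orthonormal n (Suc d) (p(d := w))"
proof -
  have "\<exists>l<n. (\<Sum>a<d. (p a l)\<^sup>2) < 1"
  proof (rule ccontr)
    assume "\<not> ?thesis"
    then have "1 \<le> (\<Sum>a<d. (p a l)\<^sup>2)" if "l < n" for l using that by (meson not_less)
    then have "(\<Sum>l<n. 1) \<le> (\<Sum>l<n. \<Sum>a<d. (p a l)\<^sup>2)" by (intro sum_mono) auto
    then show False using d unfolding orthonormal_sum_squares[OF p] by simp
  qed
  then obtain l where l: "l < n" "(\<Sum>a<d. (p a l)\<^sup>2) < 1" by auto
  define r where "r = (\<lambda>k. (if k = l then 1 else 0) - (\<Sum>a<d. p a l * p a k))"
  define c where "c = ip n r r"
  have r: "c > 0" "\<And>a. a < d \<Longrightarrow> ip n (p a) r = 0"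
    using orthonormal_residual[OF p l(1)] l(2) unfolding r_def c_def by auto
  define w where "w = (\<lambda>k. (1 / sqrt c) * r k)"
  have "ip n w w = (1 / sqrt c) * ((1 / sqrt c) * c)" by (simp only: w_def ip_scale_left ip_scale_right c_def)
  also have "\<dots> = 1" using r(1) by (simp add: field_simps)
  finally have "ip n w w = 1" .
  moreover have "ip n (p a) w = 0" if "a < d" for a using r(2)[OF that] unfolding w_def ip_scale_right by simp
  moreover have "ip n w (p a) = 0" if "a < d" for a using calculation(2)[OF that] by (simp add: ip_commute)
  ultimately show ?thesis using p by (intro exI[of _ w]) (auto simp: orthonormal_def less_Suc_eq)
qed

lemma orthonormal_complete:
  assumes p: "orthonormal n d p"
  shows "\<exists>p'. orthonormal n n p' \<and> (\<forall>a<d. p' a = p a)"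
proof -
  have "d + j \<le> n \<Longrightarrow> \<exists>p'. orthonormal n (d + j) p' \<and> (\<forall>a<d. p' a = p a)" for j
  proof (induction j)
    case 0
    then show ?case using p by auto
  next
    case (Suc j)
    then obtain p' where p': "orthonormal n (d + j) p'" "\<forall>a<d. p' a = p a" by auto
    from orthonormal_extend[OF p'(1)] Suc.prems obtain w where "orthonormal n (Suc (d + j)) (p'(d + j := w))" by auto
    moreover have "\<forall>a<d. (p'(d + j := w)) a = p a" using p'(2) by simp
    ultimately show ?case unfolding add_Suc_right by blast
  qed
  from this[of "n - d"] orthonormal_le[OF p] show ?thesis by simp
qed

text \<open>For n vectors the squared norms of the residuals add up to n - n = 0, so every residual
  vanishes, which is the orthonormality of the transposed family.\<close>

lemma orthonormal_dual:
  assumes p: "orthonormal n n p" and l: "l < n" "k < n"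
  shows "(\<Sum>a<n. p a l * p a k) = (if k = l then 1 else 0)"
proof -
  define r where "r l k = (if k = l then 1 else 0) - (\<Sum>a<n. p a l * p a k)" for l k
  have r: "ip n (r l) (r l) = 1 - (\<Sum>a<n. (p a l)\<^sup>2)" if "l < n" for l
    using orthonormal_residual(1)[OF p that] by (simp add: r_def[abs_def])
  have "(\<Sum>l<n. ip n (r l) (r l)) = (\<Sum>l<n. 1) - (\<Sum>l<n. \<Sum>a<n. (p a l)\<^sup>2)"
    unfolding sum_subtractf[symmetric] using r by (intro sum.cong) auto
  also have "\<dots> = 0" by (simp add: orthonormal_sum_squares[OF p])
  finally have "ip n (r l) (r l) = 0"
    using l by (subst (asm) sum_nonneg_eq_0_iff) (auto simp: ip_nonneg)
  then have "\<forall>k<n. r l k = 0"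
    unfolding ip_def by (subst (asm) sum_nonneg_eq_0_iff) auto
  then show ?thesis using l by (simp add: r_def)
qed

lemma orthonormal_parseval:
  assumes p: "orthonormal n n p"
  shows "ip n (\<lambda>a. ip n (p a) u) (\<lambda>a. ip n (p a) v) = ip n u v"
proof -
  have "ip n (\<lambda>a. ip n (p a) u) (\<lambda>a. ip n (p a) v) = (\<Sum>a<n. \<Sum>l<n. \<Sum>k<n. (p a l * p a k) * (u l * v k))"
    unfolding ip_def by (simp add: sum_product mult_ac)
  also have "\<dots> = (\<Sum>l<n. \<Sum>a<n. \<Sum>k<n. (p a l * p a k) * (u l * v k))" by (rule sum.swap)
  also have "\<dots> = (\<Sum>l<n. \<Sum>k<n. \<Sum>a<n. (p a l * p a k) * (u l * v k))" by (intro sum.cong refl sum.swap)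
  also have "\<dots> = (\<Sum>l<n. \<Sum>k<n. (if k = l then 1 else 0) * (u l * v k))"
    unfolding sum_distrib_right[symmetric] using orthonormal_dual[OF p] by (intro sum.cong refl) auto
  also have "\<dots> = ip n u v" by (simp add: ip_def if_distrib[of "\<lambda>x. x * _"] cong: if_cong)
  finally show ?thesis .
qed

subsection \<open>Orthonormal bases of subspaces\<close>

text \<open>\<open>orthonormal_basis\<close> is a choice, so existence has to be supplied. An
  orthonormal subset of maximal cardinality spans: otherwise a Gram-Schmidt step would enlarge
  it.\<close>

lemma exists_orthonormal_basis:
  assumes S: "is_subspace n S"
  shows "\<exists>U. is_orthonormal_basis n S U"
proof -
  interpret vec_space "TYPE(real)" n .
  have sub: "submodule class_ring S V" and sp: "VectorSpace.subspace class_ring S V"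
    using S by (auto simp: is_subspace_def VectorSpace.subspace_def)
  have SV: "S \<subseteq> carrier_vec n" using submodule.subset[OF sub] by simp
  have Sadd: "v + w \<in> S" if "v \<in> S" "w \<in> S" for v w
    using submodule.m_closed[OF sub that] by simp
  have Ssmult: "c \<cdot>\<^sub>v v \<in> S" if "v \<in> S" for c v
    using submodule.smult_closed[OF sub _ that, of c] by simp
  define ON where "ON B \<longleftrightarrow> finite B \<and> B \<subseteq> S \<and> (\<forall>u\<in>B. \<forall>v\<in>B. u \<bullet> v = (if u = v then 1 else 0))" for B :: "real Matrix.vec set"
  have coef: "u \<bullet> lincomb a B = a u" if B: "ON B" and u: "u \<in> B" for B a u
  proof -
    have BV: "B \<subseteq> carrier_vec n" using B SV by (auto simp: ON_def)
    have "u \<bullet> lincomb a B = (\<Sum>i<n. u $ i * (\<Sum>x\<in>B. a x * x $ i))"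
      using lincomb_dim[OF _ BV, of a] B lincomb_index[OF _ BV, of _ a]
      unfolding ON_def by (simp only: scalar_prod_def lessThan_atLeast0) simp
    also have "\<dots> = (\<Sum>x\<in>B. a x * (u \<bullet> x))"
    proof -
      have "(\<Sum>i<n. u $ i * (\<Sum>x\<in>B. a x * x $ i)) = (\<Sum>x\<in>B. \<Sum>i<n. a x * (u $ i * x $ i))"
        unfolding sum_distrib_left by (subst sum.swap) (simp add: mult_ac)
      also have "\<dots> = (\<Sum>x\<in>B. a x * (u \<bullet> x))"
        using BV by (intro sum.cong) (auto simp: scalar_prod_def lessThan_atLeast0 sum_distrib_left)
      finally show ?thesis .
    qed
    also have "\<dots> = (\<Sum>x\<in>B. a x * (if u = x then 1 else 0))"
      using B u by (intro sum.cong) (auto simp: ON_def)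
    also have "\<dots> = a u" using B u by (simp add: ON_def if_distrib cong: if_cong)
    finally show ?thesis .
  qed
  have ind: "lin_indpt B" if B: "ON B" for B
  proof -
    have "a v = 0" if z: "lincomb a B = 0\<^sub>v n" and v: "v \<in> B" for a v
    proof -
      have "v \<in> carrier_vec n" using v B SV by (auto simp: ON_def)
      then show ?thesis using coef[OF B v, of a] z by simp
    qed
    then show ?thesis
      by (intro finite_lin_indpt2) (use B SV in \<open>auto simp: ON_def\<close>)
  qed
  have bound: "card B \<le> n" if "ON B" for B
    using li_le_dim(2)[OF fin_dim _ ind[OF that]] that SV dim_is_n by (auto simp: ON_def)
  have "ON {}" by (simp add: ON_def)
  \<comment> \<open>Orthonormal sets are linearly independent, so their cardinality is at most n and
    a largest one exists.\<close>
  then obtain B where B: "ON B" and max: "\<And>B'. ON B' \<Longrightarrow> card B' \<le> card B"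
    using ex_has_greatest_nat[of ON "{}" card "Suc n"] bound by (auto simp: less_Suc_eq_le)
  have BS: "B \<subseteq> S" "finite B" and BV: "B \<subseteq> carrier_vec n" using B SV by (auto simp: ON_def)
  have spanS: "span B \<subseteq> S" by (rule span_is_subset[OF BS(1) sub])
  have "S \<subseteq> span B"
  proof
    fix w assume w: "w \<in> S"
    then have wV: "w \<in> carrier_vec n" using SV by auto
    define l where "l = lincomb (\<lambda>b. b \<bullet> w) B"
    have lB: "l \<in> span B" unfolding l_def by (rule in_spanI) (use BS in auto)
    then have lS: "l \<in> S" and lV: "l \<in> carrier_vec n" using spanS SV by auto
    define r where "r = w + (- 1) \<cdot>\<^sub>v l"
    have rS: "r \<in> S" and rV: "r \<in> carrier_vec n" unfolding r_def using Sadd Ssmult w lS SV by auto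
    have br: "b \<bullet> r = 0" if b: "b \<in> B" for b
    proof -
      have "b \<in> carrier_vec n" using b BV by auto
      then have "b \<bullet> r = b \<bullet> w - b \<bullet> l"
        unfolding r_def using wV lV by (simp add: scalar_prod_add_distrib[of _ n])
      then show ?thesis using coef[OF B b] by (simp add: l_def)
    qed
    have "r = 0\<^sub>v n"
    proof (rule ccontr)
      assume "r \<noteq> 0\<^sub>v n"
      then have rr: "0 < r \<bullet> r"
        using conjugate_square_greater_0_vec[OF rV] by (simp add: conjugate_vec_def vec_eq_iff)
      define u where "u = (1 / sqrt (r \<bullet> r)) \<cdot>\<^sub>v r"
      have uS: "u \<in> S" unfolding u_def by (rule Ssmult[OF rS])
      have uu: "u \<bullet> u = 1"
        unfolding u_def using rV rr by (simp add: field_simps)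
      have bu: "b \<bullet> u = 0" "u \<bullet> b = 0" if "b \<in> B" for b
      proof -
        have "b \<in> carrier_vec n" using that BV by auto
        then show "b \<bullet> u = 0" unfolding u_def using rV br[OF that] by simp
        then show "u \<bullet> b = 0" using \<open>b \<in> carrier_vec n\<close> uS SV by (subst comm_scalar_prod[of _ n]) auto
      qed
      then have "u \<notin> B" using uu by force
      then have "ON (insert u B)" using B uS uu bu by (auto simp: ON_def)
      then have "card (insert u B) \<le> card B" by (rule max)
      then show False using \<open>u \<notin> B\<close> BS by simp
    qed
    then have "w = l"
      using wV lV by (auto simp: r_def vec_eq_iff)
    then show "w \<in> span B" using lB by simp
  qed
  then have span: "span B = S" using spanS by auto
  have vs: "vectorspace class_ring (V\<lparr>carrier := S\<rparr>)" by (rule subspace_is_vs[OF sp])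
  then interpret W: vectorspace class_ring "V\<lparr>carrier := S\<rparr>" .
  have "W.basis B"
    unfolding W.basis_def using span_li_not_depend[OF BS(1) sub] ind[OF B] span BS by auto
  then have dim: "subspace_dim n S = card B"
    unfolding subspace_dim_def using W.dim_basis[OF BS(2)] by simp
  obtain bs where bs: "set bs = B" "distinct bs" using finite_distinct_list[OF BS(2)] by auto
  then have len: "length bs = card B" using distinct_card by fastforce
  define U where "U = mat_of_cols n bs"
  have cols: "cols U = bs" unfolding U_def using BV bs by (intro cols_mat_of_cols) auto
  have Uc: "U \<in> carrier_mat n (card B)" unfolding U_def using len by auto
  have "transpose_mat U * U = 1\<^sub>m (card B)"
  proof (rule eq_matI)
    fix i j assume "i < dim_row (1\<^sub>m (card B) :: real mat)" "j < dim_col (1\<^sub>m (card B) :: real mat)"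
    then have ij: "i < length bs" "j < length bs" using len by auto
    have "(transpose_mat U * U) $$ (i, j) = col U i \<bullet> col U j" using ij Uc len by simp
    also have "\<dots> = bs ! i \<bullet> bs ! j" using ij cols Uc len by (metis cols_length cols_nth carrier_matD(2))
    also have "\<dots> = (if i = j then 1 else 0)"
      using B bs ij nth_mem[OF ij(1)] nth_mem[OF ij(2)] by (auto simp: ON_def nth_eq_iff_index_eq)
    finally show "(transpose_mat U * U) $$ (i, j) = 1\<^sub>m (card B) $$ (i, j)" using ij len by simp
  qed (use Uc in auto)
  moreover have "col_space U = S" unfolding col_space_def cols bs span ..
  ultimately have "is_orthonormal_basis n S U" unfolding is_orthonormal_basis_def dim using Uc by auto
  then show ?thesis ..
qed

lemma orthonormal_basis:
  assumes "is_subspace n S"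
  shows "orthonormal_basis n S \<in> carrier_mat n (subspace_dim n S)"
    "orthonormal n (subspace_dim n S) (\<lambda>a k. orthonormal_basis n S $$ (k, a))"
proof -
  have "is_orthonormal_basis n S (orthonormal_basis n S)"
    unfolding orthonormal_basis_def by (rule someI_ex[OF exists_orthonormal_basis[OF assms]])
  then have U: "orthonormal_basis n S \<in> carrier_mat n (subspace_dim n S)"
    and UU: "transpose_mat (orthonormal_basis n S) * orthonormal_basis n S = 1\<^sub>m (subspace_dim n S)"
    by (auto simp: is_orthonormal_basis_def)
  show "orthonormal_basis n S \<in> carrier_mat n (subspace_dim n S)" by (rule U)
  show "orthonormal n (subspace_dim n S) (\<lambda>a k. orthonormal_basis n S $$ (k, a))"
    unfolding orthonormal_def
  proof (intro allI impI)
    fix a b assume ab: "a < subspace_dim n S" "b < subspace_dim n S"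
    have "ip n (\<lambda>k. orthonormal_basis n S $$ (k, a)) (\<lambda>k. orthonormal_basis n S $$ (k, b)) =
        (transpose_mat (orthonormal_basis n S) * orthonormal_basis n S) $$ (a, b)"
      using U ab by (simp add: ip_def scalar_prod_def lessThan_atLeast0)
    then show "ip n (\<lambda>k. orthonormal_basis n S $$ (k, a)) (\<lambda>k. orthonormal_basis n S $$ (k, b)) = (if a = b then 1 else 0)"
      using ab by (simp add: UU)
  qed
qed

subsection \<open>The affinity as a Frobenius norm\<close>

text \<open>For an eigenvector x + i y the symmetry of M equates \<langle>y, M x\<rangle> with
  \<langle>x, M y\<rangle>, which reads Im e (|x|^2 + |y|^2) = 0; semidefiniteness at x and y then
  gives the sign of Re e.\<close>

lemma real_eigenvalue_of_psd:
  fixes M :: "nat \<Rightarrow> nat \<Rightarrow> real" and v :: "nat \<Rightarrow> complex"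
  assumes sym: "\<And>r k. r < q \<Longrightarrow> k < q \<Longrightarrow> M r k = M k r"
    and psd: "\<And>x. 0 \<le> (\<Sum>r<q. x r * (\<Sum>k<q. M r k * x k))"
    and ev: "\<And>r. r < q \<Longrightarrow> (\<Sum>k<q. of_real (M r k) * v k) = e * v r"
    and nz: "\<exists>r<q. v r \<noteq> 0"
  shows "Im e = 0" "0 \<le> Re e"
proof -
  define x where "x k = Re (v k)" for k
  define y where "y k = Im (v k)" for k
  define al where "al = Re e"
  define be where "be = Im e"
  have Mx: "(\<Sum>k<q. M r k * x k) = al * x r - be * y r" if "r < q" for r
    using arg_cong[OF ev[OF that], of Re] by (simp add: x_def y_def al_def be_def)
  have My: "(\<Sum>k<q. M r k * y k) = be * x r + al * y r" if "r < q" for r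
    using arg_cong[OF ev[OF that], of Im] by (simp add: x_def y_def al_def be_def)
  define X where "X = (\<Sum>r<q. (x r)\<^sup>2)"
  define Y where "Y = (\<Sum>r<q. (y r)\<^sup>2)"
  define XY where "XY = (\<Sum>r<q. x r * y r)"
  have XYpos: "0 < X + Y"
  proof -
    obtain r where r: "r < q" "v r \<noteq> 0" using nz by auto
    have "0 < (x r)\<^sup>2 + (y r)\<^sup>2"
      using r(2) by (simp add: x_def y_def complex_eq_iff sum_power2_gt_zero_iff)
    also have "\<dots> \<le> X + Y"
      unfolding X_def Y_def sum.distrib[symmetric] using r(1) by (intro member_le_sum[of r "{..<q}" "\<lambda>r. (x r)\<^sup>2 + (y r)\<^sup>2"]) auto
    finally show ?thesis .
  qed
  have "(\<Sum>r<q. y r * (\<Sum>k<q. M r k * x k)) = (\<Sum>r<q. \<Sum>k<q. y r * (M r k * x k))" by (simp add: sum_distrib_left)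
  also have "\<dots> = (\<Sum>k<q. \<Sum>r<q. y r * (M r k * x k))" by (rule sum.swap)
  also have "\<dots> = (\<Sum>k<q. x k * (\<Sum>r<q. M k r * y r))"
    unfolding sum_distrib_left using sym by (intro sum.cong refl) auto
  finally have s: "(\<Sum>r<q. y r * (\<Sum>k<q. M r k * x k)) = (\<Sum>k<q. x k * (\<Sum>r<q. M k r * y r))" .
  have l: "(\<Sum>r<q. y r * (\<Sum>k<q. M r k * x k)) = al * XY - be * Y"
  proof -
    have "(\<Sum>r<q. y r * (\<Sum>k<q. M r k * x k)) = (\<Sum>r<q. al * (x r * y r) - be * (y r)\<^sup>2)"
      by (intro sum.cong refl) (subst Mx, simp, simp add: algebra_simps power2_eq_square)
    then show ?thesis by (simp add: sum_subtractf XY_def Y_def sum_distrib_left)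
  qed
  have r: "(\<Sum>k<q. x k * (\<Sum>r<q. M k r * y r)) = be * X + al * XY"
  proof -
    have "(\<Sum>k<q. x k * (\<Sum>r<q. M k r * y r)) = (\<Sum>r<q. be * (x r)\<^sup>2 + al * (x r * y r))"
      by (intro sum.cong refl) (subst My, simp, simp add: algebra_simps power2_eq_square)
    then show ?thesis by (simp add: sum.distrib XY_def X_def sum_distrib_left)
  qed
  have "be * (X + Y) = 0" using s l r by (simp add: algebra_simps)
  then have be: "be = 0" using XYpos by simp
  then show "Im e = 0" by (simp add: be_def)
  have "0 \<le> (\<Sum>r<q. x r * (\<Sum>k<q. M r k * x k)) + (\<Sum>r<q. y r * (\<Sum>k<q. M r k * y k))"
    using psd[of x] psd[of y] by simp
  also have "\<dots> = (\<Sum>r<q. al * (x r)\<^sup>2) + (\<Sum>r<q. al * (y r)\<^sup>2)"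
    using Mx My be by (intro arg_cong2[where f="(+)"] sum.cong) (auto simp: power2_eq_square)
  also have "\<dots> = al * (X + Y)" by (simp add: X_def Y_def distrib_left flip: sum_distrib_left)
  finally show "0 \<le> Re e" using XYpos by (simp add: al_def zero_le_mult_iff)
qed

text \<open>The polynomial splits over the complex numbers, and its roots are real and nonnegative,
  so the factorisation descends to real polynomials. The singular values are defined from the real
  roots, hence all of them must be found there.\<close>

lemma char_poly_psd:
  fixes M :: "real mat"
  assumes M: "M \<in> carrier_mat q q"
    and sym: "\<And>r k. r < q \<Longrightarrow> k < q \<Longrightarrow> M $$ (r, k) = M $$ (k, r)"
    and psd: "\<And>x. 0 \<le> (\<Sum>r<q. x r * (\<Sum>k<q. M $$ (r, k) * x k))"
  shows "\<exists>es. char_poly M = (\<Prod>e\<leftarrow>es. [:- e, 1:]) \<and> length es = q \<and> (\<forall>e\<in>set es. 0 \<le> e)"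
proof -
  define Mc where "Mc = map_mat complex_of_real M"
  have Mc: "Mc \<in> carrier_mat q q" using M by (simp add: Mc_def)
  obtain as where as: "char_poly Mc = (\<Prod>a\<leftarrow>as. [:- a, 1:])" "length as = q"
    using char_poly_factorized[OF Mc] by blast
  have ev: "Im a = 0 \<and> 0 \<le> Re a" if a: "a \<in> set as" for a
  proof -
    have "poly (char_poly Mc) a = 0"
      unfolding as(1) poly_prod_list prod_list_zero_iff using a by (auto intro!: image_eqI[of _ _ a])
    then have "eigenvalue Mc a" using eigenvalue_root_char_poly[OF Mc] by simp
    then obtain v where v: "v \<in> carrier_vec q" "v \<noteq> 0\<^sub>v q" "Mc *\<^sub>v v = a \<cdot>\<^sub>v v"
      using Mc by (auto simp: eigenvalue_def eigenvector_def)
    have e: "(\<Sum>k<q. of_real (M $$ (r, k)) * v $ k) = a * v $ r" if r: "r < q" for r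
    proof -
      have "(Mc *\<^sub>v v) $ r = (a \<cdot>\<^sub>v v) $ r" using v(3) by simp
      then show ?thesis using r v(1) M
        by (simp add: Mc_def scalar_prod_def lessThan_atLeast0)
    qed
    have nz: "\<exists>r<q. v $ r \<noteq> 0" using v(1,2) by (auto simp: vec_eq_iff)
    show ?thesis
      using real_eigenvalue_of_psd[where M="\<lambda>r k. M $$ (r, k)" and q=q and v="\<lambda>k. v $ k" and e=a, OF sym psd e nz]
      by blast
  qed
  define es where "es = map Re as"
  have "as = map complex_of_real es"
    unfolding es_def using ev by (intro nth_equalityI) (auto simp: complex_eq_iff)
  then have "char_poly Mc = (\<Prod>e\<leftarrow>es. [:- complex_of_real e, 1:])" by (simp add: as(1) comp_def)
  also have "\<dots> = map_poly complex_of_real (\<Prod>e\<leftarrow>es. [:- e, 1:])"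
  proof (induction es)
    case (Cons e es)
    interpret mp: map_poly_comm_ring_hom complex_of_real ..
    have "map_poly complex_of_real [:- e, 1:] = [:- complex_of_real e, 1:]" by simp
    then show ?case unfolding list.map prod_list.Cons mp.hom_mult Cons by simp
  qed simp
  finally have "map_poly complex_of_real (char_poly M) = map_poly complex_of_real (\<Prod>e\<leftarrow>es. [:- e, 1:])"
    unfolding Mc_def of_real_hom.char_poly_hom[OF M] .
  then have "char_poly M = (\<Prod>e\<leftarrow>es. [:- e, 1:])"
    by (simp add: poly_eq_iff coeff_map_poly)
  then show ?thesis using as(2) ev by (intro exI[of _ es]) (auto simp: es_def)
qed

text \<open>Schur triangularisation puts the roots on the diagonal, and the trace is invariant under
  cyclic exchange of factors.\<close>

lemma trace_eq_sum_list:
  fixes M :: "real mat"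
  assumes M: "M \<in> carrier_mat q q" and c: "char_poly M = (\<Prod>e\<leftarrow>es. [:- e, 1:])"
  shows "(\<Sum>r<q. M $$ (r, r)) = sum_list es"
proof -
  obtain B P Q where s: "schur_decomposition M es = (B, P, Q)" by (cases "schur_decomposition M es") auto
  from schur_decomposition[OF M c s] have sim: "similar_mat_wit M B P Q" and d: "diag_mat B = es" by auto
  from similar_mat_witD2[OF M sim] have BPQ: "B \<in> carrier_mat q q" "P \<in> carrier_mat q q" "Q \<in> carrier_mat q q"
    "Q * P = 1\<^sub>m q" "M = P * B * Q" by auto
  have tr: "(\<Sum>r<q. (X * Y) $$ (r, r)) = (\<Sum>r<q. (Y * X) $$ (r, r))"
    if "X \<in> carrier_mat q q" "Y \<in> carrier_mat q q" for X Y :: "real mat"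
  proof -
    have "(\<Sum>r<q. (X * Y) $$ (r, r)) = (\<Sum>r<q. \<Sum>k<q. X $$ (r, k) * Y $$ (k, r))"
      using that by (intro sum.cong) (auto simp: scalar_prod_def lessThan_atLeast0)
    also have "\<dots> = (\<Sum>k<q. \<Sum>r<q. X $$ (r, k) * Y $$ (k, r))" by (rule sum.swap)
    also have "\<dots> = (\<Sum>r<q. (Y * X) $$ (r, r))"
      using that by (intro sum.cong) (auto simp: scalar_prod_def lessThan_atLeast0 mult.commute)
    finally show ?thesis .
  qed
  have "(\<Sum>r<q. M $$ (r, r)) = (\<Sum>r<q. (Q * (P * B)) $$ (r, r))"
    unfolding BPQ(5) by (rule tr) (use BPQ in auto)
  also have "Q * (P * B) = (Q * P) * B" using BPQ by (intro assoc_mult_mat[symmetric]) auto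
  also have "\<dots> = B" using BPQ by simp
  also have "(\<Sum>r<q. B $$ (r, r)) = sum_list (diag_mat B)"
    using BPQ by (simp add: diag_mat_def sum_list_sum_nth lessThan_atLeast0)
  finally show ?thesis by (simp add: d)
qed

text \<open>Sylvester's identity, from two factorisations of the block matrix with rows \<open>x I, A\<close> and \<open>A\<^sup>T, I\<close>.\<close>

lemma char_poly_gram_swap:
  fixes A :: "real mat"
  assumes A: "A \<in> carrier_mat p q"
  shows "monom 1 q * char_poly (A * transpose_mat A) = monom 1 p * char_poly (transpose_mat A * A)"
proof -
  define X where "X = [:0, 1 :: real:]"
  define Ap where "Ap = map_mat (\<lambda>a. [:a:]) A"
  define At where "At = map_mat (\<lambda>a. [:a:]) (transpose_mat A)"
  have c: "Ap \<in> carrier_mat p q" "At \<in> carrier_mat q p" using A by (auto simp: Ap_def At_def)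
  have hom: "map_mat (\<lambda>a. [:a:]) (B * C) = map_mat (\<lambda>a. [:a:]) B * map_mat (\<lambda>a. [:a:]) C"
    if "B \<in> carrier_mat a b" "C \<in> carrier_mat b d" for B C :: "real mat" and a b d
  proof (rule eq_matI)
    fix i j assume "i < dim_row (map_mat (\<lambda>a. [:a:]) B * map_mat (\<lambda>a. [:a:]) C)"
      "j < dim_col (map_mat (\<lambda>a. [:a:]) B * map_mat (\<lambda>a. [:a:]) C)"
    then have ij: "i < a" "j < d" using that by auto
    have sum_const: "[:\<Sum>k = 0..<b. f k:] = (\<Sum>k = 0..<b. [:f k:])" for f :: "nat \<Rightarrow> real"
    proof (induction b)
      case (Suc b)
      have "[:\<Sum>k = 0..<Suc b. f k:] = [:\<Sum>k = 0..<b. f k:] + [:f b:]" by simp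
      then show ?case using Suc by simp
    qed simp
    show "map_mat (\<lambda>a. [:a:]) (B * C) $$ (i, j) = (map_mat (\<lambda>a. [:a:]) B * map_mat (\<lambda>a. [:a:]) C) $$ (i, j)"
      using ij that by (simp add: scalar_prod_def sum_const mult.commute)
  qed (use that in auto)
  define N where "N = four_block_mat (X \<cdot>\<^sub>m 1\<^sub>m p) Ap At (1\<^sub>m q)"
  have cp: "char_poly B = det (X \<cdot>\<^sub>m 1\<^sub>m m - map_mat (\<lambda>a. [:a:]) B)" if "B \<in> carrier_mat m m" for B :: "real mat" and m
    unfolding char_poly_defs X_def by (rule arg_cong[where f=det], rule eq_matI) (use that in auto)
  have Nc: "N \<in> carrier_mat (p + q) (p + q)" unfolding N_def using c by auto
  define R where "R = four_block_mat (1\<^sub>m p) (0\<^sub>m p q) (- At) (1\<^sub>m q)"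
  have Rc: "R \<in> carrier_mat (p + q) (p + q)" unfolding R_def using c by auto
  have "N * R = four_block_mat (X \<cdot>\<^sub>m 1\<^sub>m p * 1\<^sub>m p + Ap * - At) (X \<cdot>\<^sub>m 1\<^sub>m p * 0\<^sub>m p q + Ap * 1\<^sub>m q)
      (At * 1\<^sub>m p + 1\<^sub>m q * - At) (At * 0\<^sub>m p q + 1\<^sub>m q * 1\<^sub>m q)"
    unfolding N_def R_def by (rule mult_four_block_mat) (use c in auto)
  also have "\<dots> = four_block_mat (X \<cdot>\<^sub>m 1\<^sub>m p - Ap * At) Ap (0\<^sub>m q p) (1\<^sub>m q)"
  proof (rule cong_four_block_mat)
    show "X \<cdot>\<^sub>m 1\<^sub>m p * 1\<^sub>m p + Ap * - At = X \<cdot>\<^sub>m 1\<^sub>m p - Ap * At"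
      using c by (intro eq_matI) (auto simp: scalar_prod_def sum_negf)
    show "X \<cdot>\<^sub>m 1\<^sub>m p * 0\<^sub>m p q + Ap * 1\<^sub>m q = Ap" using c by (intro eq_matI) auto
    show "At * 1\<^sub>m p + 1\<^sub>m q * - At = 0\<^sub>m q p" using c by (intro eq_matI) auto
    show "At * 0\<^sub>m p q + 1\<^sub>m q * 1\<^sub>m q = 1\<^sub>m q" using c by (intro eq_matI) auto
  qed
  finally have NR: "N * R = four_block_mat (X \<cdot>\<^sub>m 1\<^sub>m p - Ap * At) Ap (0\<^sub>m q p) (1\<^sub>m q)" .
  have detR: "det R = 1" unfolding R_def
    by (subst det_four_block_mat_upper_right_zero[of _ p _ q]) (use c in auto)
  have "det N = det (N * R)" using det_mult[OF Nc Rc] detR by simp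
  also have "\<dots> = det (X \<cdot>\<^sub>m 1\<^sub>m p - Ap * At)"
    unfolding NR by (subst det_four_block_mat_lower_left_zero[of _ p _ q]) (use c in auto)
  also have "Ap * At = map_mat (\<lambda>a. [:a:]) (A * transpose_mat A)"
    unfolding Ap_def At_def by (rule hom[symmetric]) (use A in auto)
  also have "det (X \<cdot>\<^sub>m 1\<^sub>m p - map_mat (\<lambda>a. [:a:]) (A * transpose_mat A)) = char_poly (A * transpose_mat A)"
    by (rule cp[symmetric]) (use A in auto)
  finally have d1: "det N = char_poly (A * transpose_mat A)" .
  define L where "L = four_block_mat (1\<^sub>m p) (0\<^sub>m p q) (- At) (X \<cdot>\<^sub>m 1\<^sub>m q)"
  have Lc: "L \<in> carrier_mat (p + q) (p + q)" unfolding L_def using c by auto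
  have "L * N = four_block_mat (1\<^sub>m p * (X \<cdot>\<^sub>m 1\<^sub>m p) + 0\<^sub>m p q * At) (1\<^sub>m p * Ap + 0\<^sub>m p q * 1\<^sub>m q)
      (- At * (X \<cdot>\<^sub>m 1\<^sub>m p) + X \<cdot>\<^sub>m 1\<^sub>m q * At) (- At * Ap + X \<cdot>\<^sub>m 1\<^sub>m q * 1\<^sub>m q)"
    unfolding N_def L_def by (rule mult_four_block_mat) (use c in auto)
  also have "\<dots> = four_block_mat (X \<cdot>\<^sub>m 1\<^sub>m p) Ap (0\<^sub>m q p) (X \<cdot>\<^sub>m 1\<^sub>m q - At * Ap)"
  proof (rule cong_four_block_mat)
    show "1\<^sub>m p * (X \<cdot>\<^sub>m 1\<^sub>m p) + 0\<^sub>m p q * At = X \<cdot>\<^sub>m 1\<^sub>m p" using c by (intro eq_matI) auto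
    show "1\<^sub>m p * Ap + 0\<^sub>m p q * 1\<^sub>m q = Ap" using c by (intro eq_matI) auto
    have "- At * (X \<cdot>\<^sub>m 1\<^sub>m p) = X \<cdot>\<^sub>m (- At)" using c
      by (subst mult_smult_distrib[of _ q p]) auto
    moreover have "X \<cdot>\<^sub>m 1\<^sub>m q * At = X \<cdot>\<^sub>m At" using c
      by (subst mult_smult_assoc_mat[of _ q q]) auto
    ultimately show "- At * (X \<cdot>\<^sub>m 1\<^sub>m p) + X \<cdot>\<^sub>m 1\<^sub>m q * At = 0\<^sub>m q p" using c
      by (intro eq_matI) auto
    show "- At * Ap + X \<cdot>\<^sub>m 1\<^sub>m q * 1\<^sub>m q = X \<cdot>\<^sub>m 1\<^sub>m q - At * Ap"
      using c by (intro eq_matI) (auto simp: scalar_prod_def sum_negf)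
  qed
  finally have LN: "L * N = four_block_mat (X \<cdot>\<^sub>m 1\<^sub>m p) Ap (0\<^sub>m q p) (X \<cdot>\<^sub>m 1\<^sub>m q - At * Ap)" .
  have Xm: "X ^ m = monom 1 m" for m by (simp add: X_def monom_altdef)
  have detL: "det L = monom 1 q" unfolding L_def
    by (subst det_four_block_mat_upper_right_zero[of _ p _ q]) (use c in \<open>auto simp: det_smult Xm\<close>)
  have "monom 1 q * det N = det (L * N)" using det_mult[OF Lc Nc] detL by simp
  also have "\<dots> = monom 1 p * det (X \<cdot>\<^sub>m 1\<^sub>m q - At * Ap)"
    unfolding LN by (subst det_four_block_mat_lower_left_zero[of _ p _ q]) (use c in \<open>auto simp: det_smult Xm\<close>)
  also have "At * Ap = map_mat (\<lambda>a. [:a:]) (transpose_mat A * A)"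
    unfolding Ap_def At_def by (rule hom[symmetric]) (use A in auto)
  also have "det (X \<cdot>\<^sub>m 1\<^sub>m q - map_mat (\<lambda>a. [:a:]) (transpose_mat A * A)) = char_poly (transpose_mat A * A)"
    by (rule cp[symmetric]) (use A in auto)
  finally show ?thesis unfolding d1 .
qed

text \<open>Divisibility by x^k is multiplicity of the root 0, and this order is additive over the
  linear factors.\<close>

lemma count_zero_ge:
  fixes es :: "real list"
  assumes c: "char_poly M = (\<Prod>e\<leftarrow>es. [:- e, 1:])" and d: "monom 1 k dvd char_poly M"
  shows "k \<le> count (mset es) 0"
proof -
  have nz: "(\<Prod>e\<leftarrow>es. [:- e, 1:]) \<noteq> (0 :: real poly)" by (auto simp: prod_list_zero_iff)
  have "[:- 0, 1:] ^ k dvd (\<Prod>e\<leftarrow>es. [:- e, 1 :: real:])" using d c by (simp add: monom_altdef)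
  then have "k \<le> Polynomial.order 0 (\<Prod>e\<leftarrow>es. [:- e, 1:])" using nz by (rule order_max)
  also have "\<dots> = count (mset es) 0"
  proof (induction es)
    case (Cons e es)
    have "(\<Prod>e\<leftarrow>es. [:- e, 1:]) \<noteq> (0 :: real poly)" by (auto simp: prod_list_zero_iff)
    then have "Polynomial.order 0 (\<Prod>e\<leftarrow>e # es. [:- e, 1:]) =
        Polynomial.order 0 [:- e, 1:] + Polynomial.order 0 (\<Prod>e\<leftarrow>es. [:- e, 1:])"
      unfolding list.map prod_list.Cons by (intro order_mult no_zero_divisors) simp_all
    also have "Polynomial.order 0 [:- e, 1:] = (if e = 0 then 1 else 0)"
    proof (cases "e = 0")
      case True
      then show ?thesis using order_power_n_n[of "0 :: real" 1] by simp
    next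
      case False
      then show ?thesis by (simp add: order_0I)
    qed
    finally show ?case using Cons by simp
  qed simp
  finally show ?thesis .
qed

text \<open>In the descending list the zeros stand at the end, and there are at least as many of
  them as dropped entries. The subtraction is truncated, so lists shorter than m are
  included.\<close>

lemma sum_list_take_rev_sorted:
  fixes es :: "real list"
  assumes nn: "\<forall>e\<in>set es. 0 \<le> e" and z: "length es - m \<le> count (mset es) 0"
  shows "(\<Sum>c\<leftarrow>take m (rev (sort (map sqrt es))). c\<^sup>2) = sum_list es"
proof -
  define L where "L = sort (map sqrt es)"
  define P where "P = filter (\<lambda>e. e \<noteq> 0) es"
  have mP: "mset es = replicate_mset (count (mset es) 0) 0 + mset P"
    by (intro multiset_eqI) (auto simp: P_def)
  have L: "L = replicate (count (mset es) 0) 0 @ sort (map sqrt P)"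
    unfolding L_def
  proof (rule properties_for_sort)
    have "mset (map sqrt es) = image_mset sqrt (replicate_mset (count (mset es) 0) 0 + mset P)"
      using mP by (metis mset_map)
    then show "mset (replicate (count (mset es) 0) 0 @ sort (map sqrt P)) = mset (map sqrt es)"
      by (simp add: image_replicate_mset)
    show "sorted (replicate (count (mset es) 0) 0 @ sort (map sqrt P))"
      using nn by (auto simp: sorted_append P_def)
  qed
  define k where "k = length es - m"
  have lenL: "length L = length es" by (simp add: L_def)
  have "take k L = replicate k 0" unfolding L using z by (simp add: k_def)
  then have "L = replicate k 0 @ drop k L" by (metis append_take_drop_id)
  then have rL: "rev L = rev (drop k L) @ replicate k 0" by (metis rev_append rev_replicate)
  have "(\<Sum>c\<leftarrow>L. c\<^sup>2) = (\<Sum>c\<leftarrow>map sqrt es. c\<^sup>2)"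
    by (metis L_def mset_sort sum_mset_sum_list mset_map)
  also have "\<dots> = sum_list es" using nn by (induction es) auto
  finally have tot: "(\<Sum>c\<leftarrow>rev L. c\<^sup>2) = sum_list es" by (simp add: rev_map[symmetric] sum_list_rev)
  have "take m (rev L) = rev (drop k L) @ take (m - (length es - k)) (replicate k 0)"
  proof (cases "m \<le> length es")
    case True
    then show ?thesis by (subst rL) (simp add: k_def lenL)
  next
    case False
    then show ?thesis by (subst rL) (simp add: k_def lenL)
  qed
  then have "(\<Sum>c\<leftarrow>take m (rev L). c\<^sup>2) = (\<Sum>c\<leftarrow>rev (drop k L). c\<^sup>2)" by (simp add: sum_list_replicate take_replicate)
  also have "\<dots> = (\<Sum>c\<leftarrow>rev (drop k L) @ replicate k 0. c\<^sup>2)" by (simp add: sum_list_replicate)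
  also have "\<dots> = (\<Sum>c\<leftarrow>rev L. c\<^sup>2)" by (simp only: rL)
  finally show ?thesis unfolding L_def[symmetric] tot .
qed

text \<open>The sum of all eigenvalues of the Gram matrix is its trace, the squared Frobenius norm.
  Only the min(p, q) largest are kept in the definition, so the others must vanish; for p < q
  Sylvester's identity provides q - p zero roots.\<close>

lemma sum_singular_values_power2:
  fixes A :: "real mat"
  assumes A: "A \<in> carrier_mat p q"
  shows "(\<Sum>c\<leftarrow>singular_values A. c\<^sup>2) = (\<Sum>a<p. \<Sum>b<q. (A $$ (a, b))\<^sup>2)"
proof -
  define M where "M = transpose_mat A * A"
  have M: "M \<in> carrier_mat q q" using A by (simp add: M_def)
  have Mrk: "M $$ (r, k) = (\<Sum>a<p. A $$ (a, r) * A $$ (a, k))" if "r < q" "k < q" for r k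
    using A that by (simp add: M_def scalar_prod_def lessThan_atLeast0)
  have sym: "M $$ (r, k) = M $$ (k, r)" if "r < q" "k < q" for r k
    using that by (simp add: Mrk mult.commute)
  have psd: "0 \<le> (\<Sum>r<q. x r * (\<Sum>k<q. M $$ (r, k) * x k))" for x
  proof -
    have "(\<Sum>r<q. x r * (\<Sum>k<q. M $$ (r, k) * x k)) = (\<Sum>r<q. \<Sum>k<q. \<Sum>a<p. (A $$ (a, r) * x r) * (A $$ (a, k) * x k))"
      unfolding sum_distrib_left by (intro sum.cong refl) (simp add: Mrk sum_distrib_left sum_distrib_right mult_ac)
    also have "\<dots> = (\<Sum>r<q. \<Sum>a<p. \<Sum>k<q. (A $$ (a, r) * x r) * (A $$ (a, k) * x k))" by (intro sum.cong refl sum.swap)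
    also have "\<dots> = (\<Sum>a<p. \<Sum>r<q. \<Sum>k<q. (A $$ (a, r) * x r) * (A $$ (a, k) * x k))" by (rule sum.swap)
    also have "\<dots> = (\<Sum>a<p. (\<Sum>r<q. A $$ (a, r) * x r)\<^sup>2)" by (simp add: power2_eq_square sum_product)
    finally show ?thesis by (simp add: sum_nonneg)
  qed
  obtain es where es: "char_poly M = (\<Prod>e\<leftarrow>es. [:- e, 1:])" "length es = q" "\<forall>e\<in>set es. 0 \<le> e"
    using char_poly_psd[OF M sym psd] by blast
  have pr: "proots (char_poly M) = mset es"
    unfolding es(1)
  proof (induction es)
    case (Cons e es)
    have "(\<Prod>e\<leftarrow>es. [:- e, 1:]) \<noteq> (0 :: real poly)" by (auto simp: prod_list_zero_iff)
    moreover have "proots [:- e, 1:] = {#e#}"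
    proof (rule multiset_eqI)
      fix a
      show "count (proots [:- e, 1:]) a = count {#e#} a"
      proof (cases "a = e")
        case True
        then show ?thesis using order_power_n_n[of a 1] by simp
      next
        case False
        then show ?thesis by (simp add: order_0I)
      qed
    qed
    moreover have "[:- e, 1:] \<noteq> 0" by simp
    ultimately show ?case unfolding list.map prod_list.Cons by (subst proots_mult) (use Cons in auto)
  qed simp
  have zero: "q - min p q \<le> count (mset es) 0"
  proof (cases "p \<le> q")
    case True
    have "monom 1 p * (monom 1 (q - p) * char_poly (A * transpose_mat A)) = monom 1 p * char_poly M"
      using char_poly_gram_swap[OF A] True unfolding M_def by (simp add: mult_monom flip: mult.assoc)
    then have "monom 1 (q - p) * char_poly (A * transpose_mat A) = char_poly M" by (simp add: monom_eq_0_iff)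
    then have "monom 1 (q - p) dvd char_poly M" by (metis dvd_triv_left)
    from count_zero_ge[OF es(1) this] show ?thesis using True by simp
  qed simp
  have "singular_values A = take (min p q) (rev (sort (map sqrt es)))"
    using A unfolding singular_values_def M_def[symmetric] pr
    by (simp add: sorted_list_of_multiset_mset flip: mset_map)
  then have "(\<Sum>c\<leftarrow>singular_values A. c\<^sup>2) = sum_list es"
    using sum_list_take_rev_sorted[OF es(3), of "min p q"] zero es(2) by simp
  also have "\<dots> = (\<Sum>r<q. M $$ (r, r))" by (rule trace_eq_sum_list[OF M es(1), symmetric])
  also have "\<dots> = (\<Sum>r<q. \<Sum>a<p. (A $$ (a, r))\<^sup>2)" by (intro sum.cong) (auto simp: Mrk power2_eq_square)
  also have "\<dots> = (\<Sum>a<p. \<Sum>b<q. (A $$ (a, b))\<^sup>2)" by (rule sum.swap)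
  finally show ?thesis .
qed

subsection \<open>The semirandom model in Gaussian coordinates\<close>

text \<open>The coordinates indexed by \<open>(True, j)\<close> generate the clean point \<open>j\<close>, those indexed by \<open>(False, j)\<close> its noise.\<close>

definition model_point :: "nat \<Rightarrow> (nat \<Rightarrow> real mat) \<Rightarrow> (nat \<Rightarrow> nat) \<Rightarrow> real \<Rightarrow> bool \<times> nat \<Rightarrow> (nat \<Rightarrow> real) \<Rightarrow> real Matrix.vec" where
  "model_point n U d \<sigma> p = (if fst p then sphere_point n (U (snd p)) (d (snd p)) else (\<lambda>b. Matrix.vec n (\<lambda>k. \<sigma> / sqrt (real n) * b k)))"

text \<open>A flat index set, so that the whole sample is a function of one Gaussian vector,
  although clean points use blocks of different lengths.\<close>

definition model_index :: "nat \<Rightarrow> nat \<Rightarrow> (nat \<Rightarrow> nat) \<Rightarrow> ((bool \<times> nat) \<times> nat) set" where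
  "model_index n N d = (SIGMA p : UNIV \<times> {..<N}. {..<if fst p then d (snd p) else n})"

lemma finite_model_index: "finite (model_index n N d)"
  unfolding model_index_def by (intro finite_SigmaI finite_cartesian_product) auto

lemma mem_model_index: "((b, j), k) \<in> model_index n N d \<longleftrightarrow> j < N \<and> k < (if b then d j else n)"
  by (auto simp: model_index_def)

lemma measurable_model_point:
  assumes U: "U (snd p) \<in> carrier_mat n (d (snd p))"
    and X: "\<And>k. k < (if fst p then d (snd p) else n) \<Longrightarrow> (\<lambda>\<omega>. X \<omega> k) \<in> borel_measurable M"
  shows "(\<lambda>\<omega>. model_point n U d \<sigma> p (X \<omega>)) \<in> measurable M (vec_borel n)"
proof (cases "fst p")
  case True
  then show ?thesis unfolding model_point_def
    using measurable_sphere_point[OF U, of X] X by simp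
next
  case False
  have "(\<lambda>\<omega>. Matrix.vec n (\<lambda>k. \<sigma> / sqrt (real n) * X \<omega> k)) \<in> measurable M (vec_borel n)"
  proof (rule measurable_vec_borelI)
    fix k assume k: "k < n"
    then have "(\<lambda>\<omega>. X \<omega> k) \<in> borel_measurable M" using X False by simp
    then show "(\<lambda>\<omega>. vec_index (Matrix.vec n (\<lambda>k. \<sigma> / sqrt (real n) * X \<omega> k)) k) \<in> borel_measurable M"
      using k by simp
  qed simp
  then show ?thesis using False by (simp add: model_point_def)
qed

lemma model_point_cong:
  assumes "\<And>k. k < (if fst p then d (snd p) else n) \<Longrightarrow> x k = y k"
  shows "model_point n U d \<sigma> p x = model_point n U d \<sigma> p y"
proof (cases "fst p")
  case True
  then have "Matrix.vec (d (snd p)) x = Matrix.vec (d (snd p)) y" using assms by (intro eq_vecI) auto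
  then show ?thesis using True by (simp add: model_point_def sphere_point_def)
next
  case False
  then show ?thesis using assms by (auto simp: model_point_def intro!: eq_vecI)
qed

definition model_map :: "nat \<Rightarrow> nat \<Rightarrow> (nat \<Rightarrow> real mat) \<Rightarrow> (nat \<Rightarrow> nat) \<Rightarrow> real \<Rightarrow> ((bool \<times> nat) \<times> nat \<Rightarrow> real) \<Rightarrow>
    (nat \<Rightarrow> real Matrix.vec) \<times> (nat \<Rightarrow> real Matrix.vec)" where
  "model_map n N U d \<sigma> \<omega> = (\<lambda>j\<in>{..<N}. model_point n U d \<sigma> (True, j) (\<lambda>k. \<omega> ((True, j), k)),
     \<lambda>j\<in>{..<N}. model_point n U d \<sigma> (False, j) (\<lambda>k. \<omega> ((False, j), k)))"

text \<open>Functions of disjoint blocks of coordinates are independent, so the joint law is the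
  product of the marginals, and these are the laws of the model by
  \<open>sphere_law_eq_gauss\<close> and \<open>noise_law_eq_gauss\<close>.\<close>

lemma semirandom_model_eq_gauss:
  fixes n :: nat and S :: "nat \<Rightarrow> real Matrix.vec set" and g :: "nat \<Rightarrow> nat"
  defines "U \<equiv> \<lambda>j. orthonormal_basis n (S (g j))" and "d \<equiv> \<lambda>j. subspace_dim n (S (g j))"
  assumes s: "0 < \<sigma>" and n: "0 < n" and N: "0 < N" and U: "\<And>j. j < N \<Longrightarrow> U j \<in> carrier_mat n (d j)"
  shows "model_map n N U d \<sigma> \<in> measurable (gauss (model_index n N d)) ((\<Pi>\<^sub>M j\<in>{..<N}. vec_borel n) \<Otimes>\<^sub>M (\<Pi>\<^sub>M j\<in>{..<N}. vec_borel n))"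
    and "semirandom_model n N S g \<sigma> = distr (gauss (model_index n N d))
      ((\<Pi>\<^sub>M j\<in>{..<N}. vec_borel n) \<Otimes>\<^sub>M (\<Pi>\<^sub>M j\<in>{..<N}. vec_borel n)) (model_map n N U d \<sigma>)"
proof -
  define I where "I = model_index n N d"
  define P where "P = (UNIV :: bool set) \<times> {..<N}"
  define D where "D p = (if fst p then d (snd p) else n)" for p :: "bool \<times> nat"
  define Z where "Z p \<omega> = model_point n U d \<sigma> p (\<lambda>k. \<omega> (p, k))" for p \<omega>
  let ?vb = "vec_borel n"
  have I: "finite I" "I = Sigma P (\<lambda>p. {..<D p})" unfolding I_def by (rule finite_model_index) (simp add: model_index_def P_def D_def)
  interpret G: prob_space "gauss I" by (rule prob_space_gauss)
  have comp: "(\<lambda>\<omega>. \<omega> (p, k)) \<in> borel_measurable (\<Pi>\<^sub>M i\<in>{p} \<times> {..<D p}. borel)" if "k < D p" for p k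
    using measurable_component_singleton[of "(p, k)" "{p} \<times> {..<D p}" "\<lambda>_. borel"] that by simp
  have Up: "U (snd p) \<in> carrier_mat n (d (snd p))" if "p \<in> P" for p using U that by (auto simp: P_def)
  have Zm': "Z p \<in> measurable (\<Pi>\<^sub>M i\<in>{p} \<times> {..<D p}. borel) ?vb" if p: "p \<in> P" for p
    unfolding Z_def by (rule measurable_model_point[where d=d and U=U]) (use Up[OF p] in simp, rule comp, simp add: D_def)
  have Zr: "Z p (restrict \<omega> ({p} \<times> {..<D p})) = Z p \<omega>" for p \<omega>
    unfolding Z_def by (rule model_point_cong) (auto simp: D_def)
  have "G.indep_vars (\<lambda>p. \<Pi>\<^sub>M i\<in>{p} \<times> {..<D p}. borel) (\<lambda>p \<omega>. restrict \<omega> ({p} \<times> {..<D p})) P"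
    using G.indep_vars_restrict[OF indep_vars_gauss[OF I(1)], of P "\<lambda>p. {p} \<times> {..<D p}"]
    by (auto simp: I(2) disjoint_family_on_def)
  from G.indep_vars_compose2[OF this, of Z "\<lambda>_. ?vb"] Zm'
  have ind: "G.indep_vars (\<lambda>_. ?vb) Z P" by (simp add: Zr)
  have Zm: "Z p \<in> measurable (gauss I) ?vb" if "p \<in> P" for p
    using G.indep_vars_def[THEN iffD1, OF ind] that by auto
  have Pne: "P \<noteq> {}" using N by (auto simp: P_def)
  define law where "law p = distr (gauss I) ?vb (Z p)" for p
  have law_ps: "prob_space (law p)" if "p \<in> P" for p
    unfolding law_def by (rule G.prob_space_distr[OF Zm[OF that]])
  have W: "distr (gauss I) (\<Pi>\<^sub>M p\<in>P. ?vb) (\<lambda>\<omega>. \<lambda>p\<in>P. Z p \<omega>) = (\<Pi>\<^sub>M p\<in>P. law p)"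
    using G.indep_vars_iff_distr_eq_PiM'[OF Pne, where M'="\<lambda>_. ?vb" and X=Z] Zm ind unfolding law_def by blast
  have ZPm: "(\<lambda>\<omega>. \<lambda>p\<in>P. Z p \<omega>) \<in> measurable (gauss I) (\<Pi>\<^sub>M p\<in>P. ?vb)"
    by (rule measurable_restrict) (rule Zm)
  define V where "V b \<omega> = (\<lambda>j\<in>{..<N}. Z (b, j) \<omega>)" for b \<omega>
  have setl: "sets (\<Pi>\<^sub>M j\<in>{..<N}. law (b, j)) = sets (\<Pi>\<^sub>M j\<in>{..<N}. ?vb)" for b
    by (intro sets_PiM_cong) (auto simp: law_def)
  have Vm: "V b \<in> measurable (gauss I) (\<Pi>\<^sub>M j\<in>{..<N}. ?vb)" for b
    unfolding V_def by (rule measurable_restrict) (auto intro: Zm simp: P_def)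
  have Rm: "(\<lambda>F. \<lambda>j\<in>{..<N}. F (b, j)) \<in> measurable (\<Pi>\<^sub>M p\<in>A. ?vb) (\<Pi>\<^sub>M j\<in>{..<N}. ?vb)" if "{b} \<times> {..<N} \<subseteq> A" for b A
    using that by (intro measurable_restrict measurable_component_singleton) auto
  have Vlaw: "distr (gauss I) (\<Pi>\<^sub>M j\<in>{..<N}. ?vb) (V b) = (\<Pi>\<^sub>M j\<in>{..<N}. law (b, j))" for b
  proof -
    have sub: "{b} \<times> {..<N} \<subseteq> P" by (auto simp: P_def)
    have "distr (gauss I) (\<Pi>\<^sub>M j\<in>{..<N}. ?vb) (V b) = distr (gauss I) (\<Pi>\<^sub>M j\<in>{..<N}. ?vb) ((\<lambda>F. \<lambda>j\<in>{..<N}. F (b, j)) \<circ> (\<lambda>\<omega>. \<lambda>p\<in>P. Z p \<omega>))"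
      using sub by (intro distr_cong refl) (auto simp: V_def fun_eq_iff restrict_def)
    also have "\<dots> = distr (\<Pi>\<^sub>M p\<in>P. law p) (\<Pi>\<^sub>M j\<in>{..<N}. ?vb) (\<lambda>F. \<lambda>j\<in>{..<N}. F (b, j))"
      unfolding W[symmetric] by (rule distr_distr[symmetric, OF Rm[OF sub] ZPm])
    also have "\<dots> = distr (\<Pi>\<^sub>M p\<in>P. law p) (\<Pi>\<^sub>M j\<in>{..<N}. law (b, j)) (\<lambda>F. \<lambda>j\<in>{..<N}. F (b, j))"
      by (intro distr_cong refl setl[symmetric])
    also have "\<dots> = (\<Pi>\<^sub>M j\<in>{..<N}. law (b, j))"
      using sub by (intro distr_PiM_reindex law_ps) (auto simp: inj_on_def)
    finally show ?thesis .
  qed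
  have dj: "{True} \<times> {..<N} \<inter> {False} \<times> {..<N} = {}" by auto
  have "G.indep_var (\<Pi>\<^sub>M p\<in>{True} \<times> {..<N}. ?vb) (\<lambda>\<omega>. restrict (\<lambda>p. Z p \<omega>) ({True} \<times> {..<N}))
      (\<Pi>\<^sub>M p\<in>{False} \<times> {..<N}. ?vb) (\<lambda>\<omega>. restrict (\<lambda>p. Z p \<omega>) ({False} \<times> {..<N}))"
    by (rule G.indep_var_restrict[OF ind dj]) (auto simp: P_def)
  from G.indep_var_compose[OF this Rm[OF order_refl] Rm[OF order_refl]]
  have "G.indep_var (\<Pi>\<^sub>M j\<in>{..<N}. ?vb) (V True) (\<Pi>\<^sub>M j\<in>{..<N}. ?vb) (V False)"
    by (simp add: comp_def V_def[abs_def] restrict_def cong: if_cong)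
  then have pair: "distr (gauss I) ((\<Pi>\<^sub>M j\<in>{..<N}. ?vb) \<Otimes>\<^sub>M (\<Pi>\<^sub>M j\<in>{..<N}. ?vb)) (\<lambda>\<omega>. (V True \<omega>, V False \<omega>)) =
      (\<Pi>\<^sub>M j\<in>{..<N}. law (True, j)) \<Otimes>\<^sub>M (\<Pi>\<^sub>M j\<in>{..<N}. law (False, j))"
    unfolding G.indep_var_distribution_eq Vlaw by simp
  have law_eq: "law p = distr (gauss {..<D p}) ?vb (model_point n U d \<sigma> p)" if p: "p \<in> P" for p
  proof -
    have m: "(\<lambda>\<omega>. \<lambda>k\<in>{..<D p}. \<omega> (p, k)) \<in> measurable (gauss I) (gauss {..<D p})"
      by (rule measurable_restrict) (use p in \<open>auto intro!: measurable_component_singleton simp: I(2)\<close>)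
    have mp: "model_point n U d \<sigma> p \<in> measurable (gauss {..<D p}) ?vb"
    proof (rule measurable_model_point[where d=d and U=U and X="\<lambda>x. x"])
      show "U (snd p) \<in> carrier_mat n (d (snd p))" by (rule Up[OF p])
      fix k assume "k < (if fst p then d (snd p) else n)"
      then show "(\<lambda>\<omega>. \<omega> k) \<in> borel_measurable (gauss {..<D p})"
        using measurable_component_singleton[of k "{..<D p}" "\<lambda>_. std_normal"] by (simp add: D_def)
    qed
    have "law p = distr (gauss I) ?vb (model_point n U d \<sigma> p \<circ> (\<lambda>\<omega>. \<lambda>k\<in>{..<D p}. \<omega> (p, k)))"
      unfolding law_def Z_def comp_def by (intro distr_cong refl model_point_cong) (auto simp: D_def)
    also have "\<dots> = distr (distr (gauss I) (gauss {..<D p}) (\<lambda>\<omega>. \<lambda>k\<in>{..<D p}. \<omega> (p, k))) ?vb (model_point n U d \<sigma> p)"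
      by (rule distr_distr[symmetric, OF mp m])
    also have "distr (gauss I) (gauss {..<D p}) (\<lambda>\<omega>. \<lambda>k\<in>{..<D p}. \<omega> (p, k)) = gauss {..<D p}"
      using p by (intro distr_PiM_reindex prob_space_std_normal) (auto simp: I(2) inj_on_def)
    finally show ?thesis .
  qed
  have lT: "law (True, j) = sphere_law n (S (g j))" if j: "j < N" for j
    using sphere_law_eq_gauss[of n "S (g j)"] U[OF j] law_eq[of "(True, j)"] j
    by (simp add: P_def D_def U_def d_def model_point_def[abs_def])
  have lF: "law (False, j) = noise_law n \<sigma>" if j: "j < N" for j
    using noise_law_eq_gauss[OF s n] law_eq[of "(False, j)"] j
    by (simp add: P_def D_def model_point_def[abs_def])
  have mm: "model_map n N U d \<sigma> = (\<lambda>\<omega>. (V True \<omega>, V False \<omega>))"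
    by (simp add: model_map_def[abs_def] V_def Z_def)
  show "model_map n N U d \<sigma> \<in> measurable (gauss (model_index n N d)) ((\<Pi>\<^sub>M j\<in>{..<N}. ?vb) \<Otimes>\<^sub>M (\<Pi>\<^sub>M j\<in>{..<N}. ?vb))"
    unfolding mm I_def[symmetric] using Vm by (intro measurable_Pair)
  have "(\<Pi>\<^sub>M j\<in>{..<N}. law (True, j)) = (\<Pi>\<^sub>M j\<in>{..<N}. sphere_law n (S (g j)))"
    by (rule PiM_cong) (simp_all add: lT)
  moreover have "(\<Pi>\<^sub>M j\<in>{..<N}. law (False, j)) = (\<Pi>\<^sub>M j\<in>{..<N}. noise_law n \<sigma>)"
    by (rule PiM_cong) (simp_all add: lF)
  ultimately show "semirandom_model n N S g \<sigma> = distr (gauss (model_index n N d))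
      ((\<Pi>\<^sub>M j\<in>{..<N}. ?vb) \<Otimes>\<^sub>M (\<Pi>\<^sub>M j\<in>{..<N}. ?vb)) (model_map n N U d \<sigma>)"
    unfolding mm I_def[symmetric] pair semirandom_model_def by simp
qed

subsection \<open>Inner products with the lasso path\<close>

lemma sum_power2_reflect_on:
  "(\<Sum>k\<in>Q. (reflect_on Q h u k)\<^sup>2) = (\<Sum>k\<in>Q. (u k)\<^sup>2)"
proof -
  have "(\<Sum>k\<in>Q. (reflect_on Q h u k)\<^sup>2) = (\<Sum>k\<in>Q. (reflect Q h u k)\<^sup>2)"
    by (intro sum.cong) (auto simp: reflect_on_def reflect_def)
  then show ?thesis by (simp add: sum_power2_reflect)
qed

text \<open>Restricting t to the rationals makes the event a countable union of measurable
  sets.\<close>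

lemma sets_lasso_path_cross:
  fixes y :: "'a \<Rightarrow> nat \<Rightarrow> nat \<Rightarrow> real" and v :: "'a \<Rightarrow> nat \<Rightarrow> real" and \<Lambda> \<Lambda>' c :: real
  assumes G: "finite G" and Q: "Q \<subseteq> {..<n}"
    and y: "\<And>j k. j \<in> insert i G \<Longrightarrow> k < n \<Longrightarrow> (\<lambda>\<omega>. y \<omega> j k) \<in> borel_measurable M"
    and v: "\<And>m. m \<in> Q \<Longrightarrow> (\<lambda>\<omega>. v \<omega> m) \<in> borel_measurable M"
  shows "{\<omega>\<in>space M. \<exists>t\<in>\<rat>. 0 < t \<and> L2_set (lasso_path n (y \<omega>) i G t) {..<n} \<le> \<Lambda>' \<and>
      L2_set (lasso_path n (y \<omega>) i G t) Q \<le> \<Lambda> \<and>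
      c * L2_set (v \<omega>) Q < \<bar>\<Sum>m\<in>Q. v \<omega> m * lasso_path n (y \<omega>) i G t m\<bar>} \<in> sets M" (is "?A \<in> _")
proof -
  have pm: "(\<lambda>\<omega>. lasso_path n (y \<omega>) i G t k) \<in> borel_measurable M" if "0 < t" "k < n" for t k
    using that G y by (intro borel_measurable_lasso_path)
  have Lm: "(\<lambda>\<omega>. L2_set (lasso_path n (y \<omega>) i G t) B) \<in> borel_measurable M" if "0 < t" "B \<subseteq> {..<n}" for t B
    using that by (intro borel_measurable_L2_set pm) auto
  have sm: "(\<lambda>\<omega>. \<bar>\<Sum>m\<in>Q. v \<omega> m * lasso_path n (y \<omega>) i G t m\<bar>) \<in> borel_measurable M" if "0 < t" for t
    using that Q by (intro borel_measurable_abs borel_measurable_sum borel_measurable_times v pm) auto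
  have Lv: "(\<lambda>\<omega>. L2_set (v \<omega>) Q) \<in> borel_measurable M" by (intro borel_measurable_L2_set v)
  have "?A = (\<Union>t\<in>\<rat> \<inter> {0<..}. {\<omega>\<in>space M. L2_set (lasso_path n (y \<omega>) i G t) {..<n} \<le> \<Lambda>' \<and>
      L2_set (lasso_path n (y \<omega>) i G t) Q \<le> \<Lambda> \<and>
      c * L2_set (v \<omega>) Q < \<bar>\<Sum>m\<in>Q. v \<omega> m * lasso_path n (y \<omega>) i G t m\<bar>})" by auto
  also have "\<dots> \<in> sets M"
  proof (rule sets.countable_UN'')
    show "countable (\<rat> \<inter> {0<..} :: real set)" by (intro countable_Int1 countable_rat)
    fix t :: real assume "t \<in> \<rat> \<inter> {0<..}"
    then have t: "0 < t" by simp
    show "{\<omega>\<in>space M. L2_set (lasso_path n (y \<omega>) i G t) {..<n} \<le> \<Lambda>' \<and>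
      L2_set (lasso_path n (y \<omega>) i G t) Q \<le> \<Lambda> \<and>
      c * L2_set (v \<omega>) Q < \<bar>\<Sum>m\<in>Q. v \<omega> m * lasso_path n (y \<omega>) i G t m\<bar>} \<in> sets M"
      by (intro sets.sets_Collect_conj borel_measurable_le borel_measurable_less borel_measurable_times borel_measurable_const
        Lm[OF t] Lv sm[OF t] Q order_refl)
  qed
  finally show ?thesis .
qed

text \<open>Here \<open>v\<close> is fixed and the group is random. Reflecting the data along v/|v|
  - s/q reflects the whole path, so its inner product with v/|v| becomes that of the original path
  with s/q. For a fixed outcome the bad sign vectors s are counted by
  \<open>card_signs_path_le\<close>.\<close>

lemma (in prob_space) prob_lasso_path_cross_le:
  fixes y :: "'a \<Rightarrow> nat \<Rightarrow> nat \<Rightarrow> real" and v :: "nat \<Rightarrow> real" and \<Lambda>' :: real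
  assumes G: "finite G" and Q: "Q \<subseteq> {..<n}" "Q \<noteq> {}" and L: "0 < \<Lambda>" and eta: "0 \<le> \<eta>"
    and y: "\<And>j k. j \<in> insert i G \<Longrightarrow> k < n \<Longrightarrow> (\<lambda>\<omega>. y \<omega> j k) \<in> borel_measurable M"
    and T: "\<And>h. \<exists>T\<in>measurable M M. distr M M T = M \<and>
      (\<forall>\<omega>\<in>space M. \<forall>j\<in>insert i G. \<forall>k<n. y (T \<omega>) j k = reflect_on Q h (y \<omega> j) k)"
  defines "A \<equiv> {\<omega>\<in>space M. \<exists>t\<in>\<rat>. 0 < t \<and> L2_set (lasso_path n (y \<omega>) i G t) {..<n} \<le> \<Lambda>' \<and>
      L2_set (lasso_path n (y \<omega>) i G t) Q \<le> \<Lambda> \<and>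
      (\<eta> + 1/16) * L2_set v Q < \<bar>\<Sum>m\<in>Q. v m * lasso_path n (y \<omega>) i G t m\<bar>}"
  shows "prob A \<le> (256 * \<Lambda>'\<^sup>2 + 1) * (2 * exp (- (real (card Q) * \<eta>\<^sup>2 / (2 * \<Lambda>\<^sup>2))))"
proof (cases "L2_set v Q = 0")
  case True
  have fQ: "finite Q" using Q finite_subset by auto
  have "\<forall>m\<in>Q. v m = 0" using True fQ by (simp add: L2_set_eq_0_iff)
  then have "A = {}" unfolding A_def using True by auto
  then show ?thesis by simp
next
  case False
  have fQ: "finite Q" using Q finite_subset by auto
  define l where "l = L2_set v Q"
  have l: "0 < l" using False L2_set_nonneg[of v Q] unfolding l_def by linarith
  define w where "w m = v m / l" for m
  have w1: "(\<Sum>m\<in>Q. (w m)\<^sup>2) = 1"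
  proof -
    have "(\<Sum>m\<in>Q. (w m)\<^sup>2) = (\<Sum>m\<in>Q. (v m)\<^sup>2) / l\<^sup>2" by (simp add: w_def power_divide sum_divide_distrib)
    also have "(\<Sum>m\<in>Q. (v m)\<^sup>2) = l\<^sup>2" unfolding l_def by (rule L2_set_power2[symmetric])
    finally show ?thesis using l by simp
  qed
  define q where "q = sqrt (real (card Q))"
  define h where "h s m = w m - s m / q" for s m
  obtain TT where TT: "\<And>s. TT s \<in> measurable M M" "\<And>s. distr M M (TT s) = M"
    "\<And>s \<omega> j k. \<omega> \<in> space M \<Longrightarrow> j \<in> insert i G \<Longrightarrow> k < n \<Longrightarrow> y (TT s \<omega>) j k = reflect_on Q (h s) (y \<omega> j) k"
  proof -
    have "\<forall>s. \<exists>T. T \<in> measurable M M \<and> distr M M T = M \<and>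
      (\<forall>\<omega>\<in>space M. \<forall>j\<in>insert i G. \<forall>k<n. y (T \<omega>) j k = reflect_on Q (h s) (y \<omega> j) k)"
      using T by blast
    then obtain TT where "\<forall>s. TT s \<in> measurable M M \<and> distr M M (TT s) = M \<and>
      (\<forall>\<omega>\<in>space M. \<forall>j\<in>insert i G. \<forall>k<n. y (TT s \<omega>) j k = reflect_on Q (h s) (y \<omega> j) k)"
      unfolding choice_iff by (elim exE)
    then show ?thesis using that by blast
  qed
  have A: "A \<in> sets M" unfolding A_def by (rule sets_lasso_path_cross[OF G Q(1) y]) auto
  show ?thesis
  proof (rule prob_le_average[where S="signs Q" and T=TT, OF _ _ A _ TT(1,2)])
    show "finite (signs Q)" by (rule finite_signs[OF fQ])
    show "signs Q \<noteq> {}" by (simp add: PiE_eq_empty_iff)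
    show "0 \<le> (256 * \<Lambda>'\<^sup>2 + 1) * (2 * exp (- (real (card Q) * \<eta>\<^sup>2 / (2 * \<Lambda>\<^sup>2))))" by simp
    fix \<omega> assume om: "\<omega> \<in> space M"
    define u where "u = lasso_path n (y \<omega>) i G"
    define V where "V = {u t | t. 0 < t \<and> L2_set (u t) {..<n} \<le> \<Lambda>' \<and> L2_set (u t) Q \<le> \<Lambda>}"
    have sub: "{s\<in>signs Q. TT s \<omega> \<in> A} \<subseteq>
      {s \<in> signs Q. \<exists>u\<in>V. \<eta> + 1/16 < \<bar>\<Sum>m\<in>Q. s m / sqrt (real (card Q)) * u m\<bar>}"
    proof (rule subsetI)
      fix s assume "s \<in> {s\<in>signs Q. TT s \<omega> \<in> A}"
      then have s: "s \<in> signs Q" and "TT s \<omega> \<in> A" by auto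
      then obtain t where t: "0 < t" and n1: "L2_set (lasso_path n (y (TT s \<omega>)) i G t) {..<n} \<le> \<Lambda>'"
        and n2: "L2_set (lasso_path n (y (TT s \<omega>)) i G t) Q \<le> \<Lambda>"
        and n3: "(\<eta> + 1/16) * l < \<bar>\<Sum>m\<in>Q. v m * lasso_path n (y (TT s \<omega>)) i G t m\<bar>"
        unfolding A_def l_def by blast
      have r: "lasso_path n (y (TT s \<omega>)) i G t k = reflect_on Q (h s) (u t) k" if "k < n" for k
        unfolding u_def by (rule lasso_path_reflect_on[OF Q(1) TT(3)[OF om] that])
      have "L2_set (lasso_path n (y (TT s \<omega>)) i G t) {..<n} = L2_set (reflect_on Q (h s) (u t)) {..<n}"
        by (intro L2_set_cong) (auto simp: r)
      also have "\<dots> = L2_set (u t) {..<n}"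
        using ip_reflect_on[OF Q(1), of "h s" "u t" "u t"] unfolding ip_self by simp
      finally have m1: "L2_set (u t) {..<n} \<le> \<Lambda>'" using n1 by simp
      have "L2_set (lasso_path n (y (TT s \<omega>)) i G t) Q = L2_set (reflect_on Q (h s) (u t)) Q"
        using Q by (intro L2_set_cong) (auto simp: r)
      also have "\<dots> = L2_set (u t) Q" unfolding L2_set_def sum_power2_reflect_on ..
      finally have m2: "L2_set (u t) Q \<le> \<Lambda>" using n2 by simp
      have "(\<Sum>m\<in>Q. v m * lasso_path n (y (TT s \<omega>)) i G t m) = l * (\<Sum>m\<in>Q. w m * reflect_on Q (\<lambda>m. w m - s m / q) (u t) m)"
        unfolding sum_distrib_left using l Q by (intro sum.cong) (auto simp: r w_def h_def[abs_def])
      also have "(\<Sum>m\<in>Q. w m * reflect_on Q (\<lambda>m. w m - s m / q) (u t) m) = (\<Sum>m\<in>Q. s m / q * u t m)"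
      proof (rule sum_reflect_on_swap[OF fQ w1])
        have "(\<Sum>m\<in>Q. (s m / q)\<^sup>2) = (\<Sum>m\<in>Q. 1 / q\<^sup>2)"
          using s by (intro sum.cong) (auto simp: power_divide PiE_iff)
        then show "(\<Sum>m\<in>Q. (s m / q)\<^sup>2) = 1" using Q fQ by (auto simp: q_def card_gt_0_iff)
      qed
      finally have "l * (\<eta> + 1/16) < l * \<bar>\<Sum>m\<in>Q. s m / q * u t m\<bar>" using n3 l by (simp add: abs_mult mult.commute)
      then have "\<eta> + 1/16 < \<bar>\<Sum>m\<in>Q. s m / q * u t m\<bar>" using l by simp
      moreover have "u t \<in> V" unfolding V_def using t m1 m2 by blast
      ultimately show "s \<in> {s \<in> signs Q. \<exists>u\<in>V. \<eta> + 1/16 < \<bar>\<Sum>m\<in>Q. s m / sqrt (real (card Q)) * u m\<bar>}"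
        using s unfolding q_def by blast
    qed
    have "real (card {s\<in>signs Q. TT s \<omega> \<in> A}) \<le> real (card {s \<in> signs Q. \<exists>u\<in>V. \<eta> + 1/16 < \<bar>\<Sum>m\<in>Q. s m / sqrt (real (card Q)) * u m\<bar>})"
      using sub finite_signs[OF fQ] by (auto intro!: card_mono)
    also have "\<dots> \<le> (256 * \<Lambda>'\<^sup>2 + 1) * (2 ^ card Q * (2 * exp (- (real (card Q) * \<eta>\<^sup>2 / (2 * \<Lambda>\<^sup>2)))))"
    proof (rule card_signs_path_le[OF Q L eta])
      fix a b assume "a \<in> V" "b \<in> V"
      then obtain t t' where t: "0 < t" "a = u t" "0 < t'" "b = u t'" by (auto simp: V_def)
      show "(L2_set (\<lambda>k. a k - b k) {..<n})\<^sup>2 \<le> \<bar>(L2_set a {..<n})\<^sup>2 - (L2_set b {..<n})\<^sup>2\<bar>"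
      proof (cases "t' \<le> t")
        case True
        show ?thesis using lasso_path_dist(1)[OF G t(3) True, of n "y \<omega>" i] unfolding t u_def by linarith
      next
        case False
        have "L2_set (\<lambda>k. a k - b k) {..<n} = L2_set (\<lambda>k. b k - a k) {..<n}"
          unfolding L2_set_def by (simp add: power2_commute)
        then show ?thesis using lasso_path_dist(1)[OF G t(1), of t' n "y \<omega>" i] False unfolding t u_def by simp
      qed
    qed (auto simp: V_def)
    finally show "real (card {s\<in>signs Q. TT s \<omega> \<in> A}) \<le>
      real (card (signs Q)) * ((256 * \<Lambda>'\<^sup>2 + 1) * (2 * exp (- (real (card Q) * \<eta>\<^sup>2 / (2 * \<Lambda>\<^sup>2)))))"
      by (simp add: card_signs[OF fQ] mult.left_commute[of "2 ^ card Q"])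
  qed
qed

subsection \<open>Rotated coordinates\<close>

text \<open>Data of the group in a basis \<open>p\<close> whose first d vectors span its subspace:
  clean points are normalised Gaussians in these coordinates, while the noise is rotated by
  \<open>p\<close>.\<close>

definition rotated_data :: "nat \<Rightarrow> (nat \<Rightarrow> nat \<Rightarrow> real) \<Rightarrow> nat \<Rightarrow> real \<Rightarrow> ((bool \<times> nat) \<times> nat \<Rightarrow> real) \<Rightarrow> nat \<Rightarrow> nat \<Rightarrow> real" where
  "rotated_data n p d \<sigma> \<omega> j m =
     (if m < d then \<omega> ((True, j), m) / L2_set (\<lambda>r. \<omega> ((True, j), r)) {..<d} else 0) +
     \<sigma> / sqrt (real n) * (\<Sum>k<n. p m k * \<omega> ((False, j), k))"

lemma reflect_on_add: "reflect_on Q h (\<lambda>k. u k + w k) k = reflect_on Q h u k + reflect_on Q h w k"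
  by (simp add: reflect_on_def distrib_left distrib_right sum.distrib add_divide_distrib)

text \<open>A reflection of the rotated coordinates is pulled back to the Gaussian ones block by
  block. If \<open>Q\<close> lies in the first d coordinates, the norms dividing the clean points
  are preserved; if it is disjoint from them, clean points are not moved. A set meeting both ranges
  would spoil the normalisation.\<close>

lemma exists_gauss_reflection:
  fixes J :: "nat set" and I :: "((bool \<times> nat) \<times> nat) set"
  assumes J: "finite J" and d: "d \<le> n" and p: "orthonormal n n p" and Q: "Q \<subseteq> {..<n}" "Q \<subseteq> {..<d} \<or> Q \<inter> {..<d} = {}"
    and I: "I = (SIGMA b : UNIV \<times> J. {..<if fst b then d else n})"
  shows "\<exists>T\<in>measurable (gauss I) (gauss I). distr (gauss I) (gauss I) T = gauss I \<and>
      (\<forall>\<omega>\<in>space (gauss I). \<forall>j\<in>J. \<forall>m<n. rotated_data n p d \<sigma> (T \<omega>) j m = reflect_on Q h (rotated_data n p d \<sigma> \<omega> j) m)"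
proof -
  have fQ: "finite Q" using Q finite_subset by auto
  define F where "F = (UNIV :: bool set) \<times> J"
  define D where "D b = (if fst b then d else n)" for b :: "bool \<times> nat"
  \<comment> \<open>Clean blocks are already in rotated coordinates and use \<open>h\<close> itself;
    noise blocks use its image under the transpose of \<open>p\<close>.\<close>
  define hb where "hb b k = (if fst b then (if k \<in> Q then h k else 0) else (\<Sum>m\<in>Q. h m * p m k))" for b :: "bool \<times> nat" and k
  define hh where "hh b i = (if fst i = b then hb b (snd i) else 0)" for b and i :: "(bool \<times> nat) \<times> nat"
  have fin: "finite I" "finite F" using J by (auto simp: I F_def)
  have Ib: "I = Sigma F (\<lambda>b. {..<D b})" by (simp add: I F_def D_def)
  have sumI: "(\<Sum>i\<in>I. f (hh b i) i) = (\<Sum>k<D b. f (hb b k) (b, k))" if b: "b \<in> F" and "\<And>i. f 0 i = 0"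
    for f :: "real \<Rightarrow> (bool \<times> nat) \<times> nat \<Rightarrow> real" and b
  proof -
    have "(\<Sum>i\<in>I. f (hh b i) i) = (\<Sum>i\<in>Pair b ` {..<D b}. f (hh b i) i)"
      using fin b that(2) by (intro sum.mono_neutral_right) (auto simp: hh_def Ib)
    also have "\<dots> = (\<Sum>k<D b. f (hb b k) (b, k))" by (subst sum.reindex) (auto simp: inj_on_def hh_def)
    finally show ?thesis .
  qed
  define T where "T = reflect_family I F hh"
  have Tb: "T \<omega> (b, k) = \<omega> (b, k) - 2 * (\<Sum>k<D b. hb b k * \<omega> (b, k)) / (\<Sum>k<D b. (hb b k)\<^sup>2) * hb b k"
    if b: "b \<in> F" and k: "k < D b" for \<omega> b k
  proof -
    have "(\<Sum>c\<in>F. 2 * (\<Sum>i\<in>I. hh c i * \<omega> i) / (\<Sum>i\<in>I. (hh c i)\<^sup>2) * hh c (b, k)) =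
      (\<Sum>c\<in>{b}. 2 * (\<Sum>i\<in>I. hh c i * \<omega> i) / (\<Sum>i\<in>I. (hh c i)\<^sup>2) * hh c (b, k))"
      using fin b by (intro sum.mono_neutral_right) (auto simp: hh_def)
    then show ?thesis
      using b k sumI[OF b, of "\<lambda>x i. x * \<omega> i"] sumI[OF b, of "\<lambda>x i. x\<^sup>2"]
      by (simp add: T_def reflect_family_def Ib hh_def)
  qed
  have Tx: "(if m < d then T \<omega> ((True, j), m) / L2_set (\<lambda>r. T \<omega> ((True, j), r)) {..<d} else 0) =
      reflect_on Q h (\<lambda>m. if m < d then \<omega> ((True, j), m) / L2_set (\<lambda>r. \<omega> ((True, j), r)) {..<d} else 0) m"
    if j: "j \<in> J" and m: "m < n" for \<omega> j m
  proof (cases "Q \<subseteq> {..<d}")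
    case True
    define a where "a r = \<omega> ((True, j), r)" for r
    define R where "R = L2_set a {..<d}"
    have ext: "(\<Sum>k<d. (if k \<in> Q then h k else 0) * f k) = (\<Sum>k\<in>Q. h k * f k)" for f
      using True by (intro sum.mono_neutral_cong_right) auto
    have ext2: "(\<Sum>k<d. (if k \<in> Q then h k else 0)\<^sup>2) = (\<Sum>k\<in>Q. (h k)\<^sup>2)"
      using True by (intro sum.mono_neutral_cong_right) auto
    have Ta: "T \<omega> ((True, j), r) = reflect_on Q h a r" if "r < d" for r
      using Tb[of "(True, j)" r \<omega>] j that by (simp add: F_def D_def hb_def reflect_on_def a_def ext ext2)
    have "L2_set (\<lambda>r. T \<omega> ((True, j), r)) {..<d} = L2_set (reflect_on Q h a) {..<d}"
      by (intro L2_set_cong) (auto simp: Ta)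
    also have "\<dots> = R" using ip_reflect_on[OF True, of h a a] unfolding ip_self R_def by simp
    finally have N: "L2_set (\<lambda>r. T \<omega> ((True, j), r)) {..<d} = R" .
    have "reflect_on Q h (\<lambda>m. if m < d then a m / R else 0) m = (if m < d then reflect_on Q h a m / R else 0)"
    proof -
      have "(\<Sum>k\<in>Q. h k * (if k < d then a k / R else 0)) = (\<Sum>k\<in>Q. h k * a k) / R"
        unfolding sum_divide_distrib using True by (intro sum.cong) auto
      then show ?thesis using True by (auto simp: reflect_on_def diff_divide_distrib)
    qed
    then show ?thesis unfolding N a_def[symmetric] R_def[symmetric] using Ta by simp
  next
    case False
    then have Q0: "Q \<inter> {..<d} = {}" using Q by auto
    have "hb (True, j) k = 0" if "k < d" for k using Q0 that by (auto simp: hb_def)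
    then have Ta: "T \<omega> ((True, j), r) = \<omega> ((True, j), r)" if "r < d" for r
      using Tb[of "(True, j)" r \<omega>] j that by (simp add: F_def D_def)
    have "L2_set (\<lambda>r. T \<omega> ((True, j), r)) {..<d} = L2_set (\<lambda>r. \<omega> ((True, j), r)) {..<d}"
      by (intro L2_set_cong) (auto simp: Ta)
    moreover have "(\<Sum>k\<in>Q. h k * (if k < d then f k else 0)) = 0" for f :: "nat \<Rightarrow> real"
      using Q0 by (intro sum.neutral) auto
    ultimately show ?thesis using Ta by (simp add: reflect_on_def)
  qed
  have orth: "(\<Sum>k<n. p m k * p m' k) = (if m = m' then 1 else 0)" if "m < n" "m' < n" for m m'
    using p that by (simp add: orthonormal_def ip_def)
  have Tz: "(\<Sum>k<n. p m k * T \<omega> ((False, j), k)) = reflect_on Q h (\<lambda>m. \<Sum>k<n. p m k * \<omega> ((False, j), k)) m"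
    if j: "j \<in> J" and m: "m < n" for \<omega> j m
  proof -
    define b where "b k = \<omega> ((False, j), k)" for k
    define c where "c k = (\<Sum>m\<in>Q. h m * p m k)" for k
    have pc: "(\<Sum>k<n. p m' k * c k) = (if m' \<in> Q then h m' else 0)" if "m' < n" for m'
    proof -
      have "(\<Sum>k<n. p m' k * c k) = (\<Sum>m\<in>Q. h m * (\<Sum>k<n. p m' k * p m k))"
        unfolding c_def sum_distrib_left by (subst sum.swap) (simp add: mult.left_commute)
      also have "\<dots> = (\<Sum>m\<in>Q. h m * (if m' = m then 1 else 0))"
        using Q that by (intro sum.cong) (auto simp: orth)
      also have "\<dots> = (if m' \<in> Q then h m' else 0)" using fQ by (simp add: if_distrib cong: if_cong)
      finally show ?thesis .
    qed
    have cb: "(\<Sum>k<n. c k * b k) = (\<Sum>m\<in>Q. h m * (\<Sum>k<n. p m k * b k))"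
      unfolding c_def sum_distrib_right sum_distrib_left by (subst sum.swap) (simp add: mult.assoc)
    have cc: "(\<Sum>k<n. (c k)\<^sup>2) = (\<Sum>m\<in>Q. (h m)\<^sup>2)"
    proof -
      have "(\<Sum>k<n. (c k)\<^sup>2) = (\<Sum>m\<in>Q. h m * (\<Sum>k<n. p m k * c k))"
        unfolding power2_eq_square by (subst c_def, unfold sum_distrib_right sum_distrib_left, subst sum.swap) (simp add: mult.assoc)
      also have "\<dots> = (\<Sum>m\<in>Q. (h m)\<^sup>2)" using Q pc by (intro sum.cong) (auto simp: power2_eq_square)
      finally show ?thesis .
    qed
    have Tk: "T \<omega> ((False, j), k) = b k - 2 * (\<Sum>k<n. c k * b k) / (\<Sum>k<n. (c k)\<^sup>2) * c k" if "k < n" for k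
      using Tb[of "(False, j)" k \<omega>] j that by (simp add: F_def D_def hb_def c_def b_def)
    have "(\<Sum>k<n. p m k * T \<omega> ((False, j), k)) = (\<Sum>k<n. p m k * b k) - 2 * (\<Sum>k<n. c k * b k) / (\<Sum>k<n. (c k)\<^sup>2) * (\<Sum>k<n. p m k * c k)"
      by (simp add: Tk right_diff_distrib sum_subtractf sum_distrib_left mult.left_commute)
    then show ?thesis unfolding pc[OF m] cb cc by (simp add: reflect_on_def b_def)
  qed
  have main: "rotated_data n p d \<sigma> (T \<omega>) j m = reflect_on Q h (rotated_data n p d \<sigma> \<omega> j) m" if "j \<in> J" "m < n" for \<omega> j m
    unfolding rotated_data_def[abs_def] reflect_on_add reflect_on_scale Tx[OF that] Tz[OF that] ..
  have "T \<in> measurable (gauss I) (gauss I)" unfolding T_def by (rule measurable_reflect_family[OF fin(1)])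
  moreover have "distr (gauss I) (gauss I) T = gauss I" unfolding T_def
    by (rule distr_gauss_reflect_family[OF fin]) (auto simp: hh_def intro!: sum.neutral)
  ultimately show ?thesis using main by blast
qed

text \<open>Fubini in the form of conditioning: the coordinates in \<open>I1\<close> are frozen and
  the bound is required for each frozen value.\<close>

lemma measure_gauss_le_of_sections:
  fixes I1 I2 :: "'i set"
  assumes I: "finite I1" "finite I2" "I1 \<inter> I2 = {}" and A: "A \<in> sets (gauss (I1 \<union> I2))" and del: "0 \<le> \<delta>"
    and sec: "\<And>x. x \<in> space (gauss I1) \<Longrightarrow> measure (gauss I2) {y\<in>space (gauss I2). merge I1 I2 (x, y) \<in> A} \<le> \<delta>"
  shows "measure (gauss (I1 \<union> I2)) A \<le> \<delta>"
proof -
  interpret G: prob_space "gauss (I1 \<union> I2)" by (rule prob_space_gauss)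
  interpret G1: prob_space "gauss I1" by (rule prob_space_gauss)
  interpret G2: prob_space "gauss I2" by (rule prob_space_gauss)
  have mm: "merge I1 I2 \<in> measurable (gauss I1 \<Otimes>\<^sub>M gauss I2) (gauss (I1 \<union> I2))" by (rule measurable_merge)
  have "emeasure (gauss (I1 \<union> I2)) A = (\<integral>\<^sup>+x. indicator A x \<partial>gauss (I1 \<union> I2))"
    using A by simp
  also have "\<dots> = (\<integral>\<^sup>+x. (\<integral>\<^sup>+y. indicator A (merge I1 I2 (x, y)) \<partial>gauss I2) \<partial>gauss I1)"
    using I A by (intro gauss_product.product_nn_integral_fold) auto
  also have "\<dots> \<le> (\<integral>\<^sup>+x. ennreal \<delta> \<partial>gauss I1)"
  proof (rule nn_integral_mono)
    fix x assume x: "x \<in> space (gauss I1)"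
    have mx: "(\<lambda>y. merge I1 I2 (x, y)) \<in> measurable (gauss I2) (gauss (I1 \<union> I2))"
      using measurable_compose[OF measurable_Pair1'[OF x] mm] .
    have "{y\<in>space (gauss I2). merge I1 I2 (x, y) \<in> A} = (\<lambda>y. merge I1 I2 (x, y)) -` A \<inter> space (gauss I2)" by auto
    then have S: "{y\<in>space (gauss I2). merge I1 I2 (x, y) \<in> A} \<in> sets (gauss I2)"
      using measurable_sets[OF mx A] by simp
    have "(\<integral>\<^sup>+y. indicator A (merge I1 I2 (x, y)) \<partial>gauss I2) = (\<integral>\<^sup>+y. indicator {y\<in>space (gauss I2). merge I1 I2 (x, y) \<in> A} y \<partial>gauss I2)"
      by (intro nn_integral_cong) (auto simp: indicator_def)
    also have "\<dots> = ennreal (measure (gauss I2) {y\<in>space (gauss I2). merge I1 I2 (x, y) \<in> A})"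
      using S by (simp add: G2.emeasure_eq_measure)
    also have "\<dots> \<le> ennreal \<delta>" using sec[OF x] by (rule ennreal_leI)
    finally show "(\<integral>\<^sup>+y. indicator A (merge I1 I2 (x, y)) \<partial>gauss I2) \<le> ennreal \<delta>" .
  qed
  also have "\<dots> = ennreal \<delta>" by (simp add: G1.emeasure_space_1)
  finally show ?thesis using del by (simp add: G.emeasure_eq_measure)
qed

lemma borel_measurable_rotated_data:
  assumes "\<And>r. r < d \<Longrightarrow> ((True, j), r) \<in> I" "\<And>r. r < n \<Longrightarrow> ((False, j), r) \<in> I"
  shows "(\<lambda>\<omega>. rotated_data n p d \<sigma> \<omega> j m) \<in> borel_measurable (gauss I)"
proof -
  have c: "(\<lambda>\<omega>. \<omega> i) \<in> borel_measurable (gauss I)" if "i \<in> I" for i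
    using measurable_component_singleton[OF that, of "\<lambda>_. std_normal"] by simp
  have "(\<lambda>\<omega>. \<omega> ((True, j), m) / L2_set (\<lambda>r. \<omega> ((True, j), r)) {..<d}) \<in> borel_measurable (gauss I)" if "m < d"
    using that assms by (intro borel_measurable_divide borel_measurable_L2_set c) auto
  then have "(\<lambda>\<omega>. if m < d then \<omega> ((True, j), m) / L2_set (\<lambda>r. \<omega> ((True, j), r)) {..<d} else 0) \<in> borel_measurable (gauss I)"
    by (cases "m < d") auto
  moreover have "(\<lambda>\<omega>. \<sigma> / sqrt (real n) * (\<Sum>k<n. p m k * \<omega> ((False, j), k))) \<in> borel_measurable (gauss I)"
    using assms by (intro borel_measurable_times borel_measurable_const borel_measurable_sum c) auto
  ultimately show ?thesis unfolding rotated_data_def by (rule borel_measurable_add)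
qed

text \<open>The vector \<open>v\<close> depends only on coordinates outside the blocks of the group.
  Once these are frozen it is constant, and the reflections of the group remain available.\<close>

lemma prob_gauss_cross_le:
  fixes n d i :: nat and G Q :: "nat set" and p :: "nat \<Rightarrow> nat \<Rightarrow> real" and \<sigma> :: real
    and I :: "((bool \<times> nat) \<times> nat) set" and v :: "((bool \<times> nat) \<times> nat \<Rightarrow> real) \<Rightarrow> nat \<Rightarrow> real" and \<Lambda> \<Lambda>' \<eta> :: real
  assumes I: "finite I" and G: "finite G" and d: "d \<le> n" and p: "orthonormal n n p"
    and Q: "Q \<subseteq> {..<n}" "Q \<noteq> {}" "Q \<subseteq> {..<d} \<or> Q \<inter> {..<d} = {}" and L: "0 < \<Lambda>" and eta: "0 \<le> \<eta>"
  defines "I2 \<equiv> SIGMA b : UNIV \<times> insert i G. {..<if fst b then d else n}"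
  assumes I2: "I2 \<subseteq> I" and v: "\<And>m. m \<in> Q \<Longrightarrow> (\<lambda>\<omega>. v \<omega> m) \<in> borel_measurable (gauss I)"
    and vi: "\<And>\<omega> \<omega>' m. (\<And>k. k \<in> I - I2 \<Longrightarrow> \<omega> k = \<omega>' k) \<Longrightarrow> m \<in> Q \<Longrightarrow> v \<omega> m = v \<omega>' m"
  defines "A \<equiv> {\<omega>\<in>space (gauss I). \<exists>t\<in>\<rat>. 0 < t \<and> L2_set (lasso_path n (rotated_data n p d \<sigma> \<omega>) i G t) {..<n} \<le> \<Lambda>' \<and>
      L2_set (lasso_path n (rotated_data n p d \<sigma> \<omega>) i G t) Q \<le> \<Lambda> \<and>
      (\<eta> + 1/16) * L2_set (v \<omega>) Q < \<bar>\<Sum>m\<in>Q. v \<omega> m * lasso_path n (rotated_data n p d \<sigma> \<omega>) i G t m\<bar>}"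
  shows "A \<in> sets (gauss I)"
    and "measure (gauss I) A \<le> (256 * \<Lambda>'\<^sup>2 + 1) * (2 * exp (- (real (card Q) * \<eta>\<^sup>2 / (2 * \<Lambda>\<^sup>2))))"
proof -
  define y where "y = rotated_data n p d \<sigma>"
  have m2: "((True, j), r) \<in> I2" if "j \<in> insert i G" "r < d" for j r using that by (auto simp: I2_def)
  have m3: "((False, j), r) \<in> I2" if "j \<in> insert i G" "r < n" for j r using that by (auto simp: I2_def)
  have ym: "(\<lambda>\<omega>. y \<omega> j k) \<in> borel_measurable (gauss I')" if "I2 \<subseteq> I'" "j \<in> insert i G" for j k I'
    unfolding y_def by (rule borel_measurable_rotated_data) (use that m2 m3 in blast)+
  show A: "A \<in> sets (gauss I)" unfolding A_def
    by (rule sets_lasso_path_cross[OF G Q(1) ym[OF I2, unfolded y_def] v])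
  define I1 where "I1 = I - I2"
  have IU: "I = I1 \<union> I2" "I1 \<inter> I2 = {}" "finite I1" "finite I2" using I I2 finite_subset by (auto simp: I1_def)
  have "measure (gauss (I1 \<union> I2)) A \<le> (256 * \<Lambda>'\<^sup>2 + 1) * (2 * exp (- (real (card Q) * \<eta>\<^sup>2 / (2 * \<Lambda>\<^sup>2))))"
  proof (rule measure_gauss_le_of_sections)
    show "finite I1" "finite I2" "I1 \<inter> I2 = {}" using IU by auto
    show "A \<in> sets (gauss (I1 \<union> I2))" using A IU(1) by simp
    fix x assume x: "x \<in> space (gauss I1)"
    interpret G2: prob_space "gauss I2" by (rule prob_space_gauss)
    define v0 where "v0 = v (merge I1 I2 (x, \<lambda>_. 0))"
    define A2 where "A2 = {\<omega>\<in>space (gauss I2). \<exists>t\<in>\<rat>. 0 < t \<and> L2_set (lasso_path n (y \<omega>) i G t) {..<n} \<le> \<Lambda>' \<and>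
      L2_set (lasso_path n (y \<omega>) i G t) Q \<le> \<Lambda> \<and>
      (\<eta> + 1/16) * L2_set v0 Q < \<bar>\<Sum>m\<in>Q. v0 m * lasso_path n (y \<omega>) i G t m\<bar>}"
    have "{\<omega>\<in>space (gauss I2). merge I1 I2 (x, \<omega>) \<in> A} = A2"
    proof -
      have ry: "y (merge I1 I2 (x, \<omega>)) j m = y \<omega> j m" if "j \<in> insert i G" "m < n" for \<omega> j m
      proof -
        have e: "merge I1 I2 (x, \<omega>) k = \<omega> k" if "k \<in> I2" for k using that by (auto simp: merge_def I1_def)
        have "L2_set (\<lambda>r. merge I1 I2 (x, \<omega>) ((True, j), r)) {..<d} = L2_set (\<lambda>r. \<omega> ((True, j), r)) {..<d}"
          using that m2 e by (intro L2_set_cong) auto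
        then show ?thesis using that m2 m3 e by (auto simp: y_def rotated_data_def)
      qed
      have path: "lasso_path n (y (merge I1 I2 (x, \<omega>))) i G t k = lasso_path n (y \<omega>) i G t k" if "k < n" for \<omega> t k
        by (rule lasso_path_cong[OF ry that])
      have vv: "v (merge I1 I2 (x, \<omega>)) m = v0 m" if "m \<in> Q" for m \<omega>
        unfolding v0_def by (rule vi[OF _ that]) (auto simp: merge_def I1_def)
      have Lv0: "L2_set (v (merge I1 I2 (x, \<omega>))) Q = L2_set v0 Q" for \<omega>
        by (rule L2_set_cong) (auto simp: vv)
      have LB: "L2_set (lasso_path n (y (merge I1 I2 (x, \<omega>))) i G t) B = L2_set (lasso_path n (y \<omega>) i G t) B" if "B \<subseteq> {..<n}" for \<omega> t B
        using that by (intro L2_set_cong) (auto simp: path)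
      have sv: "(\<Sum>m\<in>Q. v (merge I1 I2 (x, \<omega>)) m * lasso_path n (y (merge I1 I2 (x, \<omega>))) i G t m) = (\<Sum>m\<in>Q. v0 m * lasso_path n (y \<omega>) i G t m)" for \<omega> t
        using Q by (intro sum.cong) (auto simp: path vv)
      have sp: "merge I1 I2 (x, \<omega>) \<in> space (gauss I)" if "\<omega> \<in> space (gauss I2)" for \<omega>
        using x that IU(1) by (auto simp: space_gauss merge_def PiE_iff extensional_def)
      show ?thesis unfolding A2_def A_def y_def[symmetric] using sp Q by (auto simp: Lv0 LB sv)
    qed
    also have "measure (gauss I2) A2 \<le> (256 * \<Lambda>'\<^sup>2 + 1) * (2 * exp (- (real (card Q) * \<eta>\<^sup>2 / (2 * \<Lambda>\<^sup>2))))"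
      unfolding A2_def
    proof (rule G2.prob_lasso_path_cross_le[OF G Q(1,2) L eta])
      show "(\<lambda>\<omega>. y \<omega> j k) \<in> borel_measurable (gauss I2)" if "j \<in> insert i G" for j k
        by (rule ym[OF order_refl that])
      show "\<exists>T\<in>measurable (gauss I2) (gauss I2). distr (gauss I2) (gauss I2) T = gauss I2 \<and>
          (\<forall>\<omega>\<in>space (gauss I2). \<forall>j\<in>insert i G. \<forall>k<n. y (T \<omega>) j k = reflect_on Q h (y \<omega> j) k)" for h
        unfolding y_def using G by (intro exists_gauss_reflection[OF _ d p Q(1,3)]) (auto simp: I2_def)
    qed
    finally show "measure (gauss I2) {y\<in>space (gauss I2). merge I1 I2 (x, y) \<in> A} \<le> (256 * \<Lambda>'\<^sup>2 + 1) * (2 * exp (- (real (card Q) * \<eta>\<^sup>2 / (2 * \<Lambda>\<^sup>2))))" .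
  qed simp
  then show "measure (gauss I) A \<le> (256 * \<Lambda>'\<^sup>2 + 1) * (2 * exp (- (real (card Q) * \<eta>\<^sup>2 / (2 * \<Lambda>\<^sup>2))))"
    using IU(1) by simp
qed

subsection \<open>Inner probabilities\<close>

text \<open>Tail bounds supply measurable exceptional sets, whereas the property itself may quantify
  over uncountably many vectors.\<close>

lemma with_prob_at_least_of_bad:
  assumes "prob_space M" "A \<in> sets M" "measure M A \<le> \<delta>" "\<And>\<omega>. \<omega> \<in> space M - A \<Longrightarrow> P \<omega>"
  shows "with_prob_at_least M (1 - \<delta>) P"
  unfolding with_prob_at_least_def
  by (rule bexI[of _ "space M - A"]) (use assms in \<open>auto simp: prob_space.prob_compl\<close>)

lemma with_prob_at_least_mono:
  assumes "with_prob_at_least M p P" "\<And>\<omega>. \<omega> \<in> space M \<Longrightarrow> P \<omega> \<Longrightarrow> P' \<omega>" "p' \<le> p"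
  shows "with_prob_at_least M p' P'"
proof -
  from assms(1) obtain E where "E \<in> sets M" "\<forall>\<omega>\<in>E. P \<omega>" "p \<le> measure M E"
    unfolding with_prob_at_least_def by blast
  moreover have "E \<subseteq> space M" using calculation(1) by (rule sets.sets_into_space)
  ultimately have "(\<forall>\<omega>\<in>E. P' \<omega>) \<and> p' \<le> measure M E" using assms(2,3) by auto
  then show ?thesis unfolding with_prob_at_least_def using \<open>E \<in> sets M\<close> by blast
qed

lemma with_prob_at_least_conj:
  assumes M: "prob_space M" and "with_prob_at_least M (1 - \<delta>) P" "with_prob_at_least M (1 - \<delta>') P'"
  shows "with_prob_at_least M (1 - (\<delta> + \<delta>')) (\<lambda>\<omega>. P \<omega> \<and> P' \<omega>)"
proof -
  interpret prob_space M by (rule M)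
  from assms(2) obtain E where E: "E \<in> sets M" "\<forall>\<omega>\<in>E. P \<omega>" "1 - \<delta> \<le> prob E"
    unfolding with_prob_at_least_def by blast
  from assms(3) obtain E' where E': "E' \<in> sets M" "\<forall>\<omega>\<in>E'. P' \<omega>" "1 - \<delta>' \<le> prob E'"
    unfolding with_prob_at_least_def by blast
  have "prob (E \<union> E') = prob E + prob (E' - E)" by (rule finite_measure_Union'[OF E(1) E'(1)])
  moreover have "prob (E' - E) = prob E' - prob (E' \<inter> E)" by (rule finite_measure_Diff'[OF E'(1) E(1)])
  ultimately have "1 - (\<delta> + \<delta>') \<le> prob (E \<inter> E')" using E(3) E'(3) prob_le_1[of "E \<union> E'"] by (simp add: Int_commute)
  then show ?thesis unfolding with_prob_at_least_def using E E' by (intro bexI[of _ "E \<inter> E'"]) auto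
qed

lemma with_prob_at_least_ball:
  assumes M: "prob_space M" and J: "finite J" and P: "\<And>j. j \<in> J \<Longrightarrow> with_prob_at_least M (1 - \<delta>) (P j)"
  shows "with_prob_at_least M (1 - real (card J) * \<delta>) (\<lambda>\<omega>. \<forall>j\<in>J. P j \<omega>)"
  using J P
proof (induction J rule: finite_induct)
  case empty
  then show ?case unfolding with_prob_at_least_def
    using prob_space.prob_space[OF M] by (intro bexI[of _ "space M"]) auto
next
  case (insert j J)
  have "with_prob_at_least M (1 - (\<delta> + real (card J) * \<delta>)) (\<lambda>\<omega>. P j \<omega> \<and> (\<forall>j\<in>J. P j \<omega>))"
    using insert by (intro with_prob_at_least_conj[OF M]) auto
  moreover have "\<delta> + real (card J) * \<delta> = real (card (insert j J)) * \<delta>" using insert by (simp add: algebra_simps)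
  ultimately show ?case by simp
qed

subsection \<open>Typical behaviour of the data\<close>

text \<open>The number \<open>M j m r\<close> is the inner product of \<open>p m\<close> with the \<open>r\<close>th vector of the orthonormal basis of the subspace of
  point \<open>j\<close>; the Frobenius norm of its first \<open>d\<close> rows is the affinity.\<close>

locale semirandom_coordinates =
  fixes n N i d :: nat and G :: "nat set" and D :: "nat \<Rightarrow> nat" and M :: "nat \<Rightarrow> nat \<Rightarrow> nat \<Rightarrow> real"
    and p :: "nat \<Rightarrow> nat \<Rightarrow> real" and \<sigma> a \<rho> :: real
  assumes i: "i < N" and G: "G \<subseteq> {..<N} - {i}" and d: "1 \<le> d" and D: "\<And>j. j < N \<Longrightarrow> 1 \<le> D j"
    and D_group: "\<And>j. j \<in> insert i G \<Longrightarrow> D j = d"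
    and M_group: "\<And>j m r. j \<in> insert i G \<Longrightarrow> m < n \<Longrightarrow> r < d \<Longrightarrow> M j m r = (if m = r then 1 else 0)"
    and p: "orthonormal n n p"
    and iso: "\<And>j c. j < N \<Longrightarrow> L2_set (\<lambda>m. \<Sum>r<D j. M j m r * c r) {..<n} = L2_set c {..<D j}"
    and frob: "\<And>j. j < N \<Longrightarrow> j \<notin> insert i G \<Longrightarrow> (\<Sum>m<d. \<Sum>r<D j. (M j m r)\<^sup>2) \<le> real (min d (D j)) * (1 / 10^5 / a)\<^sup>2"
    and a_def: "a = ln (real N)"
    and sig: "0 < \<sigma>" "\<sigma> \<le> 1 / 10^14"
    and dim_small: "real d * a\<^sup>2 \<le> real n / 10^30"
    and rho: "real (card G) + 1 = \<rho> * real d" "10^8 \<le> \<rho>" "\<rho> \<le> exp (real d / 2)"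
begin

definition I where "I = model_index n N D"

definition xf :: "((bool \<times> nat) \<times> nat \<Rightarrow> real) \<Rightarrow> nat \<Rightarrow> nat \<Rightarrow> real" where
  "xf \<omega> j m = (\<Sum>r<D j. M j m r * \<omega> ((True, j), r)) / L2_set (\<lambda>r. \<omega> ((True, j), r)) {..<D j}"

definition zf :: "((bool \<times> nat) \<times> nat \<Rightarrow> real) \<Rightarrow> nat \<Rightarrow> nat \<Rightarrow> real" where
  "zf \<omega> j m = \<sigma> / sqrt (real n) * (\<Sum>k<n. p m k * \<omega> ((False, j), k))"

definition yf :: "((bool \<times> nat) \<times> nat \<Rightarrow> real) \<Rightarrow> nat \<Rightarrow> nat \<Rightarrow> real" where
  "yf \<omega> j m = xf \<omega> j m + zf \<omega> j m"

text \<open>This is log(e \<rho>), the entropy parameter of the clean points: q exp(-r) is at most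
  d/e.\<close>

definition r where "r = 1 + ln \<rho>"

abbreviation "q \<equiv> real (card G)"

sublocale Om: prob_space "gauss I" by (rule prob_space_gauss)

lemma finI: "finite I" unfolding I_def by (rule finite_model_index)

lemma finG: "finite G" using G finite_subset by blast

lemma memI: "((b, j), k) \<in> I \<longleftrightarrow> j < N \<and> k < (if b then D j else n)"
  by (simp add: I_def mem_model_index)

lemma q_le: "q + 1 \<le> real N" "q = \<rho> * real d - 1" "card (insert i G) = card G + 1"
proof -
  show c: "card (insert i G) = card G + 1" using G finG by (subst card_insert_disjoint) auto
  have "card (insert i G) \<le> card {..<N}" using G i by (intro card_mono) auto
  then show "q + 1 \<le> real N" using c by simp
  show "q = \<rho> * real d - 1" using rho by simp
qed

text \<open>The density lies between 10^8 and exp(d/2), which excludes small dimensions.\<close>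

lemma d_large: "6 < real d"
proof (rule ccontr)
  assume "\<not> ?thesis"
  then have "exp (real d / 2) \<le> exp 4" by simp
  also have "\<dots> \<le> 73" by (rule exp_4_le)
  finally show False using rho by simp
qed

lemma q_bounds: "10^7 * real d \<le> q" "real d * r \<le> q" "q \<le> \<rho> * real d" "99999999 * real d \<le> q"
proof -
  have "10^8 * real d \<le> \<rho> * real d" using rho by (intro mult_right_mono) auto
  then have e: "100000000 * real d \<le> \<rho> * real d" by simp
  then show e2: "99999999 * real d \<le> q" using q_le(2) d_large by linarith
  then have "10000000 * real d \<le> q" using d_large by linarith
  then show "10^7 * real d \<le> q" by simp
  show "q \<le> \<rho> * real d" using q_le by simp
  \<comment> \<open>Taking the logarithm of the root gives r \<le> 2 sqrt \<rho>, which is at most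
    \<rho>/2 as soon as \<rho> \<ge> 16.\<close>
  have "ln \<rho> = 2 * ln (sqrt \<rho>)" using rho by (simp add: ln_sqrt)
  also have "ln (sqrt \<rho>) \<le> sqrt \<rho> - 1" using rho by (intro ln_le_minus_one) auto
  finally have "r \<le> 2 * sqrt \<rho>" by (simp add: r_def)
  also have "\<dots> \<le> \<rho> / 2"
  proof -
    have "4 \<le> sqrt \<rho>" using rho by (intro real_le_rsqrt) simp
    then have "4 * sqrt \<rho> \<le> sqrt \<rho> * sqrt \<rho>" using rho by (intro mult_right_mono) auto
    then show ?thesis using rho by simp
  qed
  finally have "real d * r \<le> real d * (\<rho> / 2)" by (intro mult_left_mono) auto
  moreover have "2 \<le> \<rho> * real d" using e d_large by linarith
  ultimately show "real d * r \<le> q" unfolding q_le by (simp add: mult.commute)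
qed

lemma N_large: "10^8 \<le> real N" "\<rho> * real d \<le> real N" "real d \<le> real N"
proof -
  show n: "\<rho> * real d \<le> real N" using q_le by simp
  show "10^8 \<le> real N" "real d \<le> real N" using q_bounds(4) q_le(1) d_large by simp_all
qed

lemma exp_a: "exp a = real N" "exp (- a) = 1 / real N"
  using N_large by (simp_all add: a_def exp_minus field_simps)

lemma r_le: "1 \<le> r" "r \<le> a" and a1: "1 \<le> a"
proof -
  show r1: "1 \<le> r" unfolding r_def using rho by simp
  have "exp r = exp 1 * \<rho>" unfolding r_def exp_add using rho by simp
  also have "\<dots> \<le> real d * \<rho>" using rho exp_le d_large by (intro mult_right_mono) auto
  also have "\<dots> \<le> exp a" unfolding exp_a using N_large by (simp add: mult.commute)
  finally show "r \<le> a" by simp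
  then show "1 \<le> a" using r1 by simp
qed

lemma n_large: "10^30 * real d \<le> real n" "10^30 * a \<le> real n" "10^30 * (real d * a) \<le> real n" "d \<le> n" "0 < n" "10^30 \<le> real n"
proof -
  have "a * 1 \<le> a * a" using a1 by (intro mult_left_mono) auto
  then have aa: "a \<le> a\<^sup>2" by (simp add: power2_eq_square)
  have "real d * a \<le> real d * a\<^sup>2" using aa by (intro mult_left_mono) auto
  moreover have "real d * 1 \<le> real d * a" using a1 by (intro mult_left_mono) auto
  moreover have "1 * a \<le> real d * a" using a1 d by (intro mult_right_mono) auto
  ultimately show "10^30 * real d \<le> real n" "10^30 * a \<le> real n" "10^30 * (real d * a) \<le> real n"
    using dim_small by (simp_all add: field_simps)
  then have "real d \<le> real n" "10^30 \<le> real n" using d_large by simp_all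
  then show "d \<le> n" "0 < n" "10^30 \<le> real n" using d_large by auto
qed

lemma zf_L2: "L2_set (\<lambda>m. c * (\<Sum>k<n. p m k * b k)) {..<n} = \<bar>c\<bar> * L2_set b {..<n}"
proof -
  have "(L2_set (\<lambda>m. ip n (p m) b) {..<n})\<^sup>2 = (L2_set b {..<n})\<^sup>2"
    unfolding ip_self[symmetric] by (rule orthonormal_parseval[OF p])
  then have "L2_set (\<lambda>m. ip n (p m) b) {..<n} = L2_set b {..<n}" by simp
  then show ?thesis unfolding L2_set_scale by (simp add: ip_def)
qed

section \<open>Single events of high probability\<close>

lemma whp_norm:
  "with_prob_at_least (gauss I) (1 - 2 * exp (- real (D j))) (\<lambda>\<omega>. sqrt (real (D j)) / 6 \<le> L2_set (\<lambda>r. \<omega> ((True, j), r)) {..<D j} \<and>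
      L2_set (\<lambda>r. \<omega> ((True, j), r)) {..<D j} \<le> 4 * sqrt (real (D j)))"
  if j: "j < N"
proof -
  \<comment> \<open>The norm of one Gaussian vector is the case of a matrix with a single column,
    indexed by \<open>{0}\<close>.\<close>
  have "\<exists>A\<in>sets (gauss I). measure (gauss I) A \<le> 2 * exp (- real (card {..<D j})) \<and>
    (\<forall>\<omega>\<in>space (gauss I) - A. sqrt (real (card {..<D j})) / 6 * L2_set (\<lambda>_. 1) {0::nat} \<le> L2_set (\<lambda>k. \<Sum>l\<in>{0::nat}. 1 * \<omega> ((True, j), k)) {..<D j} \<and>
      L2_set (\<lambda>k. \<Sum>l\<in>{0::nat}. 1 * \<omega> ((True, j), k)) {..<D j} \<le> 4 * sqrt (real (card {..<D j})) * L2_set (\<lambda>_. 1) {0::nat})"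
    by (rule gauss_norm_bounds[OF finI, where e="\<lambda>k l. ((True, j), k)"]) (use j in \<open>auto simp: memI\<close>)
  then obtain A where "A \<in> sets (gauss I)" "measure (gauss I) A \<le> 2 * exp (- real (D j))"
    "\<forall>\<omega>\<in>space (gauss I) - A. sqrt (real (D j)) / 6 \<le> L2_set (\<lambda>k. \<omega> ((True, j), k)) {..<D j} \<and>
      L2_set (\<lambda>k. \<omega> ((True, j), k)) {..<D j} \<le> 4 * sqrt (real (D j))" by auto
  then show ?thesis by (intro with_prob_at_least_of_bad[OF Om.prob_space_axioms]) auto
qed

lemma whp_noise_norm:
  "with_prob_at_least (gauss I) (1 - 2 * exp (- real n)) (\<lambda>\<omega>. L2_set (zf \<omega> j) {..<n} \<le> 4 * \<sigma>)" if j: "j < N"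
proof -
  have "\<exists>A\<in>sets (gauss I). measure (gauss I) A \<le> 2 * exp (- real (card {..<n})) \<and>
    (\<forall>\<omega>\<in>space (gauss I) - A. sqrt (real (card {..<n})) / 6 * L2_set (\<lambda>_. 1) {0::nat} \<le> L2_set (\<lambda>k. \<Sum>l\<in>{0::nat}. 1 * \<omega> ((False, j), k)) {..<n} \<and>
      L2_set (\<lambda>k. \<Sum>l\<in>{0::nat}. 1 * \<omega> ((False, j), k)) {..<n} \<le> 4 * sqrt (real (card {..<n})) * L2_set (\<lambda>_. 1) {0::nat})"
    by (rule gauss_norm_bounds[OF finI, where e="\<lambda>k l. ((False, j), k)"]) (use j in \<open>auto simp: memI\<close>)
  then obtain A where A: "A \<in> sets (gauss I)" "measure (gauss I) A \<le> 2 * exp (- real n)"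
    "\<forall>\<omega>\<in>space (gauss I) - A. L2_set (\<lambda>k. \<omega> ((False, j), k)) {..<n} \<le> 4 * sqrt (real n)" by auto
  show ?thesis
  proof (rule with_prob_at_least_of_bad[OF Om.prob_space_axioms A(1,2)])
    fix \<omega> assume "\<omega> \<in> space (gauss I) - A"
    then have b: "L2_set (\<lambda>k. \<omega> ((False, j), k)) {..<n} \<le> 4 * sqrt (real n)" using A(3) by blast
    have "L2_set (zf \<omega> j) {..<n} = \<bar>\<sigma> / sqrt (real n)\<bar> * L2_set (\<lambda>k. \<omega> ((False, j), k)) {..<n}"
      unfolding zf_def[abs_def] by (rule zf_L2)
    also have "\<dots> \<le> \<bar>\<sigma> / sqrt (real n)\<bar> * (4 * sqrt (real n))" by (intro mult_left_mono b) auto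
    also have "\<dots> = 4 * \<sigma>" using sig n_large by simp
    finally show "L2_set (zf \<omega> j) {..<n} \<le> 4 * \<sigma>" .
  qed
qed

text \<open>The general factor 4 is too large for point i, whose noise must leave room below 2
  \<sigma>. With \<theta> = 1/4 and threshold 2.25 n the bound per coordinate is sqrt 2 exp(-9/16),
  and sqrt 2 \<le> exp(7/16) leaves exp(-1/8).\<close>

lemma whp_noise_self:
  "with_prob_at_least (gauss I) (1 - exp (- real n / 8)) (\<lambda>\<omega>. L2_set (zf \<omega> i) {..<n} \<le> 1.5 * \<sigma>)"
proof -
  define A where "A = {\<omega>\<in>space (gauss I). (1/4) * (2.25 * real n) \<le> (1/4) * (\<Sum>k\<in>{..<n}. (\<Sum>l\<in>{0::nat}. 1 * \<omega> ((False, i), k))\<^sup>2)}"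
  have "A \<in> sets (gauss I)" unfolding A_def
    by (rule prob_chi_square_ge(1)[OF finI, where e="\<lambda>k l. ((False, i), k)"]) (use i in \<open>auto simp: memI\<close>)
  moreover have "measure (gauss I) A \<le> (1 / sqrt (1 - 2 * (1/4))) ^ card {..<n} * exp (- (1/4) * (2.25 * real n))"
    unfolding A_def
    by (rule prob_chi_square_ge(2)[OF finI, where e="\<lambda>k l. ((False, i), k)"]) (use i in \<open>auto simp: memI\<close>)
  then have "measure (gauss I) A \<le> exp (- real n / 8)"
  proof (rule order_trans)
    have "1 / sqrt (1 - 2 * (1/4)) = sqrt 2" by (simp add: real_sqrt_divide)
    also have "\<dots> \<le> exp (7/16)"
    proof (rule real_le_lsqrt)
      have "(2::real) \<le> 1 + 7/8 + (7/8)\<^sup>2 / 2" by (simp add: power2_eq_square)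
      also have "\<dots> \<le> exp (7/8)" by (rule exp_lower_Taylor_quadratic) simp
      also have "\<dots> = (exp (7/16))\<^sup>2" by (simp add: exp_double[symmetric])
      finally show "(2::real) \<le> (exp (7/16))\<^sup>2" .
    qed simp_all
    finally have "(1 / sqrt (1 - 2 * (1/4))) ^ n \<le> exp (7/16) ^ n" by (intro power_mono) auto
    also have "\<dots> = exp (7/16 * real n)" using exp_of_nat_mult[of n "7/16::real"] by (simp add: mult.commute)
    finally have "(1 / sqrt (1 - 2 * (1/4))) ^ card {..<n} * exp (- (1/4) * (2.25 * real n)) \<le> exp (7/16 * real n) * exp (- (1/4) * (2.25 * real n))"
      by (intro mult_right_mono) auto
    also have "\<dots> = exp (- real n / 8)" by (simp flip: exp_add)
    finally show "(1 / sqrt (1 - 2 * (1/4))) ^ card {..<n} * exp (- (1/4) * (2.25 * real n)) \<le> exp (- real n / 8)" .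
  qed
  ultimately show ?thesis
  proof (rule with_prob_at_least_of_bad[OF Om.prob_space_axioms])
    fix \<omega> assume "\<omega> \<in> space (gauss I) - A"
    then have "(\<Sum>k<n. (\<omega> ((False, i), k))\<^sup>2) \<le> 2.25 * real n" by (auto simp: A_def)
    also have "\<dots> = (1.5 * sqrt (real n))\<^sup>2" by (simp add: power2_eq_square)
    finally have b: "L2_set (\<lambda>k. \<omega> ((False, i), k)) {..<n} \<le> 1.5 * sqrt (real n)" by (intro L2_set_leI) auto
    have "L2_set (zf \<omega> i) {..<n} = \<bar>\<sigma> / sqrt (real n)\<bar> * L2_set (\<lambda>k. \<omega> ((False, i), k)) {..<n}"
      unfolding zf_def[abs_def] by (rule zf_L2)
    also have "\<dots> \<le> \<bar>\<sigma> / sqrt (real n)\<bar> * (1.5 * sqrt (real n))" by (intro mult_left_mono b) auto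
    also have "\<dots> = 1.5 * \<sigma>" using sig n_large by simp
    finally show "L2_set (zf \<omega> i) {..<n} \<le> 1.5 * \<sigma>" .
  qed
qed

text \<open>The transposed matrix: points are rows and the d coordinates are columns, and sparsity s
  = d is no restriction. The q \<ge> 99999999 d rows beat the entropy 36864 d + 4 d.\<close>

lemma whp_frame:
  "with_prob_at_least (gauss I) (1 - 2 * exp (- real d)) (\<lambda>\<omega>. \<forall>w. sqrt q / 24 * L2_set w {..<d} \<le> L2_set (\<lambda>j. \<Sum>m<d. w m * \<omega> ((True, j), m)) G)"
proof -
  have "\<exists>A\<in>sets (gauss I).
    measure (gauss I) A \<le> 2 * exp (1 * (36864 * real d) + 4 * real (card {..<d}) * exp (- 1) - real (card G)) \<and>
    (\<forall>\<omega>\<in>space (gauss I) - A. \<forall>\<beta>. card {m\<in>{..<d}. \<beta> m \<noteq> 0} \<le> d \<longrightarrow>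
      sqrt (real (card G)) / 24 * L2_set \<beta> {..<d} \<le> L2_set (\<lambda>j. \<Sum>m\<in>{..<d}. \<beta> m * \<omega> ((True, j), m)) G \<and>
      L2_set (\<lambda>j. \<Sum>m\<in>{..<d}. \<beta> m * \<omega> ((True, j), m)) G \<le> 8 * sqrt (real (card G)) * L2_set \<beta> {..<d})"
    by (rule gauss_sparse_isometry[OF finI finG]) (use G i D_group in \<open>auto simp: memI\<close>)
  then obtain A where A: "A \<in> sets (gauss I)"
    "measure (gauss I) A \<le> 2 * exp (1 * (36864 * real d) + 4 * real (card {..<d}) * exp (- 1) - real (card G))"
    "\<forall>\<omega>\<in>space (gauss I) - A. \<forall>\<beta>. card {m\<in>{..<d}. \<beta> m \<noteq> 0} \<le> d \<longrightarrow>
      sqrt (real (card G)) / 24 * L2_set \<beta> {..<d} \<le> L2_set (\<lambda>j. \<Sum>m\<in>{..<d}. \<beta> m * \<omega> ((True, j), m)) G" by blast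
  have cd: "card {m\<in>{..<d}. \<beta> m \<noteq> 0} \<le> d" for \<beta> :: "nat \<Rightarrow> real"
    using card_mono[of "{..<d}" "{m\<in>{..<d}. \<beta> m \<noteq> 0}"] by auto
  have "4 * real d * exp (- 1) \<le> 4 * real d * 1" by (intro mult_left_mono) auto
  then have "1 * (36864 * real d) + 4 * real (card {..<d}) * exp (- 1) - real (card G) \<le> - real d"
    using q_bounds(4) by simp
  then have "measure (gauss I) A \<le> 2 * exp (- real d)" using A(2) by (smt (verit) exp_le_cancel_iff)
  with A(1) show ?thesis
    by (rule with_prob_at_least_of_bad[OF Om.prob_space_axioms]) (use A(3) cd in blast)
qed

text \<open>One statement for two uses: clean points with m = d and lam = r, noise with m = n and
  lam = a. The hypothesis on q exp(-lam) says that lam is large enough to control the entropy of q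
  columns.\<close>

lemma whp_cone:
  fixes m :: nat and lam :: real
  assumes m: "1 \<le> m" and lam: "1 \<le> lam" and ql: "q * exp (- lam) \<le> real m / 2"
    and b: "\<And>j k. j \<in> G \<Longrightarrow> k < m \<Longrightarrow> ((b, j), k) \<in> I"
  shows "with_prob_at_least (gauss I) (1 - 2 * exp (- real m / 2)) (\<lambda>\<omega>. \<forall>\<beta>.
      sqrt (real m) * (L2_set \<beta> G / 24 - 16000 * (sqrt lam / sqrt (real m)) * (\<Sum>j\<in>G. \<bar>\<beta> j\<bar>)) \<le>
        L2_set (\<lambda>k. \<Sum>j\<in>G. \<beta> j * \<omega> ((b, j), k)) {..<m} \<and>
      (442368 * lam \<le> real m \<longrightarrow> L2_set (\<lambda>k. \<Sum>j\<in>G. \<beta> j * \<omega> ((b, j), k)) {..<m} \<le>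
        8 * sqrt (real m) * (L2_set \<beta> G + 2000 * (sqrt lam / sqrt (real m)) * (\<Sum>j\<in>G. \<bar>\<beta> j\<bar>))))"
proof -
  \<comment> \<open>442368 = 12 * 36864, and lam + 3 \<le> 4 lam, so the first entropy term (lam +
    3) * 36864 s is at most m/3.\<close>
  define s where "s = nat \<lfloor>real m / (442368 * lam)\<rfloor>"
  have pos: "0 < 442368 * lam" "0 < real m" using lam m by auto
  show ?thesis
  proof (cases "s = 0")
    case True
    \<comment> \<open>No admissible sparsity: m is then so small that the left side of the lower
      bound is at most 0, and the premise of the upper bound fails.\<close>
    then have "real m / (442368 * lam) < 1" using pos unfolding s_def by linarith
    then have lt: "real m < 442368 * lam" using pos by (simp add: field_simps)
    have "L2_set \<beta> G / 24 \<le> 16000 * (sqrt lam / sqrt (real m)) * (\<Sum>j\<in>G. \<bar>\<beta> j\<bar>)" for \<beta>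
    proof -
      have "real m \<le> 1000000 * lam" using lt lam by simp
      then have "sqrt (real m) \<le> sqrt (1000000 * lam)" by (rule real_sqrt_le_mono)
      also have "\<dots> = 1000 * sqrt lam" using real_sqrt_mult[of 1000000 lam] by (simp add: real_sqrt_unique[of 1000])
      also have "\<dots> \<le> 16000 * sqrt lam" using lam by (intro mult_right_mono) auto
      finally have "1 \<le> 16000 * (sqrt lam / sqrt (real m))" using pos by (simp add: field_simps)
      then have "1 * (\<Sum>j\<in>G. \<bar>\<beta> j\<bar>) \<le> 16000 * (sqrt lam / sqrt (real m)) * (\<Sum>j\<in>G. \<bar>\<beta> j\<bar>)"
        by (intro mult_right_mono sum_nonneg) auto
      moreover have "L2_set \<beta> G \<le> (\<Sum>j\<in>G. \<bar>\<beta> j\<bar>)" by (rule L2_set_le_sum_abs)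
      moreover have "0 \<le> L2_set \<beta> G" by (rule L2_set_nonneg)
      ultimately show ?thesis by linarith
    qed
    then have "sqrt (real m) * (L2_set \<beta> G / 24 - 16000 * (sqrt lam / sqrt (real m)) * (\<Sum>j\<in>G. \<bar>\<beta> j\<bar>)) \<le>
        L2_set (\<lambda>k. \<Sum>j\<in>G. \<beta> j * \<omega> ((b, j), k)) {..<m}" for \<beta> \<omega>
      by (intro order_trans[OF mult_nonneg_nonpos L2_set_nonneg]) auto
    then show ?thesis
      using lt by (intro with_prob_at_least_of_bad[OF Om.prob_space_axioms, of "{}"]) auto
  next
    case False
    then have s: "0 < s" by simp
    have s_le: "real s \<le> real m / (442368 * lam)" unfolding s_def using pos by simp
    have s1: "real m / (442368 * lam) < real s + 1" unfolding s_def by linarith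
    have "1 \<le> real s" using s by simp
    then have "real m / (442368 * lam) \<le> 2 * real s" using s1 by linarith
    then have "real m \<le> 884736 * lam * real s" using pos by (simp add: field_simps)
    \<comment> \<open>884736 is twice 442368, from undoing the floor, and 941^2 exceeds it. Then 17
      * 941 \<le> 16000 and 2 * 941 \<le> 2000 give the constants of the statement.\<close>
    also have "\<dots> \<le> 941\<^sup>2 * (lam * real s)" using lam by (simp add: mult.assoc mult_right_mono)
    finally have "sqrt (real m) \<le> sqrt (941\<^sup>2 * (lam * real s))" by (rule real_sqrt_le_mono)
    then have "sqrt (real m) \<le> 941 * (sqrt lam * sqrt (real s))" by (simp add: real_sqrt_mult)
    then have sq: "1 / sqrt (real s) \<le> 941 * (sqrt lam / sqrt (real m))" using s m by (simp add: field_simps)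
    obtain A where A: "A \<in> sets (gauss I)"
      "measure (gauss I) A \<le> 2 * exp ((lam + 3) * (36864 * real s) + 4 * real (card G) * exp (- (lam + 3)) - real (card {..<m}))"
      "\<forall>\<omega>\<in>space (gauss I) - A. \<forall>\<beta>.
      sqrt (real (card {..<m})) * (L2_set \<beta> G / 24 - 17 * (\<Sum>j\<in>G. \<bar>\<beta> j\<bar>) / sqrt (real s)) \<le> L2_set (\<lambda>k. \<Sum>j\<in>G. \<beta> j * \<omega> ((b, j), k)) {..<m} \<and>
      L2_set (\<lambda>k. \<Sum>j\<in>G. \<beta> j * \<omega> ((b, j), k)) {..<m} \<le> 8 * sqrt (real (card {..<m})) * (L2_set \<beta> G + 2 * (\<Sum>j\<in>G. \<bar>\<beta> j\<bar>) / sqrt (real s))"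
      using gauss_cone_isometry[OF finI finite_lessThan finG, of m "\<lambda>k j. ((b, j), k)" "lam + 3" s] b lam s by auto
    have "(lam + 3) * (36864 * real s) \<le> (4 * lam) * (36864 * (real m / (442368 * lam)))"
      using lam s_le by (intro mult_mono) auto
    also have "\<dots> = real m / 3" using lam by simp
    finally have e1: "(lam + 3) * (36864 * real s) \<le> real m / 3" .
    \<comment> \<open>The shift by 3 in lam + 3 makes the second entropy term at most 2 m / 13;
      together with m/3 it is below m/2.\<close>
    have "13 \<le> exp (3::real)"
    proof -
      have "(3.625::real) \<le> 1 + 1.5 + 1.5\<^sup>2 / 2" by (simp add: power2_eq_square)
      also have "\<dots> \<le> exp 1.5" by (rule exp_lower_Taylor_quadratic) simp
      finally have "(3.625::real)\<^sup>2 \<le> (exp 1.5)\<^sup>2" by (intro power_mono) auto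
      also have "(exp 1.5 :: real)\<^sup>2 = exp 3" by (simp add: exp_double[symmetric])
      finally show ?thesis by (simp add: power2_eq_square)
    qed
    then have e3: "exp (- 3 :: real) \<le> 1 / 13" by (simp add: exp_minus field_simps)
    have "4 * q * exp (- (lam + 3)) = 4 * (q * exp (- lam)) * exp (- 3)" by (simp add: exp_add[symmetric] mult.assoc)
    also have "\<dots> \<le> 4 * (real m / 2) * (1 / 13)" using ql e3 by (intro mult_mono) auto
    finally have "(lam + 3) * (36864 * real s) + 4 * real (card G) * exp (- (lam + 3)) - real (card {..<m}) \<le> - real m / 2"
      using e1 by simp
    then have "measure (gauss I) A \<le> 2 * exp (- real m / 2)" using A(2) by (smt (verit) exp_le_cancel_iff)
    with A(1) show ?thesis
    proof (rule with_prob_at_least_of_bad[OF Om.prob_space_axioms], intro allI)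
      fix \<omega> :: "(bool \<times> nat) \<times> nat \<Rightarrow> real" and \<beta> :: "nat \<Rightarrow> real" assume om: "\<omega> \<in> space (gauss I) - A"
      define l where "l = (\<Sum>j\<in>G. \<bar>\<beta> j\<bar>)"
      have l: "0 \<le> l" by (simp add: l_def sum_nonneg)
      define t where "t = sqrt lam / sqrt (real m)"
      have t: "0 \<le> t" using lam by (simp add: t_def)
      have ls: "l / sqrt (real s) \<le> 941 * t * l" using mult_right_mono[OF sq l] by (simp add: t_def)
      have "0 \<le> t * l" using t l by simp
      then have "17 * l / sqrt (real s) \<le> 16000 * t * l" "2 * l / sqrt (real s) \<le> 2000 * t * l"
        using ls by (simp_all add: mult.assoc)
      then have "sqrt (real m) * (L2_set \<beta> G / 24 - 16000 * t * l) \<le> sqrt (real m) * (L2_set \<beta> G / 24 - 17 * l / sqrt (real s))"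
        "8 * sqrt (real m) * (L2_set \<beta> G + 2 * l / sqrt (real s)) \<le> 8 * sqrt (real m) * (L2_set \<beta> G + 2000 * t * l)"
        by (auto intro!: mult_left_mono)
      moreover have "sqrt (real m) * (L2_set \<beta> G / 24 - 17 * l / sqrt (real s)) \<le> L2_set (\<lambda>k. \<Sum>j\<in>G. \<beta> j * \<omega> ((b, j), k)) {..<m}"
        "L2_set (\<lambda>k. \<Sum>j\<in>G. \<beta> j * \<omega> ((b, j), k)) {..<m} \<le> 8 * sqrt (real m) * (L2_set \<beta> G + 2 * l / sqrt (real s))"
        using A(3) om unfolding l_def by auto
      ultimately show "sqrt (real m) * (L2_set \<beta> G / 24 - 16000 * (sqrt lam / sqrt (real m)) * (\<Sum>j\<in>G. \<bar>\<beta> j\<bar>)) \<le>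
        L2_set (\<lambda>k. \<Sum>j\<in>G. \<beta> j * \<omega> ((b, j), k)) {..<m} \<and>
      (442368 * lam \<le> real m \<longrightarrow> L2_set (\<lambda>k. \<Sum>j\<in>G. \<beta> j * \<omega> ((b, j), k)) {..<m} \<le>
        8 * sqrt (real m) * (L2_set \<beta> G + 2000 * (sqrt lam / sqrt (real m)) * (\<Sum>j\<in>G. \<bar>\<beta> j\<bar>)))"
        unfolding t_def l_def by linarith
    qed
  qed
qed

lemma exp_12: "exp (- 12 * a) = 1 / real N ^ 12"
  using exp_of_nat_mult[of 12 "- a"] by (simp add: exp_a power_one_over)

text \<open>A random direction meets each row of \<open>M\<close> in at most \<tau> times the norm
  of that row. Squaring and adding gives \<tau>^2 times the Frobenius norm, and the affinity bound
  turns min(d, D j) \<tau>^2 into order 1/a.\<close>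

lemma whp_projection:
  assumes j: "j < N" "j \<notin> insert i G"
  shows "with_prob_at_least (gauss I) (1 - real d * (2 / real N ^ 12)) (\<lambda>\<omega>. L2_set (xf \<omega> j) {..<d} \<le> 5 / 10^5 / sqrt a)"
proof -
  define Dj where "Dj = real (D j)"
  have Dj: "0 < Dj" using D[OF j(1)] by (simp add: Dj_def)
  \<comment> \<open>Makes the exponent D j \<tau>^2 / 2 equal to 12 a, so that each row fails with
    probability at most 2/N^12.\<close>
  define \<tau> where "\<tau> = sqrt (24 * a / Dj)"
  have tau: "0 \<le> \<tau>" "\<tau>\<^sup>2 = 24 * a / Dj" using a1 Dj by (auto simp: \<tau>_def)
  have "with_prob_at_least (gauss I) (1 - 2 / real N ^ 12) (\<lambda>\<omega>. \<bar>\<Sum>r<D j. M j m r * \<omega> ((True, j), r)\<bar> \<le>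
      \<tau> * L2_set (M j m) {..<D j} * L2_set (\<lambda>r. \<omega> ((True, j), r)) {..<D j})" for m
  proof -
    have D0: "{..<D j} \<noteq> {}" using D[OF j(1)] by (simp add: lessThan_empty_iff)
    have e: "inj_on (\<lambda>r. ((True, j), r)) {..<D j}" "(\<lambda>r. ((True, j), r)) ` {..<D j} \<subseteq> I"
      using j by (auto simp: inj_on_def memI)
    note P = prob_gauss_direction[OF finI finite_lessThan D0 e tau(1), of "M j m"]
    have "real (card {..<D j}) * \<tau>\<^sup>2 / 2 = 12 * a" using Dj by (simp add: tau Dj_def)
    then have "2 * exp (- (real (card {..<D j}) * \<tau>\<^sup>2 / 2)) = 2 / real N ^ 12"
      using exp_12 by simp
    then show ?thesis
      by (intro with_prob_at_least_of_bad[OF Om.prob_space_axioms P(1)]) (use P(2) in \<open>auto simp: not_less\<close>)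
  qed
  from with_prob_at_least_ball[OF Om.prob_space_axioms finite_lessThan this, of d]
  have "with_prob_at_least (gauss I) (1 - real d * (2 / real N ^ 12)) (\<lambda>\<omega>. \<forall>m\<in>{..<d}. \<bar>\<Sum>r<D j. M j m r * \<omega> ((True, j), r)\<bar> \<le>
      \<tau> * L2_set (M j m) {..<D j} * L2_set (\<lambda>r. \<omega> ((True, j), r)) {..<D j})" by simp
  then show ?thesis
  proof (rule with_prob_at_least_mono)
    fix \<omega>
    define R where "R = L2_set (\<lambda>r. \<omega> ((True, j), r)) {..<D j}"
    assume "\<forall>m\<in>{..<d}. \<bar>\<Sum>r<D j. M j m r * \<omega> ((True, j), r)\<bar> \<le>
      \<tau> * L2_set (M j m) {..<D j} * L2_set (\<lambda>r. \<omega> ((True, j), r)) {..<D j}"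
    then have h: "\<bar>\<Sum>r<D j. M j m r * \<omega> ((True, j), r)\<bar> \<le> \<tau> * L2_set (M j m) {..<D j} * R" if "m < d" for m
      using that by (simp add: R_def)
    have R: "0 \<le> R" by (simp add: R_def)
    have x: "\<bar>xf \<omega> j m\<bar> \<le> \<tau> * L2_set (M j m) {..<D j}" if m: "m < d" for m
    proof (cases "R = 0")
      case True
      then show ?thesis using tau by (simp add: xf_def R_def)
    next
      case False
      then have R: "0 < R" using R by simp
      have "\<bar>xf \<omega> j m\<bar> = \<bar>\<Sum>r<D j. M j m r * \<omega> ((True, j), r)\<bar> / R" using R by (simp add: xf_def R_def abs_divide)
      also have "\<dots> \<le> \<tau> * L2_set (M j m) {..<D j}" using h[OF m] R by (simp add: field_simps)
      finally show ?thesis .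
    qed
    have "(\<Sum>m<d. (xf \<omega> j m)\<^sup>2) \<le> (\<Sum>m<d. (\<tau> * L2_set (M j m) {..<D j})\<^sup>2)"
      using x by (intro sum_mono) (metis abs_ge_zero lessThan_iff power2_abs power_mono)
    also have "\<dots> = \<tau>\<^sup>2 * (\<Sum>m<d. \<Sum>r<D j. (M j m r)\<^sup>2)"
      by (simp add: power_mult_distrib L2_set_power2 sum_distrib_left)
    also have "\<dots> \<le> \<tau>\<^sup>2 * (real (min d (D j)) * (1 / 10^5 / a)\<^sup>2)" by (intro mult_left_mono frob j) auto
    also have "\<dots> \<le> \<tau>\<^sup>2 * (Dj * (1 / 10^5 / a)\<^sup>2)" by (intro mult_left_mono mult_right_mono) (auto simp: Dj_def)
    also have "\<dots> = 24 / 10^10 / a" unfolding tau(2) using Dj a1 by (simp add: power2_eq_square)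
    also have "\<dots> \<le> 25 / 10^10 / a" using a1 by (intro divide_right_mono) auto
    also have "\<dots> = (5 / 10^5 / sqrt a)\<^sup>2" using a1 by (simp add: power_divide)
    finally show "L2_set (xf \<omega> j) {..<d} \<le> 5 / 10^5 / sqrt a" using a1 by (intro L2_set_leI) auto
  qed simp
qed

lemma whp_noise_projection:
  assumes j: "j < N"
  shows "with_prob_at_least (gauss I) (1 - real d * (2 / real N ^ 12)) (\<lambda>\<omega>. L2_set (zf \<omega> j) {..<d} \<le> 1 / 10^5 / sqrt a)"
proof -
  have "with_prob_at_least (gauss I) (1 - 2 / real N ^ 12) (\<lambda>\<omega>. (\<Sum>k<n. p m k * \<omega> ((False, j), k))\<^sup>2 \<le> 32 * a)" if m: "m < d" for m
  proof -
    have mn: "m < n" using m n_large by simp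
    have c: "(\<Sum>k\<in>{..<n}. (p m k)\<^sup>2) = 1" using p mn by (simp add: orthonormal_def ip_def power2_eq_square)
    \<comment> \<open>For one standard normal variable, \<theta> = 3/8 gives the moment factor 2,
      and the threshold 32 a gives the exponent 12 a.\<close>
    define A where "A = {\<omega>\<in>space (gauss I). (3/8) * (32 * a) \<le> (3/8) * (\<Sum>l\<in>{0::nat}. (\<Sum>k\<in>{..<n}. p m k * \<omega> ((False, j), k))\<^sup>2)}"
    have A: "A \<in> sets (gauss I)" unfolding A_def
      by (rule prob_chi_square_ge(1)[OF finI _ _ _ _ c, where e="\<lambda>l k. ((False, j), k)"]) (use j in \<open>auto simp: memI\<close>)
    have "measure (gauss I) A \<le> (1 / sqrt (1 - 2 * (3/8))) ^ card {0::nat} * exp (- (3/8) * (32 * a))"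
      unfolding A_def
      by (rule prob_chi_square_ge(2)[OF finI _ _ _ _ c, where e="\<lambda>l k. ((False, j), k)"]) (use j in \<open>auto simp: memI\<close>)
    also have "(1 / sqrt (1 - 2 * (3/8))) ^ card {0::nat} = 2" by (simp add: real_sqrt_divide)
    also have "2 * exp (- (3/8) * (32 * a)) = 2 / real N ^ 12" using exp_12 by simp
    finally show ?thesis
      by (intro with_prob_at_least_of_bad[OF Om.prob_space_axioms A]) (auto simp: A_def)
  qed
  then have "with_prob_at_least (gauss I) (1 - real (card {..<d}) * (2 / real N ^ 12)) (\<lambda>\<omega>. \<forall>m\<in>{..<d}. (\<Sum>k<n. p m k * \<omega> ((False, j), k))\<^sup>2 \<le> 32 * a)"
    by (intro with_prob_at_least_ball[OF Om.prob_space_axioms]) auto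
  then show ?thesis
  proof (rule with_prob_at_least_mono)
    fix \<omega> assume h: "\<forall>m\<in>{..<d}. (\<Sum>k<n. p m k * \<omega> ((False, j), k))\<^sup>2 \<le> 32 * a"
    have "(\<Sum>m<d. (zf \<omega> j m)\<^sup>2) = (\<Sum>m<d. \<sigma>\<^sup>2 / real n * (\<Sum>k<n. p m k * \<omega> ((False, j), k))\<^sup>2)"
      by (simp add: zf_def power_mult_distrib power_divide)
    also have "\<dots> \<le> (\<Sum>m<d. \<sigma>\<^sup>2 / real n * (32 * a))" using h by (intro sum_mono mult_left_mono) auto
    also have "\<dots> = \<sigma>\<^sup>2 * (32 * (real d * a / real n))" by simp
    also have "\<dots> \<le> 1 * (32 * (1 / 10^30 / a))"
    proof (intro mult_mono)
      show "\<sigma>\<^sup>2 \<le> 1" using sig by (simp add: power_le_one)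
      have "real d * a\<^sup>2 / real n \<le> 1 / 10^30" using dim_small n_large by (simp add: field_simps)
      then show "real d * a / real n \<le> 1 / 10^30 / a" using a1 by (simp add: field_simps power2_eq_square)
    qed (use a1 in auto)
    also have "\<dots> = 32 / 10^30 / a" by simp
    also have "\<dots> \<le> 1 / 10^10 / a" using a1 by (intro divide_right_mono) auto
    also have "\<dots> = (1 / 10^5 / sqrt a)\<^sup>2" using a1 by (simp add: power_divide)
    finally show "L2_set (zf \<omega> j) {..<d} \<le> 1 / 10^5 / sqrt a" using a1 by (intro L2_set_leI) auto
  qed simp
qed

lemma group_mem:
  assumes "j \<in> insert i G"
  shows "j < N" "D j = d" "\<And>k. k < d \<Longrightarrow> ((True, j), k) \<in> I" "\<And>k. k < n \<Longrightarrow> ((False, j), k) \<in> I"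
  using assms i G D_group by (auto simp: memI)

lemma yf_group: "yf \<omega> j m = rotated_data n p d \<sigma> \<omega> j m" if j: "j \<in> insert i G" and m: "m < n"
proof -
  have "(\<Sum>r<d. M j m r * \<omega> ((True, j), r)) = (\<Sum>r<d. if m = r then \<omega> ((True, j), r) else 0)"
    using M_group[OF j m] by (intro sum.cong) auto
  also have "\<dots> = (if m < d then \<omega> ((True, j), m) else 0)" by simp
  finally show ?thesis by (simp add: yf_def xf_def zf_def rotated_data_def D_group[OF j])
qed

text \<open>Bounds the norm of the whole path: 3 * 10^12 from the perpendicular part plus 210 from
  the part in the subspace, rounded up.\<close>

definition \<Lambda> :: real where "\<Lambda> = 4 * 10^12 * sqrt (real d * r)"

text \<open>A point outside the group is independent of it, so its data play the role of the fixed
  vector in \<open>prob_gauss_cross_le\<close>.\<close>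

lemma whp_cross:
  assumes j: "j < N" "j \<notin> insert i G" and Q: "Q \<subseteq> {..<n}" "Q \<noteq> {}" "Q \<subseteq> {..<d} \<or> Q \<inter> {..<d} = {}" and L: "0 < L"
  shows "with_prob_at_least (gauss I) (1 - 1 / real N ^ 6) (\<lambda>\<omega>. \<forall>t\<in>\<rat>. 0 < t \<longrightarrow>
    L2_set (lasso_path n (rotated_data n p d \<sigma> \<omega>) i G t) {..<n} \<le> \<Lambda> \<longrightarrow>
    L2_set (lasso_path n (rotated_data n p d \<sigma> \<omega>) i G t) Q \<le> L \<longrightarrow>
    \<bar>\<Sum>m\<in>Q. yf \<omega> j m * lasso_path n (rotated_data n p d \<sigma> \<omega>) i G t m\<bar> \<le> (L * sqrt (24 * a / real (card Q)) + 1/16) * L2_set (yf \<omega> j) Q)"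
proof -
  have fQ: "finite Q" using Q finite_subset by auto
  then have cQ: "0 < real (card Q)" using Q by (simp add: card_gt_0_iff)
  \<comment> \<open>Again chosen to make the exponent of the sign count 12 a.\<close>
  define \<eta> where "\<eta> = L * sqrt (24 * a / real (card Q))"
  have eta: "0 \<le> \<eta>" using L a1 by (simp add: \<eta>_def)
  have comp: "(\<lambda>\<omega>. \<omega> k) \<in> borel_measurable (gauss I)" if "k \<in> I" for k
    using measurable_component_singleton[OF that, of "\<lambda>_. std_normal"] by simp
  have vm: "(\<lambda>\<omega>. yf \<omega> j m) \<in> borel_measurable (gauss I)" if "m \<in> Q" for m
    unfolding yf_def xf_def zf_def using j
    by (intro borel_measurable_add borel_measurable_divide borel_measurable_sum borel_measurable_times borel_measurable_const
      borel_measurable_L2_set comp) (auto simp: memI)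
  have vi: "yf \<omega> j m = yf \<omega>' j m"
    if h: "\<And>k. k \<in> I - (SIGMA b : UNIV \<times> insert i G. {..<if fst b then d else n}) \<Longrightarrow> \<omega> k = \<omega>' k" for \<omega> \<omega>' m
  proof -
    have e1: "\<omega> ((True, j), k) = \<omega>' ((True, j), k)" if "k < D j" for k using j that by (intro h) (auto simp: memI)
    have e2: "\<omega> ((False, j), k) = \<omega>' ((False, j), k)" if "k < n" for k using j that by (intro h) (auto simp: memI)
    have "L2_set (\<lambda>r. \<omega> ((True, j), r)) {..<D j} = L2_set (\<lambda>r. \<omega>' ((True, j), r)) {..<D j}"
      by (intro L2_set_cong) (auto simp: e1)
    moreover have "(\<Sum>r<D j. M j m r * \<omega> ((True, j), r)) = (\<Sum>r<D j. M j m r * \<omega>' ((True, j), r))"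
      by (intro sum.cong) (auto simp: e1)
    moreover have "(\<Sum>k<n. p m k * \<omega> ((False, j), k)) = (\<Sum>k<n. p m k * \<omega>' ((False, j), k))"
      by (intro sum.cong) (auto simp: e2)
    ultimately show ?thesis by (simp add: yf_def xf_def zf_def)
  qed
  have sub: "(SIGMA b : UNIV \<times> insert i G. {..<if fst b then d else n}) \<subseteq> I"
    using group_mem by (auto split: if_splits)
  define A where "A = {\<omega>\<in>space (gauss I). \<exists>t\<in>\<rat>. 0 < t \<and> L2_set (lasso_path n (rotated_data n p d \<sigma> \<omega>) i G t) {..<n} \<le> \<Lambda> \<and>
      L2_set (lasso_path n (rotated_data n p d \<sigma> \<omega>) i G t) Q \<le> L \<and>
      (\<eta> + 1/16) * L2_set (yf \<omega> j) Q < \<bar>\<Sum>m\<in>Q. yf \<omega> j m * lasso_path n (rotated_data n p d \<sigma> \<omega>) i G t m\<bar>}"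
  note C = prob_gauss_cross_le[OF finI finG n_large(4) p Q L eta sub, where v="\<lambda>\<omega>. yf \<omega> j" and \<Lambda>'=\<Lambda> and \<sigma>=\<sigma>]
  have P1: "A \<in> sets (gauss I)" unfolding A_def by (rule C(1)) (erule vm, rule vi, blast)
  have P2: "measure (gauss I) A \<le> (256 * \<Lambda>\<^sup>2 + 1) * (2 * exp (- (real (card Q) * \<eta>\<^sup>2 / (2 * L\<^sup>2))))"
    unfolding A_def by (rule C(2)) (erule vm, rule vi, blast)
  have "real (card Q) * \<eta>\<^sup>2 / (2 * L\<^sup>2) = 12 * a"
    using L cQ a1 by (simp add: \<eta>_def power_mult_distrib)
  then have ex: "exp (- (real (card Q) * \<eta>\<^sup>2 / (2 * L\<^sup>2))) = 1 / real N ^ 12" using exp_12 by simp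
  \<comment> \<open>The size of the net is of order 10^28 d r \<le> 10^28 N^2. Since N \<ge> 10^8,
    four powers of N pay for the numerical factor, and N^-6 remains.\<close>
  have "(256 * \<Lambda>\<^sup>2 + 1) * (2 * (1 / real N ^ 12)) \<le> 1 / real N ^ 6"
  proof -
    have "0 < real N" using i by simp
    then have "a \<le> real N" using ln_le_minus_one[of "real N"] unfolding a_def by linarith
    then have "real d * r \<le> real N * real N" using N_large r_le by (intro mult_mono) auto
    then have "\<Lambda>\<^sup>2 \<le> 16 * 10^24 * (real N)\<^sup>2"
      using r_le by (simp add: \<Lambda>_def power_mult_distrib power2_eq_square)
    moreover have "1 \<le> (real N)\<^sup>2" using N_large(1) by (intro one_le_power) simp
    ultimately have "(256 * \<Lambda>\<^sup>2 + 1) * 2 \<le> (10^8)^4 * (real N)\<^sup>2" by simp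
    also have "\<dots> \<le> real N ^ 4 * (real N)\<^sup>2" using N_large(1) by (intro mult_right_mono power_mono) auto
    also have "\<dots> = real N ^ 6" by (simp flip: power_add)
    finally have "(256 * \<Lambda>\<^sup>2 + 1) * 2 / real N ^ 12 \<le> real N ^ 6 / real N ^ 12" by (intro divide_right_mono) auto
    also have "real N ^ 6 / real N ^ 12 = 1 / real N ^ 6" using N_large(1) by (simp add: field_simps flip: power_add)
    finally show ?thesis by simp
  qed
  then have "measure (gauss I) A \<le> 1 / real N ^ 6"
    using P2 unfolding ex by linarith
  with P1 show ?thesis
    by (rule with_prob_at_least_of_bad[OF Om.prob_space_axioms]) (auto simp: not_less A_def \<eta>_def)
qed

lemma L2_set_abs_mono:
  fixes f g :: "nat \<Rightarrow> real"
  assumes "\<And>j. j \<in> A \<Longrightarrow> \<bar>f j\<bar> \<le> \<bar>g j\<bar>"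
  shows "L2_set f A \<le> L2_set g A"
  unfolding L2_set_def using assms by (intro real_sqrt_le_mono sum_mono) (simp add: abs_le_square_iff)

text \<open>Dividing by norms between sqrt d / 6 and 4 sqrt d transfers the Gaussian bounds to unit
  vectors: 96 = 24 * 4, and 100000 exceeds 16000 * 6. For the noise 16000 = 8 * 2000, and the scale
  \<sigma>/sqrt n cancels sqrt n.\<close>

lemma conditioned:
  assumes R: "\<And>j. j \<in> insert i G \<Longrightarrow> sqrt (real d) / 6 \<le> L2_set (\<lambda>r. \<omega> ((True, j), r)) {..<d} \<and>
      L2_set (\<lambda>r. \<omega> ((True, j), r)) {..<d} \<le> 4 * sqrt (real d)"
    and frame: "\<And>w. sqrt q / 24 * L2_set w {..<d} \<le> L2_set (\<lambda>j. \<Sum>m<d. w m * \<omega> ((True, j), m)) G"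
    and cone: "\<And>\<beta>. sqrt (real d) * (L2_set \<beta> G / 24 - 16000 * (sqrt r / sqrt (real d)) * (\<Sum>j\<in>G. \<bar>\<beta> j\<bar>)) \<le>
        L2_set (\<lambda>k. \<Sum>j\<in>G. \<beta> j * \<omega> ((True, j), k)) {..<d}"
    and zcone: "\<And>\<beta>. L2_set (\<lambda>k. \<Sum>j\<in>G. \<beta> j * \<omega> ((False, j), k)) {..<n} \<le>
        8 * sqrt (real n) * (L2_set \<beta> G + 2000 * (sqrt a / sqrt (real n)) * (\<Sum>j\<in>G. \<bar>\<beta> j\<bar>))"
    and zi: "L2_set (zf \<omega> i) {..<n} \<le> 1.5 * \<sigma>"
  defines "x \<equiv> \<lambda>j m. if m < d then \<omega> ((True, j), m) / L2_set (\<lambda>r. \<omega> ((True, j), r)) {..<d} else 0"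
  shows "conditioned_group n d G i x (zf \<omega>) \<sigma> a r"
proof -
  define Rj where "Rj j = L2_set (\<lambda>r. \<omega> ((True, j), r)) {..<d}" for j
  have sd: "0 < sqrt (real d)" using d by simp
  have Rj: "sqrt (real d) / 6 \<le> Rj j" "Rj j \<le> 4 * sqrt (real d)" "0 < Rj j" if "j \<in> insert i G" for j
    using R[OF that] sd unfolding Rj_def[symmetric] by linarith+
  show ?thesis
  proof
    show "x j k = 0" if "d \<le> k" for j k using that by (simp add: x_def)
    have Rd: "x j m = (if m < d then \<omega> ((True, j), m) / Rj j else 0)" for j m by (simp add: x_def Rj_def)
    show "L2_set (x i) {..<n} = 1"
    proof -
      have "L2_set (x i) {..<n} = L2_set (x i) {..<d}"
        unfolding L2_set_def using n_large(4) by (intro arg_cong[where f=sqrt] sum.mono_neutral_right) (auto simp: x_def)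
      also have "\<dots> = L2_set (\<lambda>m. (1 / Rj i) * \<omega> ((True, i), m)) {..<d}" by (intro L2_set_cong) (auto simp: Rd)
      also have "\<dots> = \<bar>1 / Rj i\<bar> * Rj i" unfolding L2_set_scale Rj_def ..
      also have "\<dots> = 1" using Rj(3)[of i] by simp
      finally show ?thesis .
    qed
    show "1/96 * (sqrt q / sqrt (real d)) * L2_set w {..<d} \<le> L2_set (\<lambda>j. ip d (x j) w) G" for w
    proof -
      have "1/96 * (sqrt q / sqrt (real d)) * L2_set w {..<d} = 1 / (4 * sqrt (real d)) * (sqrt q / 24 * L2_set w {..<d})" by simp
      also have "\<dots> \<le> 1 / (4 * sqrt (real d)) * L2_set (\<lambda>j. \<Sum>m<d. w m * \<omega> ((True, j), m)) G"
        by (intro mult_left_mono frame) auto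
      also have "\<dots> = L2_set (\<lambda>j. 1 / (4 * sqrt (real d)) * (\<Sum>m<d. w m * \<omega> ((True, j), m))) G"
        using sd L2_set_scale[of "1 / (4 * sqrt (real d))" "\<lambda>j. \<Sum>m<d. w m * \<omega> ((True, j), m)" G] by simp
      also have "\<dots> \<le> L2_set (\<lambda>j. ip d (x j) w) G"
      proof (rule L2_set_abs_mono)
        fix j assume j: "j \<in> G"
        have "ip d (x j) w = 1 / Rj j * (\<Sum>m<d. w m * \<omega> ((True, j), m))"
          unfolding ip_def sum_distrib_left by (intro sum.cong) (auto simp: Rd)
        moreover have "1 / (4 * sqrt (real d)) \<le> 1 / Rj j" using Rj(2,3)[of j] j sd by (intro divide_left_mono mult_pos_pos) simp_all
        ultimately show "\<bar>1 / (4 * sqrt (real d)) * (\<Sum>m<d. w m * \<omega> ((True, j), m))\<bar> \<le> \<bar>ip d (x j) w\<bar>"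
          using mult_right_mono[of "1 / (4 * sqrt (real d))" "1 / Rj j" "\<bar>\<Sum>m<d. w m * \<omega> ((True, j), m)\<bar>"] Rj(3)[of j] j sd
          by (simp add: abs_mult abs_divide)
      qed
      finally show ?thesis .
    qed
    show "L2_set \<beta> G / 96 - 100000 * (sqrt r / sqrt (real d)) * (\<Sum>j\<in>G. \<bar>\<beta> j\<bar>) \<le> L2_set (\<lambda>k. \<Sum>j\<in>G. \<beta> j * x j k) {..<n}" for \<beta>
    proof -
      define b where "b j = \<beta> j / Rj j" for j
      define t where "t = sqrt r / sqrt (real d)"
      have t: "0 \<le> t" using r_le by (simp add: t_def)
      have "L2_set \<beta> G / (4 * sqrt (real d)) = L2_set (\<lambda>j. 1 / (4 * sqrt (real d)) * \<beta> j) G"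
        using sd L2_set_scale[of "1 / (4 * sqrt (real d))" \<beta> G] by simp
      also have "\<dots> \<le> L2_set b G"
      proof (rule L2_set_abs_mono)
        fix j assume j: "j \<in> G"
        have "1 / (4 * sqrt (real d)) \<le> 1 / Rj j" using Rj(2,3)[of j] j sd by (intro divide_left_mono mult_pos_pos) simp_all
        then have "1 / (4 * sqrt (real d)) * \<bar>\<beta> j\<bar> \<le> 1 / Rj j * \<bar>\<beta> j\<bar>" by (intro mult_right_mono) auto
        then show "\<bar>1 / (4 * sqrt (real d)) * \<beta> j\<bar> \<le> \<bar>b j\<bar>"
          using Rj(3)[of j] j sd by (simp add: b_def abs_mult abs_divide)
      qed
      finally have b2: "L2_set \<beta> G / (4 * sqrt (real d)) \<le> L2_set b G" .
      have "(\<Sum>j\<in>G. \<bar>b j\<bar>) \<le> (\<Sum>j\<in>G. 6 / sqrt (real d) * \<bar>\<beta> j\<bar>)"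
      proof (rule sum_mono)
        fix j assume j: "j \<in> G"
        have Rp: "0 < Rj j" using Rj(3)[of j] j by simp
        have "1 / Rj j \<le> 1 / (sqrt (real d) / 6)"
          using Rj(1)[of j] j sd Rp by (intro divide_left_mono mult_pos_pos) auto
        then have "1 / Rj j * \<bar>\<beta> j\<bar> \<le> 1 / (sqrt (real d) / 6) * \<bar>\<beta> j\<bar>" by (intro mult_right_mono) auto
        then show "\<bar>b j\<bar> \<le> 6 / sqrt (real d) * \<bar>\<beta> j\<bar>" using Rj(3)[of j] j by (simp add: b_def abs_divide)
      qed
      also have "\<dots> = 6 / sqrt (real d) * (\<Sum>j\<in>G. \<bar>\<beta> j\<bar>)" by (simp add: sum_distrib_left)
      finally have b1: "(\<Sum>j\<in>G. \<bar>b j\<bar>) \<le> 6 / sqrt (real d) * (\<Sum>j\<in>G. \<bar>\<beta> j\<bar>)" .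
      have "L2_set \<beta> G / 96 - 100000 * t * (\<Sum>j\<in>G. \<bar>\<beta> j\<bar>) \<le> L2_set \<beta> G / 96 - 96000 * t * (\<Sum>j\<in>G. \<bar>\<beta> j\<bar>)"
        using t by (intro diff_left_mono mult_right_mono sum_nonneg) auto
      also have "\<dots> = sqrt (real d) * (L2_set \<beta> G / (4 * sqrt (real d)) / 24 - 16000 * t * (6 / sqrt (real d) * (\<Sum>j\<in>G. \<bar>\<beta> j\<bar>)))"
        using sd by (simp add: right_diff_distrib)
      also have "\<dots> \<le> sqrt (real d) * (L2_set b G / 24 - 16000 * t * (\<Sum>j\<in>G. \<bar>b j\<bar>))"
        using b1 b2 t sd by (intro mult_left_mono diff_mono divide_right_mono) auto
      also have "\<dots> \<le> L2_set (\<lambda>k. \<Sum>j\<in>G. b j * \<omega> ((True, j), k)) {..<d}" unfolding t_def by (rule cone)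
      also have "\<dots> = L2_set (\<lambda>k. \<Sum>j\<in>G. \<beta> j * x j k) {..<d}" by (intro L2_set_cong) (auto simp: Rd b_def)
      also have "\<dots> = L2_set (\<lambda>k. \<Sum>j\<in>G. \<beta> j * x j k) {..<n}"
        unfolding L2_set_def using n_large(4) by (intro arg_cong[where f=sqrt] sum.mono_neutral_left) (auto simp: x_def)
      finally show ?thesis unfolding t_def .
    qed
    show "L2_set (\<lambda>k. \<Sum>j\<in>G. \<beta> j * zf \<omega> j k) {..<n} \<le> \<sigma> * (8 * L2_set \<beta> G + 16000 * (sqrt a / sqrt (real n)) * (\<Sum>j\<in>G. \<bar>\<beta> j\<bar>))" for \<beta>
    proof -
      have "(\<Sum>j\<in>G. \<beta> j * zf \<omega> j m) = \<sigma> / sqrt (real n) * (\<Sum>k<n. p m k * (\<Sum>j\<in>G. \<beta> j * \<omega> ((False, j), k)))" for m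
        unfolding zf_def sum_distrib_left by (subst sum.swap) (simp add: mult_ac)
      then have "L2_set (\<lambda>k. \<Sum>j\<in>G. \<beta> j * zf \<omega> j k) {..<n} = \<bar>\<sigma> / sqrt (real n)\<bar> * L2_set (\<lambda>k. \<Sum>j\<in>G. \<beta> j * \<omega> ((False, j), k)) {..<n}"
        by (simp only: zf_L2)
      also have "\<dots> \<le> \<bar>\<sigma> / sqrt (real n)\<bar> * (8 * sqrt (real n) * (L2_set \<beta> G + 2000 * (sqrt a / sqrt (real n)) * (\<Sum>j\<in>G. \<bar>\<beta> j\<bar>)))"
        by (intro mult_left_mono zcone) auto
      also have "\<dots> = \<sigma> * (8 * L2_set \<beta> G + 16000 * (sqrt a / sqrt (real n)) * (\<Sum>j\<in>G. \<bar>\<beta> j\<bar>))"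
        using sig n_large(5) by (simp add: distrib_left)
      finally show ?thesis .
    qed
  qed (use finG d n_large(4) a1 r_le sig q_bounds dim_small zi in auto)
qed

end

text \<open>The constants are linked by \<open>97 / 0.707 < 140\<close>; coefficients and \<open>t\<close> are rational to make the set of typical
  data measurable.\<close>

definition typical_data :: "nat \<Rightarrow> nat \<Rightarrow> nat \<Rightarrow> nat \<Rightarrow> nat set \<Rightarrow> real \<Rightarrow> (nat \<Rightarrow> nat \<Rightarrow> real) \<Rightarrow> bool" where
  "typical_data n N d i G \<sigma> y \<longleftrightarrow>
    (\<exists>\<beta>\<in>G \<rightarrow>\<^sub>E (\<rat> :: real set). (\<Sum>j\<in>G. \<bar>\<beta> j\<bar>) \<le> 97 * sqrt (real d) \<and> L2_set (resid y i G \<beta>) {..<n} \<le> 2 * \<sigma>) \<and>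
    2 * \<sigma> < L2_set (y i) {..<n} \<and>
    (\<forall>j\<in>{..<N} - insert i G. \<forall>t\<in>\<rat>. 0 < t \<longrightarrow> t \<le> 140 * sqrt (real d) / \<sigma> \<longrightarrow> \<bar>ip n (y j) (lasso_path n y i G t)\<bar> \<le> 1/2)"

lemma typical_data_cong:
  assumes i: "i < N" and G: "G \<subseteq> {..<N}" and eq: "\<And>j k. j < N \<Longrightarrow> k < n \<Longrightarrow> y' j k = y j k"
  shows "typical_data n N d i G \<sigma> y' \<longleftrightarrow> typical_data n N d i G \<sigma> y"
proof -
  have "L2_set (resid y' i G \<beta>) {..<n} = L2_set (resid y i G \<beta>) {..<n}" for \<beta>
    unfolding resid_def using i G eq by (intro L2_set_cong refl arg_cong2[where f="(-)"] sum.cong) auto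
  moreover have "L2_set (y' i) {..<n} = L2_set (y i) {..<n}" using i eq by (intro L2_set_cong) auto
  moreover have "ip n (y' j) (lasso_path n y' i G t) = ip n (y j) (lasso_path n y i G t)" if "j < N" for j t
    using i G eq that by (intro ip_cong lasso_path_cong) auto
  ultimately show ?thesis by (simp add: typical_data_def)
qed

text \<open>Strict inequalities survive a small rounding of the coefficients. This is why the bounds
  96 and 1.8 were proved before 97 and 2 are claimed.\<close>

lemma exists_rational_representation:
  fixes y :: "nat \<Rightarrow> nat \<Rightarrow> real"
  assumes "(\<Sum>j\<in>G. \<bar>\<beta> j\<bar>) < B" "L2_set (resid y i G \<beta>) {..<n} < C"
  shows "\<exists>\<beta>'\<in>G \<rightarrow>\<^sub>E (\<rat> :: real set). (\<Sum>j\<in>G. \<bar>\<beta>' j\<bar>) \<le> B \<and> L2_set (resid y i G \<beta>') {..<n} \<le> C"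
proof -
  define \<beta>s where "\<beta>s m = (\<lambda>j\<in>G. of_int \<lfloor>of_nat (Suc m) * \<beta> j\<rfloor> / of_nat (Suc m) :: real)" for m
  have lim: "(\<lambda>m. \<beta>s m j) \<longlonglongrightarrow> \<beta> j" if "j \<in> G" for j
    using floor_scaled_tendsto[of "\<beta> j"] that by (simp add: \<beta>s_def)
  have "(\<lambda>m. \<Sum>j\<in>G. \<bar>\<beta>s m j\<bar>) \<longlonglongrightarrow> (\<Sum>j\<in>G. \<bar>\<beta> j\<bar>)" by (intro tendsto_intros lim)
  then have e1: "\<forall>\<^sub>F m in sequentially. (\<Sum>j\<in>G. \<bar>\<beta>s m j\<bar>) < B" using assms(1) by (rule order_tendstoD)
  have "(\<lambda>m. L2_set (resid y i G (\<beta>s m)) {..<n}) \<longlonglongrightarrow> L2_set (resid y i G \<beta>) {..<n}"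
    unfolding L2_set_def resid_def by (intro tendsto_intros lim)
  then have e2: "\<forall>\<^sub>F m in sequentially. L2_set (resid y i G (\<beta>s m)) {..<n} < C" using assms(2) by (rule order_tendstoD)
  from eventually_conj[OF e1 e2] obtain m where
    m: "(\<Sum>j\<in>G. \<bar>\<beta>s m j\<bar>) < B" "L2_set (resid y i G (\<beta>s m)) {..<n} < C"
    by (auto dest: eventually_happens)
  have "\<beta>s m \<in> G \<rightarrow>\<^sub>E \<rat>" by (auto simp: \<beta>s_def)
  then show ?thesis using m by (intro bexI[of _ "\<beta>s m"]) auto
qed

section \<open>Assembling the typical event\<close>

context semirandom_coordinates
begin

text \<open>The inner product is split into the first d coordinates, contributing at most 1/8, and
  the others, contributing at most 3/8. In both blocks the a priori size of the path decides that
  the random-sign bound applies.\<close>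

lemma typical_of_conditions:
  assumes R: "\<forall>j\<in>insert i G. sqrt (real d) / 6 \<le> L2_set (\<lambda>r. \<omega> ((True, j), r)) {..<d} \<and>
      L2_set (\<lambda>r. \<omega> ((True, j), r)) {..<d} \<le> 4 * sqrt (real d)"
    and frame: "\<forall>w. sqrt q / 24 * L2_set w {..<d} \<le> L2_set (\<lambda>j. \<Sum>m<d. w m * \<omega> ((True, j), m)) G"
    and cone: "\<forall>\<beta>. sqrt (real d) * (L2_set \<beta> G / 24 - 16000 * (sqrt r / sqrt (real d)) * (\<Sum>j\<in>G. \<bar>\<beta> j\<bar>)) \<le>
        L2_set (\<lambda>k. \<Sum>j\<in>G. \<beta> j * \<omega> ((True, j), k)) {..<d}"
    and zcone: "\<forall>\<beta>. L2_set (\<lambda>k. \<Sum>j\<in>G. \<beta> j * \<omega> ((False, j), k)) {..<n} \<le>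
        8 * sqrt (real n) * (L2_set \<beta> G + 2000 * (sqrt a / sqrt (real n)) * (\<Sum>j\<in>G. \<bar>\<beta> j\<bar>))"
    and zi: "L2_set (zf \<omega> i) {..<n} \<le> 1.5 * \<sigma>"
    and zn: "\<forall>j\<in>{..<N} - insert i G. L2_set (zf \<omega> j) {..<n} \<le> 4 * \<sigma>"
    and xp: "\<forall>j\<in>{..<N} - insert i G. L2_set (xf \<omega> j) {..<d} \<le> 5 / 10^5 / sqrt a"
    and zp: "\<forall>j\<in>{..<N} - insert i G. L2_set (zf \<omega> j) {..<d} \<le> 1 / 10^5 / sqrt a"
    and par: "\<forall>j\<in>{..<N} - insert i G. \<forall>t\<in>\<rat>. 0 < t \<longrightarrow>
      L2_set (lasso_path n (rotated_data n p d \<sigma> \<omega>) i G t) {..<n} \<le> \<Lambda> \<longrightarrow>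
      L2_set (lasso_path n (rotated_data n p d \<sigma> \<omega>) i G t) {..<d} \<le> 210 * sqrt (real d) \<longrightarrow>
      \<bar>\<Sum>m<d. yf \<omega> j m * lasso_path n (rotated_data n p d \<sigma> \<omega>) i G t m\<bar> \<le>
        (210 * sqrt (real d) * sqrt (24 * a / real d) + 1/16) * L2_set (yf \<omega> j) {..<d}"
    and perp: "\<forall>j\<in>{..<N} - insert i G. \<forall>t\<in>\<rat>. 0 < t \<longrightarrow>
      L2_set (lasso_path n (rotated_data n p d \<sigma> \<omega>) i G t) {..<n} \<le> \<Lambda> \<longrightarrow>
      L2_set (lasso_path n (rotated_data n p d \<sigma> \<omega>) i G t) {d..<n} \<le> 3 * 10^12 * sqrt (real d * r) \<longrightarrow>
      \<bar>\<Sum>m\<in>{d..<n}. yf \<omega> j m * lasso_path n (rotated_data n p d \<sigma> \<omega>) i G t m\<bar> \<le>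
        (3 * 10^12 * sqrt (real d * r) * sqrt (24 * a / real (n - d)) + 1/16) * L2_set (yf \<omega> j) {d..<n}"
  shows "typical_data n N d i G \<sigma> (yf \<omega>)"
proof -
  define y where "y = rotated_data n p d \<sigma> \<omega>"
  define x where "x = (\<lambda>j m. if m < d then \<omega> ((True, j), m) / L2_set (\<lambda>r. \<omega> ((True, j), r)) {..<d} else 0)"
  interpret C: conditioned_group n d G i x "zf \<omega>" \<sigma> a r
    unfolding x_def using R frame cone zcone zi by (intro conditioned) auto
  have yC: "C.y = y"
  proof (intro ext)
    show "C.y j m = y j m" for j m unfolding C.y_def y_def rotated_data_def zf_def by (simp add: x_def)
  qed
  have yg: "yf \<omega> j m = y j m" if "j \<in> insert i G" "m < n" for j m
    unfolding y_def by (rule yf_group[OF that])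
  have sd: "1 \<le> sqrt (real d)" using d by simp
  have path: "lasso_path n (yf \<omega>) i G t m = lasso_path n y i G t m" if "m < n" for t m
    by (rule lasso_path_cong[OF yg that])
  show ?thesis unfolding typical_data_def
  proof (intro conjI ballI impI)
    obtain \<beta> where b: "(\<Sum>j\<in>G. \<bar>\<beta> j\<bar>) \<le> 96 * sqrt (real d)" "L2_set (resid y i G \<beta>) {..<n} \<le> 1.8 * \<sigma>"
      using C.exists_sparse_representation unfolding yC by blast
    have "L2_set (resid (yf \<omega>) i G \<beta>) {..<n} = L2_set (resid y i G \<beta>) {..<n}"
      by (intro L2_set_cong) (auto simp: resid_def yg)
    then have b2: "L2_set (resid (yf \<omega>) i G \<beta>) {..<n} < 2 * \<sigma>" using b(2) sig by simp
    have b1: "(\<Sum>j\<in>G. \<bar>\<beta> j\<bar>) < 97 * sqrt (real d)" using b(1) sd by linarith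
    show "\<exists>\<beta>\<in>G \<rightarrow>\<^sub>E \<rat>. (\<Sum>j\<in>G. \<bar>\<beta> j\<bar>) \<le> 97 * sqrt (real d) \<and> L2_set (resid (yf \<omega>) i G \<beta>) {..<n} \<le> 2 * \<sigma>"
      by (rule exists_rational_representation[OF b1 b2])
    have "L2_set (yf \<omega> i) {..<n} = L2_set (y i) {..<n}" by (intro L2_set_cong) (auto simp: yg)
    then show "2 * \<sigma> < L2_set (yf \<omega> i) {..<n}" using C.y_self(2) sig unfolding yC by simp
  next
    fix j t assume j: "j \<in> {..<N} - insert i G" and t: "t \<in> \<rat>" "0 < t" "t \<le> 140 * sqrt (real d) / \<sigma>"
    define u where "u = lasso_path n y i G t"
    have up: "L2_set u {d..<n} \<le> 3 * 10^12 * sqrt (real d * r)" "L2_set u {..<d} \<le> 210 * sqrt (real d)"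
      using C.lasso_path_perp_le[OF t(2,3)] C.lasso_path_par_le[OF t(2,3)] unfolding yC u_def by auto
    have split: "{..<n} = {..<d} \<union> {d..<n}" "{..<d} \<inter> {d..<n} = {}" using n_large(4) by auto
    have un: "L2_set u {..<n} \<le> \<Lambda>"
    proof -
      have "L2_set u {..<n} \<le> L2_set u {..<d} + L2_set u {d..<n}"
      proof (rule L2_set_leI)
        have "(\<Sum>k<n. (u k)\<^sup>2) = (L2_set u {..<d})\<^sup>2 + (L2_set u {d..<n})\<^sup>2"
          unfolding L2_set_power2 split(1) by (rule sum.union_disjoint) auto
        then show "(\<Sum>k<n. (u k)\<^sup>2) \<le> (L2_set u {..<d} + L2_set u {d..<n})\<^sup>2"
          by (simp add: power2_sum)
      qed simp
      also have "\<dots> \<le> 210 * sqrt (real d * r) + 3 * 10^12 * sqrt (real d * r)"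
      proof (rule add_mono[OF order_trans[OF up(2)] up(1)])
        have "real d * 1 \<le> real d * r" using r_le by (intro mult_left_mono) auto
        then show "210 * sqrt (real d) \<le> 210 * sqrt (real d * r)" by simp
      qed
      also have "\<dots> \<le> \<Lambda>"
      proof -
        have "0 \<le> sqrt (real d * r)" using r_le by simp
        then show ?thesis unfolding \<Lambda>_def by simp
      qed
      finally show ?thesis .
    qed
    have sa: "1 \<le> sqrt a" using a1 by simp
    \<comment> \<open>The dimension cancels: 210 sqrt d * sqrt(24 a / d) is at most 1050 sqrt a, and
      the projection of y_j is at most 6 * 10^-5 / sqrt a.\<close>
    have P1: "\<bar>\<Sum>m<d. yf \<omega> j m * u m\<bar> \<le> 1/8"
    proof -
      have "L2_set (yf \<omega> j) {..<d} \<le> L2_set (xf \<omega> j) {..<d} + L2_set (zf \<omega> j) {..<d}"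
        using L2_set_triangle_ineq[of "xf \<omega> j" "zf \<omega> j" "{..<d}"] by (simp add: yf_def[abs_def])
      also have "\<dots> \<le> 5 / 10^5 / sqrt a + 1 / 10^5 / sqrt a" using xp zp j by (intro add_mono) auto
      also have "\<dots> = 6 / 10^5 / sqrt a" by simp
      finally have Ly: "L2_set (yf \<omega> j) {..<d} \<le> 6 / 10^5 / sqrt a" .
      have "\<bar>\<Sum>m<d. yf \<omega> j m * u m\<bar> \<le> (210 * sqrt (real d) * sqrt (24 * a / real d) + 1/16) * L2_set (yf \<omega> j) {..<d}"
        using par j t un up unfolding u_def y_def by blast
      also have "210 * sqrt (real d) * sqrt (24 * a / real d) = 210 * sqrt 24 * sqrt a"
        using sd by (simp add: real_sqrt_divide real_sqrt_mult)
      also have "(210 * sqrt 24 * sqrt a + 1/16) * L2_set (yf \<omega> j) {..<d} \<le> (1051 * sqrt a) * (6 / 10^5 / sqrt a)"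
      proof (intro mult_mono Ly)
        have "sqrt 24 \<le> 5" by (rule real_le_lsqrt) auto
        then have "210 * sqrt 24 * sqrt a \<le> 1050 * sqrt a" using sa by (intro mult_right_mono) auto
        then show "210 * sqrt 24 * sqrt a + 1/16 \<le> 1051 * sqrt a" using sa by linarith
      qed (use sa in auto)
      also have "\<dots> \<le> 1/8" using a1 by simp
      finally show ?thesis .
    qed
    \<comment> \<open>Here y_j has norm up to 2; smallness comes from the many coordinates: sqrt(d
      r) * sqrt(24 a / (n - d)) is at most 7 * 10^-15 because d r a is at most n / 10^30.\<close>
    have P2: "\<bar>\<Sum>m\<in>{d..<n}. yf \<omega> j m * u m\<bar> \<le> 3/8"
    proof -
      have "L2_set (xf \<omega> j) {..<n} \<le> 1"
      proof -
        define R where "R = L2_set (\<lambda>r. \<omega> ((True, j), r)) {..<D j}"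
        have "L2_set (xf \<omega> j) {..<n} = L2_set (\<lambda>m. (1 / R) * (\<Sum>r<D j. M j m r * \<omega> ((True, j), r))) {..<n}"
          by (simp add: xf_def[abs_def] R_def)
        also have "\<dots> = \<bar>1 / R\<bar> * R"
          unfolding L2_set_scale using iso[of j "\<lambda>r. \<omega> ((True, j), r)"] j by (simp add: R_def)
        also have "\<dots> \<le> 1" by (simp add: R_def)
        finally show ?thesis .
      qed
      then have "L2_set (yf \<omega> j) {..<n} \<le> 1 + 4 * \<sigma>"
        using L2_set_triangle_ineq[of "xf \<omega> j" "zf \<omega> j" "{..<n}"] zn j by (force simp: yf_def[abs_def])
      moreover have "L2_set (yf \<omega> j) {d..<n} \<le> L2_set (yf \<omega> j) {..<n}"
        unfolding L2_set_def by (intro real_sqrt_le_mono sum_mono2) auto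
      ultimately have Ly: "L2_set (yf \<omega> j) {d..<n} \<le> 2" using sig by simp
      have "sqrt (real d * r) * sqrt (24 * a / real (n - d)) = sqrt (24 * (real d * (r * a)) / real (n - d))"
        unfolding real_sqrt_mult[symmetric] by (simp add: mult_ac)
      also have "\<dots> \<le> sqrt (24 * (real n / 10^30) / (real n / 2))"
      proof (intro real_sqrt_le_mono frac_le mult_left_mono)
        have "real d * (r * a) \<le> real d * a\<^sup>2" using r_le a1 unfolding power2_eq_square by (intro mult_left_mono mult_right_mono) auto
        then show "real d * (r * a) \<le> real n / 10^30" using dim_small by linarith
        show "real n / 2 \<le> real (n - d)" using n_large(1,4) by (simp add: of_nat_diff)
      qed (use n_large in auto)
      also have "\<dots> \<le> sqrt ((7 / 10^15)\<^sup>2)" using n_large(5) by (intro real_sqrt_le_mono) (simp add: power_divide)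
      finally have e: "sqrt (real d * r) * sqrt (24 * a / real (n - d)) \<le> 7 / 10^15" by simp
      have "\<bar>\<Sum>m\<in>{d..<n}. yf \<omega> j m * u m\<bar> \<le> (3 * 10^12 * sqrt (real d * r) * sqrt (24 * a / real (n - d)) + 1/16) * L2_set (yf \<omega> j) {d..<n}"
        using perp j t un up unfolding u_def y_def by blast
      also have "\<dots> \<le> (3 * 10^12 * (7 / 10^15) + 1/16) * 2"
      proof (rule mult_mono)
        show "3 * 10^12 * sqrt (real d * r) * sqrt (24 * a / real (n - d)) + 1/16 \<le> 3 * 10^12 * (7 / 10^15) + 1/16"
          unfolding mult.assoc[of _ "sqrt (real d * r)"] by (intro add_right_mono mult_left_mono e) simp
      qed (use Ly in simp_all)
      also have "\<dots> \<le> 3/8" by simp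
      finally show ?thesis .
    qed
    have "ip n (yf \<omega> j) (lasso_path n (yf \<omega>) i G t) = (\<Sum>m<n. yf \<omega> j m * u m)"
      unfolding ip_def u_def by (intro sum.cong) (auto simp: path)
    also have "\<dots> = (\<Sum>m<d. yf \<omega> j m * u m) + (\<Sum>m\<in>{d..<n}. yf \<omega> j m * u m)"
      unfolding split(1) by (rule sum.union_disjoint) auto
    finally show "\<bar>ip n (yf \<omega> j) (lasso_path n (yf \<omega>) i G t)\<bar> \<le> 1/2" using P1 P2 by linarith
  qed
qed

text \<open>The six exponential terms of the theorem: four for the norms of all points of the group,
  one for the frame bound and one for the cone bound. The norms are affordable because \<rho> \<le>
  exp(d/2) leaves exp(-d/2) after the union over \<rho> d points.\<close>

lemma exp_d_bounds:
  "2 * exp (- real d) \<le> exp (- real d / 100)" "2 * exp (- real d / 2) \<le> exp (- real d / 100)"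
  "real (card (insert i G)) * (2 * exp (- real d)) \<le> 4 * exp (- real d / 100)"
proof -
  \<comment> \<open>The constant c is paid by the gap between the rates \<gamma> and 1/100, using d
    > 6.\<close>
  have key: "c * exp (- \<gamma> * real d) \<le> exp (- real d / 100)" if "c \<le> 1 + (\<gamma> - 1/100) * 6 + ((\<gamma> - 1/100) * 6)\<^sup>2 / 2" "1/100 \<le> \<gamma>" for c \<gamma> :: real
  proof -
    have "c \<le> exp ((\<gamma> - 1/100) * 6)" by (rule order_trans[OF that(1) exp_lower_Taylor_quadratic]) (use that in simp)
    also have "\<dots> \<le> exp ((\<gamma> - 1/100) * real d)"
      using mult_left_mono[of 6 "real d" "\<gamma> - 1/100"] d_large that by simp
    finally have "c * exp (- \<gamma> * real d) \<le> exp ((\<gamma> - 1/100) * real d) * exp (- \<gamma> * real d)" by (intro mult_right_mono) auto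
    also have "\<dots> = exp (- real d / 100)" by (simp add: algebra_simps flip: exp_add)
    finally show ?thesis .
  qed
  show "2 * exp (- real d) \<le> exp (- real d / 100)" using key[of 2 1] by (simp add: power2_eq_square)
  show "2 * exp (- real d / 2) \<le> exp (- real d / 100)" using key[of 2 "1/2"] by (simp add: power2_eq_square)
  have "real (card (insert i G)) = \<rho> * real d" using q_le by simp
  then have "real (card (insert i G)) * (2 * exp (- real d)) \<le> (exp (real d / 2) * real d) * (2 * exp (- real d))"
    using mult_right_mono[OF rho(3), of "real d"] by (intro mult_right_mono) auto
  also have "\<dots> = 2 * real d * exp (- real d / 2)" by (simp add: algebra_simps flip: exp_add)
  also have "\<dots> \<le> 2 * (8 * exp (real d / 8)) * exp (- real d / 2)"
  proof (intro mult_right_mono mult_left_mono)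
    show "real d \<le> 8 * exp (real d / 8)" using exp_ge_add_one_self[of "real d / 8"] by linarith
  qed auto
  also have "\<dots> = 4 * (4 * exp (- (3/8) * real d))" by (simp add: algebra_simps flip: exp_add)
  also have "\<dots> \<le> 4 * exp (- real d / 100)" using key[of 4 "3/8"] by (simp add: power2_eq_square)
  finally show "real (card (insert i G)) * (2 * exp (- real d)) \<le> 4 * exp (- real d / 100)" .
qed

text \<open>n exceeds 10^30 log N, so all failures of order exp(-n/8) can be charged to the
  polynomial term 23/N^2.\<close>

lemma exp_n_bound: "exp (- c * real n) \<le> 1 / real N ^ 12" if "1/8 \<le> c"
proof -
  have "12 * a \<le> 1/8 * real n" using n_large(2) a1 by simp
  also have "\<dots> \<le> c * real n" using that by (intro mult_right_mono) auto
  finally show ?thesis unfolding exp_12[symmetric] by simp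
qed

lemma power_N_bounds:
  "1 / real N ^ 12 \<le> 1 / (real N)\<^sup>2" "real N * (1 / real N ^ 12) \<le> 1 / (real N)\<^sup>2"
  "real N * (real d * (1 / real N ^ 12)) \<le> 1 / (real N)\<^sup>2" "real N * (1 / real N ^ 6) \<le> 1 / (real N)\<^sup>2"
proof -
  have N: "1 \<le> real N" "0 < real N" using N_large(1) by auto
  have key: "real N ^ k * (1 / real N ^ l) \<le> 1 / (real N)\<^sup>2" if "k + 2 \<le> l" for k l
  proof -
    have "real N ^ (k + 2) \<le> real N ^ l" using N that by (intro power_increasing) auto
    then show ?thesis using N by (simp add: field_simps power_add power2_eq_square)
  qed
  show "1 / real N ^ 12 \<le> 1 / (real N)\<^sup>2" using key[of 0 12] by simp
  show "real N * (1 / real N ^ 12) \<le> 1 / (real N)\<^sup>2" using key[of 1 12] by simp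
  show "real N * (1 / real N ^ 6) \<le> 1 / (real N)\<^sup>2" using key[of 1 6] by simp
  have "real N * (real d * (1 / real N ^ 12)) \<le> real N * (real N * (1 / real N ^ 12))"
    using N_large by (intro mult_left_mono mult_right_mono) auto
  also have "\<dots> \<le> 1 / (real N)\<^sup>2" using key[of 2 12] by (simp add: power2_eq_square mult.assoc)
  finally show "real N * (real d * (1 / real N ^ 12)) \<le> 1 / (real N)\<^sup>2" .
qed

lemma whp_typical:
  "with_prob_at_least (gauss I) (1 - (6 * exp (- real d / 100) + 23 / (real N)\<^sup>2)) (\<lambda>\<omega>. typical_data n N d i G \<sigma> (yf \<omega>))"
proof -
  define O' where "O' = {..<N} - insert i G"
  note conj = with_prob_at_least_conj[OF Om.prob_space_axioms]
  note ball = with_prob_at_least_ball[OF Om.prob_space_axioms]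
  have O': "finite O'" "real (card O') \<le> real N" "\<And>j. j \<in> O' \<Longrightarrow> j < N" "\<And>j. j \<in> O' \<Longrightarrow> j \<notin> insert i G"
    using card_mono[of "{..<N}" O'] by (auto simp: O'_def)
  have R: "with_prob_at_least (gauss I) (1 - real (card (insert i G)) * (2 * exp (- real d))) (\<lambda>\<omega>. \<forall>j\<in>insert i G.
      sqrt (real d) / 6 \<le> L2_set (\<lambda>r. \<omega> ((True, j), r)) {..<d} \<and> L2_set (\<lambda>r. \<omega> ((True, j), r)) {..<d} \<le> 4 * sqrt (real d))"
  proof (rule ball)
    fix j assume j: "j \<in> insert i G"
    show "with_prob_at_least (gauss I) (1 - 2 * exp (- real d)) (\<lambda>\<omega>. sqrt (real d) / 6 \<le> L2_set (\<lambda>r. \<omega> ((True, j), r)) {..<d} \<and>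
      L2_set (\<lambda>r. \<omega> ((True, j), r)) {..<d} \<le> 4 * sqrt (real d))"
      using whp_norm[of j] group_mem(1,2)[OF j] by simp
  qed (use finG in simp)
  \<comment> \<open>With r = 1 + log \<rho> the factor exp(-r) cancels the density and leaves
    d/e.\<close>
  have qr: "q * exp (- r) \<le> real d / 2"
  proof -
    have "q * exp (- r) \<le> (\<rho> * real d) * exp (- r)" using q_bounds by (intro mult_right_mono) auto
    also have "\<dots> = real d * exp (- 1)"
    proof -
      have "exp (- r) = exp (- 1) * (1 / \<rho>)" using rho unfolding r_def minus_add_distrib exp_add by (simp add: exp_minus inverse_eq_divide)
      then show ?thesis using rho by simp
    qed
    also have "\<dots> \<le> real d * (1 / 2)"
    proof (intro mult_left_mono)
      have "2 \<le> exp (1::real)" using exp_ge_add_one_self[of 1] by simp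
      then show "exp (- 1) \<le> 1 / (2::real)" by (simp add: exp_minus field_simps)
    qed auto
    finally show "q * exp (- r) \<le> real d / 2" by (simp del: exp_le_cancel_iff)
  qed
  have qa: "q * exp (- a) \<le> real n / 2"
  proof -
    have "q * exp (- a) \<le> 1" using q_le(1) N_large(1) unfolding exp_a by (simp add: field_simps)
    then show ?thesis using n_large(6) by simp
  qed
  have cone: "with_prob_at_least (gauss I) (1 - 2 * exp (- real d / 2)) (\<lambda>\<omega>. \<forall>\<beta>.
      sqrt (real d) * (L2_set \<beta> G / 24 - 16000 * (sqrt r / sqrt (real d)) * (\<Sum>j\<in>G. \<bar>\<beta> j\<bar>)) \<le>
        L2_set (\<lambda>k. \<Sum>j\<in>G. \<beta> j * \<omega> ((True, j), k)) {..<d})"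
    by (rule with_prob_at_least_mono[OF whp_cone[OF d r_le(1) qr, of True]]) (auto intro: group_mem)
  have "442368 * a \<le> real n" using n_large(2) a1 by simp
  then have zcone: "with_prob_at_least (gauss I) (1 - 2 * exp (- real n / 2)) (\<lambda>\<omega>. \<forall>\<beta>. L2_set (\<lambda>k. \<Sum>j\<in>G. \<beta> j * \<omega> ((False, j), k)) {..<n} \<le>
        8 * sqrt (real n) * (L2_set \<beta> G + 2000 * (sqrt a / sqrt (real n)) * (\<Sum>j\<in>G. \<bar>\<beta> j\<bar>)))"
    using n_large(5) by (intro with_prob_at_least_mono[OF whp_cone[OF _ a1 qa, of False]]) (auto intro: group_mem)
  have zn: "with_prob_at_least (gauss I) (1 - real (card O') * (2 * exp (- real n))) (\<lambda>\<omega>. \<forall>j\<in>O'. L2_set (zf \<omega> j) {..<n} \<le> 4 * \<sigma>)"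
    by (rule ball[OF O'(1)]) (rule whp_noise_norm[OF O'(3)])
  have xp: "with_prob_at_least (gauss I) (1 - real (card O') * (real d * (2 / real N ^ 12))) (\<lambda>\<omega>. \<forall>j\<in>O'. L2_set (xf \<omega> j) {..<d} \<le> 5 / 10^5 / sqrt a)"
    by (rule ball[OF O'(1)]) (rule whp_projection[OF O'(3,4)])
  have zp: "with_prob_at_least (gauss I) (1 - real (card O') * (real d * (2 / real N ^ 12))) (\<lambda>\<omega>. \<forall>j\<in>O'. L2_set (zf \<omega> j) {..<d} \<le> 1 / 10^5 / sqrt a)"
    by (rule ball[OF O'(1)]) (rule whp_noise_projection[OF O'(3)])
  have Qd: "{..<d} \<subseteq> {..<n}" "{..<d} \<noteq> {}" "{..<d} \<subseteq> {..<d} \<or> {..<d} \<inter> {..<d} = {}" "0 < 210 * sqrt (real d)"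
    using n_large(4) d by (auto simp: lessThan_empty_iff)
  have "d < n" using n_large(1,5) d by simp
  then have Qn: "{d..<n} \<subseteq> {..<n}" "{d..<n} \<noteq> {}" "{d..<n} \<subseteq> {..<d} \<or> {d..<n} \<inter> {..<d} = {}" "0 < 3 * 10^12 * sqrt (real d * r)"
    using d r_le by auto
  have par: "with_prob_at_least (gauss I) (1 - real (card O') * (1 / real N ^ 6)) (\<lambda>\<omega>. \<forall>j\<in>O'. \<forall>t\<in>\<rat>. 0 < t \<longrightarrow>
      L2_set (lasso_path n (rotated_data n p d \<sigma> \<omega>) i G t) {..<n} \<le> \<Lambda> \<longrightarrow>
      L2_set (lasso_path n (rotated_data n p d \<sigma> \<omega>) i G t) {..<d} \<le> 210 * sqrt (real d) \<longrightarrow>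
      \<bar>\<Sum>m<d. yf \<omega> j m * lasso_path n (rotated_data n p d \<sigma> \<omega>) i G t m\<bar> \<le>
        (210 * sqrt (real d) * sqrt (24 * a / real d) + 1/16) * L2_set (yf \<omega> j) {..<d})"
    by (rule ball[OF O'(1)]) (use whp_cross[OF O'(3,4) Qd] in simp)
  have perp: "with_prob_at_least (gauss I) (1 - real (card O') * (1 / real N ^ 6)) (\<lambda>\<omega>. \<forall>j\<in>O'. \<forall>t\<in>\<rat>. 0 < t \<longrightarrow>
      L2_set (lasso_path n (rotated_data n p d \<sigma> \<omega>) i G t) {..<n} \<le> \<Lambda> \<longrightarrow>
      L2_set (lasso_path n (rotated_data n p d \<sigma> \<omega>) i G t) {d..<n} \<le> 3 * 10^12 * sqrt (real d * r) \<longrightarrow>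
      \<bar>\<Sum>m\<in>{d..<n}. yf \<omega> j m * lasso_path n (rotated_data n p d \<sigma> \<omega>) i G t m\<bar> \<le>
        (3 * 10^12 * sqrt (real d * r) * sqrt (24 * a / real (n - d)) + 1/16) * L2_set (yf \<omega> j) {d..<n})"
    by (rule ball[OF O'(1)]) (use whp_cross[OF O'(3,4) Qn] in simp)
  note all = conj[OF R conj[OF whp_frame conj[OF cone conj[OF zcone conj[OF whp_noise_self conj[OF zn conj[OF xp conj[OF zp conj[OF par perp]]]]]]]]]
  show ?thesis
  proof (rule with_prob_at_least_mono[OF all])
    \<comment> \<open>Bookkeeping: everything that does not decay in d is at most 11/N^2, namely 3
      for cone and norm of the noise, 2 each for the three unions over noise norms and projections,
      and 1 for each of the two blocks.\<close>
    have mono: "real (card O') * x \<le> real N * x" if "0 \<le> x" for x using O'(2) that by (rule mult_right_mono)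
    define E where "E = 1 / real N ^ 12"
    define F where "F = 1 / (real N)\<^sup>2"
    have E0: "0 \<le> E" by (simp add: E_def)
    have n1: "exp (- real n / 2) \<le> E" "exp (- real n / 8) \<le> E" "exp (- real n) \<le> E"
      using exp_n_bound[of "1/2"] exp_n_bound[of "1/8"] exp_n_bound[of 1] by (simp_all add: E_def)
    have b: "E \<le> F" "real N * E \<le> F" "real N * (real d * E) \<le> F" "real N * (1 / real N ^ 6) \<le> F"
      unfolding E_def F_def by (rule power_N_bounds)+
    have "real (card O') * exp (- real n) \<le> F"
      using mono[OF exp_ge_zero[of "- real n"]] mult_left_mono[OF n1(3) of_nat_0_le_iff[of N]] b(2) by linarith
    then have "real (card O') * (2 * exp (- real n)) \<le> 2 * F" by linarith
    moreover have "real (card O') * (real d * (2 / real N ^ 12)) \<le> 2 * F"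
    proof -
      have "real d * (2 / real N ^ 12) = 2 * (real d * E)" by (simp add: E_def)
      then show ?thesis using mono[of "2 * (real d * E)"] b(3) E0 by (simp only: mult.left_commute[of _ 2]) simp
    qed
    moreover have "real (card O') * (1 / real N ^ 6) \<le> F" using mono[of "1 / real N ^ 6"] b(4) by simp
    moreover have "23 / (real N)\<^sup>2 = 23 * F" "0 \<le> F" by (simp_all add: F_def)
    ultimately show "1 - (6 * exp (- real d / 100) + 23 / (real N)\<^sup>2) \<le> 1 - (real (card (insert i G)) * (2 * exp (- real d)) +
        (2 * exp (- real d) + (2 * exp (- real d / 2) + (2 * exp (- real n / 2) + (exp (- real n / 8) +
        (real (card O') * (2 * exp (- real n)) + (real (card O') * (real d * (2 / real N ^ 12)) +
        (real (card O') * (real d * (2 / real N ^ 12)) + (real (card O') * (1 / real N ^ 6) + real (card O') * (1 / real N ^ 6))))))))))"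
      using exp_d_bounds n1 b(1) by linarith
  qed (elim conjE, rule typical_of_conditions, auto simp: O'_def)
qed

end

subsection \<open>The two-step procedure on typical data\<close>

text \<open>Both programs see the data only through norms of residuals, which the orthonormal basis
  \<open>p\<close> preserves.\<close>

lemma L2_set_resid_rotated:
  assumes p: "orthonormal n n p" and Y: "Y \<in> carrier_mat n N" and b: "\<beta> \<in> carrier_vec N" "vec_index \<beta> i = 0" and i: "i < N"
  shows "l2_norm (col Y i - Y *\<^sub>v \<beta>) = L2_set (resid (\<lambda>j m. \<Sum>k<n. p m k * Y $$ (k, j)) i ({..<N} - {i}) (vec_index \<beta>)) {..<n}"
proof -
  define v where "v = col Y i - Y *\<^sub>v \<beta>"
  have vk: "vec_index v k = Y $$ (k, i) - (\<Sum>j\<in>{..<N} - {i}. vec_index \<beta> j * Y $$ (k, j))" if k: "k < n" for k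
  proof -
    have "vec_index (Y *\<^sub>v \<beta>) k = (\<Sum>j<N. Y $$ (k, j) * vec_index \<beta> j)"
      using Y b k by (simp add: scalar_prod_def lessThan_atLeast0)
    also have "\<dots> = (\<Sum>j\<in>{..<N} - {i}. Y $$ (k, j) * vec_index \<beta> j)"
      using b by (intro sum.mono_neutral_right) auto
    finally show ?thesis using Y k i by (simp add: v_def mult.commute)
  qed
  have r: "resid (\<lambda>j m. \<Sum>k<n. p m k * Y $$ (k, j)) i ({..<N} - {i}) (vec_index \<beta>) m = ip n (p m) (vec_index v)" for m
  proof -
    have "ip n (p m) (vec_index v) = (\<Sum>k<n. p m k * Y $$ (k, i) - (\<Sum>j\<in>{..<N} - {i}. vec_index \<beta> j * (p m k * Y $$ (k, j))))"
      unfolding ip_def by (intro sum.cong) (auto simp: vk right_diff_distrib sum_distrib_left mult_ac)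
    also have "\<dots> = (\<Sum>k<n. p m k * Y $$ (k, i)) - (\<Sum>j\<in>{..<N} - {i}. vec_index \<beta> j * (\<Sum>k<n. p m k * Y $$ (k, j)))"
      unfolding sum_subtractf by (subst sum.swap) (simp add: sum_distrib_left)
    finally show ?thesis by (simp add: resid_def)
  qed
  have "(L2_set (\<lambda>m. ip n (p m) (vec_index v)) {..<n})\<^sup>2 = (L2_set (vec_index v) {..<n})\<^sup>2"
    unfolding ip_self[symmetric] by (rule orthonormal_parseval[OF p])
  then have "L2_set (\<lambda>m. ip n (p m) (vec_index v)) {..<n} = L2_set (vec_index v) {..<n}" by simp
  moreover have "dim_vec v = n" using Y by (simp add: v_def)
  ultimately show ?thesis by (simp add: l2_norm_eq v_def[symmetric] r[abs_def])
qed

lemma l1_norm_eq: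
  assumes "\<beta> \<in> carrier_vec N" "vec_index \<beta> i = 0"
  shows "l1_norm \<beta> = (\<Sum>j\<in>{..<N} - {i}. \<bar>vec_index \<beta> j\<bar>)"
  unfolding l1_norm_def using assms by (intro sum.mono_neutral_right) auto

text \<open>The deterministic end of the argument. The sparse representation is feasible, so the
  first step has optimal l1 norm at most 97 sqrt d and \<lambda> is bounded below; zero is
  infeasible because y_i is longer than 2 \<sigma>, so the output is not set by convention.\<close>

lemma no_false_discovery_of_typical:
  fixes Y :: "real mat"
  assumes p: "orthonormal n n p" and Y: "Y \<in> carrier_mat n N" and i: "i < N" and G: "G \<subseteq> {..<N} - {i}" and sig: "0 < \<sigma>" and d: "1 \<le> d"
    and f: "\<And>t. 0 < t \<Longrightarrow> 0 < f t \<and> 0.707 * \<sigma> * inverse t \<le> f t"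
    and tdat: "typical_data n N d i G \<sigma> (\<lambda>j m. \<Sum>k<n. p m k * Y $$ (k, j))"
    and out: "two_step_output (2 * \<sigma>) f conv Y i b" and j: "j < N" "j \<notin> insert i G"
  shows "vec_index b j = 0"
proof -
  define y where "y = (\<lambda>j m. \<Sum>k<n. p m k * Y $$ (k, j))"
  define H where "H = {..<N} - {i}"
  have fin: "finite H" "finite G" "G \<subseteq> H" using G finite_subset by (auto simp: H_def)
  have dY: "dim_col Y = N" using Y by simp
  have L2: "l2_norm (col Y i - Y *\<^sub>v \<beta>) = L2_set (resid y i H (vec_index \<beta>)) {..<n}" if "\<beta> \<in> carrier_vec N" "vec_index \<beta> i = 0" for \<beta>
    unfolding y_def H_def by (rule L2_set_resid_rotated[OF p Y that i])
  have L1: "l1_norm \<beta> = (\<Sum>j\<in>H. \<bar>vec_index \<beta> j\<bar>)" if "\<beta> \<in> carrier_vec N" "vec_index \<beta> i = 0" for \<beta>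
    unfolding H_def by (rule l1_norm_eq[OF that])
  note tdat' = tdat[folded y_def, unfolded typical_data_def]
  obtain \<beta>0 where b0: "(\<Sum>j\<in>G. \<bar>\<beta>0 j\<bar>) \<le> 97 * sqrt (real d)" "L2_set (resid y i G \<beta>0) {..<n} \<le> 2 * \<sigma>"
    using tdat' by blast
  define \<beta>1 where "\<beta>1 = Matrix.vec N (\<lambda>j. if j \<in> G then \<beta>0 j else 0)"
  have b1: "\<beta>1 \<in> carrier_vec N" "vec_index \<beta>1 i = 0" using i G by (auto simp: \<beta>1_def)
  have b1i: "vec_index \<beta>1 j = (if j \<in> G then \<beta>0 j else 0)" if "j \<in> H" for j using that by (simp add: \<beta>1_def H_def)
  have "resid y i H (vec_index \<beta>1) = resid y i G \<beta>0"
  proof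
    fix m
    have "(\<Sum>j\<in>H. vec_index \<beta>1 j * y j m) = (\<Sum>j\<in>G. \<beta>0 j * y j m)"
      using fin by (intro sum.mono_neutral_cong_right) (auto simp: b1i)
    then show "resid y i H (vec_index \<beta>1) m = resid y i G \<beta>0 m" by (simp add: resid_def)
  qed
  then have feas1: "step1_feasible (2 * \<sigma>) Y i \<beta>1" using b1 b0 by (simp add: step1_feasible_def dY L2)
  have "l1_norm \<beta>1 = (\<Sum>j\<in>G. \<bar>\<beta>0 j\<bar>)"
    unfolding L1[OF b1] using fin by (intro sum.mono_neutral_cong_right) (auto simp: b1i)
  then have l1b1: "l1_norm \<beta>1 \<le> 97 * sqrt (real d)" using b0 by simp
  have z: "0\<^sub>v N \<in> carrier_vec N" "vec_index (0\<^sub>v N) i = (0::real)" using i by auto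
  have "resid y i H (vec_index (0\<^sub>v N)) = y i" by (auto simp: resid_def H_def fun_eq_iff)
  then have "\<not> step1_feasible (2 * \<sigma>) Y i (0\<^sub>v N)"
    using L2[OF z] tdat' by (simp add: step1_feasible_def)
  then have "\<not> step1_solution (2 * \<sigma>) Y i (0\<^sub>v (dim_col Y))" by (simp add: step1_solution_def is_arg_min_def dY)
  with out feas1 obtain \<beta> where sol: "step1_solution (2 * \<sigma>) Y i \<beta>" "\<beta> \<noteq> 0\<^sub>v N" "lasso_solution (f (l1_norm \<beta>)) Y i b"
    unfolding two_step_output_def dY by blast
  have be: "\<beta> \<in> carrier_vec N" "vec_index \<beta> i = 0" using sol(1) by (auto simp: step1_solution_def is_arg_min_def step1_feasible_def dY)
  have l1le: "l1_norm \<beta> \<le> 97 * sqrt (real d)"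
    using sol(1) feas1 l1b1 unfolding step1_solution_def is_arg_min_def by (meson not_le order_less_le_trans order_less_imp_le linorder_not_less order_trans)
  have l1pos: "0 < l1_norm \<beta>"
  proof (rule ccontr)
    assume "\<not> 0 < l1_norm \<beta>"
    then have "(\<Sum>k<N. \<bar>vec_index \<beta> k\<bar>) \<le> 0" using be by (simp add: l1_norm_def)
    moreover have "0 \<le> (\<Sum>k<N. \<bar>vec_index \<beta> k\<bar>)" by (simp add: sum_nonneg)
    ultimately have "(\<Sum>k<N. \<bar>vec_index \<beta> k\<bar>) = 0" by linarith
    then have "\<forall>k<N. vec_index \<beta> k = 0" by (simp add: sum_nonneg_eq_0_iff)
    then have "\<beta> = 0\<^sub>v N" using be by (intro eq_vecI) auto
    then show False using sol(2) by simp
  qed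
  define lam where "lam = f (l1_norm \<beta>)"
  have lam: "0 < lam" "0.707 * \<sigma> * inverse (l1_norm \<beta>) \<le> lam" using f[OF l1pos] by (auto simp: lam_def)
  have sd: "0 < sqrt (real d)" using d by simp
  \<comment> \<open>97 / 0.707 is about 137.2; the bound 140 leaves a margin.\<close>
  have t_le: "1 / lam \<le> 140 * sqrt (real d) / \<sigma>"
  proof -
    have "0.707 * \<sigma> \<le> lam * l1_norm \<beta>" using lam(2) l1pos by (simp add: field_simps)
    also have "\<dots> \<le> lam * (97 * sqrt (real d))" using lam(1) l1le by (intro mult_left_mono) auto
    finally have "\<sigma> \<le> (97 / 0.707) * (lam * sqrt (real d))" by simp
    also have "\<dots> \<le> 140 * (lam * sqrt (real d))" using lam(1) sd by (intro mult_right_mono) auto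
    finally show ?thesis using lam(1) sig by (simp add: field_simps)
  qed
  have bc: "b \<in> carrier_vec N" "vec_index b i = 0"
    using sol(3) by (auto simp: lasso_solution_def is_arg_min_def dY)
  have obj: "1/2 * (l2_norm (col Y i - Y *\<^sub>v c))\<^sup>2 + lam * l1_norm c = lasso_obj n y i H lam (vec_index c)"
    if "c \<in> carrier_vec N" "vec_index c i = 0" for c
    unfolding L2[OF that] L1[OF that] lasso_obj_def ip_self ..
  have min: "lasso_obj n y i H lam (vec_index b) \<le> lasso_obj n y i H lam c" for c
  proof -
    define c' where "c' = Matrix.vec N (\<lambda>j. if j = i then 0 else c j)"
    have c': "c' \<in> carrier_vec N" "vec_index c' i = 0" using i by (auto simp: c'_def)
    have cj: "vec_index c' j = c j" if "j \<in> H" for j using that by (auto simp: c'_def H_def)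
    have "resid y i H (vec_index c') = resid y i H c" by (auto simp: resid_def fun_eq_iff cj intro!: sum.cong)
    then have eq: "lasso_obj n y i H lam (vec_index c') = lasso_obj n y i H lam c"
      by (simp add: lasso_obj_def cj)
    have "\<not> 1/2 * (l2_norm (col Y i - Y *\<^sub>v c'))\<^sup>2 + lam * l1_norm c' < 1/2 * (l2_norm (col Y i - Y *\<^sub>v b))\<^sup>2 + lam * l1_norm b"
      using sol(3) c' unfolding lasso_solution_def is_arg_min_def lam_def[symmetric] dY by blast
    then show ?thesis unfolding obj[OF c'] obj[OF bc] eq by simp
  qed
  show ?thesis
  proof (rule lasso_zero_of_strict[OF fin(1) fin(3) lam(1) min])
    fix l assume l: "l \<in> H - G"
    then have lO: "l \<in> {..<N} - insert i G" by (auto simp: H_def)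
    define t where "t = 1 / lam"
    have t: "0 < t" using lam by (simp add: t_def)
    define C where "C = L2_set (y l) {..<n} * L2_set (y i) {..<n} + 1"
    have C: "0 < C" by (simp add: C_def add_nonneg_pos)
    \<comment> \<open>Typicality speaks of rational parameters only. A rational s just below t =
      1/\<lambda> changes the inner product by at most 1/4 by the Lipschitz bound, and 1/2 + 1/4 <
      1.\<close>
    obtain s where s: "s \<in> \<rat>" "max 0 (t - 1 / (4 * C)) < s" "s < t"
      using Rats_dense_in_real[of "max 0 (t - 1 / (4 * C))" t] t C by auto
    have s0: "0 < s" "t - s \<le> 1 / (4 * C)" using s by auto
    have "\<bar>ip n (y l) (lasso_path n y i G s)\<bar> \<le> 1/2"
      using tdat' lO s s0 t_le by (auto simp: t_def)
    moreover have "\<bar>ip n (y l) (\<lambda>k. lasso_path n y i G t k - lasso_path n y i G s k)\<bar> \<le> 1/4"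
    proof -
      have "\<bar>ip n (y l) (\<lambda>k. lasso_path n y i G t k - lasso_path n y i G s k)\<bar> \<le>
         L2_set (y l) {..<n} * L2_set (\<lambda>k. lasso_path n y i G t k - lasso_path n y i G s k) {..<n}" by (rule abs_ip_le)
      also have "\<dots> \<le> L2_set (y l) {..<n} * ((t - s) * L2_set (y i) {..<n})"
        using s s0 by (intro mult_left_mono lasso_path_dist(2)[OF fin(2)]) auto
      also have "\<dots> = (t - s) * (C - 1)" by (simp add: C_def)
      also have "\<dots> \<le> (t - s) * C" using s by (intro mult_left_mono) auto
      also have "\<dots> \<le> 1 / (4 * C) * C" using s0 C by (intro mult_right_mono) auto
      also have "\<dots> = 1/4" using C by simp
      finally show ?thesis .
    qed
    ultimately show "\<bar>ip n (y l) (lasso_path n y i G (1 / lam))\<bar> < 1"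
      unfolding ip_diff_right t_def by linarith
  next
    show "j \<in> H - G" using j by (auto simp: H_def)
  qed
qed

lemma sets_typical_data:
  fixes y :: "'a \<Rightarrow> nat \<Rightarrow> nat \<Rightarrow> real"
  assumes i: "i < N" and G: "G \<subseteq> {..<N}" and y: "\<And>j k. j < N \<Longrightarrow> k < n \<Longrightarrow> (\<lambda>\<omega>. y \<omega> j k) \<in> borel_measurable M"
  shows "{\<omega>\<in>space M. typical_data n N d i G \<sigma> (y \<omega>)} \<in> sets M"
proof -
  have finG: "finite G" using G finite_subset by auto
  have yG: "(\<lambda>\<omega>. y \<omega> j k) \<in> borel_measurable M" if "j \<in> insert i G" "k < n" for j k using that i G y by auto
  have m1: "(\<lambda>\<omega>. L2_set (resid (y \<omega>) i G \<beta>) {..<n}) \<in> borel_measurable M" for \<beta>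
    unfolding resid_def
    by (intro borel_measurable_L2_set borel_measurable_diff borel_measurable_sum borel_measurable_times borel_measurable_const yG) auto
  have m2: "(\<lambda>\<omega>. L2_set (y \<omega> i) {..<n}) \<in> borel_measurable M" by (intro borel_measurable_L2_set yG) auto
  have m3: "(\<lambda>\<omega>. \<bar>ip n (y \<omega> j) (lasso_path n (y \<omega>) i G t)\<bar>) \<in> borel_measurable M" if "j < N" "0 < t" for j t
    unfolding ip_def using that
    by (intro borel_measurable_abs borel_measurable_sum borel_measurable_times y borel_measurable_lasso_path[OF finG _ _ yG]) auto
  have c: "countable (G \<rightarrow>\<^sub>E (\<rat> :: real set))" by (intro countable_PiE finG countable_rat)
  have a: "{\<omega>\<in>space M. \<exists>\<beta>\<in>G \<rightarrow>\<^sub>E \<rat>. (\<Sum>j\<in>G. \<bar>\<beta> j\<bar>) \<le> 97 * sqrt (real d) \<and> L2_set (resid (y \<omega>) i G \<beta>) {..<n} \<le> 2 * \<sigma>} \<in> sets M"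
    by (intro sets.sets_Collect_countable_Ex' c sets.sets_Collect_conj sets.sets_Collect_const borel_measurable_le m1 borel_measurable_const)
  have b: "{\<omega>\<in>space M. 2 * \<sigma> < L2_set (y \<omega> i) {..<n}} \<in> sets M" by (intro borel_measurable_less m2 borel_measurable_const)
  have e: "{\<omega>\<in>space M. \<forall>j\<in>{..<N} - insert i G. \<forall>t\<in>\<rat>. 0 < t \<longrightarrow> t \<le> 140 * sqrt (real d) / \<sigma> \<longrightarrow> \<bar>ip n (y \<omega> j) (lasso_path n (y \<omega>) i G t)\<bar> \<le> 1/2} \<in> sets M"
  proof (rule sets.sets_Collect_finite_All, rule sets.sets_Collect_countable_All')
    fix j t assume "j \<in> {..<N} - insert i G"
    then show "{\<omega>\<in>space M. 0 < t \<longrightarrow> t \<le> 140 * sqrt (real d) / \<sigma> \<longrightarrow> \<bar>ip n (y \<omega> j) (lasso_path n (y \<omega>) i G t)\<bar> \<le> 1/2} \<in> sets M"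
    proof (cases "0 < t \<and> t \<le> 140 * sqrt (real d) / \<sigma>")
      case True
      then show ?thesis using \<open>j \<in> {..<N} - insert i G\<close> borel_measurable_le[OF m3[of j t] borel_measurable_const[of "1/2"]] by simp
    next
      case False
      then have "{\<omega>\<in>space M. 0 < t \<longrightarrow> t \<le> 140 * sqrt (real d) / \<sigma> \<longrightarrow> \<bar>ip n (y \<omega> j) (lasso_path n (y \<omega>) i G t)\<bar> \<le> 1/2} = space M" by blast
      then show ?thesis by (simp only: sets.top)
    qed
  qed (auto intro: countable_rat)
  show ?thesis unfolding typical_data_def by (intro sets.sets_Collect_conj a b e)
qed

subsection \<open>The main theorem\<close>

lemma orthonormal_ip_sum:
  assumes U: "orthonormal n d u"
  shows "L2_set (\<lambda>k. \<Sum>r<d. u r k * c r) {..<n} = L2_set c {..<d}"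
proof -
  have "ip n (\<lambda>k. \<Sum>r<d. u r k * c r) (\<lambda>k. \<Sum>r<d. u r k * c r) = (\<Sum>r<d. \<Sum>s<d. c r * c s * ip n (u r) (u s))"
    unfolding ip_sum_left ip_sum_right ip_def by (simp add: sum_distrib_left mult_ac)
  also have "\<dots> = (\<Sum>r<d. \<Sum>s<d. if r = s then c r * c s else 0)"
    using U by (intro sum.cong refl) (auto simp: orthonormal_def)
  also have "\<dots> = (\<Sum>r<d. (c r)\<^sup>2)" by (simp add: power2_eq_square)
  finally have "(L2_set (\<lambda>k. \<Sum>r<d. u r k * c r) {..<n})\<^sup>2 = (L2_set c {..<d})\<^sup>2"
    unfolding ip_self L2_set_power2[of c] .
  then show ?thesis by simp
qed

text \<open>The squared affinity times the smaller dimension is the squared Frobenius norm of the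
  matrix of inner products of the two bases.\<close>

lemma sum_power2_le_of_aff_le:
  assumes S: "is_subspace n S" "1 \<le> subspace_dim n S" and T: "is_subspace n T" "1 \<le> subspace_dim n T" and aff: "aff n S T \<le> \<kappa>"
  shows "(\<Sum>m<subspace_dim n S. \<Sum>r<subspace_dim n T.
      (ip n (\<lambda>k. orthonormal_basis n S $$ (k, m)) (\<lambda>k. orthonormal_basis n T $$ (k, r)))\<^sup>2)
    \<le> real (min (subspace_dim n S) (subspace_dim n T)) * \<kappa>\<^sup>2"
proof -
  define A where "A = transpose_mat (orthonormal_basis n S) * orthonormal_basis n T"
  define d where "d = real (min (subspace_dim n S) (subspace_dim n T))"
  have d: "0 < d" using S T by (simp add: d_def)
  have US: "orthonormal_basis n S \<in> carrier_mat n (subspace_dim n S)" and UT: "orthonormal_basis n T \<in> carrier_mat n (subspace_dim n T)"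
    using orthonormal_basis(1) S T by auto
  have A: "A \<in> carrier_mat (subspace_dim n S) (subspace_dim n T)" unfolding A_def using US UT by simp
  have Amr: "A $$ (m, r) = ip n (\<lambda>k. orthonormal_basis n S $$ (k, m)) (\<lambda>k. orthonormal_basis n T $$ (k, r))"
    if "m < subspace_dim n S" "r < subspace_dim n T" for m r
    using US UT that by (simp add: A_def scalar_prod_def ip_def lessThan_atLeast0)
  define F where "F = (\<Sum>m<subspace_dim n S. \<Sum>r<subspace_dim n T. (A $$ (m, r))\<^sup>2)"
  have F0: "0 \<le> F" by (simp add: F_def sum_nonneg)
  have "aff n S T = sqrt (F / d)"
    unfolding aff_def principal_cosines_def A_def[symmetric] sum_singular_values_power2[OF A] F_def d_def ..
  then have "sqrt (F / d) \<le> \<kappa>" using aff by simp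
  then have "(sqrt (F / d))\<^sup>2 \<le> \<kappa>\<^sup>2" using F0 d by (intro power_mono) auto
  then have "F \<le> d * \<kappa>\<^sup>2" using F0 d by (simp add: field_simps)
  then show ?thesis unfolding F_def d_def by (simp add: Amr)
qed

lemma whp_no_false_discovery:
  fixes n L N i :: nat and \<sigma> :: real and f :: "real \<Rightarrow> real" and S :: "nat \<Rightarrow> real Matrix.vec set" and g :: "nat \<Rightarrow> nat"
  defines "d \<equiv> subspace_dim n (S (g i))"
  assumes N: "2 \<le> N" and S: "\<And>l. l < L \<Longrightarrow> is_subspace n (S l) \<and> 1 \<le> subspace_dim n (S l)" and g: "\<And>j. j < N \<Longrightarrow> g j < L"
    and dens: "\<And>l. l < L \<Longrightarrow> sampling_density n N S g l \<le> exp (real (subspace_dim n (S l)) / 2)"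
    and sig: "0 < \<sigma>" "\<sigma> < 1 / 10^14"
    and dim: "\<And>l. l < L \<Longrightarrow> real (subspace_dim n (S l)) < 1 / 10^30 * (real n / (ln (real N))\<^sup>2)"
    and i: "i < N"
    and aff: "\<And>k. k < L \<Longrightarrow> k \<noteq> g i \<Longrightarrow> aff n (S (g i)) (S k) \<le> 1 / 10^5 / ln (real N)"
    and rho: "10^8 \<le> sampling_density n N S g (g i)"
    and f: "\<And>t. 0 < t \<Longrightarrow> 0 < f t \<and> 0.707 * \<sigma> * inverse t \<le> f t"
  shows "with_prob_at_least (semirandom_model n N S g \<sigma>) (1 - (6 * exp (- real d / 100) + 23 / (real N)\<^sup>2))
    (\<lambda>\<omega>. \<forall>b. two_step_output (2 * \<sigma>) f conv (data_matrix n N \<omega>) i b \<longrightarrow> (\<forall>j<N. \<not> false_discovery g i b j))"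
proof -
  define U where "U j = orthonormal_basis n (S (g j))" for j
  define D where "D j = subspace_dim n (S (g j))" for j
  define G where "G = {j. j < N \<and> g j = g i} - {i}"
  have gS: "is_subspace n (S (g j))" "1 \<le> D j" if "j < N" for j using S[OF g[OF that]] by (auto simp: D_def)
  have U: "U j \<in> carrier_mat n (D j)" "orthonormal n (D j) (\<lambda>a k. U j $$ (k, a))" if "j < N" for j
    using orthonormal_basis[OF gS(1)[OF that]] by (simp_all add: U_def D_def)
  have Dd: "D i = d" by (simp add: D_def d_def)
  \<comment> \<open>Completing the chosen basis of the subspace of point i gives \<open>M\<close> an
    identity block for the group, while for other points its first d rows are the matrix in the
    affinity.\<close>
  obtain p where p: "orthonormal n n p" "\<And>a. a < d \<Longrightarrow> p a = (\<lambda>k. U i $$ (k, a))"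
    using orthonormal_complete[OF U(2)[OF i]] unfolding Dd by blast
  define M where "M j m r = ip n (p m) (\<lambda>k. U j $$ (k, r))" for j m r
  have UG: "U j = U i" "D j = d" if "j \<in> insert i G" for j using that by (auto simp: G_def U_def D_def d_def)
  have dn: "d \<le> n" by (rule orthonormal_le[OF U(2)[OF i, unfolded Dd]])
  have lnN: "0 < ln (real N)" using N by simp
  interpret semirandom_coordinates n N i d G D M p \<sigma> "ln (real N)" "sampling_density n N S g (g i)"
  proof
    show "i < N" "1 \<le> d" "0 < \<sigma>" "orthonormal n n p" "\<sigma> \<le> 1 / 10^14" "10^8 \<le> sampling_density n N S g (g i)"
      using i gS(2)[OF i] sig p(1) rho by (auto simp: Dd)
    show "G \<subseteq> {..<N} - {i}" by (auto simp: G_def)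
    show "1 \<le> D j" if "j < N" for j using gS(2)[OF that] .
    show "D j = d" if "j \<in> insert i G" for j using UG(2)[OF that] .
    show "M j m r = (if m = r then 1 else 0)" if "j \<in> insert i G" "m < n" "r < d" for j m r
      using p that dn by (simp add: M_def UG(1)[OF that(1)] p(2)[symmetric] orthonormal_def)
    show "L2_set (\<lambda>m. \<Sum>r<D j. M j m r * c r) {..<n} = L2_set c {..<D j}" if "j < N" for j c
    proof -
      have "(\<Sum>r<D j. M j m r * c r) = ip n (p m) (\<lambda>k. \<Sum>r<D j. U j $$ (k, r) * c r)" for m
        unfolding ip_sum_right M_def ip_def sum_distrib_right by (simp add: mult.assoc)
      then have "(L2_set (\<lambda>m. \<Sum>r<D j. M j m r * c r) {..<n})\<^sup>2 = (L2_set (\<lambda>k. \<Sum>r<D j. U j $$ (k, r) * c r) {..<n})\<^sup>2"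
        unfolding ip_self[symmetric] using orthonormal_parseval[OF p(1)] by simp
      then have "L2_set (\<lambda>m. \<Sum>r<D j. M j m r * c r) {..<n} = L2_set (\<lambda>k. \<Sum>r<D j. U j $$ (k, r) * c r) {..<n}" by simp
      then show ?thesis using orthonormal_ip_sum[OF U(2)[OF that], of c] by simp
    qed
    show "(\<Sum>m<d. \<Sum>r<D j. (M j m r)\<^sup>2) \<le> real (min d (D j)) * (1 / 10^5 / ln (real N))\<^sup>2" if j: "j < N" "j \<notin> insert i G" for j
    proof -
      have gj: "g j \<noteq> g i" using j by (auto simp: G_def)
      have "(\<Sum>m<d. \<Sum>r<D j. (M j m r)\<^sup>2) = (\<Sum>m<d. \<Sum>r<D j. (ip n (\<lambda>k. U i $$ (k, m)) (\<lambda>k. U j $$ (k, r)))\<^sup>2)"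
        by (intro sum.cong refl) (simp add: M_def p(2))
      also have "\<dots> \<le> real (min d (D j)) * (1 / 10^5 / ln (real N))\<^sup>2"
        using sum_power2_le_of_aff_le[OF gS(1)[OF i] _ gS(1)[OF j(1)] _ aff[OF g[OF j(1)] gj]] gS(2)[OF i] gS(2)[OF j(1)]
        unfolding U_def D_def d_def by simp
      finally show ?thesis .
    qed
    show "real d * (ln (real N))\<^sup>2 \<le> real n / 10^30"
      using dim[OF g[OF i]] lnN by (simp add: d_def[symmetric] field_simps)
    have "card (insert i G) = group_size N g (g i)"
      unfolding group_size_def using i by (intro arg_cong[where f=card]) (auto simp: G_def)
    moreover have "card (insert i G) = card G + 1" by (subst card_insert_disjoint) (auto simp: G_def)
    ultimately show "real (card G) + 1 = sampling_density n N S g (g i) * real d"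
      using gS(2)[OF i] by (simp add: sampling_density_def d_def[symmetric] Dd)
    show "sampling_density n N S g (g i) \<le> exp (real d / 2)" using dens[OF g[OF i]] by (simp add: d_def)
  qed (simp add: )
  define MM where "MM = (\<Pi>\<^sub>M j\<in>{..<N}. vec_borel n) \<Otimes>\<^sub>M (\<Pi>\<^sub>M j\<in>{..<N}. vec_borel n)"
  define \<Phi> where "\<Phi> = model_map n N U D \<sigma>"
  have N0: "0 < N" using N by simp
  have Phi: "\<Phi> \<in> measurable (gauss I) MM" and mod: "semirandom_model n N S g \<sigma> = distr (gauss I) MM \<Phi>"
  proof -
    have UD: "(\<lambda>j. orthonormal_basis n (S (g j))) = U" "(\<lambda>j. subspace_dim n (S (g j))) = D" by (simp_all add: fun_eq_iff U_def D_def)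
    note E = semirandom_model_eq_gauss[OF sig(1) n_large(5) N0, of S g, unfolded UD]
    show "\<Phi> \<in> measurable (gauss I) MM" "semirandom_model n N S g \<sigma> = distr (gauss I) MM \<Phi>"
      unfolding \<Phi>_def MM_def I_def by (rule E[OF U(1)[unfolded U_def D_def]], assumption)+
  qed
  define yh where "yh \<xi> j m = (\<Sum>k<n. p m k * (vec_index (fst \<xi> j) k + vec_index (snd \<xi> j) k))" for \<xi> :: "(nat \<Rightarrow> real Matrix.vec) \<times> (nat \<Rightarrow> real Matrix.vec)" and j m
  have yhm: "(\<lambda>\<xi>. yh \<xi> j m) \<in> borel_measurable MM" if j: "j < N" for j m
  proof -
    have "(\<lambda>\<xi>. fst \<xi> j) \<in> measurable MM (vec_borel n)" "(\<lambda>\<xi>. snd \<xi> j) \<in> measurable MM (vec_borel n)"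
      unfolding MM_def using j
      by (auto intro!: measurable_compose[OF measurable_fst measurable_component_singleton] measurable_compose[OF measurable_snd measurable_component_singleton])
    then have "(\<lambda>\<xi>. vec_index (fst \<xi> j) k) \<in> borel_measurable MM" "(\<lambda>\<xi>. vec_index (snd \<xi> j) k) \<in> borel_measurable MM" if "k < n" for k
      using measurable_compose[OF _ measurable_vec_index[OF that]] by auto
    then show ?thesis unfolding yh_def
      by (intro borel_measurable_sum borel_measurable_times borel_measurable_const borel_measurable_add) auto
  qed
  \<comment> \<open>The good event must be a measurable set of samples, so it is defined from the
    sample through \<open>yh\<close>; only its probability is computed in Gaussian
    coordinates.\<close>
  define E where "E = {\<xi>\<in>space MM. typical_data n N d i G \<sigma> (yh \<xi>)}"
  have GN: "G \<subseteq> {..<N}" by (auto simp: G_def)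
  have E: "E \<in> sets MM" unfolding E_def by (rule sets_typical_data[OF i GN yhm])
  have yh: "yh (\<Phi> \<omega>) j m = yf \<omega> j m" if j: "j < N" and m: "m < n" for \<omega> j m
  proof -
    have x: "vec_index (fst (\<Phi> \<omega>) j) k = (\<Sum>r<D j. U j $$ (k, r) * \<omega> ((True, j), r)) / L2_set (\<lambda>r. \<omega> ((True, j), r)) {..<D j}" if k: "k < n" for k
      using j sphere_point_index[OF U(1)[OF j] k, of "\<lambda>r. \<omega> ((True, j), r)"] orthonormal_ip_sum[OF U(2)[OF j], of "\<lambda>r. \<omega> ((True, j), r)"]
      by (simp add: \<Phi>_def model_map_def model_point_def)
    have z: "vec_index (snd (\<Phi> \<omega>) j) k = \<sigma> / sqrt (real n) * \<omega> ((False, j), k)" if k: "k < n" for k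
      using j k by (simp add: \<Phi>_def model_map_def model_point_def)
    define R where "R = L2_set (\<lambda>r. \<omega> ((True, j), r)) {..<D j}"
    have "yh (\<Phi> \<omega>) j m = (\<Sum>k<n. p m k * ((\<Sum>r<D j. U j $$ (k, r) * \<omega> ((True, j), r)) / R)) + (\<Sum>k<n. p m k * (\<sigma> / sqrt (real n) * \<omega> ((False, j), k)))"
      unfolding yh_def R_def sum.distrib[symmetric] by (intro sum.cong) (simp_all add: x z distrib_left)
    also have "(\<Sum>k<n. p m k * ((\<Sum>r<D j. U j $$ (k, r) * \<omega> ((True, j), r)) / R)) = (\<Sum>r<D j. M j m r * \<omega> ((True, j), r)) / R"
      unfolding M_def ip_def sum_divide_distrib sum_distrib_left sum_distrib_right by (subst sum.swap) (simp add: mult_ac)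
    also have "(\<Sum>k<n. p m k * (\<sigma> / sqrt (real n) * \<omega> ((False, j), k))) = \<sigma> / sqrt (real n) * (\<Sum>k<n. p m k * \<omega> ((False, j), k))"
      by (simp add: sum_distrib_left mult_ac)
    finally show ?thesis by (simp add: yf_def xf_def zf_def R_def)
  qed
  have typ_eq: "typical_data n N d i G \<sigma> (yh (\<Phi> \<omega>)) \<longleftrightarrow> typical_data n N d i G \<sigma> (yf \<omega>)" for \<omega>
    by (rule typical_data_cong[OF i GN yh])
  have prob: "1 - (6 * exp (- real d / 100) + 23 / (real N)\<^sup>2) \<le> measure (semirandom_model n N S g \<sigma>) E"
  proof -
    from whp_typical obtain B where B: "B \<in> sets (gauss I)" "\<forall>\<omega>\<in>B. typical_data n N d i G \<sigma> (yf \<omega>)"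
      "1 - (6 * exp (- real d / 100) + 23 / (real N)\<^sup>2) \<le> measure (gauss I) B"
      unfolding with_prob_at_least_def by blast
    have "B \<subseteq> \<Phi> -` E \<inter> space (gauss I)"
      using B(2) sets.sets_into_space[OF B(1)] measurable_space[OF Phi] by (auto simp: E_def typ_eq)
    then have "measure (gauss I) B \<le> measure (gauss I) (\<Phi> -` E \<inter> space (gauss I))"
      by (rule Om.finite_measure_mono) (rule measurable_sets[OF Phi E])
    also have "\<dots> = measure (semirandom_model n N S g \<sigma>) E"
      unfolding mod by (rule measure_distr[OF Phi E, symmetric])
    finally show ?thesis using B(3) by linarith
  qed
  have det: "\<not> false_discovery g i b j" if xi: "\<xi> \<in> E" and out: "two_step_output (2 * \<sigma>) f conv (data_matrix n N \<xi>) i b" and j: "j < N" for \<xi> b j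
  proof (cases "j \<in> insert i G")
    case True
    then show ?thesis by (auto simp: false_discovery_def G_def)
  next
    case False
    have sp: "space (vec_borel n) = carrier_vec n" by (simp add: vec_borel_def)
    have "\<xi> \<in> space MM" using xi unfolding E_def by blast
    then have "fst \<xi> \<in> {..<N} \<rightarrow>\<^sub>E carrier_vec n" "snd \<xi> \<in> {..<N} \<rightarrow>\<^sub>E carrier_vec n"
      unfolding MM_def space_pair_measure space_PiM sp mem_Times_iff by blast+
    then have c: "fst \<xi> j \<in> carrier_vec n" "snd \<xi> j \<in> carrier_vec n" if "j < N" for j
      using that by (blast dest: PiE_mem)+
    have dm: "data_matrix n N \<xi> \<in> carrier_mat n N"
      unfolding data_matrix_def split_def by (rule mat_of_cols_carrier(1)[of n "map (\<lambda>j. fst \<xi> j + snd \<xi> j) [0..<N]", simplified])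
    have dk: "data_matrix n N \<xi> $$ (k, j) = vec_index (fst \<xi> j) k + vec_index (snd \<xi> j) k" if "k < n" "j < N" for k j
      using that c[of j] by (simp add: data_matrix_def split_def mat_of_cols_index)
    have "typical_data n N d i G \<sigma> (\<lambda>j m. \<Sum>k<n. p m k * data_matrix n N \<xi> $$ (k, j)) \<longleftrightarrow> typical_data n N d i G \<sigma> (yh \<xi>)"
      by (rule typical_data_cong[OF i GN]) (simp add: yh_def dk)
    then have t: "typical_data n N d i G \<sigma> (\<lambda>j m. \<Sum>k<n. p m k * data_matrix n N \<xi> $$ (k, j))" using xi unfolding E_def by blast
    have Gi: "G \<subseteq> {..<N} - {i}" by (auto simp: G_def)
    have d1: "1 \<le> d" using gS(2)[OF i] by (simp add: Dd)
    have "vec_index b j = 0"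
      by (rule no_false_discovery_of_typical[OF p(1) dm i Gi sig(1) d1 f t out j False])
    then show ?thesis by (simp add: false_discovery_def)
  qed
  show ?thesis unfolding with_prob_at_least_def
  proof (rule bexI[of _ E], intro conjI ballI allI impI)
    show "E \<in> sets (semirandom_model n N S g \<sigma>)" unfolding mod using E by simp
    show "1 - (6 * exp (- real d / 100) + 23 / (real N)\<^sup>2) \<le> measure (semirandom_model n N S g \<sigma>) E" by (rule prob)
    fix \<xi> b j assume "\<xi> \<in> E" "two_step_output (2 * \<sigma>) f conv (data_matrix n N \<xi>) i b" "j < N"
    then show "\<not> false_discovery g i b j" by (rule det)
  qed
qed

theorem theorem3p1:
  shows "\<exists>\<sigma>\<^sub>s c\<^sub>0 \<kappa>\<^sub>0 \<rho>\<^sub>s \<gamma>\<^sub>1 \<gamma>\<^sub>2 :: real.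
    0 < \<sigma>\<^sub>s \<and> \<sigma>\<^sub>s < 1 \<and> 0 < c\<^sub>0 \<and> 0 < \<kappa>\<^sub>0 \<and> 1 < \<rho>\<^sub>s \<and> 0 < \<gamma>\<^sub>1 \<and> 0 < \<gamma>\<^sub>2 \<and>
    (\<forall>(n :: nat) (L :: nat) (N :: nat) (S :: nat \<Rightarrow> real Matrix.vec set) (g :: nat \<Rightarrow> nat)
      (\<sigma> :: real) (i :: nat) (f :: real \<Rightarrow> real) (conv :: real mat \<Rightarrow> real Matrix.vec).
        2 \<le> N \<longrightarrow>
        (\<forall>l<L. is_subspace n (S l) \<and> 1 \<le> subspace_dim n (S l)) \<longrightarrow>
        (\<forall>j<N. g j < L) \<longrightarrow>
        (\<forall>l<L. sampling_density n N S g l \<le> exp (real (subspace_dim n (S l)) / 2)) \<longrightarrow>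
        0 < \<sigma> \<longrightarrow> \<sigma> < \<sigma>\<^sub>s \<longrightarrow>
        (\<forall>l<L. real (subspace_dim n (S l)) < c\<^sub>0 * (real n / (ln (real N))\<^sup>2)) \<longrightarrow>
        i < N \<longrightarrow>
        (\<forall>k<L. k \<noteq> g i \<longrightarrow> aff n (S (g i)) (S k) \<le> \<kappa>\<^sub>0 / ln (real N)) \<longrightarrow>
        \<rho>\<^sub>s \<le> sampling_density n N S g (g i) \<longrightarrow>
        (\<forall>t>0. 0 < f t \<and> 0.707 * \<sigma> * inverse t \<le> f t) \<longrightarrow>
        (\<forall>Y. conv Y \<in> carrier_vec (dim_col Y)) \<longrightarrow>
        with_prob_at_least (semirandom_model n N S g \<sigma>)
          (1 - 2 * exp (- \<gamma>\<^sub>1 * real n)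
             - 6 * exp (- \<gamma>\<^sub>2 * real (subspace_dim n (S (g i))))
             - exp (- sqrt (real (group_size N g (g i)) * real (subspace_dim n (S (g i)))))
             - 23 / (real N)\<^sup>2)
          (\<lambda>\<omega>. \<forall>b. two_step_output (2 * \<sigma>) f conv (data_matrix n N \<omega>) i b \<longrightarrow>
                 (\<forall>j<N. \<not> false_discovery g i b j)))"
proof (rule exI[of _ "1 / 10^14"], rule exI[of _ "1 / 10^30"], rule exI[of _ "1 / 10^5"], rule exI[of _ "10^8"],
    rule exI[of _ 1], rule exI[of _ "1 / 100"], intro conjI allI impI)
  fix n L N :: nat and S :: "nat \<Rightarrow> real Matrix.vec set" and g :: "nat \<Rightarrow> nat" and \<sigma> :: real and i :: nat
    and f :: "real \<Rightarrow> real" and conv :: "real mat \<Rightarrow> real Matrix.vec"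
  assume h: "2 \<le> N" "\<forall>l<L. is_subspace n (S l) \<and> 1 \<le> subspace_dim n (S l)" "\<forall>j<N. g j < L"
    "\<forall>l<L. sampling_density n N S g l \<le> exp (real (subspace_dim n (S l)) / 2)"
    "0 < \<sigma>" "\<sigma> < 1 / 10^14" "\<forall>l<L. real (subspace_dim n (S l)) < 1 / 10^30 * (real n / (ln (real N))\<^sup>2)" "i < N"
    "\<forall>k<L. k \<noteq> g i \<longrightarrow> aff n (S (g i)) (S k) \<le> 1 / 10^5 / ln (real N)" "10^8 \<le> sampling_density n N S g (g i)"
    "\<forall>t>0. 0 < f t \<and> 0.707 * \<sigma> * inverse t \<le> f t"
  have "with_prob_at_least (semirandom_model n N S g \<sigma>) (1 - (6 * exp (- real (subspace_dim n (S (g i))) / 100) + 23 / (real N)\<^sup>2))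
    (\<lambda>\<omega>. \<forall>b. two_step_output (2 * \<sigma>) f conv (data_matrix n N \<omega>) i b \<longrightarrow> (\<forall>j<N. \<not> false_discovery g i b j))"
    by (rule whp_no_false_discovery[where L=L]) (use h in blast)+
  then show "with_prob_at_least (semirandom_model n N S g \<sigma>)
          (1 - 2 * exp (- 1 * real n) - 6 * exp (- (1 / 100) * real (subspace_dim n (S (g i))))
             - exp (- sqrt (real (group_size N g (g i)) * real (subspace_dim n (S (g i))))) - 23 / (real N)\<^sup>2)
          (\<lambda>\<omega>. \<forall>b. two_step_output (2 * \<sigma>) f conv (data_matrix n N \<omega>) i b \<longrightarrow> (\<forall>j<N. \<not> false_discovery g i b j))"
  proof (rule with_prob_at_least_mono)
    have "0 \<le> exp (- 1 * real n)" "0 \<le> exp (- sqrt (real (group_size N g (g i)) * real (subspace_dim n (S (g i)))))"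
      "exp (- real (subspace_dim n (S (g i))) / 100) = exp (- (1 / 100) * real (subspace_dim n (S (g i))))" by simp_all
    then show "1 - 2 * exp (- 1 * real n) - 6 * exp (- (1 / 100) * real (subspace_dim n (S (g i))))
             - exp (- sqrt (real (group_size N g (g i)) * real (subspace_dim n (S (g i))))) - 23 / (real N)\<^sup>2
      \<le> 1 - (6 * exp (- real (subspace_dim n (S (g i))) / 100) + 23 / (real N)\<^sup>2)" by linarith
  qed
qed simp_all

end
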